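(* Suppose all tiles of a pentagonal tiling of a compact connected surface without boundary are non-degenerate, and it is possible to label some vertices by $\circ$ such that each tile has exactly one $\circ$-vertex and its other four vertices have degree $3$. Then the surface is orientable, and (for a suitable orientation) the tiling is the pentagonal subdivision $T(5)$ of some tiling $T$.
   Context: A tiling of a compact connected surface without boundary is a graph embedded in the surface such that the complementary regions (tiles) are open disks; tilings are edge-to-edge, every vertex has degree at least $3$, every tile has at least $3$ edges, and tiles may be degenerate (boundary not a simple closed curve); a polygon is non-degenerate if its boundary is a simple closed curve. A pentagonal tiling has $5$ edges along each tile boundary. Pentagonal subdivision: let $T$ be a tiling of an oriented surface. Divide each edge of $T$ into three segments by two dividing points. For a tile $t$ and an edge $e$ on its boundary, traverse $e$ in the direction induced by the orientation of $\partial t$ and call the dividing point met first the first dividing point of $e$ from the viewpoint of $t$. Choose a center point in each tile $t$ and join it to the first dividing point (from the viewpoint of $t$) of each edge of $t$, for every pair $(t,e)$. The resulting pentagonal tiling is the pentagonal subdivision $T(5)$. *)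

theory Defs
  imports "HOL-Complex_Analysis.Complex_Analysis"
begin

subsection \<open>Surfaces and orientations\<close>

text \<open>The plane is modelled by the complex numbers. Surfaces have no boundary.\<close>

definition surface :: "'a topology \<Rightarrow> bool" where
  "surface X \<longleftrightarrow> Hausdorff_space X \<and> second_countable X \<and>
     (\<forall>x\<in>topspace X. \<exists>U (W :: complex set). openin X U \<and> x \<in> U \<and> open W \<and>
        subtopology X U homeomorphic_space top_of_set W)"

definition compact_connected_surface :: "'a topology \<Rightarrow> bool" where
  "compact_connected_surface X \<longleftrightarrow>
     surface X \<and> compact_space X \<and> connected_space X \<and> topspace X \<noteq> {}"

text \<open>Used for injective continuous maps \<open>f\<close> on an open set \<open>U\<close>: such a map sends every small
  counterclockwise circle around \<open>z\<close> to a closed curve of winding number 1 or -1 around \<open>f z\<close>, and it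
  preserves the orientation if the value is always 1. No differentiability is needed.\<close>

definition orientation_preserving_on :: "complex set \<Rightarrow> (complex \<Rightarrow> complex) \<Rightarrow> bool" where
  "orientation_preserving_on U f \<longleftrightarrow>
     (\<forall>z r. 0 < r \<and> cball z r \<subseteq> U \<longrightarrow> winding_number (f \<circ> circlepath z r) (f z) = 1)"

definition surface_chart :: "'a topology \<Rightarrow> 'a set \<Rightarrow> ('a \<Rightarrow> complex) \<Rightarrow> bool" where
  "surface_chart X U f \<longleftrightarrow>
     openin X U \<and> open (f ` U) \<and> homeomorphic_map (subtopology X U) (top_of_set (f ` U)) f"

definition oriented_atlas :: "'a topology \<Rightarrow> ('a set \<times> ('a \<Rightarrow> complex)) set \<Rightarrow> bool" where
  "oriented_atlas X A \<longleftrightarrow>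
     (\<forall>(U, f)\<in>A. surface_chart X U f) \<and> (\<Union>(U, f)\<in>A. U) = topspace X \<and>
     (\<forall>(U, f)\<in>A. \<forall>(U', f')\<in>A. orientation_preserving_on (f ` (U \<inter> U')) (f' \<circ> inv_into U f))"

definition orientable_surface :: "'a topology \<Rightarrow> bool" where
  "orientable_surface X \<longleftrightarrow> (\<exists>A. oriented_atlas X A)"

subsection \<open>Tilings\<close>

text \<open>A graph embedded in \<open>X\<close> is given by its finite vertex set \<open>V\<close> and the finite set \<open>E\<close> of its
  closed edges, as point sets. Loops and multiple edges are allowed.\<close>

definition edge_path :: "'a topology \<Rightarrow> 'a set \<Rightarrow> (real \<Rightarrow> 'a) \<Rightarrow> bool" where
  "edge_path X V g \<longleftrightarrow> pathin X g \<and> inj_on g {0<..<1} \<and>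
     g 0 \<in> V \<and> g 1 \<in> V \<and> g ` {0<..<1} \<inter> V = {}"

definition embedded_graph :: "'a topology \<Rightarrow> 'a set \<Rightarrow> 'a set set \<Rightarrow> bool" where
  "embedded_graph X V E \<longleftrightarrow> finite V \<and> finite E \<and> V \<subseteq> topspace X \<and>
     (\<forall>e\<in>E. \<exists>g. edge_path X V g \<and> e = g ` {0..1}) \<and>
     (\<forall>e\<in>E. \<forall>e'\<in>E. e \<noteq> e' \<longrightarrow> e \<inter> e' \<subseteq> V)"

text \<open>A loop meets \<open>V\<close> in one point only and is counted twice.\<close>

definition vertex_degree :: "'a set \<Rightarrow> 'a set set \<Rightarrow> 'a \<Rightarrow> nat" where
  "vertex_degree V E v = card {e\<in>E. v \<in> e} + card {e\<in>E. e \<inter> V = {v}}"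

definition tiles :: "'a topology \<Rightarrow> 'a set \<Rightarrow> 'a set set \<Rightarrow> 'a set set" where
  "tiles X V E = connected_components_of (subtopology X (topspace X - (V \<union> \<Union>E)))"

text \<open>The closed unit disk is regarded as an \<open>n\<close>-gon whose corners are the \<open>n\<close>-th roots of unity.
  Its side \<open>k\<close> is the circular arc parametrized, counterclockwise, by
  \<open>polygon_side n k s\<close> with \<open>s\<close> in the unit interval.\<close>

definition polygon_side :: "nat \<Rightarrow> nat \<Rightarrow> real \<Rightarrow> complex" where
  "polygon_side n k s = cis (2 * pi * (real k + s) / real n)"

text \<open>The map \<open>\<phi>\<close> exhibits the complementary region \<open>t\<close> as an open disk whose boundary, traversed once,
  is a closed walk of \<open>n\<close> edges. It need not be injective on the boundary circle, so that the
  tile may be degenerate.\<close>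

definition polygon_map ::
    "'a topology \<Rightarrow> 'a set \<Rightarrow> 'a set set \<Rightarrow> nat \<Rightarrow> 'a set \<Rightarrow> (complex \<Rightarrow> 'a) \<Rightarrow> bool" where
  "polygon_map X V E n t \<phi> \<longleftrightarrow> 3 \<le> n \<and>
     continuous_map (top_of_set (cball 0 1)) X \<phi> \<and>
     homeomorphic_map (top_of_set (ball 0 1)) (subtopology X t) \<phi> \<and>
     (\<forall>k<n. edge_path X V (\<phi> \<circ> polygon_side n k) \<and> (\<phi> \<circ> polygon_side n k) ` {0..1} \<in> E)"

definition tiling :: "'a topology \<Rightarrow> 'a set \<Rightarrow> 'a set set \<Rightarrow> bool" where
  "tiling X V E \<longleftrightarrow> embedded_graph X V E \<and>
     (\<forall>v\<in>V. 3 \<le> vertex_degree V E v) \<and>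
     (\<forall>t\<in>tiles X V E. \<exists>n \<phi>. polygon_map X V E n t \<phi>)"

definition pentagonal_tiling :: "'a topology \<Rightarrow> 'a set \<Rightarrow> 'a set set \<Rightarrow> bool" where
  "pentagonal_tiling X V E \<longleftrightarrow> tiling X V E \<and>
     (\<forall>t\<in>tiles X V E. \<exists>\<phi>. polygon_map X V E 5 t \<phi>)"

text \<open>The boundary of the \<open>n\<close>-gon \<open>t\<close> is a simple closed curve.\<close>

definition nondegenerate_polygon ::
    "'a topology \<Rightarrow> 'a set \<Rightarrow> 'a set set \<Rightarrow> nat \<Rightarrow> 'a set \<Rightarrow> bool" where
  "nondegenerate_polygon X V E n t \<longleftrightarrow> (\<exists>\<phi>. polygon_map X V E n t \<phi> \<and> inj_on \<phi> (sphere 0 1))"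

definition tile_vertices :: "'a topology \<Rightarrow> 'a set \<Rightarrow> 'a set \<Rightarrow> 'a set" where
  "tile_vertices X V t = V \<inter> X closure_of t"

subsection \<open>Pentagonal subdivision\<close>

text \<open>If \<open>\<phi>\<close> is positively oriented, the counterclockwise orientation of the unit circle induces the
  orientation of the boundary of the tile parametrized by \<open>\<phi>\<close>.\<close>

definition positively_oriented ::
    "('a set \<times> ('a \<Rightarrow> complex)) set \<Rightarrow> (complex \<Rightarrow> 'a) \<Rightarrow> bool" where
  "positively_oriented A \<phi> \<longleftrightarrow>
     (\<forall>(U, f)\<in>A. orientation_preserving_on {z \<in> ball 0 1. \<phi> z \<in> U} (f \<circ> \<phi>))"

text \<open>The path \<open>h\<close>, defined on the unit interval, meets the set \<open>D\<close> first at time \<open>s\<close>.\<close>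

definition first_meets :: "(real \<Rightarrow> 'a) \<Rightarrow> 'a set \<Rightarrow> real \<Rightarrow> bool" where
  "first_meets h D s \<longleftrightarrow> s \<in> {0..1} \<and> h s \<in> D \<and> (\<forall>r\<in>{0..<s}. h r \<notin> D)"

text \<open>The graph \<open>(V', E')\<close> is the pentagonal subdivision of the tiling \<open>(V, E)\<close> of \<open>X\<close>, with respect to
  the orientation given by the atlas \<open>A\<close>. Here \<open>\<gamma> e\<close> parametrizes the edge \<open>e\<close>; since the parametrization
  is arbitrary, so are the two dividing points \<open>\<gamma> e (1/3)\<close> and \<open>\<gamma> e (2/3)\<close>. The map \<open>\<Phi> t\<close> exhibits
  the tile \<open>t\<close> as an \<open>n t\<close>-gon, with center \<open>\<Phi> t (c t)\<close>, and \<open>j t k\<close> is the arc that joins, inside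
  the disk, the center to the first dividing point on side \<open>k\<close>. Working with the sides of
  the polygon takes care of edges that appear twice on the boundary of a degenerate tile.\<close>

definition pentagonal_subdivision ::
    "'a topology \<Rightarrow> ('a set \<times> ('a \<Rightarrow> complex)) set \<Rightarrow>
     'a set \<Rightarrow> 'a set set \<Rightarrow> 'a set \<Rightarrow> 'a set set \<Rightarrow> bool" where
  "pentagonal_subdivision X A V E V' E' \<longleftrightarrow>
     (\<exists>(\<gamma> :: 'a set \<Rightarrow> real \<Rightarrow> 'a) (n :: 'a set \<Rightarrow> nat) (\<Phi> :: 'a set \<Rightarrow> complex \<Rightarrow> 'a)
        (c :: 'a set \<Rightarrow> complex) (j :: 'a set \<Rightarrow> nat \<Rightarrow> real \<Rightarrow> complex) (D :: 'a set).
        (\<forall>e\<in>E. edge_path X V (\<gamma> e) \<and> \<gamma> e ` {0..1} = e) \<and>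
        D = (\<Union>e\<in>E. {\<gamma> e (1/3), \<gamma> e (2/3)}) \<and>
        (\<forall>t\<in>tiles X V E.
           polygon_map X V E (n t) t (\<Phi> t) \<and> positively_oriented A (\<Phi> t) \<and> c t \<in> ball 0 1 \<and>
           (\<forall>k<n t. arc (j t k) \<and> pathstart (j t k) = c t \<and>
              (\<exists>s. first_meets (\<Phi> t \<circ> polygon_side (n t) k) D s \<and>
                   pathfinish (j t k) = polygon_side (n t) k s) \<and>
              path_image (j t k) - {pathfinish (j t k)} \<subseteq> ball 0 1) \<and>
           (\<forall>k<n t. \<forall>l<n t. k \<noteq> l \<longrightarrow> path_image (j t k) \<inter> path_image (j t l) = {c t})) \<and>
        V' = V \<union> D \<union> (\<Union>t\<in>tiles X V E. {\<Phi> t (c t)}) \<and>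
        E' = (\<Union>e\<in>E. {\<gamma> e ` {0..1/3}, \<gamma> e ` {1/3..2/3}, \<gamma> e ` {2/3..1}}) \<union>
             (\<Union>t\<in>tiles X V E. \<Union>k<n t. {\<Phi> t ` path_image (j t k)}))"

end

theory Submission
  imports Defs
begin

text \<open>
  Number the corners of every tile from 0 to 4 so that corner 0 is the \<open>\<circ>\<close>-vertex. Every other
  vertex has degree 3, so any two edges at it span exactly one tile. Let \<open>A\<close> be the set of the
  neighbours of \<open>\<circ>\<close>-vertices; it contains corners 1 and 4. The local structure at degree 3 vertices
  shows that corners 2 and 3 are not both in \<open>A\<close>, and counting the pairs of a tile and a corner in \<open>A\<close>
  shows that exactly one of them is. Hence each tile has a preferred direction around its boundary, the
  one for which corner 3 is in \<open>A\<close> and corner 2 is not, and a case distinction shows that adjacent tiles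
  traverse their common side in opposite directions. The preferred directions therefore define an
  orientation of the surface.

  The three tiles around a corner 2 fit together to a triangle with center corner 2 whose corners are
  \<open>\<circ>\<close>-vertices. A side of this triangle consists of side 0 of one tile and sides 3 and 4 of the next one.
  These triangles are the tiles of \<open>T\<close>, and the sides 2 of the tiles are the segments from the centers to
  the first dividing points.
\<close>

subsection \<open>Orientation-preserving maps of the plane\<close>

text \<open>Everything takes place in the topological category, where a derivative need not exist to
  decide about orientation. Instead, the winding number of the image of a small circle under an
  injective continuous map is 1 or -1 and locally constant. The atlas is not built by choosing
  charts: it consists of all charts that agree with every tile in its preferred direction. Charts at
  interior points of tiles and of edges suffice, because the vertices are isolated and a chart
  around a vertex has a constant sign on a punctured disk. A chart across an edge glues two tiles,
  which must run through their common side in opposite directions and also at the same speed; all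
  tiles are reparametrized for this purpose. A tile is merely a component of the complement of the
  graph, so the finiteness of the set of tiles and the fact that each edge borders exactly two of
  them have to be derived, with invariance of domain as the source. Corners 1, 3 and 4 become the
  dividing points of T. Since T may have loops, injectivity is claimed only for its open tiles and
  open edges.\<close>

lemma winding_number_image_circlepath:
  fixes f :: "complex \<Rightarrow> complex"
  assumes f: "continuous_on (cball a R) f" "inj_on f (cball a R)"
    and z: "z \<in> ball a R" and r: "0 < r" "cball z r \<subseteq> cball a R"
  shows "winding_number (f \<circ> circlepath z r) (f z) = winding_number (f \<circ> circlepath a R) (f a)"
proof -
  have R: "0 < R" using z by (metis dist_not_less_zero less_trans mem_ball not_less_iff_gr_or_eq zero_le_dist)
  \<comment> \<open>Straight-line homotopy: points with the same angle on the two circles move along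
    a segment.\<close>
  have hl: "homotopic_loops (cball a R - {z}) (circlepath z r) (circlepath a R)"
  proof (rule homotopic_loops_linear; (intro path_part_circlepath)?)
    fix t :: real
    let ?e = "exp (2 * of_real pi * \<i> * of_real t) :: complex"
    have e: "cmod ?e = 1" by simp
    show "closed_segment (circlepath z r t) (circlepath a R t) \<subseteq> cball a R - {z}"
    proof
      fix x assume x: "x \<in> closed_segment (circlepath z r t) (circlepath a R t)"
      then obtain u where u: "0 \<le> u" "u \<le> 1"
        and xu: "x = (1 - u) *\<^sub>R circlepath z r t + u *\<^sub>R circlepath a R t"
        by (auto simp: closed_segment_def)
      have "circlepath z r t \<in> cball z r" "circlepath a R t \<in> cball a R"
        using r R e by (auto simp: circlepath dist_norm norm_mult)
      then have "x \<in> cball a R"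
        using x r(2) by (meson closed_segment_subset convex_cball subsetD)
      moreover have "x \<noteq> z"
      proof
        assume "x = z"
        \<comment> \<open>Compare moduli: the left side has modulus at least \<open>u * R\<close>,
          the right side less than that unless \<open>u = 0\<close>, and then the left side has
          modulus \<open>r > 0\<close>.\<close>
        then have "of_real ((1 - u) * r + u * R) * ?e = of_real u * (z - a)"
          using xu by (simp add: circlepath scaleR_conv_of_real algebra_simps)
        then have "cmod (of_real ((1 - u) * r + u * R) * ?e) = u * cmod (z - a)"
          using u by (simp add: norm_mult)
        then have "\<bar>(1 - u) * r + u * R\<bar> = u * cmod (z - a)"
          using e by (metis mult.right_neutral norm_mult norm_of_real)
        moreover have "u = 0 \<or> u * cmod (z - a) < u * R"
        proof (cases "u = 0")
        case False
        then show ?thesis using z u by (simp add: dist_norm norm_minus_commute)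
      qed simp
        moreover have "0 \<le> (1 - u) * r" "0 \<le> u * R" using u r R by auto
        ultimately show False using r by auto
      qed
      ultimately show "x \<in> cball a R - {z}" by blast
    qed
  qed auto
  have hl2: "homotopic_loops (-{f z}) (f \<circ> circlepath z r) (f \<circ> circlepath a R)"
    using hl
  proof (rule homotopic_loops_continuous_image)
    show "continuous_on (cball a R - {z}) f" using f(1) by (rule continuous_on_subset) auto
    show "f \<in> cball a R - {z} \<rightarrow> - {f z}"
      using f(2) z by (auto simp: inj_on_def)
  qed
  have "winding_number (f \<circ> circlepath z r) (f z) = winding_number (f \<circ> circlepath a R) (f z)"
    using hl2 by (rule winding_number_homotopic_loops)
  \<comment> \<open>The base point moves from \<open>f z\<close> to \<open>f a\<close> inside the
    connected image of the open disk, which misses the curve because \<open>f\<close> is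
    injective.\<close>
  also have "\<dots> = winding_number (f \<circ> circlepath a R) (f a)"
  proof (rule winding_number_eq)
    show "path (f \<circ> circlepath a R)" using homotopic_loops_imp_path[OF hl2] by blast
    show "pathfinish (f \<circ> circlepath a R) = pathstart (f \<circ> circlepath a R)"
      using homotopic_loops_imp_loop[OF hl2] by blast
    show "connected (f ` ball a R)"
      by (rule connected_continuous_image) (auto intro: continuous_on_subset[OF f(1)])
    show "f z \<in> f ` ball a R" "f a \<in> f ` ball a R" using z R by auto
    show "f ` ball a R \<inter> path_image (f \<circ> circlepath a R) = {}"
      using f(2) R by (auto simp: path_image_compose inj_on_def) 
         (metis dist_norm dual_order.irrefl mem_ball mem_cball mem_sphere order.order_iff_strict)
  qed
  finally show ?thesis .
qed

text \<open>The image of the circle is a Jordan curve, so it suffices that \<open>f z\<close> lies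
  inside it. The component of the complement that contains \<open>f z\<close> meets the image of the
  open disk in a set that is relatively open by invariance of domain and relatively closed as the
  trace of a compact image. Hence the component lies in a bounded set.\<close>

lemma winding_number_image_circlepath_cases:
  fixes f :: "complex \<Rightarrow> complex"
  assumes f: "continuous_on (cball z r) f" "inj_on f (cball z r)" and r: "0 < r"
  shows "winding_number (f \<circ> circlepath z r) (f z) \<in> {1, -1}"
proof -
  let ?g = "f \<circ> circlepath z r"
  have im: "path_image ?g = f ` sphere z r" using r by (simp add: path_image_compose)
  have sp: "simple_path ?g"
  proof (rule simple_path_continuous_image)
    show "simple_path (circlepath z r)" using r by (simp add: simple_path_circlepath)
  qed (use r continuous_on_subset[OF f(1)] inj_on_subset[OF f(2)] in simp_all)
  have "f z \<in> inside (path_image ?g)"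
  proof -
    have 1: "f z \<notin> f ` sphere z r"
      using inj_on_image_mem_iff[OF f(2), of z "sphere z r"] r by simp
    have cb: "cball z r = ball z r \<union> sphere z r" by auto
    let ?C = "connected_component_set (- f ` sphere z r) (f z)"
    have "open (f ` ball z r)"
      using invariance_of_domain[OF continuous_on_subset[OF f(1)] open_ball inj_on_subset[OF f(2)]] by simp
    moreover have "closed (f ` cball z r)"
      using compact_continuous_image[OF f(1)] by (simp add: compact_imp_closed)
    moreover have "?C \<inter> f ` ball z r = ?C \<inter> f ` cball z r"
      using connected_component_subset[of "- f ` sphere z r" "f z"] unfolding cb image_Un by blast
    ultimately have "openin (top_of_set ?C) (?C \<inter> f ` ball z r) \<and> closedin (top_of_set ?C) (?C \<inter> f ` ball z r)"
      using openin_open_Int closedin_closed_Int by metis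
    moreover have "f z \<in> ?C \<inter> f ` ball z r" using r 1 by (auto simp: connected_component_refl_eq)
    ultimately have "?C = ?C \<inter> f ` ball z r"
      using connected_clopen[THEN iffD1, OF connected_connected_component[of "- f ` sphere z r" "f z"]] by blast
    then have "?C \<subseteq> f ` cball z r"
      using image_mono[OF ball_subset_cball, of f z r] by blast
    then have "bounded ?C"
      using compact_imp_bounded[OF compact_continuous_image[OF f(1)]] bounded_subset by simp
    then show ?thesis using 1 by (simp add: inside_def im)
  qed
  then show ?thesis using simple_closed_path_winding_number_inside[OF sp] by blast
qed

text \<open>In the plane punctured at \<open>f z\<close>, loops are classified by their winding
  number. The image of the small circle under \<open>f\<close> is therefore homotopic to a round
  circle traversed once, forwards or backwards, and \<open>g\<close> can be applied to that circle
  instead.\<close>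

lemma winding_number_image_compose:
  fixes f g :: "complex \<Rightarrow> complex"
  assumes f: "continuous_on (cball z r) f" "inj_on f (cball z r)" and r: "0 < r"
    and fim: "f ` cball z r \<subseteq> cball (f z) \<rho>"
    and g: "continuous_on (cball (f z) \<rho>) g" "inj_on g (cball (f z) \<rho>)" and \<rho>: "0 < \<rho>"
  shows "winding_number (g \<circ> f \<circ> circlepath z r) (g (f z)) =
    winding_number (f \<circ> circlepath z r) (f z) * winding_number (g \<circ> circlepath (f z) \<rho>) (g (f z))"
proof -
  let ?w = "f z" let ?p = "f \<circ> circlepath z r"
  define n where "n = winding_number ?p ?w"
  define q where "q = (if n = 1 then circlepath ?w \<rho> else reversepath (circlepath ?w \<rho>))"
  \<comment> \<open>The homotopy may leave the disk on which \<open>g\<close> is controlled. The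
    radial retraction \<open>c\<close> brings it back, fixes the disk pointwise and sends no other
    point to the center.\<close>
  define c where "c y = ?w + (y - ?w) /\<^sub>R max 1 (norm (y - ?w) / \<rho>)" for y
  have n: "n = 1 \<or> n = -1"
    using winding_number_image_circlepath_cases[OF f r] by (auto simp: n_def)
  have w_q: "?w \<notin> path_image (circlepath ?w \<rho>)" using \<rho> by simp
  have pim: "path_image ?p = f ` sphere z r" using r by (simp add: path_image_compose)
  have "homotopic_loops (-{?w}) ?p q"
  proof (subst winding_number_homotopic_loops_eq[symmetric])
    show "path ?p"
      by (intro path_continuous_image continuous_on_subset[OF f(1)]) (use r in auto)
    show "?w \<notin> path_image ?p" using f(2) r unfolding pim by (force simp: inj_on_def)
    show "pathfinish ?p = pathstart ?p" by (simp add: pathfinish_compose pathstart_compose)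
    show "path q" "?w \<notin> path_image q" "pathfinish q = pathstart q"
      using w_q by (auto simp: q_def)
    show "winding_number ?p ?w = winding_number q ?w"
      using n \<rho> w_q unfolding n_def[symmetric]
      by (auto simp: q_def winding_number_reversepath winding_number_circlepath_centre
              )
  qed
  then have "homotopic_loops (-{g ?w}) ((g \<circ> c) \<circ> ?p) ((g \<circ> c) \<circ> q)"
  proof (rule homotopic_loops_continuous_image)
    have c: "c y \<in> cball ?w \<rho>" "y \<noteq> ?w \<Longrightarrow> c y \<noteq> ?w" for y
    proof -
      have "norm (y - ?w) / max 1 (norm (y - ?w) / \<rho>) \<le> \<rho>"
        using \<rho> by (auto simp: max_def field_simps)
      then show "c y \<in> cball ?w \<rho>" by (simp add: c_def dist_norm divide_inverse mult.commute)
      have "max 1 (norm (y - ?w) / \<rho>) > 0" by simp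
      then show "c y \<noteq> ?w" if "y \<noteq> ?w" using that by (simp add: c_def)
    qed
    have "continuous_on (-{?w}) c"
      unfolding c_def using \<rho> by (intro continuous_intros) (auto simp: max_def)
    then show "continuous_on (-{?w}) (g \<circ> c)"
      using c(1) by (intro continuous_on_compose continuous_on_subset[OF g(1)]) auto
    show "g \<circ> c \<in> - {?w} \<rightarrow> - {g ?w}"
    proof
      fix y assume "y \<in> - {?w}"
      then show "(g \<circ> c) y \<in> - {g ?w}"
        using inj_onD[OF g(2), of "c y" ?w] c[of y] \<rho> by auto
    qed
  qed
  then have "winding_number ((g \<circ> c) \<circ> ?p) (g ?w) = winding_number ((g \<circ> c) \<circ> q) (g ?w)"
    by (rule winding_number_homotopic_loops)
  moreover have c_id: "c y = y" if "y \<in> cball ?w \<rho>" for y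
    using that \<rho> by (auto simp: c_def dist_norm norm_minus_commute max_def field_simps)
  have "winding_number ((g \<circ> c) \<circ> ?p) (g ?w) = winding_number (g \<circ> f \<circ> circlepath z r) (g ?w)"
  proof (rule winding_number_cong)
    fix t :: real assume "0 \<le> t" "t \<le> 1"
    then have "?p t \<in> path_image ?p" by (simp add: path_image_def)
    moreover have "f ` sphere z r \<subseteq> f ` cball z r" by (intro image_mono) auto
    ultimately have "?p t \<in> cball ?w \<rho>" using fim unfolding pim by blast
    then show "((g \<circ> c) \<circ> ?p) t = (g \<circ> f \<circ> circlepath z r) t" by (simp add: c_id)
  qed
  moreover have "winding_number ((g \<circ> c) \<circ> q) (g ?w) = winding_number (g \<circ> q) (g ?w)"
  proof (rule winding_number_cong)
    fix t :: real assume "0 \<le> t" "t \<le> 1"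
    then have "q t \<in> path_image q" by (simp add: path_image_def)
    moreover have "path_image q = sphere ?w \<rho>" using \<rho> by (auto simp: q_def)
    ultimately show "((g \<circ> c) \<circ> q) t = (g \<circ> q) t" by (simp add: c_id)
  qed
  moreover have "winding_number (g \<circ> q) (g ?w) = n * winding_number (g \<circ> circlepath ?w \<rho>) (g ?w)"
  proof (cases "n = 1")
    case False
    then have "g \<circ> q = reversepath (g \<circ> circlepath ?w \<rho>)" by (auto simp: q_def reversepath_def)
    moreover have "path (g \<circ> circlepath ?w \<rho>)"
      by (intro path_continuous_image continuous_on_subset[OF g(1)]) (use \<rho> in auto)
    moreover have "g ?w \<notin> path_image (g \<circ> circlepath ?w \<rho>)"
      using g(2) \<rho> by (force simp: path_image_compose inj_on_def)
    ultimately show ?thesis using False n by (simp add: winding_number_reversepath)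
  qed (simp add: q_def)
  ultimately show ?thesis by (simp add: n_def)
qed

lemma small_cball_image:
  fixes f :: "complex \<Rightarrow> complex"
  assumes "open U" "continuous_on U f" "z \<in> U" "0 < \<rho>" "0 < r0"
  obtains r where "0 < r" "r \<le> r0" "cball z r \<subseteq> U" "f ` cball z r \<subseteq> ball (f z) \<rho>"
proof -
  have "open (U \<inter> f -` ball (f z) \<rho>)" using assms by (simp add: continuous_open_preimage)
  then obtain r where "0 < r" "cball z r \<subseteq> U \<inter> f -` ball (f z) \<rho>"
    using assms by (metis IntI centre_in_ball open_contains_cball vimageI)
  moreover have "cball z (min r r0) \<subseteq> cball z r" by auto
  ultimately show thesis using that[of "min r r0"] assms by fastforce
qed

lemma orientation_preserving_on_cong:
  assumes "\<And>z. z \<in> U \<Longrightarrow> f z = g z"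
  shows "orientation_preserving_on U f \<longleftrightarrow> orientation_preserving_on U g"
proof -
  have "winding_number (f \<circ> circlepath z r) (f z) = winding_number (g \<circ> circlepath z r) (g z)"
    if "0 < r" "cball z r \<subseteq> U" for z r
  proof -
    have "winding_number (f \<circ> circlepath z r) (f z) = winding_number (g \<circ> circlepath z r) (f z)"
    proof (rule winding_number_cong)
      fix t :: real assume "0 \<le> t" "t \<le> 1"
      then have "circlepath z r t \<in> path_image (circlepath z r)" by (simp add: path_image_def)
      then have "circlepath z r t \<in> U" using that by auto
      then show "(f \<circ> circlepath z r) t = (g \<circ> circlepath z r) t" using assms by simp
    qed
    then show ?thesis using assms[of z] that by (simp add: subset_iff)
  qed
  then show ?thesis by (simp add: orientation_preserving_on_def)
qed

lemma orientation_preserving_on_subset: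
  "orientation_preserving_on U f \<Longrightarrow> T \<subseteq> U \<Longrightarrow> orientation_preserving_on T f"
  by (auto simp: orientation_preserving_on_def)

text \<open>The sign is constant on every closed disk in the domain, so one point of each disk
  decides it. This is why orientation needs to be checked only on the open tiles, which are
  dense.\<close>

lemma orientation_preserving_on_dense:
  assumes U: "continuous_on U f" "inj_on f U"
    and d: "\<And>z e. z \<in> U \<Longrightarrow> 0 < e \<Longrightarrow> \<exists>z' T. z' \<in> ball z e \<and> z' \<in> T \<and> open T \<and> orientation_preserving_on T f"
  shows "orientation_preserving_on U f"
  unfolding orientation_preserving_on_def
proof (intro allI impI, elim conjE)
  fix z r assume r: "0 < (r::real)" "cball z r \<subseteq> U"
  then obtain z' T where T: "z' \<in> ball z r" "z' \<in> T" "open T" "orientation_preserving_on T f"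
    using d[of z r] by (metis centre_in_cball less_imp_le subsetD)
  have "open (T \<inter> ball z r)" using T by auto
  then obtain r' where r': "0 < r'" "cball z' r' \<subseteq> T \<inter> ball z r"
    using T by (metis IntI open_contains_cball)
  have "winding_number (f \<circ> circlepath z' r') (f z') = winding_number (f \<circ> circlepath z r) (f z)"
    by (rule winding_number_image_circlepath)
       (use r r' T in \<open>auto intro: continuous_on_subset[OF U(1)] inj_on_subset[OF U(2)] simp: less_imp_le\<close>)
  then show "winding_number (f \<circ> circlepath z r) (f z) = 1"
    using T(4) r' by (auto simp: orientation_preserving_on_def)
qed

text \<open>The sign is multiplicative on a circle so small that its image fits into a disk on which
  \<open>g\<close> is defined.\<close>

lemma orientation_preserving_on_compose:
  assumes U: "open U" "continuous_on U f" "inj_on f U" "orientation_preserving_on U f"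
    and V: "open V" "continuous_on V g" "inj_on g V" "orientation_preserving_on V g"
    and fim: "f ` U \<subseteq> V"
  shows "orientation_preserving_on U (g \<circ> f)"
  unfolding orientation_preserving_on_def
proof (intro allI impI, elim conjE)
  fix z r assume r: "0 < (r::real)" "cball z r \<subseteq> U"
  then have z: "z \<in> U" by auto
  have "f z \<in> V" using z fim by blast
  then obtain \<rho> where \<rho>: "0 < \<rho>" "cball (f z) \<rho> \<subseteq> V" using V(1) open_contains_cball by blast
  obtain s where s: "0 < s" "s \<le> r" "cball z s \<subseteq> U" "f ` cball z s \<subseteq> ball (f z) \<rho>"
    using small_cball_image[OF U(1,2) z \<rho>(1) r(1)] by blast
  have gf: "continuous_on U (g \<circ> f)" "inj_on (g \<circ> f) U"
    using continuous_on_compose[OF U(2) continuous_on_subset[OF V(2) fim]]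
      comp_inj_on[OF U(3) inj_on_subset[OF V(3) fim]] by auto
  have "winding_number (g \<circ> f \<circ> circlepath z s) ((g \<circ> f) z) = winding_number (g \<circ> f \<circ> circlepath z r) ((g \<circ> f) z)"
    using winding_number_image_circlepath[OF continuous_on_subset[OF gf(1) r(2)] inj_on_subset[OF gf(2) r(2)], of z s] r s
      subset_cball[of s r z] by simp
  moreover have "winding_number (g \<circ> f \<circ> circlepath z s) (g (f z)) =
      winding_number (f \<circ> circlepath z s) (f z) * winding_number (g \<circ> circlepath (f z) \<rho>) (g (f z))"
    using winding_number_image_compose[OF continuous_on_subset[OF U(2) s(3)] inj_on_subset[OF U(3) s(3)] s(1) _
        continuous_on_subset[OF V(2) \<rho>(2)] inj_on_subset[OF V(3) \<rho>(2)] \<rho>(1)] s(4) ball_subset_cball by blast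
  ultimately show "winding_number (g \<circ> f \<circ> circlepath z r) ((g \<circ> f) z) = 1"
    using U(4) V(4) s(1,3) \<rho> by (simp add: orientation_preserving_on_def)
qed

lemma continuous_on_left_inverse_open:
  fixes f :: "complex \<Rightarrow> complex"
  assumes "open U" "continuous_on U f" "\<And>z. z \<in> U \<Longrightarrow> g (f z) = z"
  shows "continuous_on (f ` U) g" "open (f ` U)"
proof -
  have inj: "inj_on f U" using assms by (metis inj_onI)
  show "open (f ` U)" using invariance_of_domain[OF assms(2,1) inj] .
  show "continuous_on (f ` U) g"
  proof -
    obtain h where h: "homeomorphism U (f ` U) f h"
      using invariance_of_domain_homeomorphism[OF assms(1,2) _ inj] by auto
    then have "continuous_on (f ` U) h" by (simp add: homeomorphism_def)
    moreover have "h y = g y" if "y \<in> f ` U" for y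
      using that h assms(3) by (auto simp: homeomorphism_def)
    ultimately show ?thesis using continuous_on_cong by force
  qed
qed

text \<open>The product formula for \<open>g \<circ> f\<close>, which is the identity on
  \<open>U\<close>: the sign of \<open>f\<close> is 1, hence so is that of \<open>g\<close>.\<close>

lemma orientation_preserving_on_inverse:
  assumes U: "open U" "continuous_on U f" "orientation_preserving_on U f"
    and g: "\<And>z. z \<in> U \<Longrightarrow> g (f z) = z"
  shows "orientation_preserving_on (f ` U) g"
  unfolding orientation_preserving_on_def
proof (intro allI impI, elim conjE)
  fix w \<rho> assume \<rho>: "0 < (\<rho>::real)" "cball w \<rho> \<subseteq> f ` U"
  then obtain z where z: "z \<in> U" "w = f z" by (metis centre_in_cball image_iff less_imp_le subsetD)
  have inj: "inj_on f U" using g by (metis inj_onI)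
  have injg: "inj_on g (f ` U)" using g by (auto simp: inj_on_def)
  have cg: "continuous_on (f ` U) g" by (rule continuous_on_left_inverse_open[OF U(1,2) g])
  obtain s where s: "0 < s" "s \<le> 1" "cball z s \<subseteq> U" "f ` cball z s \<subseteq> ball (f z) \<rho>"
    using small_cball_image[OF U(1,2) z(1) \<rho>(1) zero_less_one] by blast
  have "winding_number (g \<circ> f \<circ> circlepath z s) (g (f z)) =
      winding_number (f \<circ> circlepath z s) (f z) * winding_number (g \<circ> circlepath (f z) \<rho>) (g (f z))"
    by (rule winding_number_image_compose)
       (use s \<rho> z in \<open>auto intro: continuous_on_subset[OF U(2)] inj_on_subset[OF inj]
          continuous_on_subset[OF cg] inj_on_subset[OF injg]\<close>)
  moreover have "winding_number (f \<circ> circlepath z s) (f z) = 1"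
    using U(3) s by (auto simp: orientation_preserving_on_def)
  moreover have "winding_number (g \<circ> f \<circ> circlepath z s) (g (f z)) = winding_number (circlepath z s) z"
    unfolding g[OF z(1)]
  proof (rule winding_number_cong)
    fix t :: real assume "0 \<le> t" "t \<le> 1"
    then have "circlepath z s t \<in> path_image (circlepath z s)" by (simp add: path_image_def)
    then have "circlepath z s t \<in> U" using s by auto
    then show "(g \<circ> f \<circ> circlepath z s) t = circlepath z s t" using g by simp
  qed
  ultimately show "winding_number (g \<circ> circlepath w \<rho>) (g w) = 1"
    using z s winding_number_circlepath_centre[of s z] by simp
qed

text \<open>Conjugation negates the winding number, and 1 differs from -1.\<close>

lemma orientation_preserving_on_not_cnj:
  assumes "open T" "continuous_on T f" "inj_on f T" "T \<noteq> {}"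
    and "orientation_preserving_on T f"
  shows "\<not> orientation_preserving_on T (cnj \<circ> f)"
proof
  assume c: "orientation_preserving_on T (cnj \<circ> f)"
  obtain z r where r: "0 < r" "cball z r \<subseteq> T"
    using assms(1,4) by (meson ex_in_conv open_contains_cball)
  have "path (f \<circ> circlepath z r)"
    by (intro path_continuous_image continuous_on_subset[OF assms(2)]) (use r in auto)
  moreover have "f z \<notin> path_image (f \<circ> circlepath z r)"
    using inj_on_subset[OF assms(3) r(2)] r by (force simp: path_image_compose inj_on_def)
  ultimately have "winding_number (cnj \<circ> (f \<circ> circlepath z r)) (cnj (f z)) = - cnj (winding_number (f \<circ> circlepath z r) (f z))"
    by (rule winding_number_cnj)
  then show False using c assms(5) r by (auto simp: orientation_preserving_on_def o_assoc)
qed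

text \<open>The sign is 1 or -1 and locally constant, hence constant on a connected set, and
  conjugation in the target negates it.\<close>

lemma orientation_preserving_on_or_cnj:
  fixes f :: "complex \<Rightarrow> complex"
  assumes U: "open U" "connected U" "continuous_on U f" "inj_on f U"
  shows "orientation_preserving_on U f \<or> orientation_preserving_on U (cnj \<circ> f)"
proof -
  define w where "w z r = winding_number (f \<circ> circlepath z r) (f z)" for z r
  have w: "w z' r' = w z r" if "0 < r'" "cball z' r' \<subseteq> cball z r" "z' \<in> ball z r" "cball z r \<subseteq> U" for z z' r r'
    unfolding w_def using winding_number_image_circlepath[OF continuous_on_subset[OF U(3) that(4)]
        inj_on_subset[OF U(4) that(4)] that(3,1,2)] .
  define P where "P n = {z\<in>U. \<exists>r>0. cball z r \<subseteq> U \<and> w z r = n}" for n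
  have Pw: "w z r = n" if zr: "z \<in> P n" "0 < r" "cball z r \<subseteq> U" for z r n
  proof -
    obtain s where s: "s > 0" "cball z s \<subseteq> U" "w z s = n" using zr(1) unfolding P_def by blast
    have "w z (min r s) = w z s" "w z (min r s) = w z r"
      using w[of "min r s" z z s] w[of "min r s" z z r] zr s
        subset_cball[of "min r s" r z] subset_cball[of "min r s" s z] by auto
    then show ?thesis using s by simp
  qed
  have oP: "open (P n)" for n
    unfolding open_contains_ball
  proof
    fix z assume "z \<in> P n"
    then obtain r where r: "r > 0" "cball z r \<subseteq> U" "w z r = n" by (auto simp: P_def)
    have "ball z r \<subseteq> P n"
    proof
      fix z' assume z': "z' \<in> ball z r"
      then obtain r' where r': "r' > 0" "cball z' r' \<subseteq> ball z r" by (meson open_ball open_contains_cball)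
      moreover have "cball z' r' \<subseteq> cball z r" using r'(2) ball_subset_cball by blast
      ultimately have "w z' r' = w z r" using z' r w by blast
      moreover have "cball z' r' \<subseteq> U" using r' r ball_subset_cball by blast
      ultimately show "z' \<in> P n" using r r' z' by (auto simp: P_def)
    qed
    then show "\<exists>e>0. ball z e \<subseteq> P n" using r by blast
  qed
  have cov: "U \<subseteq> P 1 \<union> P (-1)"
  proof
    fix z assume z: "z \<in> U"
    then obtain r where r: "r > 0" "cball z r \<subseteq> U" using U(1) by (meson open_contains_cball)
    have "w z r \<in> {1,-1}" unfolding w_def
      by (rule winding_number_image_circlepath_cases)
         (use r continuous_on_subset[OF U(3)] inj_on_subset[OF U(4)] in simp_all)
    then show "z \<in> P 1 \<union> P (-1)" using r z by (auto simp: P_def)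
  qed
  have "P 1 \<inter> P (-1) = {}"
  proof (rule ccontr)
    assume "P 1 \<inter> P (-1) \<noteq> {}"
    then obtain z where z: "z \<in> P 1" "z \<in> P (-1)" by blast
    then obtain r where "0 < r" "cball z r \<subseteq> U" by (auto simp: P_def)
    then have "w z r = 1" "w z r = -1" using Pw z by blast+
    then show False by simp
  qed
  then have "P 1 \<inter> U = {} \<or> P (-1) \<inter> U = {}"
    using connectedD[OF U(2) oP oP, of 1 "-1"] cov by blast
  then consider "U \<subseteq> P (-1)" | "U \<subseteq> P 1" using cov by blast
  then show ?thesis
  proof cases
    case 2
    then have "orientation_preserving_on U f"
      unfolding orientation_preserving_on_def w_def[symmetric]
      by (metis Pw centre_in_cball less_imp_le subsetD)
    then show ?thesis ..
  next
    case 1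
    have "winding_number (cnj \<circ> f \<circ> circlepath z r) ((cnj \<circ> f) z) = 1" if r: "0 < r" "cball z r \<subseteq> U" for z r
    proof -
      have sub: "sphere z r \<subseteq> U" using r(2) sphere_cball by blast
      have "path (f \<circ> circlepath z r)"
        by (intro path_continuous_image continuous_on_subset[OF U(3)]) (use r sub in simp_all)
      moreover have "f z \<notin> path_image (f \<circ> circlepath z r)"
        using inj_on_image_mem_iff[OF U(4) _ sub, of z] r by (simp add: path_image_compose subset_iff)
      ultimately have "winding_number (cnj \<circ> (f \<circ> circlepath z r)) (cnj (f z)) = - cnj (w z r)"
        unfolding w_def by (rule winding_number_cnj)
      moreover have "z \<in> U" using r by auto
      with 1 have "z \<in> P (-1)" by blast
      then have "w z r = -1" using Pw r by blast
      ultimately show ?thesis by (simp add: comp_assoc)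
    qed
    then show ?thesis by (simp add: orientation_preserving_on_def)
  qed
qed

text \<open>For a unit \<open>c\<close> this inversion exchanges the two sides of the unit circle,
  and it attaches a second tile to the outside of the disk of the first one. The sign is computed on
  one circle and spreads over the connected punctured plane.\<close>

lemma orientation_preserving_on_divide:
  assumes "c \<noteq> 0"
  shows "orientation_preserving_on (-{0}) (\<lambda>w. c / w)"
proof -
  let ?f = "\<lambda>w. c / w"
  have f: "continuous_on (-{0}) ?f" "inj_on ?f (-{0})"
    using assms by (auto intro!: continuous_intros simp: inj_on_def field_simps)
  \<comment> \<open>With \<open>z * z = -c\<close> the derivative \<open>-c / z^2\<close> at
    \<open>z\<close> equals 1, so the image of a circle around \<open>z\<close> can be compared with
    the translate of that circle to \<open>c / z\<close>.\<close>
  define z where "z = csqrt (-c)"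
  have z2: "z * z = -c" unfolding z_def by (metis power2_csqrt power2_eq_square)
  have z0: "z \<noteq> 0" using z2 assms by auto
  define r where "r = cmod z / 2"
  have r: "0 < r" using z0 by (simp add: r_def)
  have sub: "cball z r \<subseteq> -{0}" using z0 by (auto simp: r_def dist_norm)
  have "homotopic_loops (-{c / z}) (?f \<circ> circlepath z r) (circlepath (c / z) r)"
  proof (rule homotopic_loops_linear)
    show "path (?f \<circ> circlepath z r)"
      by (intro path_continuous_image continuous_on_subset[OF f(1)]) (use r sub in auto)
    show "pathfinish (?f \<circ> circlepath z r) = pathstart (?f \<circ> circlepath z r)"
      by (simp add: pathfinish_compose pathstart_compose)
    fix t :: real assume "t \<in> {0..1}"
    define w where "w = circlepath z r t"
    have wz: "w - z = of_real r * exp (2 * of_real pi * \<i> * of_real t)" by (simp add: w_def circlepath)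
    have "cmod (w - z) = r" using r by (simp add: wz norm_mult)
    then have w: "w \<in> cball z r" "w \<noteq> z" using r by (auto simp: dist_norm norm_minus_commute)
    have "c / z \<notin> closed_segment (c / w) (circlepath (c / z) r t)"
    proof
      assume "c / z \<in> closed_segment (c / w) (circlepath (c / z) r t)"
      then obtain u where u: "0 \<le> u" "u \<le> 1"
        and e: "c / z = (1 - u) *\<^sub>R (c / w) + u *\<^sub>R (c / z + (w - z))"
        by (auto simp: closed_segment_def circlepath wz)
      have w0: "w \<noteq> 0" using w sub by auto
      have c: "c = - z * z" using z2 by simp
      \<comment> \<open>Clearing denominators with \<open>c = - z * z\<close> leaves a product. Its
        second factor is a point of the segment from \<open>z\<close> to \<open>w\<close>, which
        stays in a disk that omits 0.\<close>
      have "(w - z) * ((1 - u) *\<^sub>R z + u *\<^sub>R w) = 0"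
        using e w0 z0 unfolding c by (simp add: field_simps scaleR_conv_of_real)
      then have "(1 - u) *\<^sub>R z + u *\<^sub>R w = 0" using w by simp
      then have "0 \<in> closed_segment z w" using u by (auto simp: closed_segment_def intro!: exI[of _ u])
      moreover have "closed_segment z w \<subseteq> cball z r" using w r by (simp add: closed_segment_subset)
      ultimately show False using sub by blast
    qed
    then show "closed_segment ((?f \<circ> circlepath z r) t) (circlepath (c / z) r t) \<subseteq> - {c / z}"
      by (auto simp: w_def)
  qed auto
  then have "winding_number (?f \<circ> circlepath z r) (c / z) = winding_number (circlepath (c / z) r) (c / z)"
    by (rule winding_number_homotopic_loops)
  then have w1: "winding_number (?f \<circ> circlepath z r) (?f z) = 1"
    using r by (simp add: winding_number_circlepath_centre)
  have "connected (-{0::complex})" by (simp add: connected_punctured_universe)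
  then consider "orientation_preserving_on (-{0}) ?f" | "orientation_preserving_on (-{0}) (cnj \<circ> ?f)"
    using orientation_preserving_on_or_cnj[of "-{0}" ?f] f by auto
  then show ?thesis
  proof cases
    case 2
    have "path (?f \<circ> circlepath z r)"
      by (intro path_continuous_image continuous_on_subset[OF f(1)]) (use r sub in auto)
    moreover have "?f z \<notin> path_image (?f \<circ> circlepath z r)"
      using inj_on_subset[OF f(2) sub] r by (force simp: path_image_compose inj_on_def)
    ultimately have "winding_number (cnj \<circ> (?f \<circ> circlepath z r)) (cnj (?f z)) = - cnj 1"
      using winding_number_cnj w1 by metis
    then show ?thesis using 2 r sub by (auto simp: orientation_preserving_on_def o_assoc)
  qed
qed

text \<open>Off 0, multiplication by \<open>c\<close> is a composite of two inversions; density of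
  the punctured plane takes care of 0.\<close>

lemma orientation_preserving_on_mult:
  assumes "c \<noteq> 0"
  shows "orientation_preserving_on UNIV (\<lambda>z. c * z)"
proof (rule orientation_preserving_on_dense)
  show "continuous_on UNIV (\<lambda>z. c * z)" by (intro continuous_intros)
  show "inj (\<lambda>z. c * z)" using assms by (auto intro: injI)
  fix z :: complex and e :: real assume "0 < e"
  have o: "open (-{0::complex})" by auto
  have d: "continuous_on (-{0}) (\<lambda>w. a / w)" "inj_on (\<lambda>w. a / w) (-{0})" if "a \<noteq> 0" for a :: complex
    using that by (auto intro!: continuous_intros simp: inj_on_def field_simps)
  have "orientation_preserving_on (-{0}) ((\<lambda>w. c / w) \<circ> (\<lambda>w. 1 / w))"
    by (rule orientation_preserving_on_compose[OF o d[OF one_neq_zero] orientation_preserving_on_divide[OF one_neq_zero]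
          o d[OF assms] orientation_preserving_on_divide[OF assms]]) auto
  moreover have "((\<lambda>w. c / w) \<circ> (\<lambda>w. 1 / w)) w = c * w" for w by simp
  ultimately have "orientation_preserving_on (-{0}) (\<lambda>z. c * z)"
    using orientation_preserving_on_cong[of "-{0}" "(\<lambda>w. c / w) \<circ> (\<lambda>w. 1 / w)" "\<lambda>z. c * z"] by simp
  moreover obtain z' where "z' \<in> ball z e" "z' \<noteq> 0"
  proof (cases "z = 0")
    case True
    show thesis by (rule that[of "of_real (e/2)"]) (use True \<open>0 < e\<close> in simp_all)
  next
    case False
    show thesis by (rule that[of z]) (use False \<open>0 < e\<close> in simp_all)
  qed
  ultimately show "\<exists>z' T. z' \<in> ball z e \<and> z' \<in> T \<and> open T \<and> orientation_preserving_on T (\<lambda>z. c * z)"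
    using o by (intro exI[of _ z'] exI[of _ "-{0}"]) simp
qed

text \<open>The segments give a homotopy of the boundary curve to a circle around \<open>m\<close>, so one winding number is 1.\<close>

lemma orientation_preserving_on_ball_boundary:
  assumes R: "continuous_on (cball 0 1) R" "inj_on R (cball 0 1)" and m: "m \<in> R ` ball 0 1"
    and b: "\<And>u. cmod u = 1 \<Longrightarrow> m \<notin> closed_segment (R u) (m + u)"
  shows "orientation_preserving_on (ball 0 1) R"
proof -
  obtain z0 where z0: "z0 \<in> ball 0 1" "m = R z0" using m by auto
  have pth: "path (R \<circ> circlepath 0 1)"
    by (intro path_continuous_image continuous_on_subset[OF R(1)]) auto
  have lp: "pathfinish (R \<circ> circlepath 0 1) = pathstart (R \<circ> circlepath 0 1)"
    by (simp add: pathfinish_compose pathstart_compose)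
  have "homotopic_loops (-{m}) (R \<circ> circlepath 0 1) (circlepath m 1)"
  proof (rule homotopic_loops_linear[OF pth _ lp])
    fix t :: real
    have "cmod (circlepath 0 1 t) = 1" by (simp add: circlepath)
    from b[OF this] show "closed_segment ((R \<circ> circlepath 0 1) t) (circlepath m 1 t) \<subseteq> -{m}"
      by (auto simp: circlepath)
  qed auto
  then have 1: "winding_number (R \<circ> circlepath 0 1) m = 1"
    using winding_number_homotopic_loops winding_number_circlepath_centre[of 1 m] by fastforce
  have "winding_number (R \<circ> circlepath 0 1) (R 0) = winding_number (R \<circ> circlepath 0 1) m"
  proof (rule winding_number_eq[OF pth lp])
    show "connected (R ` ball 0 1)"
      by (rule connected_continuous_image[OF continuous_on_subset[OF R(1)]]) auto
    show "R ` ball 0 1 \<inter> path_image (R \<circ> circlepath 0 1) = {}"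
      using inj_on_image_Int[OF R(2), of "ball 0 1" "sphere 0 1"] by (auto simp: path_image_compose)
  qed (use z0 in auto)
  with 1 have 2: "winding_number (R \<circ> circlepath 0 1) (R 0) = 1" by simp
  show ?thesis unfolding orientation_preserving_on_def
  proof (intro allI impI, elim conjE)
    fix z r assume r: "0 < (r::real)" "cball z r \<subseteq> ball (0::complex) 1"
    then have "z \<in> ball 0 1" "cball z r \<subseteq> cball 0 1" using ball_subset_cball[of "0::complex" 1] by (auto simp: subset_iff)
    then show "winding_number (R \<circ> circlepath z r) (R z) = 1"
      using winding_number_image_circlepath[OF R, of z r] 2 r by simp
  qed
qed

subsection \<open>Maps of the polygon\<close>

text \<open>The preimage of a closed set is a finite union of images of compact sets. So a map can
  be defined piecewise on compact images, such as the sides of a polygon or the thirds of a disk,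
  without explicit inverses of the pieces.\<close>

lemma continuous_map_from_compact_images:
  fixes q :: "'i \<Rightarrow> 'b::topological_space \<Rightarrow> 'c::t2_space"
  assumes "finite I" and K: "\<And>i. i \<in> I \<Longrightarrow> compact (K i)" "\<And>i. i \<in> I \<Longrightarrow> continuous_on (K i) (q i)"
    and h: "\<And>i. i \<in> I \<Longrightarrow> continuous_map (top_of_set (K i)) X (h \<circ> q i)"
  shows "continuous_map (top_of_set (\<Union>i\<in>I. q i ` K i)) X h"
  unfolding continuous_map_closedin
proof (intro conjI allI impI ballI)
  let ?S = "\<Union>i\<in>I. q i ` K i"
  show "h \<in> topspace (top_of_set ?S) \<rightarrow> topspace X"
    using continuous_map_funspace[OF h] by (auto simp: Pi_iff)
  fix C assume C: "closedin X C"
  let ?D = "\<lambda>i. {x \<in> K i. (h \<circ> q i) x \<in> C}"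
  have "closed (q i ` ?D i)" if i: "i \<in> I" for i
  proof -
    have "closedin (top_of_set (K i)) (?D i)"
      using h[OF i] C unfolding continuous_map_closedin by simp
    then have "compact (?D i)" by (rule closedin_compact[OF K(1)[OF i]])
    moreover have "continuous_on (?D i) (q i)" by (rule continuous_on_subset[OF K(2)[OF i]]) auto
    ultimately show ?thesis by (intro compact_imp_closed compact_continuous_image)
  qed
  then have "closed (\<Union>i\<in>I. q i ` ?D i)" using \<open>finite I\<close> by blast
  moreover have "{x \<in> topspace (top_of_set ?S). h x \<in> C} = (\<Union>i\<in>I. q i ` ?D i)" by auto
  ultimately show "closedin (top_of_set ?S) {x \<in> topspace (top_of_set ?S). h x \<in> C}"
    using closed_subset[of "\<Union>i\<in>I. q i ` ?D i" ?S] by auto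
qed

lemma continuous_on_polygon_side [continuous_intros]: "continuous_on S (polygon_side n k)"
  unfolding polygon_side_def cis_conv_exp divide_inverse by (intro continuous_intros)

lemma norm_polygon_side [simp]: "cmod (polygon_side n k s) = 1"
  by (simp add: polygon_side_def)

lemma polygon_side_1: "0 < n \<Longrightarrow> k < n \<Longrightarrow> polygon_side n k 1 = polygon_side n (Suc k mod n) 0"
  by (cases "Suc k = n") (auto simp: polygon_side_def add.commute)

lemma polygon_side_mod: "0 < n \<Longrightarrow> polygon_side n (k mod n) s = polygon_side n k s"
proof -
  assume n: "0 < n"
  have "real k = real n * real (k div n) + real (k mod n)" by (metis mult_div_mod_eq of_nat_add of_nat_mult)
  then have "2 * pi * (real k + s) / real n = 2 * pi * (real (k mod n) + s) / real n + 2 * pi * real (k div n)"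
    using n by (simp add: field_simps)
  then show ?thesis
    by (simp add: polygon_side_def complex_eq_iff cos_add sin_add)
      (metis cos_int_2pin sin_int_2pin mult.commute mult_1 mult_zero_right diff_zero add_0_right of_int_of_nat_eq)
qed

lemma polygon_side_inj:
  assumes "polygon_side n k s = polygon_side n l s'" "k < n" "l < n" "0 \<le> s" "s < 1" "0 \<le> s'" "s' < 1"
  shows "k = l \<and> s = s'"
proof -
  have n: "0 < real n" using assms by simp
  obtain j :: int where j: "2 * pi * (real k + s) / real n = 2 * pi * (real l + s') / real n + 2 * pi * real_of_int j"
    using assms(1) sin_cos_eq_iff[of "2 * pi * (real k + s) / real n" "2 * pi * (real l + s') / real n"]
    by (auto simp: polygon_side_def complex_eq_iff)
  then have "2 * pi * (real k + s) = 2 * pi * ((real l + s') + real n * real_of_int j)"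
    using n by (simp add: field_simps)
  then have e: "real k + s = real l + s' + real n * real_of_int j" by simp
  have "real k + s < real n" "real l + s' < real n" using assms by linarith+
  then have "real n * real_of_int j < real n * 1" "real n * (-1) < real n * real_of_int j"
    using e assms(4,6) of_nat_0_le_iff[of k, where 'a = real] of_nat_0_le_iff[of l, where 'a = real]
    by linarith+
  then have "real_of_int j < 1" "-1 < real_of_int j" using n by (simp_all only: mult_less_cancel_left_pos)
  then have "j = 0" by linarith
  then have "real k + s = real l + s'" using e by simp
  then have "k = l" using assms by linarith
  then show ?thesis using \<open>real k + s = real l + s'\<close> by simp
qed

lemma polygon_side_surj:
  assumes "cmod u = 1" "0 < n"
  obtains k s where "k < n" "0 \<le> s" "s < 1" "u = polygon_side n k s"
proof -
  obtain t where t: "0 \<le> t" "t < 2 * pi" "u = Complex (cos t) (sin t)"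
    using complex_unimodular_polar[OF assms(1)] by blast
  define x where "x = real n * t / (2 * pi)"
  have x: "0 \<le> x" "x < real n" using t assms by (auto simp: x_def field_simps)
  define k where "k = nat \<lfloor>x\<rfloor>"
  have k: "real k \<le> x" "x < real k + 1" using x by (auto simp: k_def)
  have "k < n" using k x by linarith
  moreover have "2 * pi * (real k + (x - real k)) / real n = t" using assms by (simp add: x_def)
  then have "u = polygon_side n k (x - real k)" by (simp add: polygon_side_def t complex_eq_iff)
  ultimately show thesis using that[of k "x - real k"] k by simp
qed

lemma sphere_eq_polygon_sides: "0 < n \<Longrightarrow> sphere 0 1 = (\<Union>k<n. polygon_side n k ` {0..1})"
proof
  assume n: "0 < n"
  show "sphere 0 1 \<subseteq> (\<Union>k<n. polygon_side n k ` {0..1})"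
  proof
    fix u :: complex assume "u \<in> sphere 0 1"
    then obtain k s where "k < n" "0 \<le> s" "s < 1" "u = polygon_side n k s"
      using polygon_side_surj[of u n] n by auto
    then show "u \<in> (\<Union>k<n. polygon_side n k ` {0..1})" by force
  qed
qed auto

lemma circle_map_from_sides:
  fixes \<sigma> :: "nat \<Rightarrow> real \<Rightarrow> complex"
  assumes n: "0 < n" and c: "\<And>k. k < n \<Longrightarrow> continuous_on {0..1} (\<sigma> k)"
    and j: "\<And>k. k < n \<Longrightarrow> \<sigma> k 1 = \<sigma> (Suc k mod n) 0"
  obtains \<rho> where "continuous_on (sphere 0 1) \<rho>"
    "\<And>k s. k < n \<Longrightarrow> s \<in> {0..1} \<Longrightarrow> \<rho> (polygon_side n k s) = \<sigma> k s"
proof -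
  \<comment> \<open>\<open>P u\<close> picks the unique side and parameter in the half-open
    interval; the value at parameter 1 is then supplied by the junction condition.\<close>
  define P where "P u = (SOME p. fst p < n \<and> 0 \<le> snd p \<and> snd p < 1 \<and> u = polygon_side n (fst p) (snd p))" for u
  define \<rho> where "\<rho> u = \<sigma> (fst (P u)) (snd (P u))" for u
  have 1: "\<rho> (polygon_side n k s) = \<sigma> k s" if k: "k < n" "0 \<le> s" "s < 1" for k s
  proof -
    let ?Q = "\<lambda>p. fst p < n \<and> 0 \<le> snd p \<and> snd p < 1 \<and> polygon_side n k s = polygon_side n (fst p) (snd p)"
    have "?Q (k, s)" using k by simp
    then have "?Q (P (polygon_side n k s))" unfolding P_def by (rule someI)
    then have "k = fst (P (polygon_side n k s)) \<and> s = snd (P (polygon_side n k s))"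
      using polygon_side_inj k by blast
    then show ?thesis by (simp add: \<rho>_def)
  qed
  have 2: "\<rho> (polygon_side n k s) = \<sigma> k s" if k: "k < n" "s \<in> {0..1}" for k s
  proof (cases "s = 1")
    case True
    have "\<rho> (polygon_side n (Suc k mod n) 0) = \<sigma> (Suc k mod n) 0" using n by (intro 1) auto
    then show ?thesis using True polygon_side_1[OF n] k j by simp
  qed (use 1 k in auto)
  have "continuous_map (top_of_set (\<Union>k\<in>{..<n}. polygon_side n k ` {0..1})) euclidean \<rho>"
  proof (rule continuous_map_from_compact_images)
    fix k assume "k \<in> {..<n}"
    then have "k < n" by simp
    then show "continuous_map (top_of_set {0..1}) euclidean (\<rho> \<circ> polygon_side n k)"
      using continuous_on_eq[OF c[of k], of "\<rho> \<circ> polygon_side n k"] 2 by simp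
  qed (auto intro: continuous_intros)
  then have "continuous_on (sphere 0 1) \<rho>" using sphere_eq_polygon_sides[OF n] by simp
  then show thesis using that 2 by blast
qed

lemma inj_on_circle_from_sides:
  assumes n: "0 < n" and \<rho>: "\<And>k s. k < n \<Longrightarrow> s \<in> {0..1} \<Longrightarrow> \<rho> (polygon_side n k s) = \<sigma> k s"
    and i: "\<And>k. k < n \<Longrightarrow> inj_on (\<sigma> k) {0..<1}"
    and d: "\<And>k l s s'. k < n \<Longrightarrow> l < n \<Longrightarrow> k \<noteq> l \<Longrightarrow> s \<in> {0..<1} \<Longrightarrow> s' \<in> {0..<1} \<Longrightarrow> \<sigma> k s \<noteq> \<sigma> l s'"
  shows "inj_on \<rho> (sphere 0 1)"
proof (rule inj_onI)
  fix u v :: complex assume u: "u \<in> sphere 0 1" and v: "v \<in> sphere 0 1" and e: "\<rho> u = \<rho> v"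
  obtain k s where k: "k < n" "0 \<le> s" "s < 1" "u = polygon_side n k s"
    using polygon_side_surj[of u n] u n by auto
  obtain l s' where l: "l < n" "0 \<le> s'" "s' < 1" "v = polygon_side n l s'"
    using polygon_side_surj[of v n] v n by auto
  have "\<sigma> k s = \<sigma> l s'" using e k l \<rho>[of k s] \<rho>[of l s'] by simp
  then have "k = l" using d[of k l s s'] k l by auto
  then show "u = v" using \<open>\<sigma> k s = \<sigma> l s'\<close> i[of k] k l by (auto dest: inj_onD)
qed

text \<open>\<open>R\<close> is the cone over \<open>\<rho>\<close> with apex \<open>m\<close>.
  Convexity puts the open segments from \<open>m\<close> to frontier points into the interior, which
  gives injectivity. Surjectivity comes from invariance of domain: the image of the open disk is
  open, and relatively closed in the connected interior of \<open>K\<close>.\<close>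

lemma cone_extension:
  fixes K :: "complex set"
  assumes K: "compact K" "convex K" "m \<in> interior K"
    and \<rho>: "continuous_on (sphere 0 1) \<rho>" "inj_on \<rho> (sphere 0 1)" "\<rho> ` sphere 0 1 \<subseteq> frontier K"
  obtains R where "continuous_on (cball 0 1) R" "inj_on R (cball 0 1)" "\<forall>u. cmod u = 1 \<longrightarrow> R u = \<rho> u"
    "R ` cball 0 1 = K" "R ` ball 0 1 = interior K" "R 0 = m"
proof -
  define R where "R z = m + cmod z *\<^sub>R (\<rho> (sgn z) - m)" for z
  have sgn1: "cmod (sgn z) = 1" if "z \<noteq> 0" for z :: complex using that by (simp add: norm_sgn)
  have fK: "\<rho> u \<in> K" "\<rho> u \<notin> interior K" if "cmod u = 1" for u
  proof -
    have "\<rho> u \<in> frontier K" using that \<rho>(3) by auto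
    then show "\<rho> u \<in> K" "\<rho> u \<notin> interior K"
      using compact_imp_closed[OF K(1)] by (auto simp: frontier_def)
  qed
  have Ru: "R u = \<rho> u" if "cmod u = 1" for u using that by (simp add: R_def sgn_div_norm)
  have R0: "R 0 = m" by (simp add: R_def)
  have seg: "open_segment m (\<rho> u) \<subseteq> interior K" if "cmod u = 1" for u
    using in_interior_closure_convex_segment[OF K(2,3)] fK(1)[OF that] closure_subset by blast
  have Rint: "R z \<in> interior K" if "cmod z < 1" for z
  proof (cases "z = 0")
    case False
    have "m \<noteq> \<rho> (sgn z)" using fK(2)[OF sgn1[OF False]] K(3) by auto
    moreover have "R z = (1 - cmod z) *\<^sub>R m + cmod z *\<^sub>R \<rho> (sgn z)" by (simp add: R_def algebra_simps)
    ultimately have "R z \<in> open_segment m (\<rho> (sgn z))"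
      using that False unfolding in_segment by (auto intro!: exI[of _ "cmod z"])
    then show ?thesis using seg[OF sgn1[OF False]] by blast
  qed (use K R0 in simp)
  have cont0: "continuous_on (cball 0 1 - {0}) R"
  proof -
    have "continuous_on (cball 0 1 - {0}) (\<lambda>z. \<rho> (sgn z))"
      by (rule continuous_on_compose2[OF \<rho>(1)]) (auto intro!: continuous_intros simp: norm_sgn split: if_splits)
    then show ?thesis unfolding R_def by (intro continuous_intros)
  qed
  obtain B where B: "\<And>x. x \<in> K \<Longrightarrow> cmod (x - m) \<le> B" "0 < B"
  proof -
    have "bounded ((\<lambda>x. x - m) ` K)" using compact_imp_bounded[OF K(1)] bounded_translation_minus by blast
    then show thesis using that unfolding bounded_pos by auto
  qed
  have cont: "continuous_on (cball 0 1) R"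
    unfolding continuous_on_eq_continuous_within
  proof
    fix z :: complex assume z: "z \<in> cball 0 1"
    show "continuous (at z within cball 0 1) R"
    proof (cases "z = 0")
      case True
      have "((\<lambda>y. R y - m) \<longlongrightarrow> 0) (at 0 within cball 0 1)"
      proof (rule Lim_null_comparison)
        show "\<forall>\<^sub>F y in at 0 within cball 0 1. cmod (R y - m) \<le> cmod y * B"
          unfolding eventually_at_filter
          by (rule always_eventually) (auto simp: R_def intro!: mult_left_mono B(1) fK sgn1)
        have "((\<lambda>y. cmod y * B) \<longlongrightarrow> cmod 0 * B) (at (0::complex) within cball 0 1)"
          by (intro tendsto_intros)
        then show "((\<lambda>y. cmod y * B) \<longlongrightarrow> 0) (at (0::complex) within cball 0 1)" by simp
      qed
      then have "(R \<longlongrightarrow> R 0) (at 0 within cball 0 1)" using R0 LIM_zero_cancel by metis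
      then show ?thesis using True by (simp add: continuous_within)
    next
      case False
      have "continuous (at z within (cball 0 1 - {0})) R"
        using cont0 z False by (simp add: continuous_on_eq_continuous_within)
      moreover have "at z within (cball 0 1 - {0}) = at z within cball 0 1"
        by (rule at_within_nhd[of _ "-{0}"]) (use False in auto)
      ultimately show ?thesis by (simp add: continuous_within)
    qed
  qed
  have inj: "inj_on R (cball 0 1)"
  proof (rule inj_onI)
    \<comment> \<open>If two rays with different directions overlapped,
      \<open>\<rho> (sgn w)\<close> would lie strictly between \<open>m\<close> and
      \<open>\<rho> (sgn z)\<close>, hence in the interior.\<close>
    have *: "sgn z = sgn w"
      if z: "z \<noteq> 0" "w \<noteq> 0" and e: "cmod z *\<^sub>R (\<rho> (sgn z) - m) = cmod w *\<^sub>R (\<rho> (sgn w) - m)" and le: "cmod z \<le> cmod w" for z w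
    proof (rule ccontr)
      assume ne: "sgn z \<noteq> sgn w"
      let ?t = "cmod z / cmod w"
      have "\<rho> (sgn z) \<noteq> \<rho> (sgn w)" using \<rho>(2) ne sgn1 z by (auto dest: inj_onD)
      moreover have w: "\<rho> (sgn w) - m = ?t *\<^sub>R (\<rho> (sgn z) - m)"
        using arg_cong[OF e, of "\<lambda>x. x /\<^sub>R cmod w"] z by (simp add: divide_inverse mult.commute)
      ultimately have "?t \<noteq> 1" by (metis diff_add_cancel scaleR_one)
      then have t: "0 < ?t" "?t < 1" using z le by (auto simp: field_simps)
      have "\<rho> (sgn w) = (1 - ?t) *\<^sub>R m + ?t *\<^sub>R \<rho> (sgn z)" using w by (simp add: algebra_simps)
      moreover have "m \<noteq> \<rho> (sgn z)" using fK(2)[OF sgn1[OF z(1)]] K(3) by auto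
      ultimately have "\<rho> (sgn w) \<in> open_segment m (\<rho> (sgn z))"
        using t unfolding in_segment by blast
      then show False using seg[OF sgn1[OF z(1)]] fK(2)[OF sgn1[OF z(2)]] by blast
    qed
    fix z w assume zw: "z \<in> cball 0 1" "w \<in> cball 0 1" "R z = R w"
    have e: "cmod z *\<^sub>R (\<rho> (sgn z) - m) = cmod w *\<^sub>R (\<rho> (sgn w) - m)" using zw by (simp add: R_def)
    have nz: "\<rho> (sgn z) - m \<noteq> 0" if "z \<noteq> 0" for z using fK(2)[OF sgn1[OF that]] K(3) by auto
    show "z = w"
    proof (cases "z = 0 \<or> w = 0")
      case True
      then show ?thesis using e nz by (metis norm_zero scaleR_eq_0_iff norm_eq_zero)
    next
      case False
      then have s: "sgn z = sgn w" using *[of z w] *[of w z] e by (metis linear)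
      then have "cmod z = cmod w" using e nz[of w] False by auto
      then show ?thesis using s by (metis sgn_zero_iff scaleR_left_imp_eq False scaleR_cancel_left inverse_eq_iff_eq sgn_div_norm inverse_zero_imp_zero norm_eq_zero)
    qed
  qed
  have Rb: "R ` ball 0 1 \<subseteq> interior K" using Rint by auto
  have Rs: "R ` sphere 0 1 \<inter> interior K = {}" using Ru fK(2) by auto
  have cb: "cball (0::complex) 1 = ball 0 1 \<union> sphere 0 1" by auto
  have "open (R ` ball 0 1)"
    using invariance_of_domain[OF continuous_on_subset[OF cont ball_subset_cball] open_ball
        inj_on_subset[OF inj ball_subset_cball]] .
  then have 1: "openin (top_of_set (interior K)) (R ` ball 0 1)" using Rb by (simp add: openin_open_eq)
  have cR: "R ` cball 0 1 = R ` ball 0 1 \<union> R ` sphere 0 1" unfolding cb by (rule image_Un)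
  have clR: "closed (R ` cball 0 1)" by (intro compact_imp_closed compact_continuous_image[OF cont] compact_cball)
  moreover have "R ` ball 0 1 = interior K \<inter> R ` cball 0 1" unfolding cR using Rs Rb by blast
  ultimately have 2: "closedin (top_of_set (interior K)) (R ` ball 0 1)" by (metis closedin_closed_Int)
  have "connected (interior K)" using K(2) by (simp add: convex_connected convex_interior)
  then have ball: "R ` ball 0 1 = interior K"
    using 1 2 unfolding connected_clopen by (metis ball_eq_empty image_is_empty not_one_le_zero)
  have "R ` cball 0 1 = K"
  proof
    have "R ` sphere 0 1 \<subseteq> K" using Ru fK(1) by auto
    then show "R ` cball 0 1 \<subseteq> K" unfolding cR ball using interior_subset by blast
    have "K \<subseteq> closure (interior K)"
      using convex_closure_interior[OF K(2)] K(3) closure_subset by blast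
    also have "\<dots> \<subseteq> R ` cball 0 1"
      by (rule closure_minimal[OF _ clR]) (use cR ball in blast)
    finally show "K \<subseteq> R ` cball 0 1" .
  qed
  then show thesis using that cont inj Ru ball R0 by blast
qed

subsection \<open>Charts and orientations of surfaces\<close>

lemma surface_chart_D:
  assumes "surface_chart X U f"
  shows "openin X U" "open (f ` U)" "inj_on f U" "continuous_map (subtopology X U) euclidean f"
    "continuous_map (top_of_set (f ` U)) X (inv_into U f)"
    "U \<subseteq> topspace X"
proof -
  have U: "openin X U" "open (f ` U)" and h: "homeomorphic_map (subtopology X U) (top_of_set (f ` U)) f"
    using assms by (auto simp: surface_chart_def)
  show "openin X U" "open (f ` U)" by fact+
  show sub: "U \<subseteq> topspace X" using U openin_subset by blast
  then have ts: "topspace (subtopology X U) = U" by auto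
  show inj: "inj_on f U" using h ts homeomorphic_imp_injective_map by metis
  show "continuous_map (subtopology X U) euclidean f"
    using homeomorphic_imp_continuous_map[OF h] continuous_map_into_fulltopology by blast
  obtain g where g: "homeomorphic_maps (subtopology X U) (top_of_set (f ` U)) f g"
    using h homeomorphic_map_maps by blast
  then have "continuous_map (top_of_set (f ` U)) X g"
    unfolding homeomorphic_maps_def using continuous_map_into_fulltopology by blast
  moreover have "g y = inv_into U f y" if "y \<in> topspace (top_of_set (f ` U))" for y
    using that g ts inj by (auto simp: homeomorphic_maps_def)
  ultimately show "continuous_map (top_of_set (f ` U)) X (inv_into U f)"
    by (rule continuous_map_eq)
qed

lemma surface_chart_preimage:
  assumes "surface_chart X U f" "open W"
  shows "openin X {x \<in> U. f x \<in> W}"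
proof -
  note D = surface_chart_D[OF assms(1)]
  have "openin (subtopology X U) {x \<in> topspace (subtopology X U). f x \<in> W}"
    by (rule openin_continuous_map_preimage[OF D(4)]) (simp add: assms(2))
  moreover have "{x \<in> topspace (subtopology X U). f x \<in> W} = {x \<in> U. f x \<in> W}" using D(6) by auto
  ultimately show ?thesis using D(1) openin_trans_full by metis
qed

lemma surface_chartE:
  assumes "surface X" "x \<in> topspace X"
  obtains U f where "surface_chart X U f" "x \<in> U"
proof -
  obtain U and W :: "complex set" where U: "openin X U" "x \<in> U" "open W"
    and h: "subtopology X U homeomorphic_space top_of_set W"
    using assms unfolding surface_def by blast
  then obtain f where f: "homeomorphic_map (subtopology X U) (top_of_set W) f"
    using homeomorphic_space by blast
  moreover have "f ` topspace (subtopology X U) = topspace (top_of_set W)"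
    using f homeomorphic_imp_surjective_map by blast
  then have "f ` U = W" using openin_subset[OF U(1)] by (simp add: inf_absorb2)
  ultimately show thesis using that[of U f] U by (simp add: surface_chart_def)
qed

lemma surface_chart_restrict:
  assumes "surface_chart X U f" "openin X U'" "U' \<subseteq> U"
  shows "surface_chart X U' f"
proof -
  note D = surface_chart_D[OF assms(1)]
  have h: "homeomorphic_map (subtopology X U) (top_of_set (f ` U)) f"
    using assms(1) by (simp add: surface_chart_def)
  have ts: "topspace (subtopology X U) = U" using D(6) by auto
  have "homeomorphic_map (subtopology (subtopology X U) U') (subtopology (top_of_set (f ` U)) (f ` U')) f"
    by (rule homeomorphic_map_subtopologies_alt[OF h]) (use D(3) assms(3) ts in \<open>auto dest: inj_onD\<close>)
  moreover have "subtopology (subtopology X U) U' = subtopology X U'"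
    using assms(3) by (simp add: subtopology_subtopology inf_absorb2)
  moreover have "subtopology (top_of_set (f ` U)) (f ` U') = top_of_set (f ` U')"
    using assms(3) by (simp add: subtopology_subtopology inf_absorb2 image_mono)
  moreover have "open (f ` U')"
  proof -
    have "openin (subtopology X U) U'" using assms(2,3) by (simp add: openin_open_subtopology D(1))
    then have "openin (top_of_set (f ` U)) (f ` U')"
      using homeomorphic_imp_open_map[OF h] by (simp add: open_map_def)
    then show ?thesis using D(2) openin_open_trans by blast
  qed
  ultimately show ?thesis using assms(2) by (simp add: surface_chart_def)
qed

lemma surface_chart_cnj:
  assumes "surface_chart X U f"
  shows "surface_chart X U (cnj \<circ> f)"
proof -
  note D = surface_chart_D[OF assms(1)]
  have h: "homeomorphic_map (subtopology X U) (top_of_set (f ` U)) f"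
    using assms(1) by (simp add: surface_chart_def)
  have c: "continuous_on A cnj" for A by (intro continuous_intros)
  have "homeomorphic_maps (top_of_set (f ` U)) (top_of_set (cnj ` f ` U)) cnj cnj"
    unfolding homeomorphic_maps_def continuous_map_subtopology_eu using c by auto
  then have "homeomorphic_map (top_of_set (f ` U)) (top_of_set (cnj ` f ` U)) cnj"
    using homeomorphic_map_maps by blast
  then have "homeomorphic_map (subtopology X U) (top_of_set (cnj ` f ` U)) (cnj \<circ> f)"
    using h homeomorphic_map_compose by blast
  moreover have "open (cnj ` f ` U)"
    by (rule invariance_of_domain[OF c D(2)]) (simp add: inj_on_def)
  ultimately show ?thesis using D(1) by (simp add: surface_chart_def image_comp)
qed

text \<open>Shrinks a chart until its image is a round disk, which is connected and stays so when
  its center is removed.\<close>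

lemma surface_chart_ball:
  assumes "surface_chart X U f" "x \<in> U" "openin X S" "x \<in> S"
  obtains U' r where "x \<in> U'" "U' \<subseteq> U \<inter> S" "surface_chart X U' f" "0 < r" "f ` U' = ball (f x) r"
proof -
  note D = surface_chart_D[OF assms(1)]
  have c: "surface_chart X (U \<inter> S) f"
    using surface_chart_restrict[OF assms(1)] D(1) assms(3) by (simp add: openin_Int)
  then have "open (f ` (U \<inter> S))" by (rule surface_chart_D)
  moreover have "f x \<in> f ` (U \<inter> S)" using assms by blast
  ultimately obtain r where r: "0 < r" "ball (f x) r \<subseteq> f ` (U \<inter> S)" by (meson open_contains_ball)
  let ?U' = "{y \<in> U \<inter> S. f y \<in> ball (f x) r}"
  have "surface_chart X ?U' f"
    by (rule surface_chart_restrict[OF c surface_chart_preimage[OF c open_ball]]) auto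
  moreover have "f ` ?U' = ball (f x) r" using r by auto
  moreover have "x \<in> ?U'" using assms r by simp
  ultimately show thesis using that[of ?U' r] r(1) by auto
qed

lemma open_map_preimage:
  assumes "open N" "continuous_map (top_of_set N) X G" "openin X U"
  shows "open {z \<in> N. G z \<in> U}"
proof -
  have "openin (top_of_set N) {z \<in> topspace (top_of_set N). G z \<in> U}"
    using assms(2,3) by (rule openin_continuous_map_preimage)
  then show ?thesis using assms(1) openin_open_trans by auto
qed

lemma surface_chart_compose:
  assumes "surface_chart X U f" "open N" "continuous_map (top_of_set N) X G" "inj_on G N"
  shows "open {z \<in> N. G z \<in> U}" "continuous_on {z \<in> N. G z \<in> U} (f \<circ> G)" "inj_on (f \<circ> G) {z \<in> N. G z \<in> U}"
proof -
  note D = surface_chart_D[OF assms(1)]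
  show "open {z \<in> N. G z \<in> U}" by (rule open_map_preimage[OF assms(2,3) D(1)])
  have "continuous_map (top_of_set {z \<in> N. G z \<in> U}) (subtopology X U) G"
    using continuous_map_from_subtopology[OF assms(3), of "{z \<in> N. G z \<in> U}"]
    by (auto simp: continuous_map_in_subtopology subtopology_subtopology Int_absorb1 subset_iff)
  then show "continuous_on {z \<in> N. G z \<in> U} (f \<circ> G)"
    using continuous_map_compose[OF _ D(4), of "top_of_set {z \<in> N. G z \<in> U}" G] by simp
  show "inj_on (f \<circ> G) {z \<in> N. G z \<in> U}"
    using D(3) assms(4) by (auto simp: inj_on_def)
qed

text \<open>Planar invariance of domain, read in a chart around each point of the image.\<close>

lemma surface_invariance_of_domain:
  assumes X: "surface X" and N: "open (N :: complex set)" "continuous_map (top_of_set N) X G" "inj_on G N"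
  shows "openin X (G ` N)"
proof (subst openin_subopen, intro ballI)
  fix y assume y: "y \<in> G ` N"
  then have "y \<in> topspace X" using continuous_map_funspace[OF N(2)] by auto
  then obtain U f where U: "surface_chart X U f" "y \<in> U" using surface_chartE[OF X] by blast
  let ?N = "{z \<in> N. G z \<in> U}"
  note C = surface_chart_compose[OF U(1) N]
  have "open ((f \<circ> G) ` ?N)" by (rule invariance_of_domain[OF C(2,1,3)])
  then have "openin X {x \<in> U. f x \<in> (f \<circ> G) ` ?N}" by (rule surface_chart_preimage[OF U(1)])
  moreover have "{x \<in> U. f x \<in> (f \<circ> G) ` ?N} \<subseteq> G ` N"
    using surface_chart_D(3)[OF U(1)] by (auto dest: inj_onD)
  moreover have "y \<in> {x \<in> U. f x \<in> (f \<circ> G) ` ?N}" using y U by auto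
  ultimately show "\<exists>T. openin X T \<and> y \<in> T \<and> T \<subseteq> G ` N" by blast
qed

lemma surface_homeomorphic_map:
  assumes X: "surface X" and N: "open (N :: complex set)" "continuous_map (top_of_set N) X G" "inj_on G N"
  shows "homeomorphic_map (top_of_set N) (subtopology X (G ` N)) G"
proof (rule bijective_open_imp_homeomorphic_map)
  have sub: "G ` N \<subseteq> topspace X" using continuous_map_funspace[OF N(2)] by auto
  show "continuous_map (top_of_set N) (subtopology X (G ` N)) G"
    using N(2) by (auto simp: continuous_map_in_subtopology)
  show "open_map (top_of_set N) (subtopology X (G ` N)) G"
    unfolding open_map_def
  proof (intro allI impI)
    fix S assume S: "openin (top_of_set N) S"
    then have s: "open S" "S \<subseteq> N" using N(1) openin_open_eq by blast+
    have "openin X (G ` S)"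
      by (rule surface_invariance_of_domain[OF X s(1)])
        (use s N(2,3) continuous_map_from_subtopology_mono inj_on_subset in blast)+
    then show "openin (subtopology X (G ` N)) (G ` S)"
      using s(2) by (simp add: openin_open_subtopology surface_invariance_of_domain[OF X N] image_mono)
  qed
  show "G ` topspace (top_of_set N) = topspace (subtopology X (G ` N))" using sub by auto
  show "inj_on G (topspace (top_of_set N))" using N(3) by simp
qed

text \<open>The charts on tiles and across edges arise in this way, as inverses of explicit
  parametrizations.\<close>

lemma surface_chart_inverse:
  assumes X: "surface X" and N: "open (N :: complex set)" "continuous_map (top_of_set N) X G" "inj_on G N"
  shows "surface_chart X (G ` N) (inv_into N G)"
proof -
  have im: "inv_into N G ` G ` N = N" using N(3) by (simp add: inv_into_image_cancel)
  have sub: "G ` N \<subseteq> topspace X" using continuous_map_funspace[OF N(2)] by auto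
  obtain g where g: "homeomorphic_maps (top_of_set N) (subtopology X (G ` N)) G g"
    using surface_homeomorphic_map[OF assms] homeomorphic_map_maps by blast
  have "g x = inv_into N G x" if "x \<in> topspace (subtopology X (G ` N))" for x
    using that g N(3) by (auto simp: homeomorphic_maps_def)
  moreover have "homeomorphic_map (subtopology X (G ` N)) (top_of_set N) g"
    using g homeomorphic_map_maps homeomorphic_maps_sym by blast
  ultimately have "homeomorphic_map (subtopology X (G ` N)) (top_of_set N) (inv_into N G)"
    using homeomorphic_map_eq by blast
  then show ?thesis
    using surface_invariance_of_domain[OF assms] N(1) by (simp add: surface_chart_def im)
qed

section \<open>Orientation prescribed by a dense family of parametrized disks\<close>

definition positive_on :: "(complex \<Rightarrow> 'a) set \<Rightarrow> ('a \<Rightarrow> complex) \<Rightarrow> 'a set \<Rightarrow> bool" where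
  "positive_on P f U \<longleftrightarrow> (\<forall>\<phi>\<in>P. orientation_preserving_on {z \<in> ball 0 1. \<phi> z \<in> U} (f \<circ> \<phi>))"

text \<open>All compatible charts are taken at once, so nothing has to be chosen and membership is
  tested for each chart separately against the disks.\<close>

definition positive_charts :: "'a topology \<Rightarrow> (complex \<Rightarrow> 'a) set \<Rightarrow> ('a set \<times> ('a \<Rightarrow> complex)) set" where
  "positive_charts X P = {(U, f). surface_chart X U f \<and> positive_on P f U}"

locale dense_disks =
  fixes X :: "'a topology" and P :: "(complex \<Rightarrow> 'a) set"
  assumes surface: "surface X"
    and disk_cont: "\<And>\<phi>. \<phi> \<in> P \<Longrightarrow> continuous_map (top_of_set (ball 0 1)) X \<phi>"
    and disk_inj: "\<And>\<phi>. \<phi> \<in> P \<Longrightarrow> inj_on \<phi> (ball 0 1)"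
    and disk_dense: "\<And>S. openin X S \<Longrightarrow> S \<noteq> {} \<Longrightarrow> \<exists>\<phi>\<in>P. \<exists>z\<in>ball 0 1. \<phi> z \<in> S"
begin

lemma disk_chart:
  assumes "surface_chart X U f" "\<phi> \<in> P"
  shows "open {z \<in> ball 0 1. \<phi> z \<in> U}" "continuous_on {z \<in> ball 0 1. \<phi> z \<in> U} (f \<circ> \<phi>)"
    "inj_on (f \<circ> \<phi>) {z \<in> ball 0 1. \<phi> z \<in> U}"
  by (rule surface_chart_compose[OF assms(1) open_ball disk_cont[OF assms(2)] disk_inj[OF assms(2)]])+

lemma disk_preimage_open: "openin X U \<Longrightarrow> \<phi> \<in> P \<Longrightarrow> open {z \<in> ball 0 1. \<phi> z \<in> U}"
  using open_map_preimage[OF open_ball disk_cont] by blast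

lemma transition_continuous_inj:
  assumes "surface_chart X U f" "surface_chart X U' f'"
  shows "continuous_on (f ` (U \<inter> U')) (f' \<circ> inv_into U f)" "inj_on (f' \<circ> inv_into U f) (f ` (U \<inter> U'))"
proof -
  note D = surface_chart_D[OF assms(1)] and D' = surface_chart_D[OF assms(2)]
  have "inj_on (inv_into U f) (f ` U)" by (simp add: inj_on_inv_into)
  note C = surface_chart_compose[OF assms(2) D(2,5) this]
  have "{z \<in> f ` U. inv_into U f z \<in> U'} = f ` (U \<inter> U')" using D(3) by auto
  then show "continuous_on (f ` (U \<inter> U')) (f' \<circ> inv_into U f)" "inj_on (f' \<circ> inv_into U f) (f ` (U \<inter> U'))"
    using C by auto
qed

text \<open>Near a dense set of points the transition map factors through a disk of
  \<open>P\<close>, as \<open>f' \<circ> \<phi>\<close> after the inverse of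
  \<open>f \<circ> \<phi>\<close>, and both factors preserve orientation.\<close>

lemma transition_orientation_preserving:
  assumes A: "(U, f) \<in> positive_charts X P" "(U', f') \<in> positive_charts X P"
  shows "orientation_preserving_on (f ` (U \<inter> U')) (f' \<circ> inv_into U f)"
proof (rule orientation_preserving_on_dense)
  have ch: "surface_chart X U f" "surface_chart X U' f'" and pos: "positive_on P f U" "positive_on P f' U'"
    using A by (auto simp: positive_charts_def)
  note D = surface_chart_D[OF ch(1)] and D' = surface_chart_D[OF ch(2)]
  show "continuous_on (f ` (U \<inter> U')) (f' \<circ> inv_into U f)" "inj_on (f' \<circ> inv_into U f) (f ` (U \<inter> U'))"
    using transition_continuous_inj[OF ch] by auto
  fix y and e :: real assume y: "y \<in> f ` (U \<inter> U')" "0 < e"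
  have UU: "openin X (U \<inter> U')" using D(1) D'(1) by blast
  have c: "surface_chart X (U \<inter> U') f" by (rule surface_chart_restrict[OF ch(1) UU]) auto
  have "openin X {x \<in> U \<inter> U'. f x \<in> ball y e}" by (rule surface_chart_preimage[OF c open_ball])
  moreover have "{x \<in> U \<inter> U'. f x \<in> ball y e} \<noteq> {}" using y by auto
  ultimately obtain \<phi> z where z: "\<phi> \<in> P" "z \<in> ball 0 1" "\<phi> z \<in> U \<inter> U'" "f (\<phi> z) \<in> ball y e"
    using disk_dense by blast
  define T0 where "T0 = {z \<in> ball 0 1. \<phi> z \<in> U \<inter> U'}"
  have sub: "T0 \<subseteq> {z \<in> ball 0 1. \<phi> z \<in> U}" "T0 \<subseteq> {z \<in> ball 0 1. \<phi> z \<in> U'}" by (auto simp: T0_def)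
  have T0: "open T0" unfolding T0_def by (rule disk_preimage_open[OF UU z(1)])
  note C = disk_chart[OF ch(1) z(1)] and C' = disk_chart[OF ch(2) z(1)]
  have c0: "continuous_on T0 (f \<circ> \<phi>)" "inj_on (f \<circ> \<phi>) T0" "continuous_on T0 (f' \<circ> \<phi>)" "inj_on (f' \<circ> \<phi>) T0"
    using continuous_on_subset[OF C(2) sub(1)] inj_on_subset[OF C(3) sub(1)]
      continuous_on_subset[OF C'(2) sub(2)] inj_on_subset[OF C'(3) sub(2)] .
  have op: "orientation_preserving_on T0 (f \<circ> \<phi>)" "orientation_preserving_on T0 (f' \<circ> \<phi>)"
    using pos z(1) orientation_preserving_on_subset sub unfolding positive_on_def by blast+
  define k where "k = inv_into T0 (f \<circ> \<phi>)"
  have k: "k ((f \<circ> \<phi>) z) = z" if "z \<in> T0" for z unfolding k_def by (rule inv_into_f_f[OF c0(2) that])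
  let ?T = "(f \<circ> \<phi>) ` T0"
  have T: "open ?T" by (rule invariance_of_domain[OF c0(1) T0 c0(2)])
  have kop: "orientation_preserving_on ?T k" by (rule orientation_preserving_on_inverse[OF T0 c0(1) op(1) k])
  have kc: "continuous_on ?T k" by (rule continuous_on_left_inverse_open[OF T0 c0(1) k])
  have ki: "inj_on k ?T" by (simp add: k_def inj_on_inv_into)
  have kT: "k ` ?T \<subseteq> T0" using k by auto
  have "orientation_preserving_on ?T ((f' \<circ> \<phi>) \<circ> k)"
    by (rule orientation_preserving_on_compose[OF T kc ki kop T0 c0(3,4) op(2) kT])
  moreover have "((f' \<circ> \<phi>) \<circ> k) w = (f' \<circ> inv_into U f) w" if w: "w \<in> ?T" for w
  proof -
    obtain z where z: "z \<in> T0" "w = (f \<circ> \<phi>) z" using w by blast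
    then have "\<phi> z \<in> U" by (simp add: T0_def)
    then show ?thesis using z k[OF z(1)] inv_into_f_f[OF D(3)] by simp
  qed
  ultimately have "orientation_preserving_on ?T (f' \<circ> inv_into U f)"
    using orientation_preserving_on_cong by blast
  moreover have "f (\<phi> z) \<in> ?T" using z by (auto simp: T0_def)
  ultimately show "\<exists>z' T. z' \<in> ball y e \<and> z' \<in> T \<and> open T \<and> orientation_preserving_on T (f' \<circ> inv_into U f)"
    using T z(4) by blast
qed

text \<open>The density criterion applies with each point as its own witness.\<close>

lemma positive_on_local:
  assumes ch: "surface_chart X U f"
    and loc: "\<And>x. x \<in> U \<Longrightarrow> \<exists>S. openin X S \<and> x \<in> S \<and> positive_on P f S"
  shows "positive_on P f U"
  unfolding positive_on_def
proof
  fix \<phi> assume \<phi>: "\<phi> \<in> P"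
  note C = disk_chart[OF ch \<phi>]
  show "orientation_preserving_on {z \<in> ball 0 1. \<phi> z \<in> U} (f \<circ> \<phi>)"
  proof (rule orientation_preserving_on_dense[OF C(2,3)])
    fix z and e :: real assume z: "z \<in> {z \<in> ball 0 1. \<phi> z \<in> U}" and e: "0 < e"
    then obtain S where S: "openin X S" "\<phi> z \<in> S" "positive_on P f S" using loc by blast
    show "\<exists>z' T. z' \<in> ball z e \<and> z' \<in> T \<and> open T \<and> orientation_preserving_on T (f \<circ> \<phi>)"
      using z e S \<phi> disk_preimage_open[OF S(1) \<phi>]
      by (intro exI[of _ z] exI[of _ "{z \<in> ball 0 1. \<phi> z \<in> S}"]) (simp add: positive_on_def)
  qed
qed

text \<open>Around each point \<open>f\<close> is compared with a positive chart on a small disk,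
  where the transition map or its conjugate preserves orientation. The parts of \<open>U\<close> on
  which \<open>f\<close> or its conjugate is positive are open and cover \<open>U\<close>. They are
  disjoint because an overlap would meet a disk of \<open>P\<close>, so connectedness makes one of
  them empty.\<close>

lemma positive_on_or_cnj:
  assumes ch: "surface_chart X U f" and conn: "connected (f ` U)"
    and loc: "\<And>x. x \<in> U \<Longrightarrow> \<exists>(U', f')\<in>positive_charts X P. x \<in> U'"
  shows "positive_on P f U \<or> positive_on P (cnj \<circ> f) U"
proof -
  define Q where "Q g = {S. openin X S \<and> S \<subseteq> U \<and> positive_on P g S}" for g
  note D = surface_chart_D[OF ch]
  have cov: "U \<subseteq> \<Union>(Q f) \<union> \<Union>(Q (cnj \<circ> f))"
  proof
    fix y assume y: "y \<in> U"
    then obtain U1 f1 where U1: "(U1, f1) \<in> positive_charts X P" "y \<in> U1" using loc by blast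
    then have ch1: "surface_chart X U1 f1" and pos1: "positive_on P f1 U1" by (auto simp: positive_charts_def)
    obtain U2 r where U2: "y \<in> U2" "U2 \<subseteq> U1 \<inter> U" "surface_chart X U2 f1" "f1 ` U2 = ball (f1 y) r"
      using surface_chart_ball[OF ch1 U1(2) D(1) y] by metis
    note D1 = surface_chart_D[OF ch1] and D2 = surface_chart_D[OF U2(3)]
    define h where "h = f \<circ> inv_into U2 f1"
    have hc: "continuous_on (f1 ` U2) h" "inj_on h (f1 ` U2)"
      using transition_continuous_inj[OF U2(3) ch] U2(2) unfolding h_def by (simp_all add: Int_absorb2)
    have h: "h (f1 x) = f x" if "x \<in> U2" for x using that D2(3) by (simp add: h_def)
    have posi: "positive_on P g U2"
      if g: "\<And>x. x \<in> U2 \<Longrightarrow> g x = k (f1 x)" and k: "orientation_preserving_on (f1 ` U2) k"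
        "continuous_on (f1 ` U2) k" "inj_on k (f1 ` U2)" for g k
      unfolding positive_on_def
    proof
      fix \<phi> assume \<phi>: "\<phi> \<in> P"
      note C = disk_chart[OF U2(3) \<phi>]
      have "orientation_preserving_on {z \<in> ball 0 1. \<phi> z \<in> U1} (f1 \<circ> \<phi>)" using pos1 \<phi> by (simp add: positive_on_def)
      then have "orientation_preserving_on {z \<in> ball 0 1. \<phi> z \<in> U2} (f1 \<circ> \<phi>)"
        by (rule orientation_preserving_on_subset) (use U2(2) in auto)
      then have "orientation_preserving_on {z \<in> ball 0 1. \<phi> z \<in> U2} (k \<circ> (f1 \<circ> \<phi>))"
        using orientation_preserving_on_compose[OF C _ D2(2) k(2,3,1)] by auto
      then show "orientation_preserving_on {z \<in> ball 0 1. \<phi> z \<in> U2} (g \<circ> \<phi>)"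
        using orientation_preserving_on_cong[of "{z \<in> ball 0 1. \<phi> z \<in> U2}" "k \<circ> (f1 \<circ> \<phi>)" "g \<circ> \<phi>"] g by simp
    qed
    have "connected (f1 ` U2)" using U2(4) by simp
    then consider "orientation_preserving_on (f1 ` U2) h" | "orientation_preserving_on (f1 ` U2) (cnj \<circ> h)"
      using orientation_preserving_on_or_cnj[OF D2(2) _ hc] by blast
    then show "y \<in> \<Union>(Q f) \<union> \<Union>(Q (cnj \<circ> f))"
    proof cases
      case 1
      then have "positive_on P f U2" using posi[of f h] h hc by simp
      then show ?thesis using U2(1,2) D2(1) unfolding Q_def by blast
    next
      case 2
      have "continuous_on (f1 ` U2) (cnj \<circ> h)" "inj_on (cnj \<circ> h) (f1 ` U2)"
        using hc by (auto intro: continuous_intros simp: inj_on_def o_def)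
      then have "positive_on P (cnj \<circ> f) U2" using posi[of "cnj \<circ> f" "cnj \<circ> h"] 2 h by simp
      then show ?thesis using U2(1,2) D2(1) unfolding Q_def by blast
    qed
  qed
  have opn: "openin X (\<Union>(Q g))" "\<Union>(Q g) \<subseteq> U" for g unfolding Q_def by blast+
  have fo: "open (f ` \<Union>(Q g))" for g
    using surface_chart_D(2)[OF surface_chart_restrict[OF ch opn]] .
  have disj: "f ` \<Union>(Q f) \<inter> f ` \<Union>(Q (cnj \<circ> f)) = {}"
  proof (rule ccontr)
    assume "f ` \<Union>(Q f) \<inter> f ` \<Union>(Q (cnj \<circ> f)) \<noteq> {}"
    then have "f ` (\<Union>(Q f) \<inter> \<Union>(Q (cnj \<circ> f))) \<noteq> {}"
      using inj_on_image_Int[OF D(3) opn(2)[of f] opn(2)[of "cnj \<circ> f"]] by simp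
    then obtain S S' where S: "S \<in> Q f" "S' \<in> Q (cnj \<circ> f)" "S \<inter> S' \<noteq> {}" by blast
    then have SS: "openin X (S \<inter> S')" "S \<inter> S' \<subseteq> U" unfolding Q_def by blast+
    then obtain \<phi> z where z: "\<phi> \<in> P" "z \<in> ball 0 1" "\<phi> z \<in> S \<inter> S'"
      using disk_dense[OF SS(1) S(3)] by blast
    let ?T = "{z \<in> ball 0 1. \<phi> z \<in> S \<inter> S'}"
    note C = disk_chart[OF surface_chart_restrict[OF ch SS] z(1)]
    have "orientation_preserving_on ?T (f \<circ> \<phi>)" "orientation_preserving_on ?T ((cnj \<circ> f) \<circ> \<phi>)"
      using S z(1) unfolding Q_def positive_on_def
      by (blast intro: orientation_preserving_on_subset)+
    then show False using orientation_preserving_on_not_cnj[OF C] z by (auto simp: comp_assoc)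
  qed
  define A B where "A = \<Union>(Q f)" and "B = \<Union>(Q (cnj \<circ> f))"
  have AB: "open (f ` A)" "open (f ` B)" "f ` A \<inter> f ` B = {}" "U \<subseteq> A \<union> B" "A \<subseteq> U" "B \<subseteq> U"
    using fo disj cov opn(2) by (simp_all add: A_def B_def)
  have "f ` A \<inter> f ` B \<inter> f ` U = {}" "f ` U \<subseteq> f ` A \<union> f ` B"
    using AB(3) image_mono[OF AB(4), of f] by (simp_all add: image_Un)
  then have "f ` A \<inter> f ` U = {} \<or> f ` B \<inter> f ` U = {}"
    by (rule connectedD[OF conn AB(1,2)])
  then have "f ` A = {} \<or> f ` B = {}"
    using image_mono[OF AB(5), of f] image_mono[OF AB(6), of f] by (simp add: Int_absorb2)
  then have "U \<subseteq> \<Union>(Q (cnj \<circ> f)) \<or> U \<subseteq> \<Union>(Q f)" using AB(4) unfolding A_def B_def by auto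
  then show ?thesis
  proof
    assume "U \<subseteq> \<Union>(Q f)"
    then have "positive_on P f U" by (intro positive_on_local[OF ch]) (auto simp: Q_def)
    then show ?thesis ..
  next
    assume "U \<subseteq> \<Union>(Q (cnj \<circ> f))"
    then have "positive_on P (cnj \<circ> f) U"
      by (intro positive_on_local[OF surface_chart_cnj[OF ch]]) (auto simp: Q_def)
    then show ?thesis ..
  qed
qed

text \<open>Around a point of \<open>F\<close>, a chart is either positive or orientation-reversing throughout the connected
  punctured neighbourhood; in the second case its complex conjugate is a positive chart.\<close>

theorem positive_charts_oriented_atlas:
  assumes F: "finite F" and FP: "\<And>\<phi>. \<phi> \<in> P \<Longrightarrow> \<phi> ` ball 0 1 \<inter> F = {}"
    and cov: "\<And>x. x \<in> topspace X \<Longrightarrow> x \<notin> F \<Longrightarrow> \<exists>(U, f)\<in>positive_charts X P. x \<in> U"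
  shows "oriented_atlas X (positive_charts X P)"
  unfolding oriented_atlas_def
proof (intro conjI)
  show "\<forall>(U, f)\<in>positive_charts X P. surface_chart X U f" by (auto simp: positive_charts_def)
  show "\<forall>(U, f)\<in>positive_charts X P. \<forall>(U', f')\<in>positive_charts X P.
      orientation_preserving_on (f ` (U \<inter> U')) (f' \<circ> inv_into U f)"
    using transition_orientation_preserving by blast
  have "x \<in> (\<Union>(U, f)\<in>positive_charts X P. U)" if x: "x \<in> topspace X" for x
  proof (cases "x \<in> F")
    case True
    have H: "Hausdorff_space X" using surface by (simp add: surface_def)
    obtain U f where ch: "surface_chart X U f" "x \<in> U" using surface_chartE[OF surface x] by blast
    have "closedin X (F \<inter> topspace X - {x})" by (rule closedin_Hausdorff_finite[OF H]) (use F in auto)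
    then have "openin X (topspace X - (F \<inter> topspace X - {x}))" by blast
    then obtain U' r where U': "x \<in> U'" "U' \<subseteq> U \<inter> (topspace X - (F \<inter> topspace X - {x}))"
      "surface_chart X U' f" "0 < r" "f ` U' = ball (f x) r"
      using surface_chart_ball[OF ch] x by blast
    note D' = surface_chart_D[OF U'(3)]
    have "closedin X {x}" using closedin_Hausdorff_singleton[OF H x] .
    then have Q: "openin X (U' - {x})" using D'(1) by blast
    have chQ: "surface_chart X (U' - {x}) f" by (rule surface_chart_restrict[OF U'(3) Q]) blast
    have "f ` (U' - {x}) = ball (f x) r - {f x}"
      using inj_on_image_set_diff[OF D'(3), of U' "{x}"] U'(1,5) by simp
    then have conn: "connected (f ` (U' - {x}))" by (simp add: connected_punctured_ball)
    have "\<exists>(V, g)\<in>positive_charts X P. y \<in> V" if "y \<in> U' - {x}" for y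
      by (rule cov) (use that U'(2) in blast)+
    then have pos: "positive_on P f (U' - {x}) \<or> positive_on P (cnj \<circ> f) (U' - {x})"
      by (rule positive_on_or_cnj[OF chQ conn])
    \<comment> \<open>The disks avoid \<open>F\<close>, so putting \<open>x\<close> back into the
      punctured neighbourhood does not change the condition.\<close>
    have "{z \<in> ball 0 1. \<phi> z \<in> U'} = {z \<in> ball 0 1. \<phi> z \<in> U' - {x}}" if "\<phi> \<in> P" for \<phi>
      using FP[OF that] True by blast
    then have "positive_on P f U' \<or> positive_on P (cnj \<circ> f) U'" using pos unfolding positive_on_def by simp
    then have "(U', f) \<in> positive_charts X P \<or> (U', cnj \<circ> f) \<in> positive_charts X P"
      using U'(3) surface_chart_cnj[OF U'(3)] by (auto simp: positive_charts_def)
    then show ?thesis using U'(1) by blast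
  qed (use cov[OF x] in auto)
  moreover have "(\<Union>(U, f)\<in>positive_charts X P. U) \<subseteq> topspace X"
    by (auto simp: positive_charts_def dest: surface_chart_D(6))
  ultimately show "(\<Union>(U, f)\<in>positive_charts X P. U) = topspace X" by blast
qed

end

subsection \<open>Tilings by nondegenerate pentagons\<close>

lemma compact_embedding_inverse:
  assumes H: "Hausdorff_space X" and K: "compact K" "continuous_map (top_of_set K) X q" "inj_on q K"
  shows "continuous_map (subtopology X (q ` K)) (top_of_set K) (inv_into K q)"
proof -
  have sub: "q ` K \<subseteq> topspace X" using continuous_map_funspace[OF K(2)] by auto
  have "homeomorphic_map (top_of_set K) (subtopology X (q ` K)) q"
  proof (rule continuous_imp_homeomorphic_map)
    show "compact_space (top_of_set K)" using K(1) by (simp add: compact_space_subtopology)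
    show "Hausdorff_space (subtopology X (q ` K))" using H by (rule Hausdorff_space_subtopology)
    show "continuous_map (top_of_set K) (subtopology X (q ` K)) q"
      using K(2) by (auto simp: continuous_map_in_subtopology)
  qed (use sub K(3) in auto)
  then obtain h where h: "homeomorphic_maps (top_of_set K) (subtopology X (q ` K)) q h"
    using homeomorphic_map_maps by blast
  then have "continuous_map (subtopology X (q ` K)) (top_of_set K) h" by (simp add: homeomorphic_maps_def)
  moreover have "h y = inv_into K q y" if "y \<in> topspace (subtopology X (q ` K))" for y
    using h that K(3) by (auto simp: homeomorphic_maps_def)
  ultimately show ?thesis by (rule continuous_map_eq)
qed

text \<open>In a chart, the inverse of the embedding is injective and continuous, so invariance of
  domain applies to it. The consequence of interest: a boundary point of a closed tile, or a point
  of an arc, is never interior to what this tile or arc covers alone.\<close>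

lemma open_preimage_of_compact_embedding:
  fixes K :: "complex set"
  assumes X: "surface X" and K: "compact K" "continuous_map (top_of_set K) X q" "inj_on q K"
    and S: "openin X S" "S \<subseteq> q ` K"
  shows "open {z \<in> K. q z \<in> S}"
proof (subst open_subopen, intro ballI)
  fix z assume z: "z \<in> {z \<in> K. q z \<in> S}"
  have H: "Hausdorff_space X" using X by (simp add: surface_def)
  define h where "h = inv_into K q"
  have hq: "h (q w) = w" if "w \<in> K" for w unfolding h_def by (rule inv_into_f_f[OF K(3) that])
  have hc: "continuous_map (subtopology X (q ` K)) euclidean h"
    using compact_embedding_inverse[OF H K] continuous_map_into_fulltopology unfolding h_def by blast
  have "q z \<in> topspace X" using z openin_subset[OF S(1)] by auto
  then obtain U f where U: "surface_chart X U f" "q z \<in> U" using surface_chartE[OF X] by blast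
  have "q z \<in> S" using z by simp
  then obtain U' r where U': "q z \<in> U'" "U' \<subseteq> U \<inter> S" "surface_chart X U' f"
    by (rule surface_chart_ball[OF U S(1)])
  note D = surface_chart_D[OF U'(3)]
  have sK: "U' \<subseteq> q ` K" using U'(2) S(2) by blast
  have im: "inv_into U' f ` f ` U' = U'" by (rule inv_into_image_cancel[OF D(3)]) simp
  have "continuous_map (top_of_set (f ` U')) (subtopology X (q ` K)) (inv_into U' f)"
    using D(5) im sK by (auto simp: continuous_map_in_subtopology)
  then have c: "continuous_on (f ` U') (h \<circ> inv_into U' f)"
    using continuous_map_compose[OF _ hc] by fastforce
  have ih: "inj_on h U'" unfolding h_def by (rule inj_on_inv_into[OF sK])
  have "inj_on (inv_into U' f) (f ` U')" by (rule inj_on_inv_into) simp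
  then have i: "inj_on (h \<circ> inv_into U' f) (f ` U')" using ih im by (intro comp_inj_on) simp_all
  have "open ((h \<circ> inv_into U' f) ` (f ` U'))" by (rule invariance_of_domain[OF c D(2) i])
  then have "open (h ` U')" using im by (metis image_comp)
  moreover have "z \<in> h ` U'" using hq[of z] z U'(1) by (metis (lifting) image_eqI mem_Collect_eq)
  moreover have "h ` U' \<subseteq> {z \<in> K. q z \<in> S}"
  proof
    fix w assume "w \<in> h ` U'"
    then obtain y where y: "y \<in> U'" "w = h y" by blast
    then obtain v where "v \<in> K" "y = q v" using sK by blast
    then show "w \<in> {z \<in> K. q z \<in> S}" using y hq[of v] U'(2) by auto
  qed
  ultimately show "\<exists>T. open T \<and> z \<in> T \<and> T \<subseteq> {z \<in> K. q z \<in> S}" by blast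
qed

lemma polygon_side_add:
  "polygon_side n (k + j) s = cis (2 * pi * real j / real n) * polygon_side n k s"
  by (simp add: polygon_side_def cis_mult add_divide_distrib distrib_left algebra_simps)

lemma cnj_polygon_side:
  assumes "k < n"
  shows "cnj (polygon_side n k s) = polygon_side n (n - 1 - k) (1 - s)"
proof -
  have "2 * pi * (real (n - 1 - k) + (1 - s)) / real n = 2 * pi + - (2 * pi * (real k + s) / real n)"
    using assms by (simp add: of_nat_diff field_simps)
  then show ?thesis
    unfolding polygon_side_def cis_cnj[symmetric] by (simp add: cis_mult[symmetric] complex_eq_iff del: cis_cnj)
qed

text \<open>With this constant as \<open>c\<close>, the point \<open>c / z\<close> runs through side
  \<open>l\<close> backwards while \<open>z\<close> runs through side \<open>k\<close>.\<close>

lemma polygon_side_mult_opposite: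
  "polygon_side n k s * polygon_side n l (1 - s) = cis (2 * pi * real (k + l + 1) / real n)"
  by (simp add: polygon_side_def cis_mult add_divide_distrib[symmetric] algebra_simps)

lemma polygon_map_compose:
  assumes X: "surface X" and p: "polygon_map X V E n t \<phi>"
    and h: "continuous_on (cball 0 1) h" "inj_on h (cball 0 1)" "h ` cball 0 1 = cball 0 1" "h ` ball 0 1 = ball 0 1"
    and s: "\<And>k. k < n \<Longrightarrow> edge_path X V (\<phi> \<circ> h \<circ> polygon_side n k) \<and> (\<phi> \<circ> h \<circ> polygon_side n k) ` {0..1} \<in> E"
    and t: "\<phi> ` ball 0 1 = t" "inj_on \<phi> (ball 0 1)"
  shows "polygon_map X V E n t (\<phi> \<circ> h)"
proof -
  have hc: "continuous_map (top_of_set (cball 0 1)) (top_of_set (cball 0 1)) h" using h by auto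
  have c: "continuous_map (top_of_set (cball 0 1)) X (\<phi> \<circ> h)"
    using continuous_map_compose[OF hc] p by (auto simp: polygon_map_def)
  have "continuous_map (top_of_set (ball 0 1)) X (\<phi> \<circ> h)"
    using continuous_map_from_subtopology_mono[OF c] by auto
  moreover have "inj_on (\<phi> \<circ> h) (ball 0 1)"
    using comp_inj_on[OF inj_on_subset[OF h(2) ball_subset_cball]] t(2) h(4) by auto
  ultimately have "homeomorphic_map (top_of_set (ball 0 1)) (subtopology X ((\<phi> \<circ> h) ` ball 0 1)) (\<phi> \<circ> h)"
    by (intro surface_homeomorphic_map[OF X]) auto
  moreover have "(\<phi> \<circ> h) ` ball 0 1 = t" using h(4) t(1) by (metis image_comp)
  ultimately show ?thesis using c p s by (simp add: polygon_map_def)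
qed

definition simple_pentagon ::
    "'a topology \<Rightarrow> 'a set \<Rightarrow> 'a set set \<Rightarrow> 'a set \<Rightarrow> (complex \<Rightarrow> 'a) \<Rightarrow> bool" where
  "simple_pentagon X V E t \<phi> \<longleftrightarrow> polygon_map X V E 5 t \<phi> \<and> inj_on \<phi> (sphere 0 1)"

abbreviation corner :: "(complex \<Rightarrow> 'a) \<Rightarrow> nat \<Rightarrow> 'a" where
  "corner \<phi> k \<equiv> \<phi> (polygon_side 5 k 0)"

abbreviation side :: "(complex \<Rightarrow> 'a) \<Rightarrow> nat \<Rightarrow> 'a set" where
  "side \<phi> k \<equiv> (\<phi> \<circ> polygon_side 5 k) ` {0..1}"

locale nondegenerate_pentagonal_tiling =
  fixes X :: "'a topology" and V :: "'a set" and E :: "'a set set"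
  assumes compact_connected: "compact_connected_surface X"
    and pentagonal: "pentagonal_tiling X V E"
    and nondegenerate: "\<forall>t\<in>tiles X V E. nondegenerate_polygon X V E 5 t"
begin

lemma surface: "surface X" using compact_connected by (simp add: compact_connected_surface_def)

lemma Hausdorff: "Hausdorff_space X" using surface by (simp add: surface_def)

lemma graph: "finite V" "finite E" "V \<subseteq> topspace X"
  and edge_pathE: "e \<in> E \<Longrightarrow> \<exists>g. edge_path X V g \<and> e = g ` {0..1}"
  and edge_Int: "e \<in> E \<Longrightarrow> e' \<in> E \<Longrightarrow> e \<noteq> e' \<Longrightarrow> e \<inter> e' \<subseteq> V"
  and degree_ge: "v \<in> V \<Longrightarrow> 3 \<le> vertex_degree V E v"
  using pentagonal by (auto simp: pentagonal_tiling_def tiling_def embedded_graph_def)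

lemma edge_closed:
  assumes "e \<in> E"
  shows "closedin X e" "e \<subseteq> topspace X"
proof -
  obtain g where g: "edge_path X V g" "e = g ` {0..1}" using edge_pathE[OF assms] by blast
  then have "continuous_map (top_of_set {0..1}) X g" by (simp add: edge_path_def pathin_def)
  moreover have "compactin (top_of_set {0..1}) {0..1::real}" by (simp add: compactin_subtopology)
  ultimately have "compactin X e" using image_compactin g(2) by metis
  then show "closedin X e" using compactin_imp_closedin[OF Hausdorff] by blast
  then show "e \<subseteq> topspace X" by (rule closedin_subset)
qed

lemma vertices_closed: "closedin X V" using closedin_Hausdorff_finite[OF Hausdorff] graph by blast

lemma tiles_Union: "\<Union>(tiles X V E) = topspace X - (V \<union> \<Union>E)"
  unfolding tiles_def Union_connected_components_of by auto

lemma tiles_disjoint: "t \<in> tiles X V E \<Longrightarrow> t' \<in> tiles X V E \<Longrightarrow> t \<noteq> t' \<Longrightarrow> t \<inter> t' = {}"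
  unfolding tiles_def by (metis connected_components_of_disjoint disjnt_def)

lemma tile_subset: "t \<in> tiles X V E \<Longrightarrow> t \<subseteq> topspace X" "t \<in> tiles X V E \<Longrightarrow> t \<inter> V = {}"
  "t \<in> tiles X V E \<Longrightarrow> e \<in> E \<Longrightarrow> t \<inter> e = {}"
  using tiles_Union by blast+

lemma simple_pentagon_exists: "t \<in> tiles X V E \<Longrightarrow> \<exists>\<phi>. simple_pentagon X V E t \<phi>"
  using nondegenerate by (simp add: nondegenerate_polygon_def simple_pentagon_def)

context
  fixes t \<phi> assumes t: "t \<in> tiles X V E" and sp: "simple_pentagon X V E t \<phi>"
begin

lemma pentagon_continuous: "continuous_map (top_of_set (cball 0 1)) X \<phi>"
  "continuous_map (top_of_set (ball 0 1)) X \<phi>"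
proof -
  show c: "continuous_map (top_of_set (cball 0 1)) X \<phi>" using sp by (simp add: simple_pentagon_def polygon_map_def)
  show "continuous_map (top_of_set (ball 0 1)) X \<phi>"
    using continuous_map_from_subtopology_mono[OF c] by auto
qed

lemma pentagon_side: "k < 5 \<Longrightarrow> edge_path X V (\<phi> \<circ> polygon_side 5 k)" "k < 5 \<Longrightarrow> side \<phi> k \<in> E"
  using sp by (simp_all add: simple_pentagon_def polygon_map_def)

lemma pentagon_ball: "\<phi> ` ball 0 1 = t"
proof -
  have "homeomorphic_map (top_of_set (ball 0 1)) (subtopology X t) \<phi>"
    using sp by (simp add: simple_pentagon_def polygon_map_def)
  then have "\<phi> ` topspace (top_of_set (ball 0 1)) = topspace (subtopology X t)"
    by (rule homeomorphic_imp_surjective_map)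
  then show ?thesis using tile_subset(1)[OF t] by (simp add: inf_absorb2)
qed

lemma pentagon_sphere: "\<phi> ` sphere 0 1 = (\<Union>k<5. side \<phi> k)"
  using sphere_eq_polygon_sides[of 5] by (simp add: image_UN image_comp)

lemma pentagon_cball: "\<phi> ` cball 0 1 = t \<union> (\<Union>k<5. side \<phi> k)"
proof -
  have "cball (0::complex) 1 = ball 0 1 \<union> sphere 0 1" by auto
  then show ?thesis using pentagon_ball pentagon_sphere by (metis image_Un)
qed

text \<open>The open disk goes to the tile and the circle goes to edges, which the tile avoids; so
  injectivity on the two parts suffices.\<close>

lemma pentagon_inj: "inj_on \<phi> (cball 0 1)"
proof -
  have "homeomorphic_map (top_of_set (ball 0 1)) (subtopology X t) \<phi>"
    using sp by (simp add: simple_pentagon_def polygon_map_def)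
  then have 1: "inj_on \<phi> (ball 0 1)" using homeomorphic_imp_injective_map by fastforce
  have 2: "inj_on \<phi> (sphere 0 1)" using sp by (simp add: simple_pentagon_def)
  have "\<phi> ` ball 0 1 \<inter> \<phi> ` sphere 0 1 = {}"
    unfolding pentagon_ball pentagon_sphere using tile_subset(3)[OF t] pentagon_side(2) by blast
  then have "inj_on \<phi> (ball 0 1 \<union> sphere 0 1)" using 1 2 by (auto simp: inj_on_Un)
  moreover have "cball (0::complex) 1 = ball 0 1 \<union> sphere 0 1" by auto
  ultimately show ?thesis by simp
qed

lemma pentagon_eq_iff: "cmod u = 1 \<Longrightarrow> cmod v = 1 \<Longrightarrow> \<phi> u = \<phi> v \<longleftrightarrow> u = v"
  using pentagon_inj by (auto simp: inj_on_def)

lemma corner_eq_iff: "k < 5 \<Longrightarrow> l < 5 \<Longrightarrow> corner \<phi> k = corner \<phi> l \<longleftrightarrow> k = l"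
  using polygon_side_inj[of 5 k 0 l 0] by (auto simp: pentagon_eq_iff)

lemma corner_Suc: "k < 5 \<Longrightarrow> \<phi> (polygon_side 5 k 1) = corner \<phi> (Suc k mod 5)"
  using polygon_side_1[of 5 k] by simp

lemma side_inj: "k < 5 \<Longrightarrow> inj_on (\<phi> \<circ> polygon_side 5 k) {0..1}"
proof (rule inj_onI)
  fix s s' :: real assume k: "k < 5" and s: "s \<in> {0..1}" "s' \<in> {0..1}"
    and e: "(\<phi> \<circ> polygon_side 5 k) s = (\<phi> \<circ> polygon_side 5 k) s'"
  then have e': "polygon_side 5 k s = polygon_side 5 k s'" by (simp add: pentagon_eq_iff)
  have *: False if "polygon_side 5 k 1 = polygon_side 5 k r" "0 \<le> r" "r < 1" for r
  proof -
    have "polygon_side 5 (Suc k mod 5) 0 = polygon_side 5 k r" using that polygon_side_1[of 5 k] k by simp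
    then have "Suc k mod 5 = k" using polygon_side_inj[of 5 "Suc k mod 5" 0 k r] that k by simp
    then show False using k by presburger
  qed
  show "s = s'"
    using e' *[of s] *[of s'] polygon_side_inj[OF e' k k] s by (cases "s = 1"; cases "s' = 1") force+
qed

lemma corner_in: "k < 5 \<Longrightarrow> corner \<phi> k \<in> V"
  using pentagon_side(1)[of k] by (simp add: edge_path_def)

lemma side_Int_vertices: "k < 5 \<Longrightarrow> side \<phi> k \<inter> V = {corner \<phi> k, corner \<phi> (Suc k mod 5)}"
proof -
  assume k: "k < 5"
  have "{0..1::real} = {0,1} \<union> {0<..<1}" by auto
  then have "side \<phi> k = {corner \<phi> k, corner \<phi> (Suc k mod 5)} \<union> (\<phi> \<circ> polygon_side 5 k) ` {0<..<1}"
    using corner_Suc[OF k] by (simp add: image_Un)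
  moreover have "(\<phi> \<circ> polygon_side 5 k) ` {0<..<1} \<inter> V = {}"
    using pentagon_side(1)[OF k] by (simp add: edge_path_def)
  moreover have "corner \<phi> k \<in> V" "corner \<phi> (Suc k mod 5) \<in> V" using corner_in k by auto
  ultimately show ?thesis by blast
qed

lemma side_eq_iff: "k < 5 \<Longrightarrow> l < 5 \<Longrightarrow> side \<phi> k = side \<phi> l \<longleftrightarrow> k = l"
proof
  assume k: "k < 5" "l < 5" and e: "side \<phi> k = side \<phi> l"
  have "(\<phi> \<circ> polygon_side 5 k) (1/2) \<in> side \<phi> k" by (rule imageI) simp
  then obtain s where s: "s \<in> {0..1}" "(\<phi> \<circ> polygon_side 5 k) (1/2) = (\<phi> \<circ> polygon_side 5 l) s"
    unfolding e by (rule imageE) blast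
  then have p: "polygon_side 5 k (1/2) = polygon_side 5 l s" by (simp add: pentagon_eq_iff)
  show "k = l"
  proof (cases "s = 1")
    case True
    then have "polygon_side 5 k (1/2) = polygon_side 5 (Suc l mod 5) 0" using p polygon_side_1[of 5 l] k by simp
    from polygon_side_inj[OF this] k show ?thesis by simp
  next
    case False
    from polygon_side_inj[OF p] k s False show ?thesis by simp
  qed
qed auto

lemma pentagon_closure: "X closure_of t = \<phi> ` cball 0 1"
proof
  have "compactin (top_of_set (cball 0 1)) (cball (0::complex) 1)" by (simp add: compactin_subtopology)
  then have "compactin X (\<phi> ` cball 0 1)" using image_compactin pentagon_continuous(1) by blast
  then have "closedin X (\<phi> ` cball 0 1)" using compactin_imp_closedin[OF Hausdorff] by blast
  moreover have "t \<subseteq> \<phi> ` cball 0 1" using pentagon_cball by blast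
  ultimately show "X closure_of t \<subseteq> \<phi> ` cball 0 1" by (rule closure_of_minimal[rotated])
  have "top_of_set (cball 0 1) closure_of (ball 0 1) = cball (0::complex) 1"
    by (simp add: closure_of_subtopology Int_absorb1 Int_absorb2 ball_subset_cball)
  then show "\<phi> ` cball 0 1 \<subseteq> X closure_of t"
    using continuous_map_image_closure_subset[OF pentagon_continuous(1), of "ball 0 1"] pentagon_ball by simp
qed

text \<open>The midpoint of \<open>e\<close> is not a vertex, so a side through it cannot be a
  different edge.\<close>

lemma edge_subset_closure_iff: "e \<in> E \<Longrightarrow> e \<subseteq> X closure_of t \<longleftrightarrow> (\<exists>k<5. e = side \<phi> k)"
proof
  assume e: "e \<in> E" "e \<subseteq> X closure_of t"
  obtain g where g: "edge_path X V g" "e = g ` {0..1}" using edge_pathE[OF e(1)] by blast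
  let ?x = "g (1/2)"
  have "?x \<in> g ` {0<..<1}" by (rule imageI) simp
  then have x: "?x \<in> e" "?x \<notin> V" using g unfolding edge_path_def by (simp, blast)
  have "?x \<in> t \<union> (\<Union>k<5. side \<phi> k)" using e(2) x(1) unfolding pentagon_closure pentagon_cball by (rule subsetD)
  moreover have "?x \<notin> t" using tile_subset(3)[OF t e(1)] x by blast
  ultimately obtain k where k: "k < 5" "?x \<in> side \<phi> k" by blast
  then have "e = side \<phi> k" using edge_Int[OF e(1) pentagon_side(2)[OF k(1)]] x by (meson IntI subsetD)
  then show "\<exists>k<5. e = side \<phi> k" using k by blast
next
  assume "\<exists>k<5. e = side \<phi> k"
  then obtain k where "k \<in> {..<5}" "e = side \<phi> k" by auto
  then show "e \<subseteq> X closure_of t" unfolding pentagon_closure pentagon_cball 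
    using UN_upper[of k "{..<5}" "side \<phi>"] by (metis le_supI2)
qed

lemma tile_vertices_eq: "tile_vertices X V t = corner \<phi> ` {..<5}"
proof -
  have "tile_vertices X V t = (\<Union>k<5. side \<phi> k \<inter> V)"
    unfolding tile_vertices_def pentagon_closure pentagon_cball using tile_subset(2)[OF t] by blast
  also have "\<dots> = (\<Union>k<5. {corner \<phi> k, corner \<phi> (Suc k mod 5)})"
    using side_Int_vertices by (intro SUP_cong) auto
  also have "\<dots> = corner \<phi> ` {..<5}" by auto
  finally show ?thesis .
qed

end

end

section \<open>Rotating, reflecting and reparametrizing a pentagon\<close>

lemma edge_path_reverse:
  assumes "edge_path X V g"
  shows "edge_path X V (\<lambda>s. g (1 - s))" "(\<lambda>s. g (1 - s)) ` {0..1} = g ` {0..1}"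
proof -
  have i: "(\<lambda>s. 1 - s) ` {0<..<1} = {0<..<1::real}" "(\<lambda>s. 1 - s) ` {0..1} = {0..1::real}"
    by (auto simp: image_def intro!: bexI[of _ "1 - x" for x])
  have "continuous_map (top_of_set {0..1}) (top_of_set {0..1}) (\<lambda>s::real. 1 - s)"
    using i by (auto intro: continuous_intros)
  then have "continuous_map (top_of_set {0..1}) X (g \<circ> (\<lambda>s. 1 - s))"
    by (rule continuous_map_compose) (use assms in \<open>simp add: edge_path_def pathin_def\<close>)
  moreover have "inj_on (g \<circ> (\<lambda>s. 1 - s)) {0<..<1}"
    using assms i by (intro comp_inj_on) (auto simp: edge_path_def inj_on_def)
  moreover have "(g \<circ> (\<lambda>s. 1 - s)) ` {0<..<1} = g ` {0<..<1}" "(g \<circ> (\<lambda>s. 1 - s)) ` {0..1} = g ` {0..1}"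
    unfolding image_comp[symmetric] i by simp_all
  ultimately show "edge_path X V (\<lambda>s. g (1 - s))" "(\<lambda>s. g (1 - s)) ` {0..1} = g ` {0..1}"
    using assms by (auto simp: edge_path_def pathin_def o_def)
qed

context nondegenerate_pentagonal_tiling
begin

lemma simple_pentagon_compose:
  assumes t: "t \<in> tiles X V E" "simple_pentagon X V E t \<phi>"
    and h: "continuous_on (cball 0 1) h" "inj_on h (cball 0 1)" "h ` cball 0 1 = cball 0 1" "h ` ball 0 1 = ball 0 1"
    and s: "\<And>k. k < 5 \<Longrightarrow> edge_path X V (\<phi> \<circ> h \<circ> polygon_side 5 k) \<and> (\<phi> \<circ> h \<circ> polygon_side 5 k) ` {0..1} \<in> E"
  shows "simple_pentagon X V E t (\<phi> \<circ> h)"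
proof -
  have "inj_on (\<phi> \<circ> h) (cball 0 1)" using comp_inj_on[OF h(2)] pentagon_inj[OF t] h(3) by simp
  then have "inj_on (\<phi> \<circ> h) (sphere 0 1)" by (rule inj_on_subset) auto
  moreover have "polygon_map X V E 5 t (\<phi> \<circ> h)"
  proof (rule polygon_map_compose[OF surface _ h s])
    show "inj_on \<phi> (ball 0 1)" using inj_on_subset[OF pentagon_inj[OF t] ball_subset_cball] .
  qed (use t pentagon_ball[OF t] in \<open>simp_all add: simple_pentagon_def\<close>)
  ultimately show ?thesis by (simp add: simple_pentagon_def)
qed

lemma simple_pentagon_rotate:
  assumes t: "t \<in> tiles X V E" "simple_pentagon X V E t \<phi>"
  shows "\<exists>\<phi>'. simple_pentagon X V E t \<phi>' \<and>
    (\<forall>k s. \<phi>' (polygon_side 5 k s) = \<phi> (polygon_side 5 (k + j) s))"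
proof -
  let ?c = "cis (2 * pi * real j / real 5)"
  have im: "(\<lambda>z. ?c * z) ` cball 0 1 = cball 0 1" "(\<lambda>z. ?c * z) ` ball 0 1 = ball 0 1"
  proof -
    have *: "w \<in> (\<lambda>z. ?c * z) ` S" if "cnj ?c * w \<in> S" for w S
      using that by (intro image_eqI[of _ _ "cnj ?c * w"]) (simp_all add: cis_cnj cis_mult mult.assoc[symmetric])
    show "(\<lambda>z. ?c * z) ` cball 0 1 = cball 0 1" "(\<lambda>z. ?c * z) ` ball 0 1 = ball 0 1"
      by (intro equalityI subsetI *; auto simp: norm_mult)+
  qed
  have e: "(\<phi> \<circ> (\<lambda>z. ?c * z)) (polygon_side 5 k s) = \<phi> (polygon_side 5 (k + j) s)" for k s
    by (simp add: polygon_side_add)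
  have e': "\<phi> \<circ> (\<lambda>z. ?c * z) \<circ> polygon_side 5 k = \<phi> \<circ> polygon_side 5 ((k + j) mod 5)" for k
    using e[of k] polygon_side_mod[of 5 "k + j"] by (auto simp: fun_eq_iff)
  have "simple_pentagon X V E t (\<phi> \<circ> (\<lambda>z. ?c * z))"
  proof (rule simple_pentagon_compose[OF t _ _ im])
    fix k :: nat assume "k < 5"
    show "edge_path X V (\<phi> \<circ> (\<lambda>z. ?c * z) \<circ> polygon_side 5 k) \<and> side (\<phi> \<circ> (\<lambda>z. ?c * z)) k \<in> E"
      unfolding e' using pentagon_side[OF t, of "(k + j) mod 5"] by simp
  qed (auto intro!: continuous_intros simp: inj_on_def)
  then show ?thesis using e by blast
qed

lemma simple_pentagon_reflect:
  assumes t: "t \<in> tiles X V E" "simple_pentagon X V E t \<phi>"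
  shows "\<exists>\<phi>'. simple_pentagon X V E t \<phi>' \<and>
    (\<forall>k s. k < 5 \<longrightarrow> \<phi>' (polygon_side 5 k s) = \<phi> (polygon_side 5 (4 - k) (1 - s)))"
proof -
  have im: "cnj ` cball 0 1 = cball 0 1" "cnj ` ball 0 1 = ball 0 1"
    by (auto intro!: image_eqI[of _ cnj "cnj x" for x])
  have e: "(\<phi> \<circ> cnj) (polygon_side 5 k s) = \<phi> (polygon_side 5 (4 - k) (1 - s))" if "k < 5" for k s
    using cnj_polygon_side[OF that, of s] by simp
  have "simple_pentagon X V E t (\<phi> \<circ> cnj)"
  proof (rule simple_pentagon_compose[OF t _ _ im])
    fix k :: nat assume k: "k < 5"
    have e': "\<phi> \<circ> cnj \<circ> polygon_side 5 k = (\<lambda>s. (\<phi> \<circ> polygon_side 5 (4 - k)) (1 - s))"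
      using e[OF k] by (auto simp: fun_eq_iff)
    show "edge_path X V (\<phi> \<circ> cnj \<circ> polygon_side 5 k) \<and> side (\<phi> \<circ> cnj) k \<in> E"
      unfolding e' using edge_path_reverse[OF pentagon_side(1)[OF t, of "4 - k"]] pentagon_side(2)[OF t, of "4 - k"]
      by simp
  qed (auto intro!: continuous_intros simp: inj_on_def)
  then show ?thesis using e by blast
qed

text \<open>The prescribed side parametrizations, pulled back by \<open>\<phi>\<close>, form an
  injective map of the circle to itself, and coning it at 0 extends it to the disk.\<close>

lemma simple_pentagon_reparam:
  assumes t: "t \<in> tiles X V E" "simple_pentagon X V E t \<phi>"
    and p: "\<And>k. k < 5 \<Longrightarrow> pathin X (p k)" "\<And>k. k < 5 \<Longrightarrow> inj_on (p k) {0..1}"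
      "\<And>k. k < 5 \<Longrightarrow> p k ` {0..1} = side \<phi> k"
      "\<And>k. k < 5 \<Longrightarrow> p k 0 = corner \<phi> k" "\<And>k. k < 5 \<Longrightarrow> p k 1 = corner \<phi> (Suc k mod 5)"
  shows "\<exists>\<phi>'. simple_pentagon X V E t \<phi>' \<and>
    (\<forall>k s. k < 5 \<longrightarrow> s \<in> {0..1} \<longrightarrow> \<phi>' (polygon_side 5 k s) = p k s)"
proof -
  define h where "h = inv_into (cball 0 1) \<phi>"
  have hq: "h (\<phi> z) = z" if "z \<in> cball 0 1" for z
    unfolding h_def by (rule inv_into_f_f[OF pentagon_inj[OF t] that])
  have hc: "continuous_map (subtopology X (\<phi> ` cball 0 1)) euclidean h"
    using compact_embedding_inverse[OF Hausdorff compact_cball pentagon_continuous(1)[OF t] pentagon_inj[OF t]]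
      continuous_map_into_fulltopology unfolding h_def by blast
  have ps: "\<exists>r\<in>{0..1}. p k s = \<phi> (polygon_side 5 k r)" if "k < 5" "s \<in> {0..1}" for k s
  proof -
    have "p k s \<in> side \<phi> k" using p(3)[OF that(1)] that(2) by blast
    then show ?thesis by auto
  qed
  have psc: "p k s \<in> \<phi> ` cball 0 1" if "k < 5" "s \<in> {0..1}" for k s
  proof -
    obtain r where "p k s = \<phi> (polygon_side 5 k r)" using ps[OF \<open>k < 5\<close> \<open>s \<in> {0..1}\<close>] by blast
    then show ?thesis by simp
  qed
  define \<sigma> where "\<sigma> k = h \<circ> p k" for k
  have \<sigma>n: "cmod (\<sigma> k s) = 1" "\<phi> (\<sigma> k s) = p k s" if "k < 5" "s \<in> {0..1}" for k s
  proof -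
    obtain r where "p k s = \<phi> (polygon_side 5 k r)" using ps[OF \<open>k < 5\<close> \<open>s \<in> {0..1}\<close>] by blast
    then show "cmod (\<sigma> k s) = 1" "\<phi> (\<sigma> k s) = p k s" by (simp_all add: \<sigma>_def hq)
  qed
  have c: "continuous_on {0..1} (\<sigma> k)" if k: "k < 5" for k
  proof -
    have "continuous_map (top_of_set {0..1}) (subtopology X (\<phi> ` cball 0 1)) (p k)"
      using p(1)[OF k] psc[OF k] by (auto simp: continuous_map_in_subtopology pathin_def)
    then show ?thesis using continuous_map_compose[OF _ hc] unfolding \<sigma>_def by fastforce
  qed
  have j: "\<sigma> k 1 = \<sigma> (Suc k mod 5) 0" if "k < 5" for k
    using p(4)[of "Suc k mod 5"] p(5)[OF that] by (simp add: \<sigma>_def)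
  obtain \<rho> where \<rho>: "continuous_on (sphere 0 1) \<rho>"
    "\<And>k s. k < 5 \<Longrightarrow> s \<in> {0..1} \<Longrightarrow> \<rho> (polygon_side 5 k s) = \<sigma> k s"
    using circle_map_from_sides[of 5 \<sigma>] c j by auto
  have \<sigma>i: "inj_on (\<sigma> k) {0..1}" if k: "k < 5" for k
  proof (rule inj_onI)
    fix s s' assume "s \<in> {0..1}" "s' \<in> {0..1}" "\<sigma> k s = \<sigma> k s'"
    then show "s = s'" using \<sigma>n(2)[OF k, of s] \<sigma>n(2)[OF k, of s'] p(2)[OF k] by (auto dest: inj_onD)
  qed
  have zero: "s = 0" if k: "k < 5" and s: "s \<in> {0..<1}" "p k s \<in> V" for k s
  proof -
    have "p k s \<in> side \<phi> k" using p(3)[OF k] s(1) by force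
    then have "p k s \<in> {p k 0, p k 1}" using side_Int_vertices[OF t k] s(2) unfolding p(4)[OF k] p(5)[OF k] by blast
    then show "s = 0" using inj_onD[OF p(2)[OF k], of s 0] inj_onD[OF p(2)[OF k], of s 1] s(1) by auto
  qed
  have inj: "inj_on \<rho> (sphere 0 1)"
  proof (rule inj_on_circle_from_sides[of 5 \<rho> \<sigma>])
    fix k l :: nat and s s' :: real assume k: "k < 5" "l < 5" "k \<noteq> l" and s: "s \<in> {0..<1}" "s' \<in> {0..<1::real}"
    show "\<sigma> k s \<noteq> \<sigma> l s'"
    proof
      assume "\<sigma> k s = \<sigma> l s'"
      then have e: "p k s = p l s'" using \<sigma>n(2)[of k s] \<sigma>n(2)[of l s'] k s by simp
      have "p k s \<in> side \<phi> k" "p l s' \<in> side \<phi> l" using p(3)[of k] p(3)[of l] k s by force+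
      moreover have "side \<phi> k \<noteq> side \<phi> l" using side_eq_iff[OF t] k by blast
      ultimately have "p k s \<in> V" using edge_Int[OF pentagon_side(2)[OF t] pentagon_side(2)[OF t], of k l] k e by auto
      then have "s = 0" "s' = 0" using zero k s e by auto
      then have "corner \<phi> k = corner \<phi> l" using e p(4) k by simp
      then show False using corner_eq_iff[OF t] k by blast
    qed
  qed (use \<rho>(2) in \<open>auto intro: inj_on_subset[OF \<sigma>i]\<close>)
  have fr: "\<rho> ` sphere 0 1 \<subseteq> frontier (cball 0 1)"
  proof
    fix w assume "w \<in> \<rho> ` sphere 0 1"
    then obtain u where u: "cmod u = 1" "w = \<rho> u" by auto
    obtain k s where "k < 5" "0 \<le> s" "s < 1" "u = polygon_side 5 k s" using polygon_side_surj[OF u(1), of 5] by auto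
    then show "w \<in> frontier (cball 0 1)" using \<rho>(2)[of k s] \<sigma>n(1)[of k s] u(2) by (simp add: frontier_cball)
  qed
  have "0 \<in> interior (cball (0::complex) 1)" by (simp add: interior_cball)
  then obtain R where R: "continuous_on (cball 0 1) R" "inj_on R (cball 0 1)" "\<forall>u. cmod u = 1 \<longrightarrow> R u = \<rho> u"
    "R ` cball 0 1 = cball 0 1" "R ` ball 0 1 = interior (cball 0 1)" "R 0 = 0"
    by (rule cone_extension[OF compact_cball convex_cball _ \<rho>(1) inj fr])
  have Rb: "R ` ball 0 1 = ball 0 1" using R(5) by (simp add: interior_cball)
  have e: "(\<phi> \<circ> R) (polygon_side 5 k s) = p k s" if "k < 5" "s \<in> {0..1}" for k s
    using R(3) \<rho>(2) \<sigma>n(2) that by simp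
  have "simple_pentagon X V E t (\<phi> \<circ> R)"
  proof (rule simple_pentagon_compose[OF t R(1,2,4) Rb])
    fix k :: nat assume k: "k < 5"
    have e': "(\<phi> \<circ> R \<circ> polygon_side 5 k) s = p k s" if "s \<in> {0..1}" for s using e[OF k that] by simp
    have im: "side (\<phi> \<circ> R) k = side \<phi> k" using e' p(3)[OF k] by (metis image_cong)
    have "pathin X (\<phi> \<circ> R \<circ> polygon_side 5 k)"
      using p(1)[OF k] e' continuous_map_eq[of "top_of_set {0..1}" X "p k"] by (simp add: pathin_def)
    moreover have "inj_on (\<phi> \<circ> R \<circ> polygon_side 5 k) {0<..<1}"
      using p(2)[OF k] e' by (auto simp: inj_on_def)
    moreover have "(\<phi> \<circ> R \<circ> polygon_side 5 k) ` {0<..<1} \<inter> V = {}"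
    proof (rule ccontr)
      assume "(\<phi> \<circ> R \<circ> polygon_side 5 k) ` {0<..<1} \<inter> V \<noteq> {}"
      then obtain s where s: "s \<in> {0<..<1}" "p k s \<in> V" using e' by fastforce
      then show False using zero[OF k, of s] by simp
    qed
    moreover have "(\<phi> \<circ> R \<circ> polygon_side 5 k) 0 \<in> V" "(\<phi> \<circ> R \<circ> polygon_side 5 k) 1 \<in> V"
      using e'[of 0] e'[of 1] p(4,5)[OF k] corner_in[OF t] k by auto
    ultimately show "edge_path X V (\<phi> \<circ> R \<circ> polygon_side 5 k) \<and> side (\<phi> \<circ> R) k \<in> E"
      using im pentagon_side(2)[OF t k] by (simp add: edge_path_def)
  qed
  then show ?thesis using e by blast
qed

text \<open>The two ends of a side are distinct, so a path along this edge is injective up to its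
  ends.\<close>

lemma edge_path_inj:
  assumes t: "t \<in> tiles X V E" "simple_pentagon X V E t \<phi>" and k: "k < 5"
    and g: "edge_path X V g" "g ` {0..1} = side \<phi> k"
  shows "inj_on g {0..1}" "(g 0 = corner \<phi> k \<and> g 1 = corner \<phi> (Suc k mod 5)) \<or>
    (g 1 = corner \<phi> k \<and> g 0 = corner \<phi> (Suc k mod 5))"
proof -
  have s: "{0..1::real} = {0,1} \<union> {0<..<1}" by auto
  have gV: "g ` {0..1} \<inter> V = {g 0, g 1}"
    using g(1) unfolding s image_Un edge_path_def by auto
  moreover have ne: "corner \<phi> k \<noteq> corner \<phi> (Suc k mod 5)"
  proof -
    have "Suc k mod 5 \<noteq> k" "Suc k mod 5 < 5" using k by presburger+
    then show ?thesis using corner_eq_iff[OF t k] by metis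
  qed
  ultimately have eq: "{g 0, g 1} = {corner \<phi> k, corner \<phi> (Suc k mod 5)}"
    using side_Int_vertices[OF t k] g(2) by simp
  then show "(g 0 = corner \<phi> k \<and> g 1 = corner \<phi> (Suc k mod 5)) \<or>
    (g 1 = corner \<phi> k \<and> g 0 = corner \<phi> (Suc k mod 5))"
    by (auto simp: doubleton_eq_iff)
  then have "g 0 \<noteq> g 1" using ne by auto
  moreover have "g 0 \<in> V" "g 1 \<in> V" "g ` {0<..<1} \<inter> V = {}" "inj_on g {0<..<1}"
    using g(1) by (simp_all add: edge_path_def)
  ultimately show "inj_on g {0..1}" unfolding s inj_on_Un by auto
qed

text \<open>A rotation makes \<open>e\<close> side 0, a reflection corrects the direction if
  necessary, and then the parametrization of this one side is replaced by \<open>g\<close>.\<close>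

lemma simple_pentagon_adapted:
  assumes t: "t \<in> tiles X V E" and e: "e \<in> E" "e \<subseteq> X closure_of t" and g: "edge_path X V g" "g ` {0..1} = e"
  obtains \<psi> where "simple_pentagon X V E t \<psi>" "\<And>s. s \<in> {0..1} \<Longrightarrow> \<psi> (polygon_side 5 0 s) = g s"
proof -
  obtain \<phi> where \<phi>: "simple_pentagon X V E t \<phi>" using simple_pentagon_exists[OF t] by blast
  obtain k where k: "k < 5" "e = side \<phi> k" using edge_subset_closure_iff[OF t \<phi> e(1)] e(2) by blast
  obtain \<phi>1 where \<phi>1: "simple_pentagon X V E t \<phi>1"
    "\<And>i s. \<phi>1 (polygon_side 5 i s) = \<phi> (polygon_side 5 (i + k) s)"
    using simple_pentagon_rotate[OF t \<phi>, of k] by blast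
  have "e = side \<phi>1 0" using k(2) \<phi>1(2)[of 0] by simp
  have "\<exists>\<phi>'. simple_pentagon X V E t \<phi>' \<and> side \<phi>' 0 = e \<and> g 0 = corner \<phi>' 0 \<and> g 1 = corner \<phi>' 1"
  proof (cases "g 0 = corner \<phi>1 0 \<and> g 1 = corner \<phi>1 1")
    case True
    then show ?thesis using \<phi>1(1) \<open>e = side \<phi>1 0\<close> by blast
  next
    case False
    then have g': "g 1 = corner \<phi>1 0" "g 0 = corner \<phi>1 1"
      using edge_path_inj(2)[OF t \<phi>1(1), of 0 g] g \<open>e = side \<phi>1 0\<close> by auto
    obtain \<phi>2 where \<phi>2: "simple_pentagon X V E t \<phi>2"
      "\<And>k s. k < 5 \<Longrightarrow> \<phi>2 (polygon_side 5 k s) = \<phi>1 (polygon_side 5 (4 - k) (1 - s))"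
      using simple_pentagon_reflect[OF t \<phi>1(1)] by blast
    \<comment> \<open>The reflection moves side 0 to position 4; rotating by 4 returns it to
      position 0.\<close>
    obtain \<phi>3 where \<phi>3: "simple_pentagon X V E t \<phi>3"
      "\<And>k s. \<phi>3 (polygon_side 5 k s) = \<phi>2 (polygon_side 5 (k + 4) s)"
      using simple_pentagon_rotate[OF t \<phi>2(1), of 4] by blast
    have 3: "\<phi>3 (polygon_side 5 0 s) = \<phi>1 (polygon_side 5 0 (1 - s))" for s
      using \<phi>3(2)[of 0 s] \<phi>2(2)[of 4 s] by simp
    have "side \<phi>3 0 = e"
      using edge_path_reverse(2)[OF pentagon_side(1)[OF t \<phi>1(1), of 0]] 3 \<open>e = side \<phi>1 0\<close> by (simp add: o_def)
    moreover have "g 0 = corner \<phi>3 0" using 3[of 0] g'(2) corner_Suc[OF t \<phi>1(1), of 0] by simp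
    moreover have "g 1 = corner \<phi>3 1" using 3[of 1] g'(1) corner_Suc[OF t \<phi>3(1), of 0] by simp
    ultimately show ?thesis using \<phi>3(1) by blast
  qed
  then obtain \<phi>' where \<phi>': "simple_pentagon X V E t \<phi>'" "side \<phi>' 0 = e" "g 0 = corner \<phi>' 0" "g 1 = corner \<phi>' 1"
    by blast
  define p where "p k = (if k = 0 then g else \<phi>' \<circ> polygon_side 5 k)" for k
  have g2: "inj_on g {0..1}" using edge_path_inj(1)[OF t \<phi>'(1), of 0 g] g \<phi>'(2) by simp
  have "\<exists>\<psi>. simple_pentagon X V E t \<psi> \<and> (\<forall>k s. k < 5 \<longrightarrow> s \<in> {0..1} \<longrightarrow> \<psi> (polygon_side 5 k s) = p k s)"
  proof (rule simple_pentagon_reparam[OF t \<phi>'(1), of p])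
    fix k :: nat assume k: "k < 5"
    show "pathin X (p k)" using g(1) pentagon_side(1)[OF t \<phi>'(1) k] by (simp add: p_def edge_path_def)
    show "inj_on (p k) {0..1}" using g2 side_inj[OF t \<phi>'(1) k] by (simp add: p_def)
    show "p k ` {0..1} = side \<phi>' k" using g(2) \<phi>'(2) by (simp add: p_def)
    show "p k 0 = corner \<phi>' k" using \<phi>'(3) by (simp add: p_def)
    show "p k 1 = corner \<phi>' (Suc k mod 5)" using \<phi>'(4) corner_Suc[OF t \<phi>'(1) k] by (simp add: p_def)
  qed
  then obtain \<psi> where \<psi>: "simple_pentagon X V E t \<psi>"
    "\<And>k s. k < 5 \<Longrightarrow> s \<in> {0..1} \<Longrightarrow> \<psi> (polygon_side 5 k s) = p k s" by blast
  show thesis by (rule that[OF \<psi>(1)]) (use \<psi>(2)[of 0] in \<open>simp add: p_def\<close>)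
qed


text \<open>Inside the unit circle the first pentagon is used, and outside it the second one,
  carried there by the inversion that matches side \<open>k\<close> with side \<open>l\<close>
  reversed. Only the directions of the open side \<open>k\<close> are kept, so the two descriptions
  agree wherever they meet.\<close>

lemma pentagon_glue:
  assumes t: "t1 \<in> tiles X V E" "t2 \<in> tiles X V E" "t1 \<noteq> t2"
    and \<phi>: "simple_pentagon X V E t1 \<phi>1" "simple_pentagon X V E t2 \<phi>2"
    and k: "k < 5" "l < 5"
    and e: "\<And>s. s \<in> {0..1} \<Longrightarrow> \<phi>1 (polygon_side 5 k s) = \<phi>2 (polygon_side 5 l (1 - s))"
  shows "\<exists>N G. open N \<and> continuous_map (top_of_set N) X G \<and> inj_on G N \<and>
    (\<forall>s\<in>{0<..<1}. polygon_side 5 k s \<in> N) \<and>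
    (\<forall>z\<in>N. z \<noteq> 0 \<and> (cmod z \<le> 1 \<longrightarrow> G z = \<phi>1 z) \<and>
       (1 < cmod z \<longrightarrow> G z = \<phi>2 (cis (2 * pi * real (k + l + 1) / 5) / z))) \<and>
    G ` N \<subseteq> t1 \<union> t2 \<union> side \<phi>1 k"
proof -
  define c where "c = cis (2 * pi * real (k + l + 1) / 5)"
  have c: "cmod c = 1" "c \<noteq> 0" by (auto simp: c_def)
  \<comment> \<open>\<open>C\<close> is the circle without the open side \<open>k\<close>, both ends
    included. It is closed, which makes the cone \<open>N\<close> over the open side open.\<close>
  define C where "C = (\<Union>j\<in>{..<5} - {k}. polygon_side 5 j ` {0..1}) \<union> {polygon_side 5 k 0, polygon_side 5 k 1}"
  have "closed (polygon_side 5 j ` {0..1})" for j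
    by (intro compact_imp_closed compact_continuous_image continuous_on_polygon_side compact_Icc)
  then have "closed C" unfolding C_def by (intro closed_Un closed_UN) auto
  have CI: "u \<notin> C \<longleftrightarrow> u \<in> polygon_side 5 k ` {0<..<1}" if u: "cmod u = 1" for u
  proof
    assume nC: "u \<notin> C"
    obtain j s where j: "j < 5" "0 \<le> s" "s < 1" "u = polygon_side 5 j s" using polygon_side_surj[OF u, of 5] by auto
    then have "j = k" using nC unfolding C_def by force
    moreover have "s \<noteq> 0" using nC j \<open>j = k\<close> unfolding C_def by auto
    ultimately show "u \<in> polygon_side 5 k ` {0<..<1}" using j by auto
  next
    assume "u \<in> polygon_side 5 k ` {0<..<1}"
    then obtain s where s: "0 < s" "s < 1" "u = polygon_side 5 k s" by auto
    have *: False if "polygon_side 5 k s = polygon_side 5 j r" "j < 5" "0 \<le> r" "r \<le> 1" "j \<noteq> k \<or> r = 0 \<or> r = 1" for j r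
    proof (cases "r = 1")
      case True
      then have "polygon_side 5 k s = polygon_side 5 (Suc j mod 5) 0" using that polygon_side_1[of 5 j] by simp
      from polygon_side_inj[OF this] k s show False by simp
    next
      case False
      then show False using polygon_side_inj[OF that(1) k(1) that(2)] s that by auto
    qed
    show "u \<notin> C"
    proof
      assume "u \<in> C"
      then have "u \<in> (\<Union>j\<in>{..<5} - {k}. polygon_side 5 j ` {0..1}) \<or> u = polygon_side 5 k 0 \<or> u = polygon_side 5 k 1"
        unfolding C_def by blast
      moreover have "u \<noteq> polygon_side 5 k 0" "u \<noteq> polygon_side 5 k 1"
        using *[of k 0] *[of k 1] s(3) k(1) by auto
      ultimately obtain j where j: "j < 5" "j \<noteq> k" "u \<in> polygon_side 5 j ` {0..1}" by blast
      then obtain r where "r \<in> {0..1}" "u = polygon_side 5 j r" by blast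
      then show False using *[of j r] s(3) j by simp
    qed
  qed
  define N where "N = (-{0}) \<inter> sgn -` (- C)"
  have N: "z \<in> N \<longleftrightarrow> z \<noteq> 0 \<and> sgn z \<in> polygon_side 5 k ` {0<..<1}" for z
    using CI[of "sgn z"] by (auto simp: N_def norm_sgn)
  have "open N" unfolding N_def
    by (rule continuous_open_preimage) (use \<open>closed C\<close> in \<open>auto intro!: continuous_intros\<close>)
  define G where "G z = (if cmod z \<le> 1 then \<phi>1 z else \<phi>2 (c / z))" for z
  have cz: "c / polygon_side 5 k s = polygon_side 5 l (1 - s)" for s
  proof -
    have "polygon_side 5 k s \<noteq> 0" using norm_polygon_side[of 5 k s] by (metis norm_zero zero_neq_one)
    then show ?thesis using polygon_side_mult_opposite[of 5 k s l] by (simp add: c_def field_simps)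
  qed
  have agree: "\<phi>1 z = \<phi>2 (c / z)" "\<phi>1 z \<in> side \<phi>1 k" if z: "z \<in> N" "cmod z = 1" for z
  proof -
    have "sgn z = z" using z(2) by (simp add: sgn_div_norm)
    then obtain s where s: "s \<in> {0<..<1}" "z = polygon_side 5 k s" using z N by auto
    then show "\<phi>1 z = \<phi>2 (c / z)" using e[of s] cz[of s] by simp
    show "\<phi>1 z \<in> side \<phi>1 k" using s by auto
  qed
  have "continuous_map (top_of_set N) X G"
    unfolding G_def
  proof (rule continuous_map_cases_le)
    show "continuous_map (top_of_set N) euclideanreal cmod" "continuous_map (top_of_set N) euclideanreal (\<lambda>z. 1)"
      by (auto intro!: continuous_intros)
    have "continuous_map (top_of_set {z \<in> N. cmod z \<le> 1}) X \<phi>1"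
      by (rule continuous_map_from_subtopology_mono[OF pentagon_continuous(1)[OF t(1) \<phi>(1)]]) auto
    then show "continuous_map (subtopology (top_of_set N) {x \<in> topspace (top_of_set N). cmod x \<le> 1}) X \<phi>1"
      by (simp add: subtopology_subtopology Int_def)
    have "continuous_on {z \<in> N. 1 \<le> cmod z} (\<lambda>z. c / z)"
      by (intro continuous_intros) (auto simp: N_def)
    moreover have "(\<lambda>z. c / z) \<in> {z \<in> N. 1 \<le> cmod z} \<rightarrow> cball 0 1"
      using c by (auto simp: norm_divide divide_simps)
    ultimately have "continuous_map (top_of_set {z \<in> N. 1 \<le> cmod z}) (top_of_set (cball 0 1)) (\<lambda>z. c / z)"
      by auto
    then have "continuous_map (top_of_set {z \<in> N. 1 \<le> cmod z}) X (\<phi>2 \<circ> (\<lambda>z. c / z))"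
      by (rule continuous_map_compose[OF _ pentagon_continuous(1)[OF t(2) \<phi>(2)]])
    then show "continuous_map (subtopology (top_of_set N) {x \<in> topspace (top_of_set N). 1 \<le> cmod x}) X (\<lambda>z. \<phi>2 (c / z))"
      by (simp add: subtopology_subtopology Int_def o_def)
    show "\<phi>1 x = \<phi>2 (c / x)" if "x \<in> topspace (top_of_set N)" "cmod x = 1" for x
      using agree(1) that by simp
  qed
  have b2: "c / z \<in> ball 0 1" if "1 < cmod z" for z using c that by (simp add: norm_divide divide_simps)
  have G2: "G z \<in> t2" if "1 < cmod z" for z
    using pentagon_ball[OF t(2) \<phi>(2)] b2[OF that] that by (auto simp: G_def)
  have G1: "G z \<in> t1 \<union> side \<phi>1 k" if "z \<in> N" "cmod z \<le> 1" for z
  proof (cases "cmod z = 1")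
    case False
    then have "z \<in> ball 0 1" using that by simp
    then show ?thesis using pentagon_ball[OF t(1) \<phi>(1)] that by (auto simp: G_def)
  qed (use agree(2) that in \<open>simp add: G_def\<close>)
  have disj: "t2 \<inter> (t1 \<union> side \<phi>1 k) = {}"
    using tiles_disjoint[OF t(1,2,3)] tile_subset(3)[OF t(2) pentagon_side(2)[OF t(1) \<phi>(1) k(1)]] by blast
  have "inj_on G N"
  proof (rule inj_onI)
    fix z w assume z: "z \<in> N" "w \<in> N" "G z = G w"
    consider "cmod z \<le> 1" "cmod w \<le> 1" | "1 < cmod z" "1 < cmod w" | "cmod z \<le> 1" "1 < cmod w" | "1 < cmod z" "cmod w \<le> 1"
      by linarith
    then show "z = w"
    proof cases
      case 1
      then show ?thesis using z(3) inj_onD[OF pentagon_inj[OF t(1) \<phi>(1)]] by (simp add: G_def)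
    next
      case 2
      then have "\<phi>2 (c / z) = \<phi>2 (c / w)" using z(3) by (simp add: G_def)
      then have "c / z = c / w"
        using inj_onD[OF pentagon_inj[OF t(2) \<phi>(2)]] b2[OF 2(1)] b2[OF 2(2)] ball_subset_cball by (metis subsetD)
      then show ?thesis using c(2) z N by (simp add: field_simps)
    next
      case 3
      then show ?thesis using G1[OF z(1)] G2[of w] z(3) disj by auto
    next
      case 4
      then show ?thesis using G1[OF z(2)] G2[of z] z(3) disj by auto
    qed
  qed
  moreover have "polygon_side 5 k s \<in> N" if "s \<in> {0<..<1}" for s
  proof -
    have "sgn (polygon_side 5 k s) = polygon_side 5 k s" by (simp add: sgn_div_norm)
    moreover have "polygon_side 5 k s \<noteq> 0" using norm_polygon_side[of 5 k s] by (metis norm_zero zero_neq_one)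
    ultimately show ?thesis using that N by auto
  qed
  moreover have "G z = \<phi>1 z" if "cmod z \<le> 1" for z using that by (simp add: G_def)
  moreover have "G z = \<phi>2 (cis (2 * pi * real (k + l + 1) / 5) / z)" if "1 < cmod z" for z
    using that by (simp add: G_def c_def)
  moreover have "G ` N \<subseteq> t1 \<union> t2 \<union> side \<phi>1 k"
  proof
    fix y assume "y \<in> G ` N"
    then obtain z where "z \<in> N" "y = G z" by blast
    then show "y \<in> t1 \<union> t2 \<union> side \<phi>1 k" using G1[of z] G2[of z] by (cases "cmod z \<le> 1") auto
  qed
  moreover have "\<forall>z\<in>N. z \<noteq> 0" using N by blast
  ultimately show ?thesis
    using \<open>open N\<close> \<open>continuous_map (top_of_set N) X G\<close> by (intro exI[of _ N] exI[of _ G]) simp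
qed

text \<open>The glued disk is a neighbourhood of the interior of the edge, so no third tile comes close.\<close>

lemma edge_tiles_le_2:
  assumes e: "e \<in> E" and t: "t1 \<in> tiles X V E" "t2 \<in> tiles X V E" "t3 \<in> tiles X V E" "t1 \<noteq> t2"
    and s: "e \<subseteq> X closure_of t1" "e \<subseteq> X closure_of t2" "e \<subseteq> X closure_of t3"
  shows "t3 = t1 \<or> t3 = t2"
proof -
  obtain g where g: "edge_path X V g" "g ` {0..1} = e" using edge_pathE[OF e] by blast
  obtain \<phi>1 where \<phi>1: "simple_pentagon X V E t1 \<phi>1" "\<And>s. s \<in> {0..1} \<Longrightarrow> \<phi>1 (polygon_side 5 0 s) = g s"
    by (rule simple_pentagon_adapted[OF t(1) e s(1) g]) blast
  have g': "edge_path X V (\<lambda>s. g (1 - s))" "(\<lambda>s. g (1 - s)) ` {0..1} = e"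
    using edge_path_reverse[OF g(1)] g(2) by simp_all
  obtain \<phi>2 where \<phi>2: "simple_pentagon X V E t2 \<phi>2" "\<And>s. s \<in> {0..1} \<Longrightarrow> \<phi>2 (polygon_side 5 0 s) = g (1 - s)"
    by (rule simple_pentagon_adapted[OF t(2) e s(2) g']) blast
  have "\<phi>1 (polygon_side 5 0 s) = \<phi>2 (polygon_side 5 0 (1 - s))" if "s \<in> {0..1}" for s
    using \<phi>1(2)[OF that] \<phi>2(2)[of "1 - s"] that by simp
  from pentagon_glue[OF t(1,2,4) \<phi>1(1) \<phi>2(1) _ _ this]
  obtain N G where N: "open N" "continuous_map (top_of_set N) X G" "inj_on G N"
    "\<And>s. s \<in> {0<..<1} \<Longrightarrow> polygon_side 5 0 s \<in> N" "\<And>z. z \<in> N \<Longrightarrow> cmod z \<le> 1 \<Longrightarrow> G z = \<phi>1 z"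
    "G ` N \<subseteq> t1 \<union> t2 \<union> side \<phi>1 0" by auto
  have op: "openin X (G ` N)" by (rule surface_invariance_of_domain[OF surface N(1-3)])
  let ?x = "g (1/2)"
  have "?x = G (polygon_side 5 0 (1/2))" using N(5)[OF N(4)[of "1/2"]] \<phi>1(2)[of "1/2"] by simp
  then have "?x \<in> G ` N" using N(4)[of "1/2"] by simp
  moreover have "?x \<in> e" using g(2) by force
  then have "?x \<in> X closure_of t3" using s(3) by blast
  ultimately obtain y where y: "y \<in> t3" "y \<in> G ` N" using op unfolding in_closure_of by blast
  moreover have "side \<phi>1 0 \<in> E" using pentagon_side(2)[OF t(1) \<phi>1(1)] by simp
  then have "y \<notin> side \<phi>1 0" using tile_subset(3)[OF t(3)] y(1) by blast
  ultimately have "y \<in> t1 \<or> y \<in> t2" using N(6) by blast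
  then show ?thesis using tiles_disjoint t y(1) by blast
qed

lemma finite_edge_tiles:
  assumes "e \<in> E"
  shows "finite {t \<in> tiles X V E. e \<subseteq> X closure_of t}"
proof (cases "\<exists>t1 t2. t1 \<in> tiles X V E \<and> t2 \<in> tiles X V E \<and> t1 \<noteq> t2 \<and> e \<subseteq> X closure_of t1 \<and> e \<subseteq> X closure_of t2")
  case True
  then obtain t1 t2 where "t1 \<in> tiles X V E" "t2 \<in> tiles X V E" "t1 \<noteq> t2" "e \<subseteq> X closure_of t1" "e \<subseteq> X closure_of t2"
    by blast
  then have "{t \<in> tiles X V E. e \<subseteq> X closure_of t} \<subseteq> {t1, t2}" using edge_tiles_le_2[OF assms] by blast
  then show ?thesis by (rule finite_subset) simp
next
  case False
  show ?thesis
  proof (cases "{t \<in> tiles X V E. e \<subseteq> X closure_of t} = {}")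
    case True
    show ?thesis unfolding True by simp
  next
    case ne: False
    then obtain t where "t \<in> tiles X V E" "e \<subseteq> X closure_of t" by blast
    then have "{t \<in> tiles X V E. e \<subseteq> X closure_of t} \<subseteq> {t}" using False by blast
    then show ?thesis by (rule finite_subset) simp
  qed
qed

text \<open>Each tile has a side, there are finitely many edges, and an edge borders at most two
  tiles.\<close>

lemma finite_tiles: "finite (tiles X V E)"
proof (rule finite_subset)
  show "tiles X V E \<subseteq> (\<Union>e\<in>E. {t \<in> tiles X V E. e \<subseteq> X closure_of t})"
  proof
    fix t assume t: "t \<in> tiles X V E"
    obtain \<phi> where \<phi>: "simple_pentagon X V E t \<phi>" using simple_pentagon_exists[OF t] by blast
    have "side \<phi> 0 \<in> E" using pentagon_side(2)[OF t \<phi>] by simp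
    moreover have "side \<phi> 0 \<subseteq> X closure_of t" using edge_subset_closure_iff[OF t \<phi> calculation] by force
    ultimately show "t \<in> (\<Union>e\<in>E. {t \<in> tiles X V E. e \<subseteq> X closure_of t})" using t by blast
  qed
  show "finite (\<Union>e\<in>E. {t \<in> tiles X V E. e \<subseteq> X closure_of t})" using graph(2) finite_edge_tiles by blast
qed

text \<open>Placed on the real axis, the interval is a compact planar set without interior, whereas
  the preimage of \<open>S\<close> would be open in the plane.\<close>

lemma no_open_in_arc:
  fixes a b :: real
  assumes g: "continuous_map (top_of_set {a..b}) X g" "inj_on g {a..b}" and S: "openin X S" "S \<subseteq> g ` {a..b}"
  shows "S = {}"
proof (rule ccontr)
  assume ne: "S \<noteq> {}"
  let ?K = "of_real ` {a..b} :: complex set"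
  have "open {z \<in> ?K. (g \<circ> Re) z \<in> S}"
  proof (rule open_preimage_of_compact_embedding[OF surface _ _ _ S(1)])
    show "compact ?K" by (intro compact_continuous_image continuous_intros compact_Icc)
    have "continuous_map (top_of_set ?K) (top_of_set {a..b}) Re" by (auto intro!: continuous_intros)
    then show "continuous_map (top_of_set ?K) X (g \<circ> Re)" using g(1) by (rule continuous_map_compose)
    show "inj_on (g \<circ> Re) ?K" using g(2) by (auto simp: inj_on_def)
    show "S \<subseteq> (g \<circ> Re) ` ?K" using S(2) by (simp add: image_image)
  qed
  moreover obtain s where s: "s \<in> {a..b}" "g s \<in> S" using ne S(2) by blast
  then have "of_real s \<in> {z \<in> ?K. (g \<circ> Re) z \<in> S}" by simp
  ultimately obtain r where r: "0 < r" "ball (of_real s) r \<subseteq> {z \<in> ?K. (g \<circ> Re) z \<in> S}"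
    using open_contains_ball by blast
  have "of_real s + of_real (r / 2) * \<i> \<in> ball (of_real s) r" using r(1) by (simp add: dist_norm norm_mult)
  then have "of_real s + of_real (r / 2) * \<i> \<in> ?K" using r(2) by blast
  then show False using r(1) by (auto simp: complex_eq_iff)
qed

text \<open>A neighbourhood of the midpoint of \<open>e\<close> is covered by \<open>e\<close> and
  the tiles that border \<open>e\<close>. With no such tile, an open set would lie in an arc; with
  only one, a boundary point of the pentagon would be interior to its disk; three are excluded by
  gluing.\<close>

lemma edge_tiles_card:
  assumes e: "e \<in> E"
  shows "card {t \<in> tiles X V E. e \<subseteq> X closure_of t} = 2"
proof -
  let ?T = "{t \<in> tiles X V E. e \<subseteq> X closure_of t}"
  obtain g where g: "edge_path X V g" "g ` {0..1} = e" using edge_pathE[OF e] by blast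
  let ?x = "g (1/2)"
  define S where "S = topspace X - (V \<union> \<Union>(E - {e}) \<union> \<Union>((closure_of) X ` {t \<in> tiles X V E. \<not> e \<subseteq> X closure_of t}))"
  have "closedin X (\<Union>(E - {e}))" using graph(2) edge_closed(1) by (intro closedin_Union) auto
  moreover have "closedin X (\<Union>((closure_of) X ` {t \<in> tiles X V E. \<not> e \<subseteq> X closure_of t}))"
    using finite_tiles by (intro closedin_Union) auto
  ultimately have S: "openin X S" unfolding S_def using vertices_closed by (intro openin_diff closedin_Un) auto
  have half: "?x \<in> g ` {0<..<1}" by (rule imageI) simp
  have x: "?x \<in> e" "?x \<notin> V" using g half unfolding edge_path_def by (force, blast)
  have other: "e' = e" if "e' \<in> E" "?x \<in> e'" for e' using edge_Int[OF e that(1)] x that(2) by blast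
  have xc: "e \<subseteq> X closure_of t" if t: "t \<in> tiles X V E" and xt: "?x \<in> X closure_of t" for t
  proof -
    obtain \<phi> where \<phi>: "simple_pentagon X V E t \<phi>" using simple_pentagon_exists[OF t] by blast
    have "?x \<notin> t" using tile_subset(3)[OF t e] x(1) by blast
    moreover have "?x \<in> t \<union> (\<Union>k<5. side \<phi> k)"
      using xt unfolding pentagon_closure[OF t \<phi>] pentagon_cball[OF t \<phi>] .
    ultimately obtain k where "k \<in> {..<5}" "?x \<in> side \<phi> k" by blast
    then have k: "k < 5" "side \<phi> k = e" using other[OF pentagon_side(2)[OF t \<phi>]] by simp_all
    then show ?thesis using edge_subset_closure_iff[OF t \<phi> e] by metis
  qed
  have xS: "?x \<in> S" using x other xc edge_closed(2)[OF e] unfolding S_def by blast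
  have Ssub: "S \<subseteq> e \<union> \<Union>?T"
  proof
    fix y assume y: "y \<in> S"
    show "y \<in> e \<union> \<Union>?T"
    proof (cases "y \<in> e")
      case False
      then have "y \<in> topspace X - (V \<union> \<Union>E)" using y unfolding S_def by blast
      then obtain t where t: "t \<in> tiles X V E" "y \<in> t" using tiles_Union by blast
      moreover have "y \<in> X closure_of t" using closure_of_subset[OF tile_subset(1)[OF t(1)]] t(2) by blast
      ultimately have "e \<subseteq> X closure_of t" using y unfolding S_def by blast
      then show ?thesis using t by blast
    qed simp
  qed
  have fin: "finite ?T" by (rule finite_edge_tiles[OF e])
  have le: "card ?T \<le> 2"
  proof (rule ccontr)
    assume "\<not> card ?T \<le> 2"
    then have "3 \<le> card ?T" by linarith
    then obtain T where T: "T \<subseteq> ?T" "card T = 3" by (rule obtain_subset_with_card_n)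
    from T(2) obtain t1 t2 t3 where "T = {t1, t2, t3}" "t1 \<noteq> t2" "t2 \<noteq> t3" "t1 \<noteq> t3"
      unfolding card_3_iff by blast
    then show False using edge_tiles_le_2[OF e, of t1 t2 t3] T(1) by blast
  qed
  have "card ?T \<noteq> 0"
  proof
    assume "card ?T = 0"
    then have "?T = {}" using fin by simp
    then have Se: "S \<subseteq> e" using Ssub by (metis Union_empty sup_bot_right)
    have c: "continuous_map (top_of_set {0..1}) X g" using g(1) by (simp add: edge_path_def pathin_def)
    \<comment> \<open>At this stage \<open>g\<close> is known to be injective on the open interval
      only, so the outer quarters are removed and a compact arc is left.\<close>
    let ?Z = "g ` ({0..1/4} \<union> {3/4..1})"
    have "compactin (top_of_set {0..1}) ({0..1/4} \<union> {3/4..1::real})"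
      by (simp add: compactin_subtopology compact_Un)
    then have Z: "closedin X ?Z" using image_compactin[OF _ c] compactin_imp_closedin[OF Hausdorff] by blast
    have "?x \<notin> ?Z"
    proof
      assume "?x \<in> ?Z"
      then obtain s where "s \<in> {0..1/4} \<union> {3/4..1}" "g s = ?x" by (metis imageE)
      then have s: "s \<in> {0..1}" "s \<noteq> 1/2" "g s = ?x" by auto
      then show False
        using g(1) x(2) inj_onD[of g "{0<..<1}" s "1/2"] by (cases "s = 0 \<or> s = 1") (auto simp: edge_path_def)
    qed
    then have ne: "S - ?Z \<noteq> {}" using xS by blast
    have "S - ?Z \<subseteq> g ` {1/4..3/4}"
    proof
      fix y assume y: "y \<in> S - ?Z"
      then obtain s where s: "s \<in> {0..1}" "y = g s" using Se g(2) by blast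
      then have "s \<notin> {0..1/4} \<union> {3/4..1}" using y by blast
      then show "y \<in> g ` {1/4..3/4}" using s by auto
    qed
    moreover have "continuous_map (top_of_set {1/4..3/4}) X g"
      by (rule continuous_map_from_subtopology_mono[OF c]) auto
    moreover have "inj_on g {1/4..3/4}" using g(1) by (auto simp: edge_path_def intro: inj_on_subset)
    ultimately have "S - ?Z = {}" using no_open_in_arc openin_diff[OF S Z] by blast
    then show False using ne by blast
  qed
  moreover have "card ?T \<noteq> 1"
  proof
    assume "card ?T = 1"
    then obtain t where T: "?T = {t}" using card_1_singletonE by blast
    then have t: "t \<in> tiles X V E" "e \<subseteq> X closure_of t" by auto
    obtain \<phi> where \<phi>: "simple_pentagon X V E t \<phi>" using simple_pentagon_exists[OF t(1)] by blast
    have "S \<subseteq> \<phi> ` cball 0 1"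
      using Ssub t T pentagon_closure[OF t(1) \<phi>] closure_of_subset[OF tile_subset(1)[OF t(1)]] by auto
    from open_preimage_of_compact_embedding[OF surface compact_cball pentagon_continuous(1)[OF t(1) \<phi>]
        pentagon_inj[OF t(1) \<phi>] S this]
    have "open {z \<in> cball 0 1. \<phi> z \<in> S}" .
    then have int: "{z \<in> cball 0 1. \<phi> z \<in> S} \<subseteq> interior (cball 0 1)" by (intro interior_maximal) auto
    have "?x \<notin> t" using tile_subset(3)[OF t(1) e] x(1) by blast
    moreover have "?x \<in> t \<union> (\<Union>k<5. side \<phi> k)"
      using subsetD[OF t(2) x(1)] unfolding pentagon_closure[OF t(1) \<phi>] pentagon_cball[OF t(1) \<phi>] .
    ultimately obtain k where k: "k \<in> {..<5}" "?x \<in> side \<phi> k" by blast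
    then obtain s where "?x = \<phi> (polygon_side 5 k s)" by auto
    then have "polygon_side 5 k s \<in> {z \<in> cball 0 1. \<phi> z \<in> S}" using xS by simp
    with int have "polygon_side 5 k s \<in> interior (cball 0 1)" by (rule subsetD)
    then show False by (simp add: interior_cball)
  qed
  ultimately show ?thesis using le by linarith
qed

end

subsection \<open>Combinatorics of the degree 3 vertices\<close>

lemma less_5_cases: "(k::nat) < 5 \<longleftrightarrow> k = 0 \<or> k = 1 \<or> k = 2 \<or> k = 3 \<or> k = 4"
  by linarith

text \<open>Here \<open>c t k\<close> and \<open>s t k\<close> are corner \<open>k\<close> and side \<open>k\<close> of \<open>t\<close>, and side \<open>k\<close> joins corner \<open>k\<close> to the next one.
  The corners 0 are the \<open>\<circ>\<close>-vertices.\<close>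

locale pentagon_scheme =
  fixes F :: "'t set" and E :: "'e set" and ends :: "'e \<Rightarrow> 'v set" and L :: "'v set"
    and c :: "'t \<Rightarrow> nat \<Rightarrow> 'v" and s :: "'t \<Rightarrow> nat \<Rightarrow> 'e"
  assumes finite_F: "finite F"
    and s_in: "t \<in> F \<Longrightarrow> k < 5 \<Longrightarrow> s t k \<in> E"
    and ends_s: "t \<in> F \<Longrightarrow> k < 5 \<Longrightarrow> ends (s t k) = {c t k, c t (Suc k mod 5)}"
    and c_eq: "t \<in> F \<Longrightarrow> k < 5 \<Longrightarrow> l < 5 \<Longrightarrow> c t k = c t l \<longleftrightarrow> k = l"
    and s_eq: "t \<in> F \<Longrightarrow> k < 5 \<Longrightarrow> l < 5 \<Longrightarrow> s t k = s t l \<longleftrightarrow> k = l"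
    and two_tiles: "e \<in> E \<Longrightarrow> card {t \<in> F. e \<in> s t ` {..<5}} = 2"
    and c_in_L: "t \<in> F \<Longrightarrow> k < 5 \<Longrightarrow> c t k \<in> L \<longleftrightarrow> k = 0"
    and degree_3: "t \<in> F \<Longrightarrow> k < 5 \<Longrightarrow> k \<noteq> 0 \<Longrightarrow> card {e \<in> E. c t k \<in> ends e} = 3"
begin

definition star :: "'v \<Rightarrow> 'e set" where "star v = {e \<in> E. v \<in> ends e}"

text \<open>The notion refers to the edge and the labels only, so it is the same from both tiles
  that contain the edge.\<close>

definition spoke :: "'e \<Rightarrow> bool" where "spoke e \<longleftrightarrow> ends e \<inter> L \<noteq> {}"

definition A :: "'v set" where "A = {v. v \<notin> L \<and> (\<exists>e\<in>E. v \<in> ends e \<and> spoke e)}"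

lemma ends_simps:
  assumes "t \<in> F"
  shows "ends (s t 0) = {c t 0, c t 1}" "ends (s t 1) = {c t 1, c t 2}" "ends (s t 2) = {c t 2, c t 3}"
    "ends (s t 3) = {c t 3, c t 4}" "ends (s t 4) = {c t 4, c t 0}"
  using ends_s[OF assms, of 0] ends_s[OF assms, of 1] ends_s[OF assms, of 2] ends_s[OF assms, of 3]
    ends_s[OF assms, of 4] by (simp_all add: numeral_2_eq_2[symmetric])

lemma side_in [simp]: "k < 5 \<Longrightarrow> s t k \<in> s t ` {..<5}"
  by simp

lemma spoke_s:
  assumes t: "t \<in> F" and k: "k < 5"
  shows "spoke (s t k) \<longleftrightarrow> k = 0 \<or> k = 4"
proof -
  have "Suc k mod 5 < 5" by simp
  then have "spoke (s t k) \<longleftrightarrow> k = 0 \<or> Suc k mod 5 = 0"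
    using c_in_L[OF t k] c_in_L[OF t, of "Suc k mod 5"] ends_s[OF t k] unfolding spoke_def by auto
  moreover have "Suc k mod 5 = 0 \<longleftrightarrow> k = 4" using k unfolding less_5_cases by (elim disjE) simp_all
  ultimately show ?thesis by simp
qed

lemma edge_tiles:
  assumes "e \<in> E"
  obtains t t' k k' where "t \<in> F" "t' \<in> F" "t \<noteq> t'" "k < 5" "k' < 5" "e = s t k" "e = s t' k'"
    "\<forall>t''\<in>F. e \<in> s t'' ` {..<5} \<longrightarrow> t'' = t \<or> t'' = t'"
proof -
  obtain t t' where T: "{t \<in> F. e \<in> s t ` {..<5}} = {t, t'}" "t \<noteq> t'"
    using two_tiles[OF assms] unfolding card_2_iff by blast
  then have t: "t \<in> F" "e \<in> s t ` {..<5}" "t' \<in> F" "e \<in> s t' ` {..<5}" by blast+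
  have u: "\<forall>t''\<in>F. e \<in> s t'' ` {..<5} \<longrightarrow> t'' = t \<or> t'' = t'" using T by blast
  obtain k where k: "k < 5" "e = s t k" using t(2) by blast
  obtain k' where k': "k' < 5" "e = s t' k'" using t(4) by blast
  show thesis by (rule that[OF t(1,3) T(2) k(1) k'(1) k(2) k'(2) u])
qed

lemma edge_tiles_unique:
  assumes "e \<in> E" "t1 \<in> F" "t2 \<in> F" "t3 \<in> F" "e \<in> s t1 ` {..<5}" "e \<in> s t2 ` {..<5}" "e \<in> s t3 ` {..<5}" "t1 \<noteq> t2"
  shows "t3 = t1 \<or> t3 = t2"
proof -
  obtain t t' where "\<forall>t''\<in>F. e \<in> s t'' ` {..<5} \<longrightarrow> t'' = t \<or> t'' = t'"
    by (rule edge_tiles[OF assms(1)]) blast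
  then have "t1 = t \<or> t1 = t'" "t2 = t \<or> t2 = t'" "t3 = t \<or> t3 = t'" using assms by blast+
  then show ?thesis using assms(8) by blast
qed

text \<open>\<open>(k + 4) mod 5\<close> is the index that precedes \<open>k\<close>
  cyclically.\<close>

lemma star_tile:
  assumes "t \<in> F" "k < 5"
  shows "star (c t k) \<inter> s t ` {..<5} = {s t k, s t ((k + 4) mod 5)}"
proof -
  have "c t k \<in> ends (s t j) \<longleftrightarrow> k = j \<or> k = Suc j mod 5" if "j < 5" for j
    using ends_s[OF assms(1) that] c_eq[OF assms, of j] c_eq[OF assms, of "Suc j mod 5"] that by auto
  moreover have "k = Suc j mod 5 \<longleftrightarrow> j = (k + 4) mod 5" if "j < 5" for j
    using assms(2) that unfolding less_5_cases by (elim disjE) simp_all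
  ultimately have "s t j \<in> star (c t k) \<longleftrightarrow> j = k \<or> j = (k + 4) mod 5" if "j < 5" for j
    using that s_in[OF assms(1) that] unfolding star_def by auto
  moreover have "k < 5" "(k + 4) mod 5 < 5" using assms(2) by simp_all
  ultimately show ?thesis by blast
qed

lemma star_card_3: "t \<in> F \<Longrightarrow> k < 5 \<Longrightarrow> k \<noteq> 0 \<Longrightarrow> card (star (c t k)) = 3"
  using degree_3 by (simp add: star_def)

lemma in_star_tile:
  assumes "t \<in> F" "e \<in> s t ` {..<5}" "e \<in> star v"
  obtains k where "k < 5" "v = c t k"
proof -
  obtain j where j: "j < 5" "e = s t j" using assms(2) by blast
  have "v \<in> {c t j, c t (Suc j mod 5)}" using assms(3) ends_s[OF assms(1) j(1)] j(2) by (auto simp: star_def)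
  then show thesis using that[of j] that[of "Suc j mod 5"] j(1) by auto
qed

lemma pair_at:
  assumes "t \<in> F" "a \<in> s t ` {..<5}" "b \<in> s t ` {..<5}" "a \<in> star v" "b \<in> star v" "a \<noteq> b"
  obtains k where "k < 5" "v = c t k" "{a, b} = {s t k, s t ((k + 4) mod 5)}" "star v \<inter> s t ` {..<5} = {a, b}"
proof -
  obtain k where k: "k < 5" "v = c t k" using in_star_tile[OF assms(1,2,4)] .
  have "a \<in> star v \<inter> s t ` {..<5}" "b \<in> star v \<inter> s t ` {..<5}" using assms by blast+
  then have "a = s t k \<or> a = s t ((k + 4) mod 5)" "b = s t k \<or> b = s t ((k + 4) mod 5)"
    using star_tile[OF assms(1) k(1)] k(2) by simp_all
  then have "{a, b} = {s t k, s t ((k + 4) mod 5)}" using assms(6) by auto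
  then show thesis using that[OF k] star_tile[OF assms(1) k(1)] k(2) by simp
qed

text \<open>If two tiles contained both \<open>a\<close> and \<open>b\<close>, a tile at the third
  edge \<open>d\<close> would contain \<open>a\<close> or \<open>b\<close> as well and so be one of
  the two. It would then have three sides at \<open>v\<close>.\<close>

lemma pair_unique:
  assumes v: "card (star v) = 3" and a: "a \<in> star v" "b \<in> star v" "a \<noteq> b"
    and t: "t1 \<in> F" "t2 \<in> F" "a \<in> s t1 ` {..<5}" "b \<in> s t1 ` {..<5}" "a \<in> s t2 ` {..<5}" "b \<in> s t2 ` {..<5}"
  shows "t1 = t2"
proof (rule ccontr)
  assume ne: "t1 \<noteq> t2"
  have fin: "finite (star v)" using v card.infinite by fastforce
  have "card (star v - {a, b}) = 1" using v a fin by (simp add: card_Diff_subset)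
  then obtain d where d: "star v - {a, b} = {d}" using card_1_singletonE by blast
  then have dE: "d \<in> E" "d \<in> star v" "d \<noteq> a" "d \<noteq> b" by (auto simp: star_def)
  have aE: "a \<in> E" "b \<in> E" using a by (auto simp: star_def)
  obtain t3 k where t3: "t3 \<in> F" "k < 5" "d = s t3 k" by (rule edge_tiles[OF dE(1)]) blast
  then have d3: "d \<in> s t3 ` {..<5}" by blast
  obtain j where j: "j < 5" "v = c t3 j" by (rule in_star_tile[OF t3(1) d3 dE(2)])
  have st: "star v \<inter> s t3 ` {..<5} = {s t3 j, s t3 ((j + 4) mod 5)}" using star_tile[OF t3(1) j(1)] j(2) by simp
  have "s t3 j \<noteq> s t3 ((j + 4) mod 5)"
  proof -
    have "j \<noteq> (j + 4) mod 5" "(j + 4) mod 5 < 5" using j(1) unfolding less_5_cases by (elim disjE; simp)+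
    then show ?thesis using s_eq[OF t3(1) j(1)] by blast
  qed
  then obtain d' where "d' \<noteq> d" "d' \<in> {s t3 j, s t3 ((j + 4) mod 5)}" by (metis insertI1 insertI2)
  then have d': "d' \<noteq> d" "d' \<in> star v" "d' \<in> s t3 ` {..<5}" unfolding st[symmetric] by auto
  then have "d' = a \<or> d' = b" using d by blast
  then have "t3 = t1 \<or> t3 = t2"
    using edge_tiles_unique[OF aE(1) t(1,2) t3(1) t(3,5) _ ne] edge_tiles_unique[OF aE(2) t(1,2) t3(1) t(4,6) _ ne] d'(3) by blast
  then have "{a, b, d} \<subseteq> {s t3 j, s t3 ((j + 4) mod 5)}" using st t a dE(2) d3 by blast
  then have "card {a, b, d} \<le> card {s t3 j, s t3 ((j + 4) mod 5)}" by (intro card_mono) auto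
  also have "\<dots> \<le> 2" by (simp add: card_insert_if)
  finally show False using a(3) dE by simp
qed

text \<open>Otherwise each of the two tiles at \<open>a\<close> has the third edge as its second
  side at \<open>v\<close>, and these two tiles share a pair of edges, contrary to
  \<open>pair_unique\<close>.\<close>

lemma pair_exists:
  assumes v: "card (star v) = 3" and a: "a \<in> star v" "b \<in> star v" "a \<noteq> b"
  shows "\<exists>t\<in>F. a \<in> s t ` {..<5} \<and> b \<in> s t ` {..<5}"
proof (rule ccontr)
  assume n: "\<not> (\<exists>t\<in>F. a \<in> s t ` {..<5} \<and> b \<in> s t ` {..<5})"
  have fin: "finite (star v)" using v card.infinite by fastforce
  have "card (star v - {a, b}) = 1" using v a fin by (simp add: card_Diff_subset)
  then obtain d where d: "star v - {a, b} = {d}" using card_1_singletonE by blast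
  have aE: "a \<in> E" using a by (auto simp: star_def)
  have *: "d \<in> s t ` {..<5}" if t: "t \<in> F" "a \<in> s t ` {..<5}" for t
  proof -
    obtain j where j: "j < 5" "v = c t j" by (rule in_star_tile[OF t a(1)])
    have st: "star v \<inter> s t ` {..<5} = {s t j, s t ((j + 4) mod 5)}" using star_tile[OF t(1) j(1)] j(2) by simp
    have "j \<noteq> (j + 4) mod 5" "(j + 4) mod 5 < 5" using j(1) unfolding less_5_cases by (elim disjE; simp)+
    then have "s t j \<noteq> s t ((j + 4) mod 5)" using s_eq[OF t(1) j(1)] by blast
    then obtain d' where "d' \<noteq> a" "d' \<in> {s t j, s t ((j + 4) mod 5)}" by (metis insertI1 insertI2)
    then have d': "d' \<noteq> a" "d' \<in> star v" "d' \<in> s t ` {..<5}" unfolding st[symmetric] by auto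
    then have "d' \<noteq> b" using n t by blast
    then have "d' = d" using d d' by blast
    then show ?thesis using d'(3) by simp
  qed
  obtain t1 t2 k k' where t: "t1 \<in> F" "t2 \<in> F" "t1 \<noteq> t2" "k < 5" "k' < 5" "a = s t1 k" "a = s t2 k'"
    by (rule edge_tiles[OF aE]) blast
  then have a12: "a \<in> s t1 ` {..<5}" "a \<in> s t2 ` {..<5}" by blast+
  have "d \<in> star v" "a \<noteq> d" using d by blast+
  then have "t1 = t2" using pair_unique[OF v a(1) _ _ t(1,2) a12(1) *[OF t(1) a12(1)] a12(2) *[OF t(2) a12(2)]] by blast
  then show False using t(3) by blast
qed

text \<open>Two spokes at a degree 3 corner would span a tile as its sides 4 and 0, so the corner
  would be corner 0 of that tile and lie in \<open>L\<close>.\<close>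

lemma spoke_unique:
  assumes t: "t \<in> F" "k < 5" "k \<noteq> 0" and e: "e1 \<in> star (c t k)" "e2 \<in> star (c t k)" "spoke e1" "spoke e2"
  shows "e1 = e2"
proof (rule ccontr)
  assume ne: "e1 \<noteq> e2"
  obtain t' where t': "t' \<in> F" "e1 \<in> s t' ` {..<5}" "e2 \<in> s t' ` {..<5}"
    using pair_exists[OF star_card_3[OF t] e(1,2) ne] by blast
  obtain j where j: "j < 5" "c t k = c t' j" "{e1, e2} = {s t' j, s t' ((j + 4) mod 5)}"
    by (rule pair_at[OF t' e(1,2) ne])
  have "spoke (s t' j)" "spoke (s t' ((j + 4) mod 5))" using j(3) e(3,4) by (auto simp: doubleton_eq_iff)
  then have "j = 0 \<or> j = 4" "(j + 4) mod 5 = 0 \<or> (j + 4) mod 5 = 4" using spoke_s[OF t'(1)] j(1) by auto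
  then have "j = 0" by auto
  then show False using c_in_L[OF t'(1) j(1)] c_in_L[OF t(1,2)] t(3) j(2) by simp
qed

lemma A_corners:
  assumes t: "t \<in> F" shows "c t 1 \<in> A" "c t 4 \<in> A"
proof -
  have "c t 1 \<notin> L" "s t 0 \<in> E" "c t 1 \<in> ends (s t 0)" "spoke (s t 0)"
    using c_in_L[OF t, of 1] s_in[OF t, of 0] ends_simps(1)[OF t] spoke_s[OF t, of 0] by simp_all
  then show "c t 1 \<in> A" unfolding A_def by blast
  have "c t 4 \<notin> L" "s t 4 \<in> E" "c t 4 \<in> ends (s t 4)" "spoke (s t 4)"
    using c_in_L[OF t, of 4] s_in[OF t, of 4] ends_simps(5)[OF t] spoke_s[OF t, of 4] by simp_all
  then show "c t 4 \<in> A" unfolding A_def by blast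
qed

lemma A_eq: "A = (\<Union>t\<in>F. {c t 1, c t 4})"
proof
  show "A \<subseteq> (\<Union>t\<in>F. {c t 1, c t 4})"
  proof
    fix v assume "v \<in> A"
    then obtain e where e: "v \<notin> L" "e \<in> E" "v \<in> ends e" "spoke e" by (auto simp: A_def)
    obtain t k where t: "t \<in> F" "k < 5" "e = s t k" by (rule edge_tiles[OF e(2)]) blast
    then have "k = 0 \<or> k = 4" using spoke_s e(4) by blast
    then have "v = c t 1 \<or> v = c t 4" using e(1,3) t ends_simps[OF t(1)] c_in_L[OF t(1), of 0] by auto
    then show "v \<in> (\<Union>t\<in>F. {c t 1, c t 4})" using t(1) by blast
  qed
qed (use A_corners in auto)

lemma A_star:
  assumes "v \<in> A"
  obtains e a b where "star v = {e, a, b}" "spoke e" "\<not> spoke a" "\<not> spoke b" "a \<noteq> b" "e \<noteq> a" "e \<noteq> b" "card (star v) = 3"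
proof -
  have "\<exists>t\<in>F. v = c t 1 \<or> v = c t 4" using assms unfolding A_eq by blast
  then obtain t and k :: nat where t: "t \<in> F" "k = 1 \<or> k = 4" "v = c t k" by blast
  then have t: "t \<in> F" "k < 5" "k \<noteq> 0" "v = c t k" by auto
  have c3: "card (star v) = 3" using star_card_3[OF t(1-3)] t(4) by simp
  obtain e where e: "e \<in> star v" "spoke e" using assms by (auto simp: A_def star_def)
  have fin: "finite (star v)" using c3 card.infinite by fastforce
  have "card (star v - {e}) = 2" using c3 e fin by simp
  then obtain a b where ab: "star v - {e} = {a, b}" "a \<noteq> b" unfolding card_2_iff by blast
  then have *: "star v = {e, a, b}" "e \<noteq> a" "e \<noteq> b" using e(1) by blast+
  have "\<not> spoke a" "\<not> spoke b" using spoke_unique[OF t(1-3), of e] e * t(4) by auto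
  then show thesis using that[of e a b] * e c3 ab by blast
qed

text \<open>Otherwise spokes leave corners 2 and 3 outside \<open>t\<close>. Both belong to the tile
  across side 2, where this side separates them, but the two spokes of a tile are adjacent.\<close>

lemma not_both_A:
  assumes t: "t \<in> F"
  shows "\<not> (c t 2 \<in> A \<and> c t 3 \<in> A)"
proof
  assume A: "c t 2 \<in> A \<and> c t 3 \<in> A"
  obtain e where e: "e \<in> star (c t 2)" "spoke e" using A by (auto simp: A_def star_def)
  obtain e' where e': "e' \<in> star (c t 3)" "spoke e'" using A by (auto simp: A_def star_def)
  let ?m = "s t 2"
  have m: "?m \<in> E" "\<not> spoke ?m" using s_in[OF t] spoke_s[OF t] by simp_all
  have ms: "?m \<in> star (c t 2)" "?m \<in> star (c t 3)" using m ends_simps[OF t] by (auto simp: star_def)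
  have ne: "e \<noteq> ?m" "e' \<noteq> ?m" using e e' m by auto
  have "star (c t 2) \<inter> s t ` {..<5} = {s t 2, s t 1}" "star (c t 3) \<inter> s t ` {..<5} = {s t 3, s t 2}"
    using star_tile[OF t, of 2] star_tile[OF t, of 3] by simp_all
  moreover have "\<not> spoke (s t 1)" "\<not> spoke (s t 2)" "\<not> spoke (s t 3)" using spoke_s[OF t] by simp_all
  ultimately have nin: "e \<notin> s t ` {..<5}" "e' \<notin> s t ` {..<5}"
    using e e' by (metis IntI insertE singletonD)+
  obtain t1 where t1: "t1 \<in> F" "e \<in> s t1 ` {..<5}" "?m \<in> s t1 ` {..<5}"
    using pair_exists[OF star_card_3[OF t] e(1) ms(1) ne(1)] by auto
  obtain t2 where t2: "t2 \<in> F" "e' \<in> s t2 ` {..<5}" "?m \<in> s t2 ` {..<5}"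
    using pair_exists[OF star_card_3[OF t] e'(1) ms(2) ne(2)] by auto
  have "t1 \<noteq> t" "t2 \<noteq> t" using nin t1 t2 by auto
  then have tt: "t1 = t2" using edge_tiles_unique[OF m(1) t t1(1) t2(1) _ t1(3) t2(3)] by auto
  obtain j where j: "j < 5" "c t 2 = c t1 j" "{e, ?m} = {s t1 j, s t1 ((j + 4) mod 5)}"
    by (rule pair_at[OF t1 e(1) ms(1) ne(1)])
  obtain i where i: "i < 5" "c t 3 = c t1 i" "{e', ?m} = {s t1 i, s t1 ((i + 4) mod 5)}"
    using pair_at[OF t2 e'(1) ms(2) ne(2)] tt by metis
  have ij: "i \<noteq> j" using i(2) j(2) c_eq[OF t, of 2 3] by auto
  obtain m where mm: "m < 5" "?m = s t1 m" using t1(3) by blast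
  \<comment> \<open>The ends of side \<open>m\<close> of \<open>t1\<close> are corner
    \<open>m\<close> and the next one, so the distinct corners \<open>i\<close> and \<open>j\<close>
    are these two in some order.\<close>
  have "m = j \<or> m = (j + 4) mod 5" "m = i \<or> m = (i + 4) mod 5"
    using j(3) i(3) mm s_eq[OF t1(1) mm(1)] j(1) i(1) by (auto simp: doubleton_eq_iff)
  moreover have "(i + 4) mod 5 \<noteq> (j + 4) mod 5"
    using ij i(1) j(1) unfolding less_5_cases by (elim disjE) simp_all
  ultimately consider "m = j" "m = (i + 4) mod 5" | "m = i" "m = (j + 4) mod 5" using ij by metis
  then show False
  proof cases
    case 1
    then have "e = s t1 ((j + 4) mod 5)" "e' = s t1 i"
      using j(3) i(3) mm ne by (auto simp: doubleton_eq_iff)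
    then have "i = 0 \<or> i = 4" "(j + 4) mod 5 = 0 \<or> (j + 4) mod 5 = 4"
      using spoke_s[OF t1(1)] e(2) e'(2) i(1) by auto
    moreover have "j = (i + 4) mod 5" using 1 by simp
    ultimately show False by (elim disjE) simp_all
  next
    case 2
    then have "e' = s t1 ((i + 4) mod 5)" "e = s t1 j"
      using j(3) i(3) mm ne by (auto simp: doubleton_eq_iff)
    then have "j = 0 \<or> j = 4" "(i + 4) mod 5 = 0 \<or> (i + 4) mod 5 = 4"
      using spoke_s[OF t1(1)] e(2) e'(2) j(1) by auto
    moreover have "i = (j + 4) mod 5" using 2 by simp
    ultimately show False by (elim disjE) simp_all
  qed
qed

text \<open>Each vertex in \<open>A\<close> lies on three tiles. It is corner 1 or 4 of the two that contain its spoke and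
  corner 2 or 3 of the third, so the number of tiles equals that of the corners 2 and 3 in \<open>A\<close>.\<close>

lemma exactly_one_A:
  assumes t0: "t0 \<in> F"
  shows "c t0 2 \<in> A \<longleftrightarrow> c t0 3 \<notin> A"
proof -
  define P where "P = F \<times> {1, 4::nat}"
  define Q where "Q = {p \<in> F \<times> {2, 3::nat}. c (fst p) (snd p) \<in> A}"
  have finP: "finite P" and finQ: "finite Q" using finite_F by (auto simp: P_def Q_def)
  let ?c = "\<lambda>p. c (fst p) (snd p)"
  have cP: "?c ` P = A" unfolding A_eq P_def by force
  have fibP: "card {p \<in> P. ?c p = v} = 2" if v: "v \<in> A" for v
  proof -
    obtain e a b where st: "star v = {e, a, b}" "spoke e" "\<not> spoke a" "\<not> spoke b" by (rule A_star[OF v])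
    have eE: "e \<in> E" using st by (auto simp: star_def)
    have "fst ` {p \<in> P. ?c p = v} = {t \<in> F. e \<in> s t ` {..<5}}"
    proof (intro equalityI subsetI)
      fix t assume "t \<in> fst ` {p \<in> P. ?c p = v}"
      then have "t \<in> F \<and> (\<exists>k. (k = 1 \<or> k = 4) \<and> c t k = v)" by (auto simp: P_def)
      then obtain k where k: "t \<in> F" "k = 1 \<or> k = 4" "c t k = v" by blast
      define j :: nat where "j = (if k = 1 then 0 else 4)"
      have "v \<in> ends (s t j)" "spoke (s t j)" "s t j \<in> E" "j < 5"
        using k ends_simps[OF k(1)] spoke_s[OF k(1)] s_in[OF k(1)] by (auto simp: j_def)
      then have "s t j = e" using st by (auto simp: star_def)
      then show "t \<in> {t \<in> F. e \<in> s t ` {..<5}}" using k(1) \<open>j < 5\<close> by blast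
    next
      fix t assume "t \<in> {t \<in> F. e \<in> s t ` {..<5}}"
      then obtain j where j: "t \<in> F" "j < 5" "e = s t j" by blast
      then have "j = 0 \<or> j = 4" using spoke_s st(2) by blast
      moreover have "v \<in> ends e" "v \<notin> L" using st v by (auto simp: star_def A_def)
      ultimately have "v = c t 1 \<or> v = c t 4" using j ends_simps[OF j(1)] c_in_L[OF j(1), of 0] by auto
      then show "t \<in> fst ` {p \<in> P. ?c p = v}" using j(1) by (force simp: P_def)
    qed
    moreover have "inj_on fst {p \<in> P. ?c p = v}"
    proof (rule inj_onI)
      fix p q assume pq: "p \<in> {p \<in> P. ?c p = v}" "q \<in> {p \<in> P. ?c p = v}" "fst p = fst q"
      then have "fst p \<in> F" "snd p < 5" "snd q < 5" "c (fst p) (snd p) = c (fst p) (snd q)" by (auto simp: P_def)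
      then have "snd p = snd q" using c_eq by blast
      then show "p = q" using pq(3) by (rule prod_eqI[rotated])
    qed
    ultimately show ?thesis using card_image[of fst "{p \<in> P. ?c p = v}"] two_tiles[OF eE] by simp
  qed
  have fibQ: "card {p \<in> Q. ?c p = v} = 1" if v: "v \<in> A" for v
  proof -
    obtain e a b where st: "star v = {e, a, b}" "spoke e" "\<not> spoke a" "\<not> spoke b" "a \<noteq> b" "e \<noteq> a" "e \<noteq> b" "card (star v) = 3"
      by (rule A_star[OF v])
    have ab: "a \<in> star v" "b \<in> star v" using st by auto
    obtain t where t: "t \<in> F" "a \<in> s t ` {..<5}" "b \<in> s t ` {..<5}" using pair_exists[OF st(8) ab st(5)] by blast
    obtain k where k: "k < 5" "v = c t k" "{a, b} = {s t k, s t ((k + 4) mod 5)}" by (rule pair_at[OF t ab st(5)])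
    have "\<not> spoke (s t k)" "\<not> spoke (s t ((k + 4) mod 5))" using k(3) st(3,4) by (auto simp: doubleton_eq_iff)
    then have "k \<noteq> 0" "k \<noteq> 4" "k \<noteq> 1" using spoke_s[OF t(1) k(1)] spoke_s[OF t(1), of "(k + 4) mod 5"] by auto
    then have k23: "k = 2 \<or> k = 3" using k(1) unfolding less_5_cases by blast
    have "{p \<in> Q. ?c p = v} = {(t, k)}"
    proof (intro equalityI subsetI)
      fix p assume "p \<in> {p \<in> Q. ?c p = v}"
      then obtain t' k' where p: "p = (t', k')" "t' \<in> F" "k' = 2 \<or> k' = 3" "c t' k' = v" by (auto simp: Q_def)
      have k5: "k' < 5" using p(3) by auto
      define x y where xy: "x = s t' k'" "y = s t' ((k' + 4) mod 5)"
      have "star v \<inter> s t' ` {..<5} = {x, y}" using star_tile[OF p(2) k5] p(4) xy by simp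
      then have "x \<in> star v" "y \<in> star v" by blast+
      moreover have "\<not> spoke x" "\<not> spoke y" using spoke_s[OF p(2)] p(3) xy by auto
      ultimately have "x \<in> {a, b}" "y \<in> {a, b}" unfolding st(1) using st(2) by auto
      moreover have "x \<noteq> y" using s_eq[OF p(2)] p(3) xy by auto
      ultimately have "a \<in> {x, y}" "b \<in> {x, y}" by auto
      moreover have "{x, y} \<subseteq> s t' ` {..<5}" using k5 unfolding xy by simp
      ultimately have "a \<in> s t' ` {..<5}" "b \<in> s t' ` {..<5}" by blast+
      then have "t' = t" using pair_unique[OF st(8) ab st(5) p(2) t(1) _ _ t(2,3)] by blast
      moreover then have "k' = k" using c_eq[OF t(1) k5 k(1)] p(4) k(2) by simp
      ultimately show "p \<in> {(t, k)}" using p(1) by simp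
    qed (use t k k23 v in \<open>auto simp: Q_def\<close>)
    then show ?thesis by simp
  qed
  have cQ: "?c ` Q = A"
  proof
    show "A \<subseteq> ?c ` Q"
    proof
      fix v assume "v \<in> A"
      then have "{p \<in> Q. ?c p = v} \<noteq> {}" using fibQ[of v] by (metis card.empty zero_neq_one)
      then show "v \<in> ?c ` Q" by blast
    qed
  qed (auto simp: Q_def)
  have "card P = (\<Sum>v\<in>A. card {p \<in> P. ?c p = v})"
    using sum.image_gen[OF finP, of "\<lambda>_. 1::nat" ?c] by (simp add: cP)
  then have 1: "card P = 2 * card A" using fibP by simp
  have "card Q = (\<Sum>v\<in>A. card {p \<in> Q. ?c p = v})"
    using sum.image_gen[OF finQ, of "\<lambda>_. 1::nat" ?c] by (simp add: cQ)
  then have 2: "card Q = card A" using fibQ by simp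
  have "card P = 2 * card F" by (simp add: P_def card_cartesian_product)
  with 1 2 have 3: "card Q = card F" by simp
  \<comment> \<open>No tile contributes both corners 2 and 3, so \<open>Q\<close> projects
    injectively to the tiles. Having as many elements as there are tiles, it meets every
    tile.\<close>
  have "inj_on fst Q"
  proof (rule inj_onI)
    fix p q assume pq: "p \<in> Q" "q \<in> Q" "fst p = fst q"
    then have "fst p \<in> F" "snd p \<in> {2, 3}" "snd q \<in> {2, 3}" "?c p \<in> A" "c (fst p) (snd q) \<in> A" by (auto simp: Q_def)
    then have "snd p = snd q" using not_both_A[of "fst p"] by auto
    then show "p = q" using pq(3) by (rule prod_eqI[rotated])
  qed
  then have "card (fst ` Q) = card F" using 3 card_image[of fst Q] by simp
  moreover have "fst ` Q \<subseteq> F" by (auto simp: Q_def)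
  ultimately have "fst ` Q = F" using finite_F card_subset_eq by blast
  then have "c t0 2 \<in> A \<or> c t0 3 \<in> A" using t0 by (auto simp: Q_def)
  then show ?thesis using not_both_A[OF t0] by blast
qed

end

section \<open>Agreement of the directions across edges, and rotation about a corner 2\<close>

locale oriented_pentagon_scheme = pentagon_scheme +
  assumes c_2: "t \<in> F \<Longrightarrow> c t 2 \<notin> A"
begin

lemma c_in_A:
  assumes "t \<in> F"
  shows "c t 0 \<notin> A" "c t 1 \<in> A" "c t 2 \<notin> A" "c t 3 \<in> A" "c t 4 \<in> A"
  using A_corners[OF assms] c_2[OF assms] exactly_one_A[OF assms] c_in_L[OF assms, of 0] by (auto simp: A_def)

lemma same_pair:
  assumes t: "t \<in> F" "t' \<in> F" and k: "k < 5" "k' < 5" "k \<noteq> 0" and v: "c t k = c t' k'"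
    and a: "a \<in> s t ` {..<5}" "b \<in> s t ` {..<5}" "a \<in> s t' ` {..<5}" "b \<in> s t' ` {..<5}"
      "a \<in> star (c t k)" "b \<in> star (c t k)" "a \<noteq> b"
  shows "t = t'"
  using pair_unique[OF star_card_3[OF t(1) k(1,3)] a(5-7) t a(1-4)] .

lemma star_sides:
  assumes "t \<in> F" "k < 4"
  shows "s t k \<in> star (c t (Suc k))" "s t (Suc k) \<in> star (c t (Suc k))" "s t k \<noteq> s t (Suc k)"
proof -
  have k: "k < 5" "Suc k < 5" "(Suc k + 4) mod 5 = k" using assms(2) by auto
  show "s t k \<in> star (c t (Suc k))" "s t (Suc k) \<in> star (c t (Suc k))"
    using star_tile[OF assms(1) k(2)] k(3) by auto
  show "s t k \<noteq> s t (Suc k)" using s_eq[OF assms(1) k(1,2)] by simp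
qed

text \<open>At a vertex of \<open>A\<close>, the two edges that are not spokes span just one tile,
  and a tile with corner 2 or 3 there contains both of them.\<close>

lemma not_nonspokes_twice:
  assumes t: "t \<in> F" "t' \<in> F" "t \<noteq> t'" and k: "k \<in> {2, 3}" "k' \<in> {2, 3}" and v: "c t k \<in> A"
  shows "c t k \<noteq> c t' k'"
proof
  assume e: "c t k = c t' k'"
  obtain d a b where st: "star (c t k) = {d, a, b}" "spoke d" "\<not> spoke a" "\<not> spoke b" "a \<noteq> b" "d \<noteq> a" "d \<noteq> b" "card (star (c t k)) = 3"
    by (rule A_star[OF v])
  have *: "a \<in> s t ` {..<5} \<and> b \<in> s t ` {..<5}" if t: "t \<in> F" "k \<in> {2, 3}" and e: "star (c t k) = {d, a, b}" for t k
  proof -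
    define j where "j = k - 1"
    have j: "k = Suc j" "j < 4" "j = 1 \<or> j = 2" using t(2) by (auto simp: j_def)
    note S = star_sides[OF t(1) j(2), folded j(1)]
    have "\<not> spoke (s t j)" "\<not> spoke (s t k)" using spoke_s[OF t(1)] j t(2) by auto
    then have "s t j \<in> {a, b}" "s t k \<in> {a, b}" using S(1,2) st(2) unfolding e by auto
    then have "{a, b} = {s t j, s t k}" using S(3) by auto
    moreover have "s t j \<in> s t ` {..<5}" "s t k \<in> s t ` {..<5}" using j by auto
    ultimately show ?thesis by (metis insertE insertI1 insertI2 singletonD)
  qed
  have "a \<in> star (c t k)" "b \<in> star (c t k)" using st(1) by simp_all
  then show False
    using same_pair[OF t(1,2) _ _ _ e, of a b] *[OF t(1) k(1) st(1)] *[OF t(2) k(2)] st(1,5) e k t(3) by auto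
qed

text \<open>Let \<open>v\<close> be the end in \<open>A\<close> of the common spoke. The other two
  edges at \<open>v\<close> are the sides \<open>i\<close> of \<open>t\<close> and
  \<open>t'\<close>, and the third tile \<open>u\<close> has them as its sides 2 and 3 at its corner
  3. For spokes of index 0 they are sides 1, with an end (corner 2) outside \<open>A\<close>,
  whereas side 3 of \<open>u\<close> has both ends in \<open>A\<close>. For index 4 they are sides
  3, with both ends in \<open>A\<close>, whereas side 2 of \<open>u\<close> has an end outside
  \<open>A\<close>.\<close>

lemma not_same_spoke:
  assumes t: "t \<in> F" "t' \<in> F" "t \<noteq> t'" and k: "k \<in> {0, 4}" and e: "s t k = s t' k"
  shows False
proof -
  define v i where "v t = c t (if k = 0 then 1 else 4)" and "i = (if k = 0 then 1 else 3 :: nat)" for t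
  have ends: "ends (s t k) = {c t 0, v t}" "v t \<in> A" "s t k \<in> star (v t)" "s t i \<in> star (v t)" "s t k \<noteq> s t i" if "t \<in> F" for t
    using ends_simps[OF that] A_corners[OF that] k star_sides[OF that, of 0] star_sides[OF that, of 3]
    by (auto simp: v_def i_def)
  have i: "i < 5" "i = 1 \<or> i = 3" "k < 5" using k by (auto simp: i_def)
  have vv: "v t = v t'"
  proof -
    have "c t' 0 \<in> L" "v t \<notin> L" using c_in_L[OF t(2), of 0] ends(2)[OF t(1)] by (auto simp: A_def)
    moreover have "{c t 0, v t} = {c t' 0, v t'}" using ends(1)[OF t(1)] ends(1)[OF t(2)] e by simp
    ultimately show ?thesis by (metis doubleton_eq_iff)
  qed
  define m where "m = (if k = 0 then 1 else 4 :: nat)"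
  have m: "m < 5" "m \<noteq> 0" "v t = c t m" "v t' = c t' m" by (auto simp: m_def v_def)
  have ne: "s t i \<noteq> s t' i"
  proof
    assume eq: "s t i = s t' i"
    have "s t k \<in> s t' ` {..<5}" "s t i \<in> s t' ` {..<5}" unfolding e eq using i by simp_all
    then have "t = t'"
      using same_pair[OF t(1,2) m(1,1,2), of "s t k" "s t i"] vv m i ends(3,4,5)[OF t(1)] by simp
    then show False using t(3) by simp
  qed
  have c3: "card (star (v t)) = 3" using star_card_3[OF t(1) m(1,2)] m(3) by simp
  have st: "s t i \<in> star (v t)" "s t' i \<in> star (v t)" using ends(4)[OF t(1)] ends(4)[OF t(2)] vv by simp_all
  obtain u where u: "u \<in> F" "s t i \<in> s u ` {..<5}" "s t' i \<in> s u ` {..<5}" using pair_exists[OF c3 st ne] by blast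
  obtain j where j: "j < 5" "v t = c u j" "{s t i, s t' i} = {s u j, s u ((j + 4) mod 5)}"
    by (rule pair_at[OF u st ne])
  have "\<not> spoke (s t i)" "\<not> spoke (s t' i)" using spoke_s[OF t(1) i(1)] spoke_s[OF t(2) i(1)] i(2) by auto
  then have "\<not> spoke (s u j)" "\<not> spoke (s u ((j + 4) mod 5))" using j(3) by (metis insertE insertI1 insertI2 singletonD)+
  then have "j \<noteq> 0" "j \<noteq> 4" "j \<noteq> 1" using spoke_s[OF u(1) j(1)] spoke_s[OF u(1), of "(j + 4) mod 5"] by auto
  moreover have "j \<noteq> 2" using c_2[OF u(1)] ends(2)[OF t(1)] j(2) by auto
  ultimately have "j = 3" using j(1) unfolding less_5_cases by blast
  then have q: "{s t i, s t' i} = {s u 3, s u 2}" using j(3) by simp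
  show False
  proof (cases "k = 0")
    case True
    have "s u 3 \<in> {s t i, s t' i}" unfolding q by simp
    then have "s u 3 = s t 1 \<or> s u 3 = s t' 1" using True by (simp add: i_def)
    then have "c t 2 \<in> {c u 3, c u 4} \<or> c t' 2 \<in> {c u 3, c u 4}"
      using ends_simps[OF u(1)] ends_simps[OF t(1)] ends_simps[OF t(2)] by auto
    then show False using c_in_A[OF u(1)] c_2[OF t(1)] c_2[OF t(2)] by auto
  next
    case False
    have "s u 2 \<in> {s t i, s t' i}" unfolding q by simp
    then have "s u 2 = s t 3 \<or> s u 2 = s t' 3" using False by (simp add: i_def)
    then have "c u 2 \<in> {c t 3, c t 4} \<or> c u 2 \<in> {c t' 3, c t' 4}"
      using ends_simps[OF u(1)] ends_simps[OF t(1)] ends_simps[OF t(2)] by auto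
    then show False using c_in_A[OF t(1)] c_in_A[OF t(2)] c_2[OF u(1)] by auto
  qed
qed

definition opp :: "nat \<Rightarrow> nat" where
  "opp k = (if k = 0 then 4 else if k = 1 then 2 else if k = 2 then 1 else if k = 3 then 3 else 0)"

lemma opp_simps [simp]: "opp 0 = 4" "opp 1 = 2" "opp (Suc 0) = 2" "opp 2 = 1" "opp 3 = 3" "opp 4 = 0"
  by (simp_all add: opp_def)

text \<open>The edge itself shows whether it is a spoke (indices 0 and 4), has both ends in
  \<open>A\<close> (index 3), or ends at a corner 2 (indices 1 and 2). Equal indices for spokes are
  excluded by \<open>not_same_spoke\<close>. Index 1 twice would force a common spoke of index 0,
  and index 2 twice a common corner 3. The ends are then matched by their types; only for index 3,
  where both ends are in \<open>A\<close>, the direction is decided by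
  \<open>not_nonspokes_twice\<close>.\<close>

theorem common_side:
  assumes t: "t \<in> F" "t' \<in> F" "t \<noteq> t'" and k: "k < 5" "k' < 5" and e: "s t k = s t' k'"
  shows "k' = opp k" "c t k = c t' (Suc k' mod 5)" "c t (Suc k mod 5) = c t' k'"
proof -
  have E: "ends (s t k) = ends (s t' k')" using e by simp
  note S = ends_simps[OF t(1)] and S' = ends_simps[OF t(2)]
  note I = c_in_A[OF t(1)] and I' = c_in_A[OF t(2)]
  have sp: "k = 0 \<or> k = 4 \<longleftrightarrow> k' = 0 \<or> k' = 4" using spoke_s[OF t(1) k(1)] spoke_s[OF t(2) k(2)] e by simp
  have AA: "ends (s t k) \<subseteq> A \<longleftrightarrow> k = 3" "ends (s t' k') \<subseteq> A \<longleftrightarrow> k' = 3"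
    using k I I' S S' unfolding less_5_cases by auto
  have three: "k = 3 \<longleftrightarrow> k' = 3" using AA E by simp
  have no: "\<not> (k = k' \<and> (k = 0 \<or> k = 4))" using not_same_spoke[OF t, of k] e by blast
  have c00: "c t 0 \<in> L" "c t' 0 \<in> L" "c t 1 \<notin> L" "c t 4 \<notin> L" "c t' 1 \<notin> L" "c t' 4 \<notin> L"
    using c_in_L[OF t(1)] c_in_L[OF t(2)] by simp_all
  have n33: "c t 3 \<noteq> c t' 3" using not_nonspokes_twice[OF t, of 3 3] I by simp
  have n22: "\<not> (k = 2 \<and> k' = 2)"
  proof
    assume "k = 2 \<and> k' = 2"
    then have "{c t 2, c t 3} = {c t' 2, c t' 3}" using E S S' by simp
    then show False using n33 I I' by (metis doubleton_eq_iff)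
  qed
  have n11: "\<not> (k = 1 \<and> k' = 1)"
  proof
    assume kk: "k = 1 \<and> k' = 1"
    then have "{c t 1, c t 2} = {c t' 1, c t' 2}" using E S S' by simp
    then have v: "c t 1 = c t' 1" using I I' by (metis doubleton_eq_iff)
    have "s t 0 \<in> star (c t 1)" "s t' 0 \<in> star (c t 1)"
      using star_sides(1)[OF t(1), of 0] star_sides(1)[OF t(2), of 0] v by simp_all
    then have "s t 0 = s t' 0"
      using spoke_unique[OF t(1), of 1 "s t 0" "s t' 0"] spoke_s[OF t(1), of 0] spoke_s[OF t(2), of 0] by simp
    then show False using not_same_spoke[OF t, of 0] by simp
  qed
  have pairs: "(k = 0 \<and> k' = 4) \<or> (k = 4 \<and> k' = 0) \<or> (k = 1 \<and> k' = 2) \<or> (k = 2 \<and> k' = 1) \<or> (k = 3 \<and> k' = 3)"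
    using k sp three no n22 n11 unfolding less_5_cases by auto
  then show "k' = opp k" by auto
  have "c t k = c t' (Suc k' mod 5) \<and> c t (Suc k mod 5) = c t' k'"
    using pairs
  proof (elim disjE conjE)
    assume "k = 0" "k' = 4"
    moreover then have "{c t 0, c t 1} = {c t' 4, c t' 0}" using E S S' by simp
    then have "c t 0 = c t' 0 \<and> c t 1 = c t' 4" using c00 by (metis doubleton_eq_iff)
    ultimately show ?thesis by simp
  next
    assume "k = 4" "k' = 0"
    moreover then have "{c t 4, c t 0} = {c t' 0, c t' 1}" using E S S' by simp
    then have "c t 0 = c t' 0 \<and> c t 4 = c t' 1" using c00 by (metis doubleton_eq_iff)
    ultimately show ?thesis by simp
  next
    assume "k = 1" "k' = 2"
    moreover then have "{c t 1, c t 2} = {c t' 2, c t' 3}" using E S S' by simp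
    then have "c t 2 = c t' 2 \<and> c t 1 = c t' 3" using I I' by (metis doubleton_eq_iff)
    ultimately show ?thesis by (simp add: numeral_2_eq_2[symmetric])
  next
    assume "k = 2" "k' = 1"
    moreover then have "{c t 2, c t 3} = {c t' 1, c t' 2}" using E S S' by simp
    then have "c t 2 = c t' 2 \<and> c t 3 = c t' 1" using I I' by (metis doubleton_eq_iff)
    ultimately show ?thesis by (simp add: numeral_2_eq_2[symmetric])
  next
    assume "k = 3" "k' = 3"
    moreover then have "{c t 3, c t 4} = {c t' 3, c t' 4}" using E S S' by simp
    then have "c t 3 = c t' 4 \<and> c t 4 = c t' 3" using n33 by (metis doubleton_eq_iff)
    ultimately show ?thesis by simp
  qed
  then show "c t k = c t' (Suc k' mod 5)" "c t (Suc k mod 5) = c t' k'" by auto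
qed

lemma neighbour:
  assumes t: "t \<in> F" and k: "k < 5"
  shows "\<exists>!t'. t' \<in> F \<and> t' \<noteq> t \<and> s t k \<in> s t' ` {..<5}"
proof -
  obtain t1 t2 i j where e: "t1 \<in> F" "t2 \<in> F" "t1 \<noteq> t2" "i < 5" "j < 5" "s t k = s t1 i" "s t k = s t2 j"
    "\<forall>t''\<in>F. s t k \<in> s t'' ` {..<5} \<longrightarrow> t'' = t1 \<or> t'' = t2"
    by (rule edge_tiles[OF s_in[OF t k]])
  have "t = t1 \<or> t = t2" using e(8) t k by simp
  moreover have "s t k \<in> s t1 ` {..<5}" "s t k \<in> s t2 ` {..<5}"
    using e(4-7) side_in by metis+
  ultimately show ?thesis using e by metis
qed

text \<open>One step of the rotation about corner 2, across side 1.\<close>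

definition nxt where "nxt t = (THE t'. t' \<in> F \<and> t' \<noteq> t \<and> s t 1 \<in> s t' ` {..<5})"

lemma nxt:
  assumes t: "t \<in> F"
  shows "nxt t \<in> F" "nxt t \<noteq> t" "s (nxt t) 2 = s t 1" "c (nxt t) 2 = c t 2" "c (nxt t) 3 = c t 1"
proof -
  have n: "nxt t \<in> F \<and> nxt t \<noteq> t \<and> s t 1 \<in> s (nxt t) ` {..<5}"
    unfolding nxt_def by (rule theI'[OF neighbour[OF t]]) simp
  then show "nxt t \<in> F" "nxt t \<noteq> t" by blast+
  obtain k where k: "k < 5" "s t 1 = s (nxt t) k" using n by blast
  have nt: "nxt t \<in> F" "t \<noteq> nxt t" using n by auto
  note C = common_side[OF t nt _ k(1) k(2)]
  have "k = 2" using C(1) by simp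
  then show "s (nxt t) 2 = s t 1" "c (nxt t) 2 = c t 2" "c (nxt t) 3 = c t 1"
    using k(2) C(2,3) by (simp_all add: numeral_2_eq_2[symmetric])
qed

lemma nxt_unique:
  assumes "t \<in> F" "t' \<in> F" "s t' 2 = s t 1"
  shows "t' = nxt t"
proof -
  have "t' \<noteq> t" using s_eq[OF assms(1), of 1 2] assms(3) by auto
  moreover have "s t 1 \<in> s t' ` {..<5}" unfolding assms(3)[symmetric] by simp
  moreover have "s t 1 \<in> s (nxt t) ` {..<5}" unfolding nxt(3)[OF assms(1), symmetric] by simp
  moreover have "\<exists>!t'. t' \<in> F \<and> t' \<noteq> t \<and> s t 1 \<in> s t' ` {..<5}" by (rule neighbour[OF assms(1)]) simp
  ultimately show ?thesis using nxt(1,2)[OF assms(1)] assms(2) by (metis (no_types, lifting))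
qed

lemma star_B: "t \<in> F \<Longrightarrow> s t 1 \<in> star (c t 2)" "t \<in> F \<Longrightarrow> s t 2 \<in> star (c t 2)" "t \<in> F \<Longrightarrow> s t 1 \<noteq> s t 2"
  using star_sides[of t 1] by (simp_all add: numeral_2_eq_2[symmetric])

lemma same_pair_B:
  assumes "t \<in> F" "t' \<in> F" "c t 2 = c t' 2" "{s t 1, s t 2} = {s t' 1, s t' 2}"
  shows "t = t'"
proof (rule same_pair[OF assms(1,2), of 2 2 "s t 1" "s t 2"])
  have "s t 1 = s t' 1 \<and> s t 2 = s t' 2 \<or> s t 1 = s t' 2 \<and> s t 2 = s t' 1"
    using assms(4) by (simp add: doubleton_eq_iff)
  moreover have "s t' 1 \<in> s t' ` {..<5}" "s t' 2 \<in> s t' ` {..<5}" by simp_all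
  ultimately show "s t 1 \<in> s t' ` {..<5}" "s t 2 \<in> s t' ` {..<5}" by metis+
qed (use assms star_B[OF assms(1)] in auto)

text \<open>Corner 2 has degree 3, and its edges are sides 1 and 2 of \<open>t\<close> and side 1 of
  \<open>nxt t\<close>. Side 1 of the third tile can only be side 2 of \<open>t\<close>, which
  closes the cycle. Any tile with this corner 2 is spanned by two of the three edges and so is one
  of the three tiles.\<close>

theorem nxt_cycle:
  assumes t: "t \<in> F"
  shows "nxt (nxt (nxt t)) = t" "nxt (nxt t) \<noteq> t"
    "\<And>t'. t' \<in> F \<Longrightarrow> c t' 2 = c t 2 \<Longrightarrow> t' = t \<or> t' = nxt t \<or> t' = nxt (nxt t)"
proof -
  let ?u = "nxt t" let ?w = "nxt (nxt t)"
  note n = nxt[OF t]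
  note m = nxt[OF n(1)]
  have a: "?w \<noteq> t"
  proof
    assume "?w = t"
    then have "s t 2 = s ?u 1" using m(3) by simp
    then have "?u = t" using same_pair_B[OF n(1) t n(4)] n(3) by auto
    then show False using n(2) by simp
  qed
  show "?w \<noteq> t" by (rule a)
  have b2: "c ?u 2 = c t 2" "c ?w 2 = c t 2" using n(4) m(4) by simp_all
  have ne1: "s ?u 1 \<noteq> s t 1" using star_B(3)[OF n(1)] n(3) by simp
  have ne2: "s ?u 1 \<noteq> s t 2" using same_pair_B[OF n(1) t b2(1)] n(2,3) by (auto simp: insert_commute)
  have st: "star (c t 2) = {s t 1, s t 2, s ?u 1}"
  proof (rule card_subset_eq[symmetric])
    have c3: "card (star (c t 2)) = 3" using star_card_3[OF t] by simp
    then show "finite (star (c t 2))" using card.infinite by fastforce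
    show "{s t 1, s t 2, s ?u 1} \<subseteq> star (c t 2)" using star_B[OF t] star_B[OF n(1)] b2 by auto
    show "card {s t 1, s t 2, s ?u 1} = card (star (c t 2))" using c3 ne1 ne2 star_B(3)[OF t] by auto
  qed
  have "s ?w 1 \<in> star (c t 2)" using star_B(1)[OF m(1)] b2 by simp
  moreover have "s ?w 1 \<noteq> s ?u 1" using star_B(3)[OF m(1)] m(3) by simp
  moreover have "s ?w 1 \<noteq> s t 1"
  proof
    assume "s ?w 1 = s t 1"
    then have "?w = ?u" using same_pair_B[OF m(1) n(1)] b2 n(3) m(3) by auto
    then show False using m(2) by simp
  qed
  ultimately have w1: "s ?w 1 = s t 2" unfolding st by blast
  show "nxt ?w = t" using nxt_unique[OF m(1) t] w1 by simp
  fix t' assume t': "t' \<in> F" "c t' 2 = c t 2"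
  have "s t' 1 \<in> star (c t 2)" "s t' 2 \<in> star (c t 2)" "s t' 1 \<noteq> s t' 2" using star_B[OF t'(1)] t'(2) by simp_all
  then have "{s t' 1, s t' 2} = {s t 1, s t 2} \<or> {s t' 1, s t' 2} = {s ?u 1, s ?u 2} \<or> {s t' 1, s t' 2} = {s ?w 1, s ?w 2}"
    unfolding st n(3) m(3) w1 by auto
  then show "t' = t \<or> t' = ?u \<or> t' = ?w"
    using same_pair_B[OF t'(1) t] same_pair_B[OF t'(1) n(1)] same_pair_B[OF t'(1) m(1)] t'(2) b2 by auto
qed

end

subsection \<open>Orientability\<close>

lemma orientation_preserving_on_id: "orientation_preserving_on U (\<lambda>z. z)"
  using orientation_preserving_on_subset[OF orientation_preserving_on_mult[of 1], of U]
    orientation_preserving_on_cong[of U "\<lambda>z. 1 * z" "\<lambda>z. z"] by simp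

lemma orientation_preserving_on_empty: "orientation_preserving_on {} f"
  unfolding orientation_preserving_on_def by (metis centre_in_cball empty_iff less_imp_le subsetD)

context nondegenerate_pentagonal_tiling
begin

lemma edge_is_side:
  assumes "e \<in> E"
  obtains t where "t \<in> tiles X V E" "e \<subseteq> X closure_of t"
proof -
  have "{t \<in> tiles X V E. e \<subseteq> X closure_of t} \<noteq> {}"
    using edge_tiles_card[OF assms] by (metis card.empty zero_neq_numeral)
  then show thesis using that by blast
qed

lemma vertex_on_edge:
  assumes "v \<in> V"
  obtains e where "e \<in> E" "v \<in> e"
proof -
  have "\<exists>e\<in>E. v \<in> e"
  proof (rule ccontr)
    assume n: "\<not> (\<exists>e\<in>E. v \<in> e)"
    then have "{e \<in> E. v \<in> e} = {}" "{e \<in> E. e \<inter> V = {v}} = {}" by blast+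
    then have "vertex_degree V E v = 0" unfolding vertex_degree_def by (metis add_0 card.empty)
    then show False using degree_ge[OF assms] by simp
  qed
  then show thesis using that by blast
qed

text \<open>Every vertex lies on an edge because of its degree, and every edge borders a tile, so
  each point is in the closure of some tile.\<close>

lemma tiles_dense:
  assumes S: "openin X S" "S \<noteq> {}"
  shows "\<exists>t\<in>tiles X V E. S \<inter> t \<noteq> {}"
proof -
  obtain x where x: "x \<in> S" using S(2) by blast
  then have xX: "x \<in> topspace X" using openin_subset[OF S(1)] by blast
  have "\<exists>t\<in>tiles X V E. x \<in> X closure_of t"
  proof (cases "x \<in> \<Union>E")
    case True
    then obtain e where "e \<in> E" "x \<in> e" by blast
    then show ?thesis using edge_is_side by blast
  next
    case False
    then have "x \<notin> V" using vertex_on_edge by blast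
    then obtain t where t: "t \<in> tiles X V E" "x \<in> t" using tiles_Union xX False by blast
    then show ?thesis using closure_of_subset[OF tile_subset(1)[OF t(1)]] by blast
  qed
  then obtain t where "t \<in> tiles X V E" "x \<in> X closure_of t" by blast
  then show ?thesis using S(1) x unfolding in_closure_of by blast
qed

text \<open>There are no loops in this graph, because the ends of a side of a nondegenerate pentagon
  are distinct; the second summand of \<open>vertex_degree\<close> therefore vanishes.\<close>

lemma edge_vertices_card: "e \<in> E \<Longrightarrow> card (e \<inter> V) = 2"
proof -
  assume e: "e \<in> E"
  obtain t where t: "t \<in> tiles X V E" "e \<subseteq> X closure_of t" by (rule edge_is_side[OF e])
  obtain \<phi> where \<phi>: "simple_pentagon X V E t \<phi>" using simple_pentagon_exists[OF t(1)] by blast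
  obtain k where k: "k < 5" "e = side \<phi> k" using edge_subset_closure_iff[OF t(1) \<phi> e] t(2) by blast
  have "Suc k mod 5 \<noteq> k" "Suc k mod 5 < 5" using k(1) by presburger+
  then have "corner \<phi> k \<noteq> corner \<phi> (Suc k mod 5)" using corner_eq_iff[OF t(1) \<phi> k(1)] by metis
  then show "card (e \<inter> V) = 2" using side_Int_vertices[OF t(1) \<phi> k(1)] k(2) by simp
qed

lemma vertex_degree_eq: "vertex_degree V E v = card {e \<in> E. v \<in> e}"
proof -
  have "{e \<in> E. e \<inter> V = {v}} = {}" using edge_vertices_card by fastforce
  then show ?thesis unfolding vertex_degree_def by (metis add.right_neutral card.empty)
qed

end

text \<open>Equal sides of different tiles are traversed in opposite directions and at the same speed.\<close>

locale matched_pentagonal_tiling = nondegenerate_pentagonal_tiling +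
  fixes \<phi> :: "'a set \<Rightarrow> complex \<Rightarrow> 'a"
  assumes pentagon: "t \<in> tiles X V E \<Longrightarrow> simple_pentagon X V E t (\<phi> t)"
    and matched: "t \<in> tiles X V E \<Longrightarrow> t' \<in> tiles X V E \<Longrightarrow> t \<noteq> t' \<Longrightarrow> k < 5 \<Longrightarrow> k' < 5 \<Longrightarrow>
      side (\<phi> t) k = side (\<phi> t') k' \<Longrightarrow> s \<in> {0..1} \<Longrightarrow>
      \<phi> t (polygon_side 5 k s) = \<phi> t' (polygon_side 5 k' (1 - s))"
begin

sublocale dense_disks X "\<phi> ` tiles X V E"
proof
  show "surface X" by (rule surface)
next
  fix \<psi> assume "\<psi> \<in> \<phi> ` tiles X V E"
  then obtain t where t: "t \<in> tiles X V E" "\<psi> = \<phi> t" by blast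
  show "continuous_map (top_of_set (ball 0 1)) X \<psi>"
    unfolding t(2) by (rule pentagon_continuous(2)[OF t(1) pentagon[OF t(1)]])
  show "inj_on \<psi> (ball 0 1)"
    unfolding t(2) using inj_on_subset[OF pentagon_inj[OF t(1) pentagon[OF t(1)]] ball_subset_cball] .
next
  fix S assume S: "openin X S" "S \<noteq> {}"
  obtain t where t: "t \<in> tiles X V E" "S \<inter> t \<noteq> {}" using tiles_dense[OF S] by blast
  obtain y where y: "y \<in> S" "y \<in> t" using t(2) by blast
  then obtain z where "z \<in> ball 0 1" "\<phi> t z = y" using pentagon_ball[OF t(1) pentagon[OF t(1)]] by (metis imageE)
  then show "\<exists>\<psi>\<in>\<phi> ` tiles X V E. \<exists>z\<in>ball 0 1. \<psi> z \<in> S" using t(1) y(1) by blast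
qed

text \<open>Distinct tiles are disjoint, so the inverse of a tile's parametrization only has to
  agree with that tile.\<close>

lemma tile_chart:
  assumes t: "t \<in> tiles X V E"
  shows "(t, inv_into (ball 0 1) (\<phi> t)) \<in> positive_charts X (\<phi> ` tiles X V E)"
proof -
  let ?f = "inv_into (ball 0 1) (\<phi> t)"
  have tP: "\<phi> t \<in> \<phi> ` tiles X V E" using t by blast
  have im: "\<phi> t ` ball 0 1 = t" by (rule pentagon_ball[OF t pentagon[OF t]])
  have "surface_chart X t ?f"
    using surface_chart_inverse[OF surface open_ball disk_cont[OF tP] disk_inj[OF tP]] im by simp
  moreover have "orientation_preserving_on {z \<in> ball 0 1. \<phi> t' z \<in> t} (?f \<circ> \<phi> t')" if t': "t' \<in> tiles X V E" for t'
  proof (cases "t' = t")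
    case True
    have "(?f \<circ> \<phi> t') z = z" if "z \<in> {z \<in> ball 0 1. \<phi> t' z \<in> t}" for z
      using that inv_into_f_f[OF disk_inj[OF tP]] True by simp
    then show ?thesis using orientation_preserving_on_cong orientation_preserving_on_id by (metis (no_types, lifting))
  next
    case False
    have "\<phi> t' ` ball 0 1 \<inter> t = {}"
      using pentagon_ball[OF t' pentagon[OF t']] tiles_disjoint[OF t' t False] by simp
    then have "{z \<in> ball 0 1. \<phi> t' z \<in> t} = {}" by blast
    then show ?thesis by (metis orientation_preserving_on_empty)
  qed
  ultimately show ?thesis by (simp add: positive_charts_def positive_on_def)
qed

text \<open>In the glued chart the first tile becomes the identity and the second one the inversion
  \<open>c / z\<close>; both preserve orientation. Opposite directions on the common side enter
  here: equal directions would require a reflection in the circle instead.\<close>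

lemma edge_chart:
  assumes e: "e \<in> E" and x: "x \<in> e" "x \<notin> V"
  shows "\<exists>(U, f)\<in>positive_charts X (\<phi> ` tiles X V E). x \<in> U"
proof -
  have "card {t \<in> tiles X V E. e \<subseteq> X closure_of t} = 2" by (rule edge_tiles_card[OF e])
  then obtain t1 t2 where T: "{t \<in> tiles X V E. e \<subseteq> X closure_of t} = {t1, t2}" "t1 \<noteq> t2"
    unfolding card_2_iff by blast
  then have t: "t1 \<in> tiles X V E" "t2 \<in> tiles X V E" "e \<subseteq> X closure_of t1" "e \<subseteq> X closure_of t2" by blast+
  note p1 = pentagon[OF t(1)] and p2 = pentagon[OF t(2)]
  obtain k where k: "k < 5" "e = side (\<phi> t1) k" using edge_subset_closure_iff[OF t(1) p1 e] t(3) by blast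
  obtain l where l: "l < 5" "e = side (\<phi> t2) l" using edge_subset_closure_iff[OF t(2) p2 e] t(4) by blast
  have kl: "side (\<phi> t1) k = side (\<phi> t2) l" using k l by simp
  define c where "c = cis (2 * pi * real (k + l + 1) / 5)"
  have c0: "c \<noteq> 0" by (simp add: c_def)
  obtain N G where N: "open N" "continuous_map (top_of_set N) X G" "inj_on G N"
    and Ns: "\<forall>s\<in>{0<..<1}. polygon_side 5 k s \<in> N"
    and NG: "\<forall>z\<in>N. z \<noteq> 0 \<and> (cmod z \<le> 1 \<longrightarrow> G z = \<phi> t1 z) \<and> (1 < cmod z \<longrightarrow> G z = \<phi> t2 (c / z))"
    and GN: "G ` N \<subseteq> t1 \<union> t2 \<union> e"
    using pentagon_glue[OF t(1,2) T(2) p1 p2 k(1) l(1) matched[OF t(1,2) T(2) k(1) l(1) kl]]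
    unfolding c_def k(2) by blast
  let ?f = "inv_into N G"
  have ch: "surface_chart X (G ` N) ?f" by (rule surface_chart_inverse[OF surface N])
  have fG: "?f (G w) = w" if "w \<in> N" for w by (rule inv_into_f_f[OF N(3) that])
  have cz: "c / w \<in> ball 0 1" if "1 < cmod w" for w
    using that by (simp add: c_def norm_divide divide_simps)
  have dis: "t1 \<inter> t2 = {}" "t1 \<inter> e = {}" "t2 \<inter> e = {}"
    using tiles_disjoint[OF t(1,2) T(2)] tile_subset(3)[OF t(1) e] tile_subset(3)[OF t(2) e] by auto
  have im: "\<phi> t1 ` ball 0 1 = t1" "\<phi> t2 ` ball 0 1 = t2"
    using pentagon_ball[OF t(1) p1] pentagon_ball[OF t(2) p2] .
  have i1: "inj_on (\<phi> t1) (cball 0 1)" and i2: "inj_on (\<phi> t2) (cball 0 1)"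
    using pentagon_inj[OF t(1) p1] pentagon_inj[OF t(2) p2] .
  have cb: "z \<in> cball 0 1" if "z \<in> ball 0 1" for z :: complex using that by simp
  have one: "(?f \<circ> \<phi> t1) z = z" if z: "z \<in> ball 0 1" "\<phi> t1 z \<in> G ` N" for z
  proof -
    obtain w where w: "w \<in> N" "\<phi> t1 z = G w" using z(2) by blast
    have "\<phi> t1 z \<in> t1" using im z(1) by blast
    have "cmod w \<le> 1"
    proof (rule ccontr)
      assume "\<not> cmod w \<le> 1"
      then have "G w = \<phi> t2 (c / w)" "c / w \<in> ball 0 1" using NG w(1) cz by auto
      then have "G w \<in> t2" using im by auto
      then show False using \<open>\<phi> t1 z \<in> t1\<close> w(2) dis by auto
    qed
    then have "\<phi> t1 z = \<phi> t1 w" using NG w by simp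
    then have "z = w" using inj_onD[OF i1 _ cb[OF z(1)]] \<open>cmod w \<le> 1\<close> by simp
    then show ?thesis using w fG by simp
  qed
  have two: "(?f \<circ> \<phi> t2) z = c / z \<and> z \<noteq> 0" if z: "z \<in> ball 0 1" "\<phi> t2 z \<in> G ` N" for z
  proof -
    obtain w where w: "w \<in> N" "\<phi> t2 z = G w" using z(2) by blast
    have m2: "\<phi> t2 z \<in> t2" using im z(1) by blast
    have w1: "1 < cmod w"
    proof (rule ccontr)
      assume n: "\<not> 1 < cmod w"
      then have "G w = \<phi> t1 w" using NG w(1) by auto
      moreover have "\<phi> t1 w \<in> \<phi> t1 ` cball 0 1" by (rule imageI) (use n in simp)
      ultimately have "\<phi> t2 z \<in> t1 \<union> (\<Union>k<5. side (\<phi> t1) k)" using w(2) pentagon_cball[OF t(1) p1] by simp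
      moreover have "(\<Union>k<5. side (\<phi> t1) k) \<subseteq> \<Union>E" using pentagon_side(2)[OF t(1) p1] by (intro UN_least Union_upper) simp
      ultimately have "\<phi> t2 z \<in> t1 \<union> \<Union>E" by blast
      then show False using m2 dis(1) tile_subset(3)[OF t(2)] by blast
    qed
    then have "\<phi> t2 z = \<phi> t2 (c / w)" using NG w by simp
    then have "z = c / w" using inj_onD[OF i2 _ cb[OF z(1)] cb[OF cz[OF w1]]] by simp
    moreover have "w \<noteq> 0" using w1 by auto
    ultimately have "w = c / z" "z \<noteq> 0" using c0 by auto
    then show ?thesis using w fG by simp
  qed
  have "orientation_preserving_on {z \<in> ball 0 1. \<phi> t z \<in> G ` N} (?f \<circ> \<phi> t)" if t': "t \<in> tiles X V E" for t
  proof -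
    consider "t = t1" | "t = t2" | "t \<noteq> t1" "t \<noteq> t2" by blast
    then show ?thesis
    proof cases
      case 1
      show ?thesis
        using orientation_preserving_on_cong[of "{z \<in> ball 0 1. \<phi> t z \<in> G ` N}" "?f \<circ> \<phi> t" "\<lambda>z. z"]
          orientation_preserving_on_id one 1 by simp
    next
      case 2
      have "{z \<in> ball 0 1. \<phi> t z \<in> G ` N} \<subseteq> -{0}"
      proof
        fix z assume "z \<in> {z \<in> ball 0 1. \<phi> t z \<in> G ` N}"
        then show "z \<in> -{0}" using two[of z] 2 by simp
      qed
      then have "orientation_preserving_on {z \<in> ball 0 1. \<phi> t z \<in> G ` N} (\<lambda>z. c / z)"
        using orientation_preserving_on_subset[OF orientation_preserving_on_divide[OF c0]] by blast
      then show ?thesis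
        using orientation_preserving_on_cong[of "{z \<in> ball 0 1. \<phi> t z \<in> G ` N}" "?f \<circ> \<phi> t" "\<lambda>z. c / z"]
          two 2 by simp
    next
      case 3
      have "t \<inter> (t1 \<union> t2 \<union> e) = {}"
        using tiles_disjoint[OF t' t(1) 3(1)] tiles_disjoint[OF t' t(2) 3(2)] tile_subset(3)[OF t' e] by blast
      then have "{z \<in> ball 0 1. \<phi> t z \<in> G ` N} = {}"
        using pentagon_ball[OF t' pentagon[OF t']] GN by blast
      then show ?thesis by (metis orientation_preserving_on_empty)
    qed
  qed
  then have "(G ` N, ?f) \<in> positive_charts X (\<phi> ` tiles X V E)"
    using ch by (simp add: positive_charts_def positive_on_def)
  moreover have "x \<in> G ` N"
  proof -
    obtain s where s: "s \<in> {0..1}" "x = \<phi> t1 (polygon_side 5 k s)" using x(1) k(2) by auto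
    have "s \<noteq> 0" "s \<noteq> 1" using s(2) x(2) corner_in[OF t(1) p1] corner_Suc[OF t(1) p1 k(1)] k(1)
      by (auto dest!: arg_cong[of _ _ "\<lambda>v. v \<in> V"])
    then have "polygon_side 5 k s \<in> N" using Ns s(1) by simp
    then show ?thesis using NG s(2) by (metis image_eqI norm_polygon_side order_refl)
  qed
  ultimately show ?thesis by blast
qed

lemma atlas: "oriented_atlas X (positive_charts X (\<phi> ` tiles X V E))"
proof (rule positive_charts_oriented_atlas[OF graph(1)])
  fix \<psi> assume "\<psi> \<in> \<phi> ` tiles X V E"
  then show "\<psi> ` ball 0 1 \<inter> V = {}"
    using pentagon_ball[OF _ pentagon] tile_subset(2) by blast
next
  fix x assume x: "x \<in> topspace X" "x \<notin> V"
  show "\<exists>(U, f)\<in>positive_charts X (\<phi> ` tiles X V E). x \<in> U"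
  proof (cases "x \<in> \<Union>E")
    case True
    then show ?thesis using edge_chart x(2) by blast
  next
    case False
    then obtain t where "t \<in> tiles X V E" "x \<in> t" using tiles_Union x by blast
    then show ?thesis using tile_chart by blast
  qed
qed

end

section \<open>Numbering the labelled tiling and matching its sides\<close>

locale circ_pentagonal_tiling = nondegenerate_pentagonal_tiling +
  fixes L :: "'a set"
  assumes L_subset: "L \<subseteq> V"
    and L_tile: "\<forall>t\<in>tiles X V E. \<exists>v. tile_vertices X V t \<inter> L = {v} \<and>
           (\<forall>u\<in>tile_vertices X V t - {v}. vertex_degree V E u = 3)"
begin

definition L_based :: "('a set \<Rightarrow> complex \<Rightarrow> 'a) \<Rightarrow> bool" where
  "L_based \<phi> \<longleftrightarrow> (\<forall>t\<in>tiles X V E. simple_pentagon X V E t (\<phi> t) \<and> corner (\<phi> t) 0 \<in> L)"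

lemma L_based_exists: "\<exists>\<phi>. L_based \<phi>"
proof -
  have "\<exists>\<phi>. simple_pentagon X V E t \<phi> \<and> corner \<phi> 0 \<in> L" if t: "t \<in> tiles X V E" for t
  proof -
    obtain \<phi> where \<phi>: "simple_pentagon X V E t \<phi>" using simple_pentagon_exists[OF t] by blast
    obtain v where "tile_vertices X V t \<inter> L = {v}" using L_tile t by blast
    then have "v \<in> corner \<phi> ` {..<5}" "v \<in> L" using tile_vertices_eq[OF t \<phi>] by blast+
    then obtain j where j: "corner \<phi> j \<in> L" by blast
    obtain \<phi>' where "simple_pentagon X V E t \<phi>'" "\<And>k s. \<phi>' (polygon_side 5 k s) = \<phi> (polygon_side 5 (k + j) s)"
      using simple_pentagon_rotate[OF t \<phi>, of j] by blast
    then show ?thesis using j by (intro exI[of _ \<phi>']) simp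
  qed
  then have "\<exists>\<phi>. \<forall>t\<in>tiles X V E. simple_pentagon X V E t (\<phi> t) \<and> corner (\<phi> t) 0 \<in> L" by (intro bchoice) blast
  then show ?thesis by (simp add: L_based_def)
qed

lemma L_based_scheme:
  assumes "L_based \<phi>"
  shows "pentagon_scheme (tiles X V E) E (\<lambda>e. e \<inter> V) L (\<lambda>t. corner (\<phi> t)) (\<lambda>t. side (\<phi> t))"
proof
  have sp: "simple_pentagon X V E t (\<phi> t)" "corner (\<phi> t) 0 \<in> L" if "t \<in> tiles X V E" for t
    using assms that by (auto simp: L_based_def)
  show "finite (tiles X V E)" by (rule finite_tiles)
  show "side (\<phi> t) k \<in> E" if "t \<in> tiles X V E" "k < 5" for t k
    by (rule pentagon_side(2)[OF that(1) sp(1)[OF that(1)] that(2)])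
  show "side (\<phi> t) k \<inter> V = {corner (\<phi> t) k, corner (\<phi> t) (Suc k mod 5)}" if "t \<in> tiles X V E" "k < 5" for t k
    by (rule side_Int_vertices[OF that(1) sp(1)[OF that(1)] that(2)])
  show ce: "corner (\<phi> t) k = corner (\<phi> t) l \<longleftrightarrow> k = l" if "t \<in> tiles X V E" "k < 5" "l < 5" for t k l
    by (rule corner_eq_iff[OF that(1) sp(1)[OF that(1)] that(2,3)])
  show "side (\<phi> t) k = side (\<phi> t) l \<longleftrightarrow> k = l" if "t \<in> tiles X V E" "k < 5" "l < 5" for t k l
    by (rule side_eq_iff[OF that(1) sp(1)[OF that(1)] that(2,3)])
  show "card {t \<in> tiles X V E. e \<in> side (\<phi> t) ` {..<5}} = 2" if e: "e \<in> E" for e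
  proof -
    have "{t \<in> tiles X V E. e \<in> side (\<phi> t) ` {..<5}} = {t \<in> tiles X V E. e \<subseteq> X closure_of t}"
      using edge_subset_closure_iff[OF _ sp(1) e] by blast
    then show ?thesis using edge_tiles_card[OF e] by simp
  qed
  have cV: "corner (\<phi> t) k \<in> V" if "t \<in> tiles X V E" "k < 5" for t k
    by (rule corner_in[OF that(1) sp(1)[OF that(1)] that(2)])
  have tv: "tile_vertices X V t \<inter> L = {corner (\<phi> t) 0}"
    "\<forall>u\<in>tile_vertices X V t - {corner (\<phi> t) 0}. vertex_degree V E u = 3" if t: "t \<in> tiles X V E" for t
  proof -
    obtain v where v: "tile_vertices X V t \<inter> L = {v}" "\<forall>u\<in>tile_vertices X V t - {v}. vertex_degree V E u = 3"
      using L_tile t by blast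
    have "corner (\<phi> t) 0 \<in> tile_vertices X V t" using tile_vertices_eq[OF t sp(1)[OF t]] by simp
    then have "corner (\<phi> t) 0 \<in> tile_vertices X V t \<inter> L" using sp(2)[OF t] by simp
    then have "v = corner (\<phi> t) 0" unfolding v(1) by simp
    then show "tile_vertices X V t \<inter> L = {corner (\<phi> t) 0}"
      "\<forall>u\<in>tile_vertices X V t - {corner (\<phi> t) 0}. vertex_degree V E u = 3" using v by auto
  qed
  have ct: "corner (\<phi> t) k \<in> tile_vertices X V t" if "t \<in> tiles X V E" "k < 5" for t k
    using tile_vertices_eq[OF that(1) sp(1)[OF that(1)]] that(2) by simp
  show "corner (\<phi> t) k \<in> L \<longleftrightarrow> k = 0" if "t \<in> tiles X V E" "k < 5" for t k
    using tv(1)[OF that(1)] ct[OF that] sp(2)[OF that(1)] ce[OF that, of 0] by auto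
  show "card {e \<in> E. corner (\<phi> t) k \<in> e \<inter> V} = 3" if "t \<in> tiles X V E" "k < 5" "k \<noteq> 0" for t k
  proof -
    have "vertex_degree V E (corner (\<phi> t) k) = 3"
      using tv(2)[OF that(1)] ct[OF that(1,2)] ce[OF that(1,2), of 0] that(3) by simp
    then show ?thesis using cV[OF that(1,2)] by (simp add: vertex_degree_eq)
  qed
qed

abbreviation spoke_vertices :: "'a set" where
  "spoke_vertices \<equiv> pentagon_scheme.A E (\<lambda>e. e \<inter> V) L"

text \<open>Reflecting a tile keeps corner 0 and exchanges corners 2 and 3. The set
  \<open>spoke_vertices\<close> depends on edges and labels only, so each tile can be reflected
  independently of the others.\<close>

lemma oriented_exists:
  "\<exists>\<phi>. L_based \<phi> \<and> oriented_pentagon_scheme (tiles X V E) E (\<lambda>e. e \<inter> V) L (\<lambda>t. corner (\<phi> t)) (\<lambda>t. side (\<phi> t))"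
proof -
  obtain \<phi> where \<phi>: "L_based \<phi>" using L_based_exists by blast
  interpret P: pentagon_scheme "tiles X V E" E "\<lambda>e. e \<inter> V" L "\<lambda>t. corner (\<phi> t)" "\<lambda>t. side (\<phi> t)"
    by (rule L_based_scheme[OF \<phi>])
  have "\<exists>\<psi>. simple_pentagon X V E t \<psi> \<and> corner \<psi> 0 \<in> L \<and> corner \<psi> 2 \<notin> spoke_vertices" if t: "t \<in> tiles X V E" for t
  proof -
    have sp: "simple_pentagon X V E t (\<phi> t)" "corner (\<phi> t) 0 \<in> L" using \<phi> t by (auto simp: L_based_def)
    show ?thesis
    proof (cases "corner (\<phi> t) 2 \<in> spoke_vertices")
      case True
      then have 3: "corner (\<phi> t) 3 \<notin> spoke_vertices" using P.exactly_one_A[OF t] by blast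
      obtain \<psi> where \<psi>: "simple_pentagon X V E t \<psi>"
        "\<forall>k s. k < 5 \<longrightarrow> \<psi> (polygon_side 5 k s) = \<phi> t (polygon_side 5 (4 - k) (1 - s))"
        using simple_pentagon_reflect[OF t sp(1)] by blast
      have "corner \<psi> 0 = corner (\<phi> t) 0" using \<psi>(2) corner_Suc[OF t sp(1), of 4] by simp
      moreover have "corner \<psi> 2 = corner (\<phi> t) 3" using \<psi>(2) corner_Suc[OF t sp(1), of 2] by simp
      ultimately show ?thesis using \<psi>(1) sp(2) 3 by auto
    qed (use sp in blast)
  qed
  then obtain \<psi> where \<psi>: "\<forall>t\<in>tiles X V E. simple_pentagon X V E t (\<psi> t) \<and> corner (\<psi> t) 0 \<in> L \<and> corner (\<psi> t) 2 \<notin> spoke_vertices"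
    by (metis bchoice)
  then have 1: "L_based \<psi>" by (simp add: L_based_def)
  have "oriented_pentagon_scheme (tiles X V E) E (\<lambda>e. e \<inter> V) L (\<lambda>t. corner (\<psi> t)) (\<lambda>t. side (\<psi> t))"
    by (intro oriented_pentagon_scheme.intro L_based_scheme[OF 1] oriented_pentagon_scheme_axioms.intro) (use \<psi> in blast)
  then show ?thesis using 1 by blast
qed

text \<open>One parametrization is fixed for every edge, and each tile follows it forwards or
  backwards according to its own direction. Two tiles at an edge have opposite directions there, so
  their parameters are \<open>s\<close> and \<open>1 - s\<close>.\<close>

lemma matched_exists:
  "\<exists>\<phi>. matched_pentagonal_tiling X V E \<phi> \<and>
    oriented_pentagon_scheme (tiles X V E) E (\<lambda>e. e \<inter> V) L (\<lambda>t. corner (\<phi> t)) (\<lambda>t. side (\<phi> t))"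
proof -
  obtain \<phi> where \<phi>: "L_based \<phi>"
    "oriented_pentagon_scheme (tiles X V E) E (\<lambda>e. e \<inter> V) L (\<lambda>t. corner (\<phi> t)) (\<lambda>t. side (\<phi> t))"
    using oriented_exists by blast
  interpret P: oriented_pentagon_scheme "tiles X V E" E "\<lambda>e. e \<inter> V" L "\<lambda>t. corner (\<phi> t)" "\<lambda>t. side (\<phi> t)"
    by (rule \<phi>(2))
  have sp: "simple_pentagon X V E t (\<phi> t)" if "t \<in> tiles X V E" for t using \<phi>(1) that by (simp add: L_based_def)
  obtain g where g: "\<forall>e\<in>E. edge_path X V (g e) \<and> e = g e ` {0..1}" using edge_pathE by (metis bchoice)
  define p where "p t k s = (if g (side (\<phi> t) k) 0 = corner (\<phi> t) k then g (side (\<phi> t) k) s else g (side (\<phi> t) k) (1 - s))" for t k s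
  have p: "pathin X (p t k) \<and> inj_on (p t k) {0..1} \<and> p t k ` {0..1} = side (\<phi> t) k \<and>
      p t k 0 = corner (\<phi> t) k \<and> p t k 1 = corner (\<phi> t) (Suc k mod 5)" if t: "t \<in> tiles X V E" and k: "k < 5" for t k
  proof -
    let ?e = "side (\<phi> t) k" let ?g = "g ?e"
    have ge: "edge_path X V ?g" "?g ` {0..1} = ?e" using g pentagon_side(2)[OF t sp[OF t] k] by auto
    note gi = edge_path_inj[OF t sp[OF t] k ge]
    note r = edge_path_reverse[OF ge(1)]
    show ?thesis
    proof (cases "?g 0 = corner (\<phi> t) k")
      case True
      have ne: "corner (\<phi> t) k \<noteq> corner (\<phi> t) (Suc k mod 5)"
      proof -
        have "Suc k mod 5 \<noteq> k" "Suc k mod 5 < 5" using k by presburger+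
        then show ?thesis using corner_eq_iff[OF t sp[OF t] k] by metis
      qed
      have "p t k = ?g" using True by (auto simp: p_def)
      then show ?thesis using ge gi True ne by (auto simp: edge_path_def)
    next
      case False
      have "p t k = (\<lambda>s. ?g (1 - s))" using False by (auto simp: p_def)
      moreover have "inj_on (\<lambda>s. ?g (1 - s)) {0..1}" 
      proof (rule inj_onI)
        fix x y :: real assume "x \<in> {0..1}" "y \<in> {0..1}" "?g (1 - x) = ?g (1 - y)"
        then show "x = y" using inj_onD[OF gi(1), of "1 - x" "1 - y"] by simp
      qed
      ultimately show ?thesis using r ge gi(2) False by (auto simp: edge_path_def)
    qed
  qed
  have "\<exists>\<psi>. simple_pentagon X V E t \<psi> \<and> (\<forall>k s. k < 5 \<longrightarrow> s \<in> {0..1} \<longrightarrow> \<psi> (polygon_side 5 k s) = p t k s)"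
    if t: "t \<in> tiles X V E" for t
    by (rule simple_pentagon_reparam[OF t sp[OF t], of "p t"]) (use p[OF t] in blast)+
  then obtain \<psi> where \<psi>: "\<forall>t\<in>tiles X V E. simple_pentagon X V E t (\<psi> t) \<and>
      (\<forall>k s. k < 5 \<longrightarrow> s \<in> {0..1} \<longrightarrow> \<psi> t (polygon_side 5 k s) = p t k s)" by (metis bchoice)
  have sd: "side (\<psi> t) k = side (\<phi> t) k" if t: "t \<in> tiles X V E" and k: "k < 5" for t k
  proof -
    have "(\<psi> t \<circ> polygon_side 5 k) ` {0..1} = p t k ` {0..1}" by (rule image_cong) (use \<psi> t k in auto)
    then show ?thesis using p[OF t k] by simp
  qed
  have co: "corner (\<psi> t) k = corner (\<phi> t) k" if t: "t \<in> tiles X V E" and k: "k < 5" for t k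
    using \<psi> p[OF t k] t k by simp
  have "matched_pentagonal_tiling X V E \<psi>"
  proof
    show "simple_pentagon X V E t (\<psi> t)" if "t \<in> tiles X V E" for t using \<psi> that by blast
    fix t t' k k' and s :: real
    assume t: "t \<in> tiles X V E" "t' \<in> tiles X V E" "t \<noteq> t'" and k: "k < 5" "k' < 5"
      and e: "side (\<psi> t) k = side (\<psi> t') k'" and s: "s \<in> {0..1}"
    have e': "side (\<phi> t) k = side (\<phi> t') k'" using e sd t k by simp
    note C = P.common_side[OF t k e']
    have ge: "edge_path X V (g (side (\<phi> t) k))" "g (side (\<phi> t) k) ` {0..1} = side (\<phi> t) k"
      using g pentagon_side(2)[OF t(1) sp[OF t(1)] k(1)] by auto
    note gi = edge_path_inj[OF t(1) sp[OF t(1)] k(1) ge]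
    have "corner (\<phi> t) k \<noteq> corner (\<phi> t) (Suc k mod 5)"
    proof -
      have "Suc k mod 5 \<noteq> k" "Suc k mod 5 < 5" using k by presburger+
      then show ?thesis using corner_eq_iff[OF t(1) sp[OF t(1)] k(1)] by metis
    qed
    then have "p t k s = p t' k' (1 - s)" using gi(2) C(2,3) e' by (auto simp: p_def)
    then show "\<psi> t (polygon_side 5 k s) = \<psi> t' (polygon_side 5 k' (1 - s))" using \<psi> t k s by simp
  qed
  moreover have "oriented_pentagon_scheme (tiles X V E) E (\<lambda>e. e \<inter> V) L (\<lambda>t. corner (\<psi> t)) (\<lambda>t. side (\<psi> t))"
  proof (intro oriented_pentagon_scheme.intro oriented_pentagon_scheme_axioms.intro)
    have "L_based \<psi>" unfolding L_based_def using \<psi> co \<phi>(1) by (auto simp: L_based_def)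
    then show "pentagon_scheme (tiles X V E) E (\<lambda>e. e \<inter> V) L (\<lambda>t. corner (\<psi> t)) (\<lambda>t. side (\<psi> t))"
      by (rule L_based_scheme)
    show "corner (\<psi> t) 2 \<notin> spoke_vertices" if "t \<in> tiles X V E" for t using P.c_2[OF that] co[OF that] by simp
  qed
  ultimately show ?thesis by blast
qed

end

subsection \<open>Decomposition of a triangle into three pentagons\<close>

text \<open>Precomposition with the inverse rotation reduces this to an unrotated circle, and
  rotations preserve orientation.\<close>

lemma orientation_preserving_on_ball_boundary_rotated:
  assumes R: "continuous_on (cball 0 1) R" "inj_on R (cball 0 1)" and m: "m \<in> R ` ball 0 1" and c: "cmod c = 1"
    and b: "\<And>u. cmod u = 1 \<Longrightarrow> m \<notin> closed_segment (R u) (m + c * u)"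
  shows "orientation_preserving_on (ball 0 1) R"
proof -
  have c0: "c \<noteq> 0" using c by auto
  define R' where "R' = R \<circ> (\<lambda>z. z / c)"
  have sub: "(\<lambda>z. z / c) ` cball 0 1 = cball 0 1" "(\<lambda>z. z / c) ` ball 0 1 = ball 0 1"
    using c c0 by (auto simp: norm_divide norm_mult intro!: image_eqI[of _ _ "c * x" for x])
  have inj: "inj_on (\<lambda>z. z / c) S" for S using c0 by (simp add: inj_on_def)
  have cont: "continuous_on S (\<lambda>z. z / c)" for S using c0 by (intro continuous_intros) simp
  have "orientation_preserving_on (ball 0 1) R'"
  proof (rule orientation_preserving_on_ball_boundary)
    show "continuous_on (cball 0 1) R'"
      unfolding R'_def using continuous_on_compose[OF cont] R(1) sub(1) by metis
    show "inj_on R' (cball 0 1)" unfolding R'_def using comp_inj_on[OF inj] R(2) sub(1) by metis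
    show "m \<in> R' ` ball 0 1" unfolding R'_def image_comp[symmetric] sub(2) by (rule m)
    fix u :: complex assume "cmod u = 1"
    then have "m \<notin> closed_segment (R (u / c)) (m + c * (u / c))" using c by (intro b) (simp add: norm_divide)
    then show "m \<notin> closed_segment (R' u) (m + u)" using c0 by (simp add: R'_def)
  qed
  moreover have "continuous_on (ball 0 1) R'" "inj_on R' (ball 0 1)"
  proof -
    have "continuous_on (ball 0 1) R" "inj_on R (ball 0 1)"
      using continuous_on_subset[OF R(1) ball_subset_cball] inj_on_subset[OF R(2) ball_subset_cball] .
    then show "continuous_on (ball 0 1) R'" "inj_on R' (ball 0 1)"
      unfolding R'_def using continuous_on_compose[OF cont] comp_inj_on[OF inj] sub(2) by metis+
  qed
  moreover have "(\<lambda>z. c * z) ` ball 0 1 \<subseteq> ball 0 1" using c by (auto simp: norm_mult)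
  moreover have "orientation_preserving_on (ball 0 1) (\<lambda>z. c * z)"
    using orientation_preserving_on_subset[OF orientation_preserving_on_mult[OF c0]] by simp
  moreover have "continuous_on (ball 0 1) (\<lambda>z. c * z)" "inj_on (\<lambda>z. c * z) (ball 0 1)"
    using c0 by (auto intro!: continuous_intros simp: inj_on_def)
  ultimately have "orientation_preserving_on (ball 0 1) (R' \<circ> (\<lambda>z. c * z))"
    by (intro orientation_preserving_on_compose[of "ball 0 1" "\<lambda>z. c * z" "ball 0 1" R'] open_ball)
  moreover have "(R' \<circ> (\<lambda>z. c * z)) z = R z" for z using c0 by (simp add: R'_def)
  ultimately show ?thesis using orientation_preserving_on_cong[of "ball 0 1" "R' \<circ> (\<lambda>z. c * z)" R] by simp
qed

section \<open>A third of the disk, viewed as a pentagon\<close>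

definition sector :: "complex set" where
  "sector = cball 0 1 \<inter> {z. Im z \<le> sqrt 3 * Re z} \<inter> {z. - Im z \<le> sqrt 3 * Re z}"

text \<open>The two lines bound the points with argument between \<open>- pi / 3\<close> and
  \<open>pi / 3\<close>. Written with half-planes, the sector is visibly convex, as coning
  requires.\<close>

lemma sector_halfplanes:
  "{z. Im z \<le> sqrt 3 * Re z} = {z. Complex (- sqrt 3) 1 \<bullet> z \<le> 0}"
  "{z. - Im z \<le> sqrt 3 * Re z} = {z. Complex (- sqrt 3) (- 1) \<bullet> z \<le> 0}"
  by (auto simp: inner_complex_def)

lemma convex_sector: "convex sector"
  unfolding sector_def sector_halfplanes by (intro convex_Int convex_cball convex_halfspace_le)

lemma compact_sector: "compact sector"
  unfolding sector_def sector_halfplanes by (intro compact_Int_closed compact_cball closed_halfspace_le)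

lemma interior_sector:
  "interior sector = {z. cmod z < 1 \<and> Im z < sqrt 3 * Re z \<and> - Im z < sqrt 3 * Re z}"
proof -
  have n: "Complex (- sqrt 3) 1 \<noteq> 0" "Complex (- sqrt 3) (- 1) \<noteq> 0" by (simp_all add: complex_eq_iff)
  have eq: "interior sector = ball 0 1 \<inter> {z. Complex (- sqrt 3) 1 \<bullet> z < 0} \<inter> {z. Complex (- sqrt 3) (- 1) \<bullet> z < 0}"
    unfolding sector_def sector_halfplanes interior_Int interior_cball
      interior_halfspace_le[OF n(1)] interior_halfspace_le[OF n(2)] ..
  show ?thesis unfolding eq by (auto simp: inner_complex_def)
qed

lemma cis_in_sector:
  assumes "\<bar>a\<bar> \<le> pi / 3" "0 \<le> r" "r \<le> 1"
  shows "of_real r * cis a \<in> sector"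
proof -
  have "cos (pi / 3) \<le> cos \<bar>a\<bar>" using assms(1) by (intro cos_monotone_0_pi_le) auto
  then have c: "1 / 2 \<le> cos a" by (simp add: cos_60)
  have "sin a \<le> sin (pi / 3)" "sin (- a) \<le> sin (pi / 3)"
    using assms(1) by (auto intro!: sin_monotone_2pi_le simp del: sin_minus)
  then have s: "sin a \<le> sqrt 3 / 2" "- sin a \<le> sqrt 3 / 2" by (simp_all add: sin_60)
  have "sqrt 3 * (1 / 2) \<le> sqrt 3 * cos a" using c by (intro mult_left_mono) auto
  then have "sin a \<le> sqrt 3 * cos a" "- sin a \<le> sqrt 3 * cos a" using s by linarith+
  then have "r * sin a \<le> r * (sqrt 3 * cos a)" "r * (- sin a) \<le> r * (sqrt 3 * cos a)"
    using mult_left_mono[OF _ assms(2)] by blast+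
  then show ?thesis using assms by (simp add: sector_def norm_mult mult.left_commute)
qed

lemma cis_eq_cis_iff: "\<bar>a\<bar> \<le> pi / 2 \<Longrightarrow> \<bar>b\<bar> \<le> pi / 2 \<Longrightarrow> cis a = cis b \<longleftrightarrow> a = b"
  using sin_inj_pi[of a b] by (auto simp: complex_eq_iff)

text \<open>The sector is regarded as a pentagon with corner 2 at the origin. Side 0 is the last third of its
  circular arc, sides 3 and 4 are the first two thirds, and sides 1 and 2 are the radii.\<close>

definition sector_side :: "nat \<Rightarrow> real \<Rightarrow> complex" where
  "sector_side k s = (if k = 0 then cis (pi / 9 + s * (2 * pi / 9))
     else if k = 1 then of_real (1 - s) * cis (pi / 3)
     else if k = 2 then of_real s * cis (- pi / 3)
     else if k = 3 then cis (- pi / 3 + s * (2 * pi / 9))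
     else cis (- pi / 9 + s * (2 * pi / 9)))"

lemma sector_side_simps:
  "sector_side 0 s = cis (pi / 9 + s * (2 * pi / 9))" "sector_side 1 s = of_real (1 - s) * cis (pi / 3)"
  "sector_side 2 s = of_real s * cis (- pi / 3)" "sector_side 3 s = cis (- pi / 3 + s * (2 * pi / 9))"
  "sector_side 4 s = cis (- pi / 9 + s * (2 * pi / 9))"
  by (simp_all add: sector_side_def)

lemma sector_side_frontier:
  assumes "k < 5" "s \<in> {0..1}"
  shows "sector_side k s \<in> frontier sector"
proof -
  define x where "x = s * (2 * pi / 9)"
  have x: "0 \<le> x" "x \<le> 2 * pi / 9"
    using assms(2) mult_right_mono[of s 1 "2 * pi / 9"] by (auto simp: x_def)
  have 1: "cis a \<in> sector \<and> cis a \<notin> interior sector" if "\<bar>a\<bar> \<le> pi / 3" for a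
    using cis_in_sector[of a 1] that by (simp add: interior_sector)
  have 2: "of_real r * cis (pi / 3) \<in> sector \<and> of_real r * cis (pi / 3) \<notin> interior sector"
    "of_real r * cis (- pi / 3) \<in> sector \<and> of_real r * cis (- pi / 3) \<notin> interior sector" if "r \<in> {0..1}" for r
    using cis_in_sector[of "pi / 3" r] cis_in_sector[of "- pi / 3" r] that
    by (auto simp: interior_sector cos_60 sin_60)
  have "sector_side k s \<in> sector \<and> sector_side k s \<notin> interior sector"
    using assms(1) unfolding less_5_cases
  proof (elim disjE)
    assume k: "k = 0"
    have "\<bar>pi / 9 + x\<bar> \<le> pi / 3" using x pi_gt_zero by (intro abs_leI) linarith+
    from 1[OF this] show ?thesis unfolding k sector_side_simps x_def .
  next
    assume "k = 1" then show ?thesis using 2(1)[of "1 - s"] assms(2) by (simp add: sector_side_def)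
  next
    assume "k = 2" then show ?thesis using 2(2)[of s] assms(2) by (simp add: sector_side_simps)
  next
    assume k: "k = 3"
    have "\<bar>- pi / 3 + x\<bar> \<le> pi / 3" using x pi_gt_zero by (intro abs_leI) linarith+
    from 1[OF this] show ?thesis unfolding k sector_side_simps x_def .
  next
    assume k: "k = 4"
    have "\<bar>- pi / 9 + x\<bar> \<le> pi / 3" using x pi_gt_zero by (intro abs_leI) linarith+
    from 1[OF this] show ?thesis unfolding k sector_side_simps x_def .
  qed
  then show ?thesis using closure_subset by (auto simp: frontier_def)
qed

lemma sector_side_inj:
  assumes k: "k < 5" "l < 5" and s: "s \<in> {0..<1}" "s' \<in> {0..<1}" and e: "sector_side k s = sector_side l s'"
  shows "k = l \<and> s = s'"
proof -
  \<comment> \<open>\<open>a k s\<close> is the argument of the point on an arc side; the half-open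
    ranges for sides 3, 4 and 0 follow each other.\<close>
  define a where "a k s = (if k = 0 then pi / 9 else if k = 3 then - pi / 3 else - pi / 9) + s * (2 * pi / 9)" for k :: nat and s :: real
  have arc: "sector_side k s = cis (a k s)" if "k = 0 \<or> k = 3 \<or> k = 4" for k s
    using that by (auto simp: sector_side_def a_def)
  have n: "cmod (sector_side k s) = (if k = 1 then 1 - s else if k = 2 then s else 1)" if "k < 5" "s \<in> {0..<1}" for k s
    using that unfolding less_5_cases by (auto simp: sector_side_def norm_mult simp del: of_real_diff)
  have p: "0 \<le> s * (2 * pi / 9)" "s * (2 * pi / 9) < 2 * pi / 9" if "s \<in> {0..<1}" for s
    using that mult_strict_right_mono[of s 1 "2 * pi / 9"] by auto
  have av: "a 0 s = pi / 9 + s * (2 * pi / 9)" "a 3 s = - (pi / 3) + s * (2 * pi / 9)" "a 4 s = - (pi / 9) + s * (2 * pi / 9)" for s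
    by (simp_all add: a_def)
  have bnd: "pi / 9 \<le> a 0 s" "a 0 s < pi / 3" "- (pi / 3) \<le> a 3 s" "a 3 s < - (pi / 9)" "- (pi / 9) \<le> a 4 s" "a 4 s < pi / 9"
    if "s \<in> {0..<1}" for s
    using p[OF that] pi_gt_zero unfolding av by linarith+
  have b: "\<bar>a k s\<bar> \<le> pi / 2" "a k s < pi / 3" if "k = 0 \<or> k = 3 \<or> k = 4" "s \<in> {0..<1}" for k s
  proof -
    have "- (pi / 2) \<le> a k s \<and> a k s < pi / 3"
      using that(1)
    proof (elim disjE)
      assume k: "k = 0" show ?thesis unfolding k using bnd[OF that(2)] pi_gt_zero by (intro conjI; linarith)
    next
      assume k: "k = 3" show ?thesis unfolding k using bnd[OF that(2)] pi_gt_zero by (intro conjI; linarith)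
    next
      assume k: "k = 4" show ?thesis unfolding k using bnd[OF that(2)] pi_gt_zero by (intro conjI; linarith)
    qed
    then have "- (pi / 2) \<le> a k s" "a k s < pi / 3" by auto
    then show "\<bar>a k s\<bar> \<le> pi / 2" using pi_gt_zero by (intro abs_leI; linarith)
    show "a k s < pi / 3" by fact
  qed
  have eq: "k = l \<and> s = s'"
    if "k = 0 \<or> k = 3 \<or> k = 4" "l = 0 \<or> l = 3 \<or> l = 4" "sector_side k s = sector_side l s'" "s \<in> {0..<1}" "s' \<in> {0..<1}" for k l s s'
  proof -
    have A: "a k s = a l s'"
      using that(3) arc[OF that(1)] arc[OF that(2)] cis_eq_cis_iff[OF b(1)[OF that(1,4)] b(1)[OF that(2,5)]] by simp
    have "a k s \<noteq> a l s'" if "(k, l) \<in> {(0, 3), (0, 4), (3, 0), (3, 4), (4, 0), (4, 3)}"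
      using that bnd[OF \<open>s \<in> {0..<1}\<close>] bnd[OF \<open>s' \<in> {0..<1}\<close>] pi_gt_zero by auto
    then have "k = l" using that(1,2) A by auto
    then show ?thesis using A by (simp add: a_def)
  qed
  have ne: False if "k = 0 \<or> k = 3 \<or> k = 4" "l = 1 \<or> l = 2" "sector_side k s = sector_side l s'" "s \<in> {0..<1}" "s' \<in> {0..<1}" for k l s s'
  proof -
    have "cmod (sector_side k s) = 1" "cmod (sector_side l s') = (if l = 1 then 1 - s' else s')"
      using n[of k s] n[of l s'] that(1,2,4,5) by auto
    then have "l = 1" "s' = 0" using that(3,5) by (auto split: if_splits)
    then have "cis (a k s) = cis (pi / 3)" using that(3) arc[OF that(1)] by (simp add: sector_side_def)
    then have "a k s = pi / 3" using cis_eq_cis_iff[OF b(1)[OF that(1,4)], of "pi / 3"] by simp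
    then show False using b(2)[OF that(1,4)] by simp
  qed
  have ne12: False if "sector_side 1 s = sector_side 2 s'" "s \<in> {0..<1}" "s' \<in> {0..<1}" for s s'
  proof -
    have "Im (sector_side 1 s) = Im (sector_side 2 s')" using that(1) by simp
    then have "(1 - s) * (sqrt 3 / 2) = - (s' * (sqrt 3 / 2))" by (simp add: sector_side_def sin_60)
    then have "(1 - s) * sqrt 3 = - s' * sqrt 3" by simp
    then have "1 - s = - s'" by (simp only: mult_cancel_right) simp
    then show False using that by simp
  qed
  have c: "cis (pi / 3) \<noteq> 0" "cis (- pi / 3) \<noteq> 0" by simp_all
  consider "k = 0 \<or> k = 3 \<or> k = 4" "l = 0 \<or> l = 3 \<or> l = 4" | "k = 0 \<or> k = 3 \<or> k = 4" "l = 1 \<or> l = 2"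
    | "k = 1 \<or> k = 2" "l = 0 \<or> l = 3 \<or> l = 4" | "k = 1" "l = 1" | "k = 2" "l = 2" | "k = 1" "l = 2" | "k = 2" "l = 1"
    using k unfolding less_5_cases by blast
  then show ?thesis
  proof cases
    case 1 then show ?thesis by (rule eq[OF _ _ e s])
  next
    case 2 then have False by (rule ne[OF _ _ e s]) then show ?thesis ..
  next
    case 3 then show ?thesis using ne[OF 3(2,1) e[symmetric] s(2,1)] by simp
  next
    case 4 then show ?thesis using e c by (simp add: sector_side_def)
  next
    case 5 then show ?thesis using e c by (simp add: sector_side_def)
  next
    case 6 then show ?thesis using ne12[of s s'] e s by simp
  next
    case 7 then show ?thesis using ne12[of s' s] e s by simp
  qed
qed

text \<open>Seen from \<open>1 / 2\<close>, side \<open>k\<close> of the sector lies in the open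
  half-plane around the angle \<open>2 * pi * (k + 1) / 5\<close>. Side \<open>k\<close> of the
  regular polygon, turned by \<open>pi / 5\<close>, is centered at the same angle. Hence no segment
  between corresponding boundary points passes through \<open>1 / 2\<close>, which settles the
  orientation of the map of the sector.\<close>

lemma sector_side_positive:
  assumes "k < 5" "s \<in> {0..1}"
  shows "0 < Re (cnj (cis (2 * pi * real (k + 1) / 5)) * (sector_side k s - 1 / 2))"
proof -
  define x where "x = s * (2 * pi / 9)"
  have x: "0 \<le> x" "x \<le> 2 * pi / 9"
    using assms(2) mult_right_mono[of s 1 "2 * pi / 9"] by (auto simp: x_def)
  have gen: "Re (cnj (cis d) * (of_real r * cis a - 1 / 2)) = r * cos (a - d) - cos d / 2" for d r a
    by (simp add: cos_diff algebra_simps)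
  have big: "1 / 2 < cos x" if "\<bar>x\<bar> < pi / 3" for x
    using cos_monotone_0_pi[of "\<bar>x\<bar>" "pi / 3"] that by (simp add: cos_60)
  have small: "cos d < 1 / 2" if "pi / 3 < d" "d \<le> pi" for d
    using cos_monotone_0_pi[of "pi / 3" d] that by (simp add: cos_60)
  have c72: "cos (2 * pi / 5) < 1 / 2" by (rule small) auto
  have c144: "cos (4 * pi / 5) < 0"
    using cos_monotone_0_pi[of "pi / 2" "4 * pi / 5"] by simp
  \<comment> \<open>\<open>7 * pi / 15\<close> is the angle between the radius at
    \<open>pi / 3\<close> and the direction \<open>4 * pi / 5\<close> for side 1, and likewise for
    side 2 by symmetry.\<close>
  have c84: "0 \<le> cos (7 * pi / 15)" by (rule cos_ge_zero) (use pi_gt_zero in linarith)+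
  have per: "cos (y - 2 * pi) = cos y" for y using cos_periodic[of "y - 2 * pi"] by simp
  have per': "cos (2 * pi - y) = cos y" for y using per[of "-y"] cos_minus[of "2 * pi - y"] by (simp add: cos_minus)
  show ?thesis using assms(1) unfolding less_5_cases
  proof (elim disjE)
    assume k: "k = 0"
    have "1 / 2 < cos (pi / 9 + x - 2 * pi / 5)" by (rule big, rule abs_less_iff[THEN iffD2]) (use x pi_gt_zero in \<open>intro conjI; linarith\<close>)
    then show ?thesis using k gen[of "2 * pi / 5" 1 "pi / 9 + x"] c72 by (simp add: sector_side_def x_def)
  next
    assume k: "k = 1"
    have "pi / 3 - 4 * pi / 5 = - (7 * pi / 15)" by simp
    then have "cos (pi / 3 - 4 * pi / 5) = cos (7 * pi / 15)" by (metis cos_minus)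
    then have "0 \<le> (1 - s) * cos (pi / 3 - 4 * pi / 5)" using c84 assms(2) by simp
    then show ?thesis using k gen[of "4 * pi / 5" "1 - s" "pi / 3"] c144 by (simp add: sector_side_def)
  next
    assume k: "k = 2"
    have "- pi / 3 - 6 * pi / 5 = (7 * pi / 15 - 2 * pi)" by simp
    then have "cos (- pi / 3 - 6 * pi / 5) = cos (7 * pi / 15)" by (metis per)
    then have 1: "0 \<le> s * cos (- pi / 3 - 6 * pi / 5)" using c84 assms(2) by simp
    have "6 * pi / 5 = 2 * pi - 4 * pi / 5" by simp
    then have "cos (6 * pi / 5) = cos (4 * pi / 5)" by (metis per')
    then show ?thesis using k gen[of "6 * pi / 5" s "- pi / 3"] c144 1 by (simp add: sector_side_def)
  next
    assume k: "k = 3"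
    have "1 / 2 < cos (- pi / 3 + x + 2 * pi / 5)" by (rule big, rule abs_less_iff[THEN iffD2]) (use x pi_gt_zero in \<open>intro conjI; linarith\<close>)
    moreover have "- pi / 3 + x - 8 * pi / 5 = (- pi / 3 + x + 2 * pi / 5) - 2 * pi" by simp
    then have "cos (- pi / 3 + x - 8 * pi / 5) = cos (- pi / 3 + x + 2 * pi / 5)" by (metis per)
    moreover have "8 * pi / 5 = 2 * pi - 2 * pi / 5" by simp
    then have "cos (8 * pi / 5) = cos (2 * pi / 5)" by (metis per')
    ultimately show ?thesis using k gen[of "8 * pi / 5" 1 "- pi / 3 + x"] c72 by (simp add: sector_side_def x_def)
  next
    assume k: "k = 4"
    have "1 / 2 < cos (- pi / 9 + x)" by (rule big, rule abs_less_iff[THEN iffD2]) (use x pi_gt_zero in \<open>intro conjI; linarith\<close>)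
    then show ?thesis using k gen[of "2 * pi" 1 "- pi / 9 + x"] per[of "- pi / 9 + x"] by (simp add: sector_side_def x_def)
  qed
qed

text \<open>The labelled sides give an injective map from the circle to the frontier of the sector,
  which is coned from the interior point \<open>1 / 2\<close>.\<close>

lemma sector_map_exists:
  "\<exists>R. continuous_on (cball 0 1) R \<and> inj_on R (cball 0 1) \<and> R ` cball 0 1 = sector \<and> R ` ball 0 1 = interior sector \<and>
     orientation_preserving_on (ball 0 1) R \<and> (\<forall>k<5. \<forall>s\<in>{0..1}. R (polygon_side 5 k s) = sector_side k s)"
proof -
  have c: "continuous_on {0..1} (sector_side k)" for k
    unfolding sector_side_def cis_conv_exp by (cases "k = 0"; cases "k = 1"; cases "k = 2"; cases "k = 3") (auto intro!: continuous_intros)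
  have j: "sector_side k 1 = sector_side (Suc k mod 5) 0" if "k < 5" for k
    using that unfolding less_5_cases by (elim disjE) (simp_all add: sector_side_def)
  obtain \<rho> where \<rho>: "continuous_on (sphere 0 1) \<rho>"
    "\<And>k s. k < 5 \<Longrightarrow> s \<in> {0..1} \<Longrightarrow> \<rho> (polygon_side 5 k s) = sector_side k s"
    using circle_map_from_sides[of 5 sector_side] c j by auto
  have inj: "inj_on \<rho> (sphere 0 1)"
  proof (rule inj_on_circle_from_sides[of 5 \<rho> sector_side])
    show "inj_on (sector_side k) {0..<1}" if "k < 5" for k
      using sector_side_inj[OF that that] by (auto intro: inj_onI)
    show "sector_side k s \<noteq> sector_side l s'" if "k < 5" "l < 5" "k \<noteq> l" "s \<in> {0..<1}" "s' \<in> {0..<1}" for k l s s'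
      using sector_side_inj that by blast
  qed (use \<rho>(2) in auto)
  have fr: "\<rho> ` sphere 0 1 \<subseteq> frontier sector"
  proof
    fix w assume "w \<in> \<rho> ` sphere 0 1"
    then obtain u where u: "cmod u = 1" "w = \<rho> u" by auto
    obtain k s where "k < 5" "0 \<le> s" "s < 1" "u = polygon_side 5 k s" using polygon_side_surj[OF u(1), of 5] by auto
    then show "w \<in> frontier sector" using \<rho>(2)[of k s] sector_side_frontier[of k s] u(2) by simp
  qed
  have m: "1 / 2 \<in> interior sector" by (simp add: interior_sector)
  then obtain R where R: "continuous_on (cball 0 1) R" "inj_on R (cball 0 1)" "\<forall>u. cmod u = 1 \<longrightarrow> R u = \<rho> u"
    "R ` cball 0 1 = sector" "R ` ball 0 1 = interior sector" "R 0 = 1 / 2"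
    by (rule cone_extension[OF compact_sector convex_sector _ \<rho>(1) inj fr])
  have sides: "\<forall>k<5. \<forall>s\<in>{0..1}. R (polygon_side 5 k s) = sector_side k s" using R(3) \<rho>(2) by simp
  have "orientation_preserving_on (ball 0 1) R"
  proof (rule orientation_preserving_on_ball_boundary_rotated[OF R(1,2), of "1 / 2" "cis (pi / 5)"])
    show "1 / 2 \<in> R ` ball 0 1" unfolding R(5) by (rule m)
    fix u :: complex assume u: "cmod u = 1"
    obtain k s where k: "k < 5" "0 \<le> s" "s < 1" "u = polygon_side 5 k s" using polygon_side_surj[OF u, of 5] by auto
    let ?d = "cnj (cis (2 * pi * real (k + 1) / 5))"
    have 1: "0 < Re (?d * (R u - 1 / 2))" using sector_side_positive[of k s] sides k by simp
    define y where "y = 2 * pi * (s - 1 / 2) / 5"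
    have "?d * (cis (pi / 5) * u) = cis (- (2 * pi * real (k + 1) / 5) + (pi / 5 + 2 * pi * (real k + s) / real 5))"
      by (simp add: k(4) polygon_side_def cis_cnj cis_mult)
    also have "- (2 * pi * real (k + 1) / 5) + (pi / 5 + 2 * pi * (real k + s) / real 5) = y"
      unfolding y_def by (simp add: field_simps)
    finally have "?d * (cis (pi / 5) * u) = cis y" .
    moreover have "0 < cos y"
    proof (rule cos_gt_zero_pi)
      define q where "q = s * pi"
      have q: "0 \<le> q" "q < pi" "y = (2 * q - pi) / 5" using k by (auto simp: y_def q_def field_simps)
      have "5 * y = 2 * q - pi" by (simp add: q(3))
      then have "- (5 * pi) < 10 * y" "10 * y < 5 * pi" using q(1,2) pi_gt_zero by linarith+
      then show "- (pi / 2) < y" "y < pi / 2" by linarith+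
    qed
    ultimately have 2: "0 < Re (?d * (cis (pi / 5) * u))" by simp
    show "1 / 2 \<notin> closed_segment (R u) (1 / 2 + cis (pi / 5) * u)"
    proof
      assume "1 / 2 \<in> closed_segment (R u) (1 / 2 + cis (pi / 5) * u)"
      then obtain x where x: "0 \<le> x" "x \<le> 1" "1 / 2 = (1 - x) *\<^sub>R R u + x *\<^sub>R (1 / 2 + cis (pi / 5) * u)"
        by (auto simp: closed_segment_def)
      have "(1 - x) *\<^sub>R (R u - 1 / 2) + x *\<^sub>R (cis (pi / 5) * u) = ((1 - x) *\<^sub>R R u + x *\<^sub>R (1 / 2 + cis (pi / 5) * u)) - 1 / 2"
        by (simp add: algebra_simps)
      also have "\<dots> = 0" using x(3) by simp
      finally have z: "(1 - x) *\<^sub>R (R u - 1 / 2) + x *\<^sub>R (cis (pi / 5) * u) = 0" .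
      have "(1 - x) *\<^sub>R (?d * (R u - 1 / 2)) + x *\<^sub>R (?d * (cis (pi / 5) * u)) =
          ?d * ((1 - x) *\<^sub>R (R u - 1 / 2) + x *\<^sub>R (cis (pi / 5) * u))"
        by (simp only: distrib_left mult_scaleR_right)
      also have "\<dots> = 0" unfolding z by simp
      finally have "Re ((1 - x) *\<^sub>R (?d * (R u - 1 / 2)) + x *\<^sub>R (?d * (cis (pi / 5) * u))) = Re 0" by (rule arg_cong)
      then have s0: "(1 - x) * Re (?d * (R u - 1 / 2)) + x * Re (?d * (cis (pi / 5) * u)) = 0" by simp
      have n: "0 \<le> (1 - x) * Re (?d * (R u - 1 / 2))" "0 \<le> x * Re (?d * (cis (pi / 5) * u))" using 1 2 x(1,2) by simp_all
      then have "x * Re (?d * (cis (pi / 5) * u)) = 0" "(1 - x) * Re (?d * (R u - 1 / 2)) = 0" using s0 by linarith+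
      then show False using 1 2 by auto
    qed
  qed simp
  then show ?thesis using R(1,2,4,5) sides by blast
qed

definition sector_map :: "complex \<Rightarrow> complex" where
  "sector_map = (SOME R. continuous_on (cball 0 1) R \<and> inj_on R (cball 0 1) \<and> R ` cball 0 1 = sector \<and> R ` ball 0 1 = interior sector \<and>
     orientation_preserving_on (ball 0 1) R \<and> (\<forall>k<5. \<forall>s\<in>{0..1}. R (polygon_side 5 k s) = sector_side k s))"

lemma sector_map:
  "continuous_on (cball 0 1) sector_map" "inj_on sector_map (cball 0 1)" "sector_map ` cball 0 1 = sector"
  "sector_map ` ball 0 1 = interior sector" "orientation_preserving_on (ball 0 1) sector_map"
  "k < 5 \<Longrightarrow> s \<in> {0..1} \<Longrightarrow> sector_map (polygon_side 5 k s) = sector_side k s"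
  using someI_ex[OF sector_map_exists] unfolding sector_map_def[symmetric] by blast+

text \<open>The angle \<open>5 * pi / 9\<close> moves corner 3 of the sector to the first dividing point of side \<open>k\<close> of the triangle.\<close>

definition rot :: "nat \<Rightarrow> complex" where "rot k = cis (5 * pi / 9 + 2 * pi * real k / 3)"

definition third_map :: "nat \<Rightarrow> complex \<Rightarrow> complex" where "third_map k u = rot k * sector_map u"

lemma rot: "cmod (rot k) = 1" "rot k \<noteq> 0" "rot (k + 1) = rot k * cis (2 * pi / 3)" "rot (k + 3) = rot k"
proof -
  show "cmod (rot k) = 1" "rot k \<noteq> 0" by (simp_all add: rot_def)
  show r: "rot (k + 1) = rot k * cis (2 * pi / 3)" for k by (simp add: rot_def cis_mult field_simps)
  have "rot (k + 3) = rot k * (cis (2 * pi / 3) * cis (2 * pi / 3) * cis (2 * pi / 3))"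
    using r[of k] r[of "k + 1"] r[of "k + 2"] by (simp add: eval_nat_numeral)
  also have "cis (2 * pi / 3) * cis (2 * pi / 3) * cis (2 * pi / 3) = 1" by (simp add: cis_mult)
  finally show "rot (k + 3) = rot k" by simp
qed

lemma third_map:
  "continuous_on (cball 0 1) (third_map k)" "inj_on (third_map k) (cball 0 1)" "third_map k ` cball 0 1 \<subseteq> cball 0 1"
  "third_map k ` ball 0 1 \<subseteq> ball 0 1"
  "orientation_preserving_on (ball 0 1) (third_map k)"
proof -
  show "continuous_on (cball 0 1) (third_map k)"
    unfolding third_map_def by (intro continuous_intros sector_map(1))
  show "inj_on (third_map k) (cball 0 1)" using sector_map(2) rot(2)[of k] by (auto simp: inj_on_def third_map_def)
  show "third_map k ` cball 0 1 \<subseteq> cball 0 1"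
  proof
    fix w assume "w \<in> third_map k ` cball 0 1"
    then obtain z where "z \<in> sector" "w = rot k * z" using sector_map(3) unfolding third_map_def by blast
    then show "w \<in> cball 0 1" using rot(1)[of k] by (simp add: norm_mult sector_def)
  qed
  show "third_map k ` ball 0 1 \<subseteq> ball 0 1"
  proof
    fix w assume "w \<in> third_map k ` ball 0 1"
    then obtain z where "z \<in> interior sector" "w = rot k * z" using sector_map(4) unfolding third_map_def by blast
    then show "w \<in> ball 0 1" using rot(1)[of k] by (simp add: norm_mult interior_sector)
  qed
  have "orientation_preserving_on (ball 0 1) ((\<lambda>z. rot k * z) \<circ> sector_map)"
    by (rule orientation_preserving_on_compose[OF open_ball continuous_on_subset[OF sector_map(1) ball_subset_cball]
        inj_on_subset[OF sector_map(2) ball_subset_cball] sector_map(5) open_UNIV _ _ orientation_preserving_on_mult[OF rot(2)]])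
      (use rot(2) in \<open>auto intro!: continuous_intros simp: inj_on_def\<close>)
  then show "orientation_preserving_on (ball 0 1) (third_map k)"
    by (simp add: third_map_def[abs_def] o_def)
qed

text \<open>The turned sector straddles corner \<open>k + 1\<close> of the triangle: it contributes
  the last two thirds of side \<open>k\<close> and the first third of side
  \<open>k + 1\<close>.\<close>

lemma third_map_side:
  assumes "s \<in> {0..1}"
  shows "third_map k (polygon_side 5 0 s) = polygon_side 3 (k + 1) (s / 3)"
    "third_map k (polygon_side 5 1 s) = of_real (1 - s) * polygon_side 3 (k + 1) (1 / 3)"
    "third_map k (polygon_side 5 2 s) = of_real s * polygon_side 3 k (1 / 3)"
    "third_map k (polygon_side 5 3 s) = polygon_side 3 k ((1 + s) / 3)"
    "third_map k (polygon_side 5 4 s) = polygon_side 3 k ((2 + s) / 3)"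
proof -
  have m: "rot k * (of_real r * cis a) = of_real r * cis (5 * pi / 9 + 2 * pi * real k / 3 + a)" for r a
    by (simp add: rot_def cis_mult[symmetric])
  have m': "rot k * cis a = cis (5 * pi / 9 + 2 * pi * real k / 3 + a)" for a
    by (simp add: rot_def cis_mult[symmetric])
  have t: "third_map k (polygon_side 5 j s) = rot k * sector_side j s" if "j < 5" for j
    by (simp add: third_map_def sector_map(6)[OF that assms])
  have e: "5 * pi / 9 + 2 * pi * real k / 3 + (pi / 9 + s * (2 * pi / 9)) = 2 * pi * (real (k + 1) + s / 3) / real 3"
    "5 * pi / 9 + 2 * pi * real k / 3 + pi / 3 = 2 * pi * (real (k + 1) + 1 / 3) / real 3"
    "5 * pi / 9 + 2 * pi * real k / 3 + - pi / 3 = 2 * pi * (real k + 1 / 3) / real 3"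
    "5 * pi / 9 + 2 * pi * real k / 3 + (- pi / 3 + s * (2 * pi / 9)) = 2 * pi * (real k + (1 + s) / 3) / real 3"
    "5 * pi / 9 + 2 * pi * real k / 3 + (- pi / 9 + s * (2 * pi / 9)) = 2 * pi * (real k + (2 + s) / 3) / real 3"
    by (simp_all add: field_simps)
  show "third_map k (polygon_side 5 0 s) = polygon_side 3 (k + 1) (s / 3)"
    using t[of 0] unfolding sector_side_simps m' e polygon_side_def by simp
  show "third_map k (polygon_side 5 1 s) = of_real (1 - s) * polygon_side 3 (k + 1) (1 / 3)"
    using t[of 1] unfolding sector_side_simps m e polygon_side_def by simp
  show "third_map k (polygon_side 5 2 s) = of_real s * polygon_side 3 k (1 / 3)"
    using t[of 2] unfolding sector_side_simps m e polygon_side_def by simp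
  show "third_map k (polygon_side 5 3 s) = polygon_side 3 k ((1 + s) / 3)"
    using t[of 3] unfolding sector_side_simps m' e polygon_side_def by simp
  show "third_map k (polygon_side 5 4 s) = polygon_side 3 k ((2 + s) / 3)"
    using t[of 4] unfolding sector_side_simps m' e polygon_side_def by simp
qed

lemma cis_120: "cis (2 * pi / 3) = Complex (- 1 / 2) (sqrt 3 / 2)" "cis (- (2 * pi / 3)) = Complex (- 1 / 2) (- (sqrt 3 / 2))"
  using cos_120 sin_120 by (simp_all add: complex_eq_iff)

text \<open>In the coordinates \<open>x\<close> and \<open>y\<close> the conditions for the three
  rotated sectors become linear inequalities.\<close>

lemma sector_rotations:
  assumes "cmod z \<le> 1"
  shows "z \<in> sector \<or> cis (- (2 * pi / 3)) * z \<in> sector \<or> cis (2 * pi / 3) * z \<in> sector"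
proof -
  define x y where "x = sqrt 3 * Re z" and "y = Im z"
  have 3: "sqrt 3 * (sqrt 3 * a) = 3 * a" for a by (simp add: mult.assoc[symmetric])
  have n: "cmod (cis (- (2 * pi / 3)) * z) \<le> 1" "cmod (cis (2 * pi / 3) * z) \<le> 1" using assms by (simp_all add: norm_mult)
  have "z \<in> sector \<longleftrightarrow> y \<le> x \<and> - y \<le> x" using assms by (simp add: sector_def x_def y_def)
  moreover have "cis (- (2 * pi / 3)) * z \<in> sector \<longleftrightarrow> 0 \<le> y \<and> x \<le> y"
    using n(1) unfolding sector_def cis_120 by (auto simp: x_def y_def algebra_simps 3)
  moreover have "cis (2 * pi / 3) * z \<in> sector \<longleftrightarrow> y \<le> 0 \<and> x \<le> - y"
    using n(2) unfolding sector_def cis_120 by (auto simp: x_def y_def algebra_simps 3)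
  ultimately show ?thesis by linarith
qed

lemma sector_Int_rotation:
  assumes "z \<in> sector" "cis (- (2 * pi / 3)) * z \<in> sector"
  shows "\<exists>r\<in>{0..1}. z = of_real r * cis (pi / 3)"
proof -
  have 3: "sqrt 3 * (sqrt 3 * a) = 3 * a" for a by (simp add: mult.assoc[symmetric])
  have 1: "Im z \<le> sqrt 3 * Re z" "- Im z \<le> sqrt 3 * Re z" "cmod z \<le> 1" using assms(1) by (simp_all add: sector_def)
  have "sqrt 3 * Re z \<le> Im z" using assms(2) unfolding sector_def cis_120 by (simp add: algebra_simps 3)
  then have e: "Im z = sqrt 3 * Re z" using 1 by linarith
  have "0 \<le> sqrt 3 * Re z" using 1 by linarith
  then have pos: "0 \<le> Re z" by (simp add: zero_le_mult_iff)
  have z: "z = of_real (2 * Re z) * cis (pi / 3)" by (simp add: complex_eq_iff e cos_60 sin_60)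
  then have "cmod z = \<bar>2 * Re z\<bar>" by (metis norm_cis mult.right_neutral norm_mult norm_of_real)
  then show ?thesis using z pos 1(3) by (intro bexI[of _ "2 * Re z"]) auto
qed

lemma third_map_cover:
  assumes "z \<in> cball 0 1"
  shows "\<exists>k<3. \<exists>u\<in>cball 0 1. z = third_map k u"
proof -
  define w where "w = z / rot 0"
  have w: "z = rot 0 * w" "cmod w \<le> 1" using assms rot(1,2)[of 0] by (simp_all add: w_def norm_divide)
  have *: "\<exists>u\<in>cball 0 1. rot k * v = third_map k u" if "v \<in> sector" for v k
    using that unfolding sector_map(3)[symmetric] third_map_def by blast
  have r1: "rot 1 = rot 0 * cis (2 * pi / 3)" and r2: "rot 2 = rot 0 * cis (2 * pi / 3) * cis (2 * pi / 3)"
    using rot(3)[of 0] rot(3)[of 1] by (simp_all add: numeral_2_eq_2)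
  have c3: "cis (2 * pi / 3) * cis (2 * pi / 3) * cis (2 * pi / 3) = 1" "cis (2 * pi / 3) * cis (- (2 * pi / 3)) = 1"
    by (simp_all add: cis_mult)
  from sector_rotations[OF w(2)] consider "w \<in> sector" | "cis (- (2 * pi / 3)) * w \<in> sector" | "cis (2 * pi / 3) * w \<in> sector"
    by blast
  then show ?thesis
  proof cases
    case 1
    then show ?thesis using *[of w 0] w(1) by (intro exI[of _ 0]) simp
  next
    case 2
    have "z = rot 1 * (cis (- (2 * pi / 3)) * w)"
      unfolding r1 w(1) using c3(2) by (simp add: mult.assoc[symmetric])
    then show ?thesis using *[OF 2, of 1] by (intro exI[of _ 1]) simp
  next
    case 3
    have "z = rot 2 * (cis (2 * pi / 3) * w)"
      unfolding r2 w(1) using c3(1) by (simp add: mult.assoc)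
    then show ?thesis using *[OF 3, of 2] by (intro exI[of _ 2]) simp
  qed
qed

text \<open>Consecutive thirds overlap in one radius, which is side 1 of the former and side 2 of
  the latter. The parameters are reversed, exactly as \<open>matched\<close> provides for the
  tiles.\<close>

lemma third_map_overlap:
  assumes uv: "u \<in> cball 0 1" "v \<in> cball 0 1" "third_map k u = third_map (k + 1) v"
  shows "\<exists>r\<in>{0..1}. u = polygon_side 5 1 (1 - r) \<and> v = polygon_side 5 2 r"
proof -
  have "sector_map u \<in> sector" "sector_map v \<in> sector" using uv(1,2) sector_map(3) by auto
  moreover have e: "sector_map u = cis (2 * pi / 3) * sector_map v"
    using uv(3) rot(2)[of k] unfolding third_map_def rot(3) by (simp add: mult.assoc)
  then have "cis (- (2 * pi / 3)) * sector_map u = sector_map v"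
    by (simp add: mult.assoc[symmetric] cis_mult)
  ultimately obtain r where r: "r \<in> {0..1}" "sector_map u = of_real r * cis (pi / 3)"
    using sector_Int_rotation[of "sector_map u"] by auto
  have "sector_map (polygon_side 5 1 (1 - r)) = of_real r * cis (pi / 3)"
    using sector_map(6)[of 1 "1 - r"] r(1) by (simp add: sector_side_def)
  then have 1: "u = polygon_side 5 1 (1 - r)"
    using inj_onD[OF sector_map(2), of u "polygon_side 5 1 (1 - r)"] r(2) uv(1) by simp
  have "cis (2 * pi / 3) * sector_map v = cis (2 * pi / 3) * (of_real r * cis (- pi / 3))"
  proof -
    have "cis (2 * pi / 3) * (of_real r * cis (- pi / 3)) = of_real r * (cis (2 * pi / 3) * cis (- pi / 3))"
      by (simp add: mult.left_commute)
    also have "cis (2 * pi / 3) * cis (- pi / 3) = cis (pi / 3)" by (simp add: cis_mult)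
    finally show ?thesis using e r(2) by metis
  qed
  then have "sector_map v = of_real r * cis (- pi / 3)" by (rule mult_left_cancel[THEN iffD1, rotated]) simp
  then have "sector_map v = sector_map (polygon_side 5 2 r)"
    using sector_map(6)[of 2 r] r(1) by (simp add: sector_side_def)
  then have "v = polygon_side 5 2 r"
    using inj_onD[OF sector_map(2), of v "polygon_side 5 2 r"] uv(2) by simp
  then show ?thesis using 1 r(1) by blast
qed

subsection \<open>The triangle around a corner 2\<close>

context oriented_pentagon_scheme
begin

text \<open>Since \<open>nxt\<close> has order three, its square is its inverse.\<close>

definition prv where "prv t = nxt (nxt t)"

lemma prv:
  assumes t: "t \<in> F"
  shows "prv t \<in> F" "prv t \<noteq> t" "nxt (prv t) = t" "prv (nxt t) = t" "s (prv t) 1 = s t 2" "c (prv t) 2 = c t 2" "c (prv t) 1 = c t 3"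
proof -
  show p: "prv t \<in> F" using nxt(1)[OF nxt(1)[OF t]] by (simp add: prv_def)
  show "prv t \<noteq> t" "nxt (prv t) = t" "prv (nxt t) = t" using nxt_cycle[OF t] by (simp_all add: prv_def)
  then show "s (prv t) 1 = s t 2" "c (prv t) 2 = c t 2" "c (prv t) 1 = c t 3" using nxt[OF p] by simp_all
qed

text \<open>Two different edges of this kind at \<open>x\<close> are not spokes, so they span a tile
  with corner 3 at \<open>x\<close>. One of them is side 2 of that tile and has an end outside
  \<open>A\<close>, although both ends of a side 3 lie in \<open>A\<close>.\<close>

lemma A_edge_unique:
  assumes t: "t \<in> F" "t' \<in> F" and x: "x = c t 3 \<or> x = c t 4" "x = c t' 3 \<or> x = c t' 4"
  shows "s t 3 = s t' 3"
proof (rule ccontr)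
  assume ne: "s t 3 \<noteq> s t' 3"
  have st: "s t 3 \<in> star x" "x \<in> A" if "t \<in> F" "x = c t 3 \<or> x = c t 4" for t
    using star_sides(2)[OF that(1), of 2] star_sides(1)[OF that(1), of 3] c_in_A[OF that(1)] that(2) by auto
  note s1 = st(1)[OF t(1) x(1)] and s2 = st(1)[OF t(2) x(2)]
  have xA: "x \<in> A" by (rule st(2)[OF t(1) x(1)])
  obtain d a b where "card (star x) = 3" by (rule A_star[OF xA])
  then obtain u where u: "u \<in> F" "s t 3 \<in> s u ` {..<5}" "s t' 3 \<in> s u ` {..<5}"
    using pair_exists[OF _ s1 s2 ne] by blast
  obtain j where j: "j < 5" "x = c u j" "{s t 3, s t' 3} = {s u j, s u ((j + 4) mod 5)}"
    by (rule pair_at[OF u s1 s2 ne])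
  have "\<not> spoke (s t 3)" "\<not> spoke (s t' 3)" using spoke_s[OF t(1), of 3] spoke_s[OF t(2), of 3] by simp_all
  then have "\<not> spoke (s u j)" "\<not> spoke (s u ((j + 4) mod 5))" using j(3) by (metis insertE insertI1 insertI2 singletonD)+
  then have "j \<noteq> 0" "j \<noteq> 4" "j \<noteq> 1" using spoke_s[OF u(1) j(1)] spoke_s[OF u(1), of "(j + 4) mod 5"] by auto
  moreover have "j \<noteq> 2" using c_2[OF u(1)] xA j(2) by auto
  ultimately have "j = 3" using j(1) unfolding less_5_cases by blast
  then have "s u 2 \<in> {s t 3, s t' 3}" unfolding j(3) by simp
  then have "ends (s u 2) \<subseteq> A" using ends_simps(4)[OF t(1)] ends_simps(4)[OF t(2)] c_in_A[OF t(1)] c_in_A[OF t(2)] by auto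
  then show False using ends_simps(3)[OF u(1)] c_2[OF u(1)] by auto
qed

definition tri where "tri t = {s (prv t) 0, s t 3, s t 4}"

text \<open>The tile across side 3 describes the same three edges in reverse order: by uniqueness of
  the spoke at corner 3 of \<open>t\<close>, side 0 of \<open>prv t\<close> is side 4 of the other
  tile, and conversely.\<close>

lemma tri_eq:
  assumes t: "t \<in> F" "t' \<in> F" and e: "s t 3 = s t' 3"
  shows "tri t = tri t'" "{c t 3, c t 4} = {c t' 3, c t' 4}"
proof -
  have "tri t = tri t' \<and> {c t 3, c t 4} = {c t' 3, c t' 4}"
  proof (cases "t = t'")
    case False
    note C = common_side[OF t False _ _ e]
    have c: "c t 3 = c t' 4" "c t 4 = c t' 3" using C(2,3) by simp_all
    have *: "s (prv t) 0 = s t' 4" if t: "t \<in> F" "t' \<in> F" and c: "c t 3 = c t' 4" for t t'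
    proof (rule spoke_unique[OF t(1), of 3])
      show "s (prv t) 0 \<in> star (c t 3)" using star_sides(1)[OF prv(1)[OF t(1)], of 0] prv(7)[OF t(1)] by simp
      show "s t' 4 \<in> star (c t 3)" using star_sides(2)[OF t(2), of 3] c by simp
      show "spoke (s (prv t) 0)" "spoke (s t' 4)" using spoke_s[OF prv(1)[OF t(1)], of 0] spoke_s[OF t(2), of 4] by simp_all
    qed simp_all
    show ?thesis using *[OF t c(1)] *[OF t(2,1) c(2)[symmetric]] c e by (auto simp: tri_def)
  qed simp
  then show "tri t = tri t'" "{c t 3, c t 4} = {c t' 3, c t' 4}" by auto
qed

lemma tri_subset: "t \<in> F \<Longrightarrow> tri t \<subseteq> E"
  using s_in prv(1) by (simp add: tri_def)

text \<open>\<open>opp\<close> exchanges 0 and 4, so a spoke is side 4 of one of its two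
  tiles.\<close>

lemma spoke_eq_side_4:
  assumes "e \<in> E" "spoke e"
  shows "\<exists>t\<in>F. e = s t 4"
proof -
  obtain t t' k k' where e: "t \<in> F" "t' \<in> F" "t \<noteq> t'" "k < 5" "k' < 5" "e = s t k" "e = s t' k'"
    by (rule edge_tiles[OF assms(1)])
  have "k = 0 \<or> k = 4" using spoke_s[OF e(1,4)] assms(2) e(6) by simp
  moreover have "s t k = s t' k'" using e(6,7) by simp
  then have "k' = opp k" by (rule common_side(1)[OF e(1-5)])
  ultimately have "k = 4 \<or> k' = 4" by auto
  then show ?thesis using e(1,2,6,7) by blast
qed

lemma tri_distinct:
  assumes t: "t \<in> F"
  shows "s (prv t) 0 \<noteq> s t 3" "s (prv t) 0 \<noteq> s t 4" "s t 3 \<noteq> s t 4"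
proof -
  show "s t 3 \<noteq> s t 4" using s_eq[OF t, of 3 4] by simp
  show "s (prv t) 0 \<noteq> s t 3" using spoke_s[OF prv(1)[OF t], of 0] spoke_s[OF t, of 3] by auto
  have "ends (s (prv t) 0) = {c (prv t) 0, c t 3}" using ends_simps(1)[OF prv(1)[OF t]] prv(7)[OF t] by simp
  moreover have "c t 3 \<notin> {c t 4, c t 0}" using c_eq[OF t, of 3 4] c_eq[OF t, of 3 0] by simp
  ultimately show "s (prv t) 0 \<noteq> s t 4" using ends_simps(5)[OF t] by auto
qed

definition seq where "seq t k = (nxt ^^ k) t"

lemma seq_simps [simp]: "seq t 0 = t" "seq t (Suc k) = nxt (seq t k)"
  by (simp_all add: seq_def)

lemma seq:
  assumes t: "t \<in> F"
  shows "seq t k \<in> F" "seq t (k + 3) = seq t k" "seq t (k + 2) = prv (seq t k)" "c (seq t k) 2 = c t 2"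
proof -
  show k: "seq t k \<in> F" for k using t nxt(1) by (induction k) simp_all
  show "seq t (k + 3) = seq t k" using nxt_cycle(1)[OF k[of k]] by (simp add: eval_nat_numeral)
  show "seq t (k + 2) = prv (seq t k)" by (simp add: eval_nat_numeral prv_def)
  show "c (seq t k) 2 = c t 2" using nxt(4)[OF k] by (induction k) simp_all
qed

lemma seq_image: "t \<in> F \<Longrightarrow> seq t ` {..<3} = {t' \<in> F. c t' 2 = c t 2}"
proof
  assume t: "t \<in> F"
  show "seq t ` {..<3} \<subseteq> {t' \<in> F. c t' 2 = c t 2}" using seq[OF t] by auto
  have "t \<in> seq t ` {..<3}" "nxt t \<in> seq t ` {..<3}" "nxt (nxt t) \<in> seq t ` {..<3}"
    by (auto intro: image_eqI[of _ _ 0] image_eqI[of _ _ 1] image_eqI[of _ _ 2] simp: numeral_2_eq_2)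
  then show "{t' \<in> F. c t' 2 = c t 2} \<subseteq> seq t ` {..<3}" using nxt_cycle(3)[OF t] by blast
qed

lemma seq_inj: "t \<in> F \<Longrightarrow> inj_on (seq t) {..<3}"
proof -
  assume t: "t \<in> F"
  have "t \<noteq> nxt t" "nxt t \<noteq> nxt (nxt t)" "nxt (nxt t) \<noteq> t"
    using nxt(2)[OF t] nxt(2)[OF nxt(1)[OF t]] nxt_cycle(2)[OF t] by auto
  moreover have "{..<3} = {0, 1, 2::nat}" by auto
  ultimately show ?thesis by (auto simp: numeral_2_eq_2)
qed

lemma side_2_eq:
  assumes "t \<in> F" "t' \<in> F" "s t 2 = s t' 2"
  shows "t = t'"
proof (rule ccontr)
  assume "t \<noteq> t'"
  from common_side(1)[OF assms(1,2) this _ _ assms(3)] show False by simp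
qed

end

section \<open>The triangle map assembled from three tiles\<close>

locale circ_matched_tiling =
  matched_pentagonal_tiling X V E \<phi> +
  oriented_pentagon_scheme "tiles X V E" E "\<lambda>e. e \<inter> V" L "\<lambda>t. corner (\<phi> t)" "\<lambda>t. side (\<phi> t)"
  for X :: "'a topology" and V E \<phi> and L :: "'a set" +
  assumes L_subset: "L \<subseteq> V"
begin

abbreviation F :: "'a set set" where "F \<equiv> tiles X V E"

definition turn :: "'a set \<Rightarrow> nat \<Rightarrow> 'a set" where "turn t k = seq t k"

definition pred_tile :: "'a set \<Rightarrow> 'a set" where "pred_tile t = prv t"

lemma turn:
  assumes t: "t \<in> F"
  shows "turn t k \<in> F" "turn t 0 = t" "turn t (k + 3) = turn t k" "turn t (k + 2) = pred_tile (turn t k)"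
    "corner (\<phi> (turn t k)) 2 = corner (\<phi> t) 2" "turn t (k + 1) \<noteq> turn t k"
    "side (\<phi> (turn t (k + 1))) 2 = side (\<phi> (turn t k)) 1"
  unfolding turn_def pred_tile_def Suc_eq_plus1[symmetric] seq_simps
  by (rule seq[OF t] nxt[OF seq(1)[OF t]] refl)+

lemma turn_image: "t \<in> F \<Longrightarrow> turn t ` {..<3} = {t' \<in> F. corner (\<phi> t') 2 = corner (\<phi> t) 2}"
  using seq_image[of t] unfolding turn_def[abs_def] .

lemma turn_inj: "t \<in> F \<Longrightarrow> inj_on (turn t) {..<3}"
  using seq_inj[of t] unfolding turn_def[abs_def] .

lemma pred_tile:
  assumes t: "t \<in> F"
  shows "pred_tile t \<in> F" "corner (\<phi> (pred_tile t)) 1 = corner (\<phi> t) 3" "pred_tile (turn t 1) = t"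
proof -
  show "pred_tile t \<in> F" "corner (\<phi> (pred_tile t)) 1 = corner (\<phi> t) 3"
    unfolding pred_tile_def by (rule prv[OF t])+
  show "pred_tile (turn t 1) = t" unfolding pred_tile_def turn_def One_nat_def seq_simps by (rule prv[OF t])
qed

lemma third_map_agree_Suc:
  assumes t: "t \<in> F" and u: "u \<in> cball 0 1" "v \<in> cball 0 1" "third_map k u = third_map (k + 1) v"
  shows "\<phi> (turn t k) u = \<phi> (turn t (k + 1)) v"
proof -
  obtain r where r: "r \<in> {0..1}" "u = polygon_side 5 1 (1 - r)" "v = polygon_side 5 2 r"
    using third_map_overlap[OF u] by blast
  note k = turn(1)[OF t, of k]
  have "\<phi> (turn t k) (polygon_side 5 1 (1 - r)) = \<phi> (turn t (k + 1)) (polygon_side 5 2 (1 - (1 - r)))"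
    using r(1) by (intro matched k turn(1)[OF t] turn(6)[OF t, symmetric] turn(7)[OF t, symmetric]) simp_all
  then show ?thesis using r by simp
qed

lemma third_map_3: "third_map (k + 3) = third_map k"
  using rot(4)[of k] by (simp add: third_map_def fun_eq_iff)

lemma third_map_agree:
  assumes t: "t \<in> F" and k: "k < 3" "l < 3" and u: "u \<in> cball 0 1" "v \<in> cball 0 1" "third_map k u = third_map l v"
  shows "\<phi> (turn t k) u = \<phi> (turn t l) v"
proof -
  have *: "\<phi> (turn t k) u = \<phi> (turn t l) v"
    if kl: "k < l" "l < 3" and u: "u \<in> cball 0 1" "v \<in> cball 0 1" "third_map k u = third_map l v" for k l u v
  proof -
    consider "l = k + 1" | "k = 0" "l = 2" using kl by linarith
    then show ?thesis
    proof cases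
      case 1
      then show ?thesis using third_map_agree_Suc[OF t u(1,2)] u(3) by simp
    next
      case 2
      \<comment> \<open>By periodicity, thirds 0 and 2 are treated as the consecutive thirds 2 and
        3.\<close>
      then have "third_map 2 v = third_map (2 + 1) u" using u(3) third_map_3[of 0] by simp
      from third_map_agree_Suc[OF t u(2,1) this] have "\<phi> (turn t 2) v = \<phi> (turn t (0 + 3)) u" by simp
      then show ?thesis using 2 turn(3)[OF t, of 0] by simp
    qed
  qed
  consider "k = l" | "k < l" | "l < k" by linarith
  then show ?thesis
  proof cases
    case 1
    then have "u = v" using inj_onD[OF third_map(2), of k u v] u by simp
    then show ?thesis using 1 by simp
  next
    case 2 then show ?thesis using * k u by blast
  next
    case 3 then show ?thesis using *[of l k v u] k u by simp
  qed
qed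

text \<open>A point may lie in several thirds; \<open>third_map_agree\<close> makes the value
  independent of the chosen pair.\<close>

definition tri_map where
  "tri_map t z = (let p = SOME p. fst p < 3 \<and> snd p \<in> cball 0 1 \<and> z = third_map (fst p) (snd p) in \<phi> (turn t (fst p)) (snd p))"

lemma tri_map:
  assumes t: "t \<in> F" and u: "u \<in> cball 0 1"
  shows "tri_map t (third_map k u) = \<phi> (turn t k) u"
proof -
  have 1: "tri_map t (third_map k u) = \<phi> (turn t k) u" if k: "k < 3" for k
  proof -
    let ?P = "\<lambda>p. fst p < 3 \<and> snd p \<in> cball 0 1 \<and> third_map k u = third_map (fst p) (snd p)"
    have "?P (k, u)" using k u by simp
    then have P: "?P (SOME p. ?P p)" by (rule someI)
    then show ?thesis
      using third_map_agree[OF t k, of "fst (SOME p. ?P p)" u "snd (SOME p. ?P p)"] u by (simp add: tri_map_def Let_def)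
  qed
  \<comment> \<open>Both families have period 3 in the index, so the case \<open>k < 3\<close> is
    enough.\<close>
  have 2: "third_map k = third_map (k mod 3) \<and> turn t k = turn t (k mod 3)"
  proof (induction k rule: less_induct)
    case (less k)
    show ?case
    proof (cases "k < 3")
      case False
      then have k: "k = (k - 3) + 3" by simp
      have "(k - 3) mod 3 = k mod 3" using False by (metis k mod_add_self2)
      moreover have "third_map k = third_map (k - 3)" "turn t k = turn t (k - 3)"
        using third_map_3[of "k - 3"] turn(3)[OF t, of "k - 3"] k by simp_all
      ultimately show ?thesis using less[of "k - 3"] False by simp
    qed simp
  qed
  then show ?thesis using 1[of "k mod 3"] by simp
qed

lemma tri_map_continuous:
  assumes t: "t \<in> F"
  shows "continuous_map (top_of_set (cball 0 1)) X (tri_map t)" "continuous_map (top_of_set (ball 0 1)) X (tri_map t)"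
proof -
  have "continuous_map (top_of_set (\<Union>k\<in>{..<3}. third_map k ` cball 0 1)) X (tri_map t)"
  proof (rule continuous_map_from_compact_images)
    fix k :: nat
    show "continuous_map (top_of_set (cball 0 1)) X (tri_map t \<circ> third_map k)"
      using continuous_map_eq[OF pentagon_continuous(1)[OF turn(1)[OF t] pentagon[OF turn(1)[OF t]]], of k "tri_map t \<circ> third_map k"]
        tri_map[OF t] by simp
  qed (simp_all add: third_map(1))
  moreover have "(\<Union>k\<in>{..<3}. third_map k ` cball 0 1) = cball 0 1"
  proof
    show "cball 0 1 \<subseteq> (\<Union>k\<in>{..<3}. third_map k ` cball 0 1)" using third_map_cover by fast
  qed (use third_map(3) in blast)
  ultimately show c: "continuous_map (top_of_set (cball 0 1)) X (tri_map t)" by simp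
  show "continuous_map (top_of_set (ball 0 1)) X (tri_map t)"
    by (rule continuous_map_from_subtopology_mono[OF c]) auto
qed

lemma tri_map_radius:
  assumes t: "t \<in> F" and r: "r \<in> {0..1}"
  shows "tri_map t (of_real r * polygon_side 3 k (1 / 3)) = \<phi> (turn t k) (polygon_side 5 2 r)"
  using tri_map[OF t, of "polygon_side 5 2 r" k] third_map_side(3)[OF r, of k] by simp

lemma tri_map_0: "t \<in> F \<Longrightarrow> tri_map t 0 = corner (\<phi> t) 2"
  using tri_map_radius[of t 0 0] turn(2) by simp

text \<open>A boundary point of a third that is interior to the disk lies on a radius. Points of
  side 1 are assigned to side 2 of the next third, so each radius needs to be described in one way
  only.\<close>

lemma ball_cases:
  assumes "z \<in> ball 0 1"
  shows "(\<exists>k<3. \<exists>u\<in>ball 0 1. z = third_map k u) \<or> (\<exists>k<3. \<exists>r\<in>{0..<1}. z = of_real r * polygon_side 3 k (1 / 3))"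
proof -
  have z: "z \<in> cball 0 1" "cmod z < 1" using assms by auto
  obtain k u where k: "k < 3" "u \<in> cball 0 1" "z = third_map k u" using third_map_cover[OF z(1)] by blast
  show ?thesis
  proof (cases "u \<in> ball 0 1")
    case True
    then show ?thesis using k by blast
  next
    case False
    then have "cmod u = 1" using k(2) by simp
    then obtain j s where j: "j < 5" "0 \<le> s" "s < 1" "u = polygon_side 5 j s" using polygon_side_surj[of u 5] by auto
    then have s: "s \<in> {0..1}" by simp
    note S = third_map_side[OF s, of k]
    have "j = 1 \<or> j = 2" using j(1) z(2) S unfolding less_5_cases k(3) j(4) by auto
    then show ?thesis
    proof
      assume j1: "j = 1"
      then have e: "z = of_real (1 - s) * polygon_side 3 ((k + 1) mod 3) (1 / 3)"
        using S(2) polygon_side_mod[of 3 "k + 1"] k(3) j(4) by simp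
      then have "cmod z = 1 - s" using j(3) by (simp add: norm_mult del: of_real_diff)
      then have "1 - s \<in> {0..<1}" using z(2) j(3) by simp
      then show ?thesis using e by (metis mod_less_divisor zero_less_numeral)
    next
      assume "j = 2"
      then have "z = of_real s * polygon_side 3 k (1 / 3)" using S(3) k(3) j(4) by simp
      then show ?thesis using k(1) j(2,3) by force
    qed
  qed
qed

text \<open>The part of the tile \<open>t\<close> and its sides that lies inside the triangle around corner 2. The side 1 is
  left to the next tile, of which it is side 2.\<close>

definition core where "core t = t \<union> (side (\<phi> t) 2 - {corner (\<phi> t) 3})"

lemma side_2_half_open:
  assumes t: "t \<in> F"
  shows "side (\<phi> t) 2 - {corner (\<phi> t) 3} = (\<lambda>r. \<phi> t (polygon_side 5 2 r)) ` {0..<1}"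
proof -
  define f where "f = \<phi> t \<circ> polygon_side 5 2"
  have i: "inj_on f {0..1}" unfolding f_def by (rule side_inj[OF t pentagon[OF t]]) simp
  have e: "corner (\<phi> t) 3 = f 1" using corner_Suc[OF t pentagon[OF t], of 2] by (simp add: f_def)
  have "f ` ({0..1} - {1}) = f ` {0..1} - f ` {1}" by (rule inj_on_image_set_diff[OF i]) auto
  moreover have "{0..1} - {1} = {0..<1::real}" by auto
  ultimately have "f ` {0..1} - {corner (\<phi> t) 3} = f ` {0..<1}" unfolding e by simp
  then show ?thesis by (simp add: f_def o_def)
qed

text \<open>The right-hand side depends on \<open>t\<close> only through corner 2, so the three
  tiles around that corner define the same triangle.\<close>

lemma tri_map_ball:
  assumes t: "t \<in> F"
  shows "tri_map t ` ball 0 1 = (\<Union>t'\<in>{t' \<in> F. corner (\<phi> t') 2 = corner (\<phi> t) 2}. core t')"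
proof -
  have c: "core (turn t k) = \<phi> (turn t k) ` ball 0 1 \<union> (\<lambda>r. \<phi> (turn t k) (polygon_side 5 2 r)) ` {0..<1}" for k
    using side_2_half_open[OF turn(1)[OF t]] pentagon_ball[OF turn(1)[OF t] pentagon[OF turn(1)[OF t]]] by (simp add: core_def)
  have "tri_map t ` ball 0 1 = (\<Union>k<3. core (turn t k))"
  proof
    show "tri_map t ` ball 0 1 \<subseteq> (\<Union>k<3. core (turn t k))"
    proof
      fix y assume "y \<in> tri_map t ` ball 0 1"
      then obtain z where z: "z \<in> ball 0 1" "y = tri_map t z" by blast
      from ball_cases[OF z(1)] show "y \<in> (\<Union>k<3. core (turn t k))"
      proof
        assume "\<exists>k<3. \<exists>u\<in>ball 0 1. z = third_map k u"
        then obtain k u where "k < 3" "u \<in> ball 0 1" "z = third_map k u" by blast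
        then have "y \<in> core (turn t k)" using z(2) tri_map[OF t, of u k] unfolding c by auto
        then show ?thesis using \<open>k < 3\<close> by blast
      next
        assume "\<exists>k<3. \<exists>r\<in>{0..<1}. z = of_real r * polygon_side 3 k (1 / 3)"
        then obtain k r where "k < 3" "r \<in> {0..<1}" "z = of_real r * polygon_side 3 k (1 / 3)" by blast
        then have "y \<in> core (turn t k)" using z(2) tri_map_radius[OF t, of r k] unfolding c by auto
        then show ?thesis using \<open>k < 3\<close> by blast
      qed
    qed
    have 1: "\<phi> (turn t k) u \<in> tri_map t ` ball 0 1" if "u \<in> ball 0 1" for k u
    proof -
      have "third_map k u \<in> ball 0 1" using third_map(4)[of k] that by blast
      moreover have "tri_map t (third_map k u) = \<phi> (turn t k) u" using that by (intro tri_map[OF t]) simp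
      ultimately show ?thesis by (metis imageI)
    qed
    have 2: "\<phi> (turn t k) (polygon_side 5 2 r) \<in> tri_map t ` ball 0 1" if r: "r \<in> {0..<1}" for k r
    proof -
      have "of_real r * polygon_side 3 k (1 / 3) \<in> ball 0 1" using r by (simp add: norm_mult)
      moreover have "tri_map t (of_real r * polygon_side 3 k (1 / 3)) = \<phi> (turn t k) (polygon_side 5 2 r)"
        using r by (intro tri_map_radius[OF t]) simp
      ultimately show ?thesis by (metis imageI)
    qed
    show "(\<Union>k<3. core (turn t k)) \<subseteq> tri_map t ` ball 0 1" unfolding c using 1 2 by blast
  qed
  also have "\<dots> = (\<Union>t'\<in>turn t ` {..<3}. core t')" by simp
  finally show ?thesis unfolding turn_image[OF t] .
qed

lemma side_point_in_V:
  assumes "t \<in> F" "k < 5" "s \<in> {0..1}" "\<phi> t (polygon_side 5 k s) \<in> V"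
  shows "s = 0 \<or> s = 1"
proof (rule ccontr)
  assume "\<not> (s = 0 \<or> s = 1)"
  then have "(\<phi> t \<circ> polygon_side 5 k) s \<in> (\<phi> t \<circ> polygon_side 5 k) ` {0<..<1}" using assms(3) by (intro imageI) auto
  then show False using pentagon_side(1)[OF assms(1) pentagon[OF assms(1)] assms(2)] assms(4) unfolding edge_path_def by auto
qed

lemma sides_meet_in_V:
  assumes "t \<in> F" "t' \<in> F" "k < 5" "l < 5" "side (\<phi> t) k \<noteq> side (\<phi> t') l" "x \<in> side (\<phi> t) k" "x \<in> side (\<phi> t') l"
  shows "x \<in> V"
  using edge_Int[OF s_in[OF assms(1,3)] s_in[OF assms(2,4)] assms(5)] assms(6,7) by blast

text \<open>Open thirds go to different tiles, which are disjoint from each other and from all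
  edges. Different radii go to different edges, which meet in vertices only, and among parameters
  below 1 only 0, the common center, gives a vertex.\<close>

lemma tri_map_inj:
  assumes t: "t \<in> F"
  shows "inj_on (tri_map t) (ball 0 1)"
proof (rule inj_onI)
  have tile: "tri_map t (third_map k u) \<in> turn t k" if "u \<in> ball 0 1" for k u
  proof -
    have "tri_map t (third_map k u) = \<phi> (turn t k) u" using that by (intro tri_map[OF t]) simp
    then show ?thesis using pentagon_ball[OF turn(1)[OF t] pentagon[OF turn(1)[OF t]]] that by blast
  qed
  have edge: "tri_map t (of_real r * polygon_side 3 k (1 / 3)) \<in> side (\<phi> (turn t k)) 2" if "r \<in> {0..<1}" for k r
    using that tri_map_radius[OF t, of r k] by auto
  have disj: "turn t k \<inter> side (\<phi> (turn t l)) 2 = {}" for k l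
    using tile_subset(3)[OF turn(1)[OF t] s_in[OF turn(1)[OF t]]] by simp
  have sq: "k = l" if "k < 3" "l < 3" "turn t k = turn t l" for k l
    using inj_onD[OF turn_inj[OF t] that(3)] that(1,2) by simp
  fix z w assume z: "z \<in> ball 0 1" "w \<in> ball 0 1" "tri_map t z = tri_map t w"
  consider k u l v where "k < 3" "u \<in> ball 0 1" "z = third_map k u" "l < 3" "v \<in> ball 0 1" "w = third_map l v"
    | k u l r where "k < 3" "u \<in> ball 0 1" "z = third_map k u" "l < 3" "r \<in> {0..<1}" "w = of_real r * polygon_side 3 l (1 / 3)"
    | k u l r where "k < 3" "u \<in> ball 0 1" "w = third_map k u" "l < 3" "r \<in> {0..<1}" "z = of_real r * polygon_side 3 l (1 / 3)"
    | k q l r where "k < 3" "q \<in> {0..<1}" "z = of_real q * polygon_side 3 k (1 / 3)" "l < 3" "r \<in> {0..<1}" "w = of_real r * polygon_side 3 l (1 / 3)"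
    using ball_cases[OF z(1)] ball_cases[OF z(2)] by metis
  then show "z = w"
  proof cases
    case 1
    have "turn t k \<inter> turn t l \<noteq> {}" using tile[OF 1(2), of k] tile[OF 1(5), of l] z(3) 1(3,6) by auto
    then have "turn t k = turn t l" using tiles_disjoint[OF turn(1)[OF t] turn(1)[OF t]] by blast
    then have "k = l" using sq 1 by blast
    moreover have "\<phi> (turn t k) u = \<phi> (turn t l) v" using tri_map[OF t, of u k] tri_map[OF t, of v l] 1 z(3) by simp
    ultimately have "u = v" using inj_onD[OF pentagon_inj[OF turn(1)[OF t] pentagon[OF turn(1)[OF t]]], of k u v] 1 by simp
    then show ?thesis using 1 \<open>k = l\<close> by simp
  next
    case 2
    then show ?thesis using tile[OF 2(2), of k] edge[OF 2(5), of l] disj[of k l] z(3) by auto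
  next
    case 3
    then show ?thesis using tile[OF 3(2), of k] edge[OF 3(5), of l] disj[of k l] z(3) by auto
  next
    case 4
    have e: "\<phi> (turn t k) (polygon_side 5 2 q) = \<phi> (turn t l) (polygon_side 5 2 r)"
      using tri_map_radius[OF t, of q k] tri_map_radius[OF t, of r l] 4 z(3) by simp
    show ?thesis
    proof (cases "k = l")
      case True
      have "inj_on (\<phi> (turn t k) \<circ> polygon_side 5 2) {0..1}"
        by (rule side_inj[OF turn(1)[OF t] pentagon[OF turn(1)[OF t]]]) simp
      then have "q = r" using inj_onD[of "\<phi> (turn t k) \<circ> polygon_side 5 2" "{0..1}" q r] e True 4 by simp
      then show ?thesis using True 4 by simp
    next
      case False
      then have ne: "side (\<phi> (turn t k)) 2 \<noteq> side (\<phi> (turn t l)) 2"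
        using side_2_eq[OF turn(1)[OF t] turn(1)[OF t]] sq[OF 4(1,4)] by metis
      define x where "x = tri_map t z"
      have x: "x = \<phi> (turn t k) (polygon_side 5 2 q)" "x = \<phi> (turn t l) (polygon_side 5 2 r)"
        using tri_map_radius[OF t, of q k] 4 e unfolding x_def by auto
      have "x \<in> side (\<phi> (turn t k)) 2" "x \<in> side (\<phi> (turn t l)) 2"
        using edge[OF 4(2), of k] edge[OF 4(5), of l] unfolding x_def 4(3)[symmetric] 4(6)[symmetric] z(3) by blast+
      from sides_meet_in_V[OF turn(1)[OF t] turn(1)[OF t] _ _ ne this] have V: "x \<in> V" by simp
      have "q = 0 \<or> q = 1" by (rule side_point_in_V[OF turn(1)[OF t], of 2 q k]) (use V x(1) 4(2) in auto)
      moreover have "r = 0 \<or> r = 1" by (rule side_point_in_V[OF turn(1)[OF t], of 2 r l]) (use V x(2) 4(5) in auto)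
      ultimately have "q = 0" "r = 0" using 4(2,5) by auto
      then show ?thesis using 4 by simp
    qed
  qed
qed

end

text \<open>Each set is also closed, because the others cover its complement, and a nonempty
  connected clopen set is a component.\<close>

lemma connected_components_of_open_partition:
  assumes U: "\<Union>W = topspace Y" and W: "\<And>w. w \<in> W \<Longrightarrow> openin Y w \<and> connectedin Y w \<and> w \<noteq> {}"
    and d: "\<And>w w'. w \<in> W \<Longrightarrow> w' \<in> W \<Longrightarrow> w \<noteq> w' \<Longrightarrow> w \<inter> w' = {}"
  shows "connected_components_of Y = W"
proof -
  have cl: "closedin Y w" if w: "w \<in> W" for w
  proof -
    have "w \<inter> \<Union>(W - {w}) = {}" using d[OF w] by blast
    moreover have "\<Union>W = w \<union> \<Union>(W - {w})" using w by blast
    ultimately have "topspace Y - w = \<Union>(W - {w})" unfolding U[symmetric] by blast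
    moreover have "openin Y (\<Union>(W - {w}))" using W by blast
    moreover have "w \<subseteq> topspace Y" using U w by blast
    ultimately show ?thesis by (simp add: closedin_def)
  qed
  have comp: "connected_component_of_set Y x = w" if w: "w \<in> W" and x: "x \<in> w" for x w
  proof
    have "x \<in> topspace Y" using U w x by blast
    then have "connectedin Y (connected_component_of_set Y x)" "x \<in> connected_component_of_set Y x"
      by (simp_all add: connectedin_connected_component_of connected_component_of_refl)
    then show "connected_component_of_set Y x \<subseteq> w"
      using connectedin_clopen_cases[of Y "connected_component_of_set Y x" w] cl[OF w] W[OF w] x
      by (auto simp: disjnt_iff)
    show "w \<subseteq> connected_component_of_set Y x"
      using connected_component_of_maximal W[OF w] x by metis
  qed
  show ?thesis
  proof
    show "connected_components_of Y \<subseteq> W"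
    proof
      fix C assume "C \<in> connected_components_of Y"
      then obtain x where x: "x \<in> topspace Y" "C = connected_component_of_set Y x" by (auto simp: connected_components_of_def)
      then obtain w where "w \<in> W" "x \<in> w" using U by blast
      then show "C \<in> W" using comp x(2) by simp
    qed
    show "W \<subseteq> connected_components_of Y"
    proof
      fix w assume w: "w \<in> W"
      then obtain x where x: "x \<in> w" using W by blast
      then have "x \<in> topspace Y" using U w by blast
      then show "w \<in> connected_components_of Y" using comp[OF w x] by (auto simp: connected_components_of_def)
    qed
  qed
qed

section \<open>Edges and tiles of the triangulation\<close>

context circ_matched_tiling
begin

text \<open>A side of the triangle, running from the \<open>\<circ>\<close>-corner of the preceding
  tile to that of \<open>t\<close>. Each pentagonal edge takes a third of the time, which puts the
  dividing points at \<open>1/3\<close> and \<open>2/3\<close>.\<close>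

definition tri_path :: "'a set \<Rightarrow> real \<Rightarrow> 'a" where
  "tri_path t x = (if x \<le> 1/3 then \<phi> (pred_tile t) (polygon_side 5 0 (3 * x))
     else if x \<le> 2/3 then \<phi> t (polygon_side 5 3 (3 * x - 1)) else \<phi> t (polygon_side 5 4 (3 * x - 2)))"

lemma tri_path_piece:
  assumes t: "t \<in> F"
  shows "x \<le> 1/3 \<Longrightarrow> tri_path t x = \<phi> (pred_tile t) (polygon_side 5 0 (3 * x))"
    "1/3 \<le> x \<Longrightarrow> x \<le> 2/3 \<Longrightarrow> tri_path t x = \<phi> t (polygon_side 5 3 (3 * x - 1))"
    "2/3 \<le> x \<Longrightarrow> tri_path t x = \<phi> t (polygon_side 5 4 (3 * x - 2))"
proof -
  have 1: "\<phi> (pred_tile t) (polygon_side 5 0 1) = corner (\<phi> t) 3"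
    using corner_Suc[OF pred_tile(1)[OF t] pentagon[OF pred_tile(1)[OF t]], of 0] pred_tile(2)[OF t] by simp
  have 2: "\<phi> t (polygon_side 5 3 1) = corner (\<phi> t) 4" using corner_Suc[OF t pentagon[OF t], of 3] by simp
  show "x \<le> 1/3 \<Longrightarrow> tri_path t x = \<phi> (pred_tile t) (polygon_side 5 0 (3 * x))" by (simp add: tri_path_def)
  show "1/3 \<le> x \<Longrightarrow> x \<le> 2/3 \<Longrightarrow> tri_path t x = \<phi> t (polygon_side 5 3 (3 * x - 1))"
  proof (cases "x = 1/3")
    case True
    show ?thesis unfolding True using 1 by (simp add: tri_path_def)
  qed (simp add: tri_path_def)
  show "2/3 \<le> x \<Longrightarrow> tri_path t x = \<phi> t (polygon_side 5 4 (3 * x - 2))"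
  proof (cases "x = 2/3")
    case True
    show ?thesis unfolding True using 2 by (simp add: tri_path_def)
  qed (simp add: tri_path_def)
qed

lemma tri_path_values:
  assumes t: "t \<in> F"
  shows "tri_path t 0 = corner (\<phi> (pred_tile t)) 0" "tri_path t (1/3) = corner (\<phi> t) 3"
    "tri_path t (2/3) = corner (\<phi> t) 4" "tri_path t 1 = corner (\<phi> t) 0"
  using tri_path_piece(1)[OF t, of 0] tri_path_piece(2)[OF t, of "1/3"] tri_path_piece(3)[OF t, of "2/3"]
    tri_path_piece(3)[OF t, of 1] corner_Suc[OF t pentagon[OF t], of 4] by simp_all

lemma tri_path_images:
  assumes t: "t \<in> F"
  shows "tri_path t ` {0..1/3} = side (\<phi> (pred_tile t)) 0" "tri_path t ` {1/3..2/3} = side (\<phi> t) 3"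
    "tri_path t ` {2/3..1} = side (\<phi> t) 4"
proof -
  have i: "(\<lambda>x. 3 * x) ` {0..1/3} = {0..1::real}" "(\<lambda>x. 3 * x - 1) ` {1/3..2/3} = {0..1::real}"
    "(\<lambda>x. 3 * x - 2) ` {2/3..1} = {0..1::real}"
    using image_affinity_atLeastAtMost[of 3 0 0 "1/3::real"] image_affinity_atLeastAtMost[of 3 "-1" "1/3" "2/3::real"]
      image_affinity_atLeastAtMost[of 3 "-2" "2/3" "1::real"] by simp_all
  have "tri_path t ` {0..1/3} = (\<lambda>x. (\<phi> (pred_tile t) \<circ> polygon_side 5 0) (3 * x)) ` {0..1/3}"
    by (rule image_cong) (auto simp: tri_path_piece[OF t])
  then show "tri_path t ` {0..1/3} = side (\<phi> (pred_tile t)) 0" unfolding i(1)[symmetric] image_image .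
  have "tri_path t ` {1/3..2/3} = (\<lambda>x. (\<phi> t \<circ> polygon_side 5 3) (3 * x - 1)) ` {1/3..2/3}"
    by (rule image_cong) (auto simp: tri_path_piece[OF t])
  then show "tri_path t ` {1/3..2/3} = side (\<phi> t) 3" unfolding i(2)[symmetric] image_image .
  have "tri_path t ` {2/3..1} = (\<lambda>x. (\<phi> t \<circ> polygon_side 5 4) (3 * x - 2)) ` {2/3..1}"
    by (rule image_cong) (auto simp: tri_path_piece[OF t])
  then show "tri_path t ` {2/3..1} = side (\<phi> t) 4" unfolding i(3)[symmetric] image_image .
qed

definition tri_sides :: "'a set \<Rightarrow> 'a set set" where
  "tri_sides t = {side (\<phi> (pred_tile t)) 0, side (\<phi> t) 3, side (\<phi> t) 4}"

definition tri_edge :: "'a set \<Rightarrow> 'a set" where "tri_edge t = tri_path t ` {0..1}"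

lemma tri_edge_eq: "t \<in> F \<Longrightarrow> tri_edge t = \<Union>(tri_sides t)"
proof -
  assume t: "t \<in> F"
  have "{0..1::real} = {0..1/3} \<union> {1/3..2/3} \<union> {2/3..1}" by auto
  then have "tri_edge t = tri_path t ` {0..1/3} \<union> tri_path t ` {1/3..2/3} \<union> tri_path t ` {2/3..1}"
    unfolding tri_edge_def by (simp add: image_Un)
  then show ?thesis unfolding tri_path_images[OF t] tri_sides_def by blast
qed

lemma tri_sides_tri: "tri_sides t = tri t"
  unfolding tri_sides_def tri_def pred_tile_def ..

lemma tri_sides_subset: "t \<in> F \<Longrightarrow> tri_sides t \<subseteq> E"
  unfolding tri_sides_tri by (rule tri_subset)

lemma tri_sides_eq:
  assumes "t \<in> F" "t' \<in> F" "x = corner (\<phi> t) 3 \<or> x = corner (\<phi> t) 4" "x = corner (\<phi> t') 3 \<or> x = corner (\<phi> t') 4"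
  shows "tri_sides t = tri_sides t'" "{corner (\<phi> t) 3, corner (\<phi> t) 4} = {corner (\<phi> t') 3, corner (\<phi> t') 4}"
  unfolding tri_sides_tri using tri_eq[OF assms(1,2) A_edge_unique[OF assms]] .

lemma corners_L:
  assumes "t \<in> F"
  shows "corner (\<phi> t) 0 \<in> L" "corner (\<phi> t) 1 \<notin> L" "corner (\<phi> t) 2 \<notin> L" "corner (\<phi> t) 3 \<notin> L" "corner (\<phi> t) 4 \<notin> L"
  using c_in_L[OF assms, of 0] c_in_L[OF assms, of 1] c_in_L[OF assms, of 2] c_in_L[OF assms, of 3] c_in_L[OF assms, of 4]
  by simp_all

lemma sides_V:
  assumes "t \<in> F"
  shows "side (\<phi> t) 0 \<inter> V = {corner (\<phi> t) 0, corner (\<phi> t) 1}" "side (\<phi> t) 1 \<inter> V = {corner (\<phi> t) 1, corner (\<phi> t) 2}"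
    "side (\<phi> t) 2 \<inter> V = {corner (\<phi> t) 2, corner (\<phi> t) 3}" "side (\<phi> t) 3 \<inter> V = {corner (\<phi> t) 3, corner (\<phi> t) 4}"
    "side (\<phi> t) 4 \<inter> V = {corner (\<phi> t) 4, corner (\<phi> t) 0}"
  using ends_simps[OF assms] .

lemma tri_sides_V:
  assumes t: "t \<in> F"
  shows "side (\<phi> (pred_tile t)) 0 \<inter> V = {corner (\<phi> (pred_tile t)) 0, corner (\<phi> t) 3}"
    "e \<in> tri_sides t \<Longrightarrow> e \<inter> V \<subseteq> {corner (\<phi> t) 3, corner (\<phi> t) 4} \<union> L"
    "e \<in> tri_sides t \<Longrightarrow> \<exists>x. (x = corner (\<phi> t) 3 \<or> x = corner (\<phi> t) 4) \<and> x \<in> e"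
proof -
  show 1: "side (\<phi> (pred_tile t)) 0 \<inter> V = {corner (\<phi> (pred_tile t)) 0, corner (\<phi> t) 3}"
    using sides_V(1)[OF pred_tile(1)[OF t]] pred_tile(2)[OF t] by simp
  have cases: "e \<inter> V = {corner (\<phi> (pred_tile t)) 0, corner (\<phi> t) 3} \<or> e \<inter> V = {corner (\<phi> t) 3, corner (\<phi> t) 4} \<or>
      e \<inter> V = {corner (\<phi> t) 4, corner (\<phi> t) 0}" if "e \<in> tri_sides t"
    using that unfolding tri_sides_def
  proof (elim insertE emptyE)
    assume "e = side (\<phi> (pred_tile t)) 0" then show ?thesis using 1 by metis
  next
    assume "e = side (\<phi> t) 3" then show ?thesis using sides_V(4)[OF t] by metis
  next
    assume "e = side (\<phi> t) 4" then show ?thesis using sides_V(5)[OF t] by metis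
  qed
  show "e \<inter> V \<subseteq> {corner (\<phi> t) 3, corner (\<phi> t) 4} \<union> L" if "e \<in> tri_sides t"
    using cases[OF that] by (elim disjE) (simp_all add: corners_L(1)[OF t] corners_L(1)[OF pred_tile(1)[OF t]])
  assume "e \<in> tri_sides t"
  then have "corner (\<phi> t) 3 \<in> e \<inter> V \<or> corner (\<phi> t) 4 \<in> e \<inter> V" using cases by blast
  then show "\<exists>x. (x = corner (\<phi> t) 3 \<or> x = corner (\<phi> t) 4) \<and> x \<in> e" by blast
qed

text \<open>A common point outside \<open>L\<close> gives a common pentagonal edge or a common
  vertex. Either way a corner 3 or 4 is shared, and such a corner determines the triple of
  edges.\<close>

lemma tri_edge_Int:
  assumes t: "t \<in> F" "t' \<in> F" and x: "x \<in> tri_edge t" "x \<in> tri_edge t'" "x \<notin> L"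
  shows "tri_sides t = tri_sides t'"
proof -
  obtain e where e: "e \<in> tri_sides t" "x \<in> e" using x(1) tri_edge_eq[OF t(1)] by blast
  obtain e' where e': "e' \<in> tri_sides t'" "x \<in> e'" using x(2) tri_edge_eq[OF t(2)] by blast
  have EE: "e \<in> E" "e' \<in> E" using tri_sides_subset t e e' by blast+
  show ?thesis
  proof (cases "e = e'")
    case True
    obtain y where y: "y = corner (\<phi> t) 3 \<or> y = corner (\<phi> t) 4" "y \<in> e" using tri_sides_V(3)[OF t(1) e(1)] by blast
    have "y \<in> V" "y \<notin> L" using y(1) corner_in[OF t(1) pentagon[OF t(1)]] corners_L[OF t(1)] by auto
    then have "y = corner (\<phi> t') 3 \<or> y = corner (\<phi> t') 4" using tri_sides_V(2)[OF t(2) e'(1)] y(2) True by blast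
    then show ?thesis using tri_sides_eq(1)[OF t y(1)] by blast
  next
    case False
    then have "x \<in> V" using edge_Int[OF EE] e e' by blast
    then have "x = corner (\<phi> t) 3 \<or> x = corner (\<phi> t) 4" "x = corner (\<phi> t') 3 \<or> x = corner (\<phi> t') 4"
      using tri_sides_V(2)[OF t(1) e(1)] tri_sides_V(2)[OF t(2) e'(1)] e e' x(3) by blast+
    then show ?thesis using tri_sides_eq(1)[OF t] by blast
  qed
qed

lemma tri_path_in_V:
  assumes t: "t \<in> F" and x: "x \<in> {0..1}" "tri_path t x \<in> V"
  shows "x = 0 \<or> x = 1/3 \<or> x = 2/3 \<or> x = 1"
proof -
  consider "x \<le> 1/3" | "1/3 \<le> x" "x \<le> 2/3" | "2/3 \<le> x" by linarith
  then show ?thesis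
  proof cases
    case 1
    then have "3 * x = 0 \<or> 3 * x = 1" using x tri_path_piece(1)[OF t 1]
      by (intro side_point_in_V[OF pred_tile(1)[OF t], of 0]) auto
    then show ?thesis by auto
  next
    case 2
    then have "3 * x - 1 = 0 \<or> 3 * x - 1 = 1" using x tri_path_piece(2)[OF t 2]
      by (intro side_point_in_V[OF t, of 3]) auto
    then show ?thesis by auto
  next
    case 3
    then have "3 * x - 2 = 0 \<or> 3 * x - 2 = 1" using x tri_path_piece(3)[OF t 3]
      by (intro side_point_in_V[OF t, of 4]) auto
    then show ?thesis by auto
  qed
qed

lemma tri_map_side:
  assumes t: "t \<in> F" and x: "x \<in> {0..1}"
  shows "tri_map t (polygon_side 3 k x) = tri_path (turn t k) x"
proof -
  note k = turn(1)[OF t, of k]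
  consider "x \<le> 1/3" | "1/3 \<le> x" "x \<le> 2/3" | "2/3 \<le> x" by linarith
  then show ?thesis
  proof cases
    case 1
    \<comment> \<open>The first third of side \<open>k\<close> belongs to the preceding sector,
      whose index is written \<open>k + 2\<close> instead of \<open>k - 1\<close> to avoid truncated
      subtraction.\<close>
    have k3: "k + 2 + 1 = k + 3" by simp
    have "third_map (k + 2) (polygon_side 5 0 (3 * x)) = polygon_side 3 (k + 2 + 1) (3 * x / 3)"
      by (rule third_map_side(1)) (use 1 x in simp)
    also have "\<dots> = polygon_side 3 k x"
      using polygon_side_mod[of 3 "k + 3" x] polygon_side_mod[of 3 k x] by (simp only: k3) simp
    finally show ?thesis
      using tri_map[OF t, of "polygon_side 5 0 (3 * x)" "k + 2"] turn(4)[OF t, of k] tri_path_piece(1)[OF k 1] by simp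
  next
    case 2
    have "third_map k (polygon_side 5 3 (3 * x - 1)) = polygon_side 3 k ((1 + (3 * x - 1)) / 3)"
      by (rule third_map_side(4)) (use 2 in simp)
    then show ?thesis
      using tri_map[OF t, of "polygon_side 5 3 (3 * x - 1)" k] tri_path_piece(2)[OF k 2] by simp
  next
    case 3
    have "third_map k (polygon_side 5 4 (3 * x - 2)) = polygon_side 3 k ((2 + (3 * x - 2)) / 3)"
      by (rule third_map_side(5)) (use 3 x in simp)
    then show ?thesis
      using tri_map[OF t, of "polygon_side 5 4 (3 * x - 2)" k] tri_path_piece(3)[OF k 3] by simp
  qed
qed

text \<open>The three pieces lie on different edges, which meet in vertices only, and vertices occur
  only at multiples of \<open>1/3\<close>. The ends are left out because they may coincide: an edge
  of the triangulation may be a loop.\<close>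

lemma tri_path_inj:
  assumes t: "t \<in> F"
  shows "inj_on (tri_path t) {0<..<1}"
proof -
  let ?p = "tri_path t"
  note p = pred_tile(1)[OF t]
  have S: "inj_on (\<phi> t \<circ> polygon_side 5 3) {0..1}" "inj_on (\<phi> t \<circ> polygon_side 5 4) {0..1}"
    "inj_on (\<phi> (pred_tile t) \<circ> polygon_side 5 0) {0..1}"
    using side_inj[OF t pentagon[OF t], of 3] side_inj[OF t pentagon[OF t], of 4] side_inj[OF p pentagon[OF p], of 0] by simp_all
  have same: "x = y" if "?p x = ?p y" "0 \<le> x" "x \<le> y" "y \<le> 1"
    "y \<le> 1/3 \<or> (1/3 \<le> x \<and> y \<le> 2/3) \<or> 2/3 \<le> x" for x y
    using that(5)
  proof (elim disjE conjE)
    assume "y \<le> 1/3"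
    then have "3 * x = 3 * y"
      using that tri_path_piece(1)[OF t, of x] tri_path_piece(1)[OF t, of y] by (intro inj_onD[OF S(3)]) auto
    then show ?thesis by simp
  next
    assume "1/3 \<le> x" "y \<le> 2/3"
    then have "3 * x - 1 = 3 * y - 1"
      using that tri_path_piece(2)[OF t, of x] tri_path_piece(2)[OF t, of y] by (intro inj_onD[OF S(1)]) auto
    then show ?thesis by simp
  next
    assume "2/3 \<le> x"
    then have "3 * x - 2 = 3 * y - 2"
      using that tri_path_piece(3)[OF t, of x] tri_path_piece(3)[OF t, of y] by (intro inj_onD[OF S(2)]) auto
    then show ?thesis by simp
  qed
  have d: "side (\<phi> (pred_tile t)) 0 \<noteq> side (\<phi> t) 3" "side (\<phi> (pred_tile t)) 0 \<noteq> side (\<phi> t) 4" "side (\<phi> t) 3 \<noteq> side (\<phi> t) 4"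
    unfolding pred_tile_def by (rule tri_distinct[OF t])+
  have i: "?p x \<in> side (\<phi> (pred_tile t)) 0" if "0 \<le> x" "x \<le> 1/3" for x using that unfolding tri_path_images(1)[OF t, symmetric] by simp
  have j: "?p x \<in> side (\<phi> t) 3" if "1/3 \<le> x" "x \<le> 2/3" for x using that unfolding tri_path_images(2)[OF t, symmetric] by simp
  have k: "?p x \<in> side (\<phi> t) 4" if "2/3 \<le> x" "x \<le> 1" for x using that unfolding tri_path_images(3)[OF t, symmetric] by simp
  have wlog: "x = y" if e: "?p x = ?p y" and x: "0 < x" "x \<le> y" "y < 1" for x y
  proof (cases "y \<le> 1/3 \<or> (1/3 \<le> x \<and> y \<le> 2/3) \<or> 2/3 \<le> x")
    case True
    then show ?thesis using same e x by simp
  next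
    case False
    then have "(x < 1/3 \<and> 1/3 < y) \<or> (1/3 \<le> x \<and> x < 2/3 \<and> 2/3 < y)" by linarith
    then have V: "?p x \<in> V"
    proof (elim disjE conjE)
      assume a: "x < 1/3" "1/3 < y"
      show ?thesis
      proof (cases "y \<le> 2/3")
        case True
        show ?thesis by (rule sides_meet_in_V[OF p t _ _ d(1)]) (use i[of x] j[of y] a x True e in simp_all)
      next
        case False
        show ?thesis by (rule sides_meet_in_V[OF p t _ _ d(2)]) (use i[of x] k[of y] a x False e in simp_all)
      qed
    next
      assume a: "1/3 \<le> x" "x < 2/3" "2/3 < y"
      show ?thesis by (rule sides_meet_in_V[OF t t _ _ d(3)]) (use j[of x] k[of y] a x e in simp_all)
    qed
    then have "x = 0 \<or> x = 1/3 \<or> x = 2/3 \<or> x = 1" "y = 0 \<or> y = 1/3 \<or> y = 2/3 \<or> y = 1"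
      using tri_path_in_V[OF t, of x] tri_path_in_V[OF t, of y] e x by auto
    then have "x = 1/3 \<or> x = 2/3" "y = 1/3 \<or> y = 2/3" using x by auto
    then have "x = 1/3" "y = 2/3" using False x by auto
    then show ?thesis using same[OF e] by simp
  qed
  show ?thesis
  proof (rule inj_onI)
    fix x y assume "x \<in> {0<..<1}" "y \<in> {0<..<1}" "?p x = ?p y"
    then show "x = y" using wlog[of x y] wlog[of y x] by (cases "x \<le> y") auto
  qed
qed

text \<open>Continuity is inherited from the triangle map, of which this path is side 0.\<close>

lemma tri_edge_path:
  assumes t: "t \<in> F"
  shows "edge_path X L (tri_path t)"
proof -
  have "continuous_map (top_of_set {0..1}) (top_of_set (cball 0 1)) (polygon_side 3 0)"
    by (auto intro: continuous_intros)
  then have "continuous_map (top_of_set {0..1}) X (tri_map t \<circ> polygon_side 3 0)"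
    using tri_map_continuous(1)[OF t] by (rule continuous_map_compose)
  then have "continuous_map (top_of_set {0..1}) X (tri_path t)"
    by (rule continuous_map_eq) (use tri_map_side[OF t, of _ 0] turn(2)[OF t] in simp)
  moreover have "tri_path t ` {0<..<1} \<inter> L = {}"
  proof (rule ccontr)
    assume "tri_path t ` {0<..<1} \<inter> L \<noteq> {}"
    then obtain x where x: "x \<in> {0<..<1}" "tri_path t x \<in> L" by blast
    then have "x = 1/3 \<or> x = 2/3" using tri_path_in_V[OF t, of x] L_subset by auto
    then have "tri_path t x = corner (\<phi> t) 3 \<or> tri_path t x = corner (\<phi> t) 4" using tri_path_values(2,3)[OF t] by metis
    then show False using x(2) corners_L(4,5)[OF t] by metis
  qed
  ultimately show ?thesis
    using tri_path_inj[OF t] tri_path_values(1,4)[OF t] corners_L(1)[OF t] corners_L(1)[OF pred_tile(1)[OF t]]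
    by (simp add: edge_path_def pathin_def)
qed

definition tri_edges :: "'a set set" where "tri_edges = tri_edge ` F"

lemma tri_edges_graph: "embedded_graph X L tri_edges"
  unfolding embedded_graph_def
proof (intro conjI ballI impI)
  show "finite L" using finite_subset[OF L_subset graph(1)] .
  show "finite tri_edges" unfolding tri_edges_def using finite_tiles by simp
  show "L \<subseteq> topspace X" using L_subset graph(3) by blast
  show "\<exists>g. edge_path X L g \<and> e = g ` {0..1}" if "e \<in> tri_edges" for e
    using that tri_edge_path unfolding tri_edges_def tri_edge_def by blast
  fix e e' assume e: "e \<in> tri_edges" "e' \<in> tri_edges" "e \<noteq> e'"
  then obtain t t' where t: "t \<in> F" "t' \<in> F" "e = tri_edge t" "e' = tri_edge t'" unfolding tri_edges_def by blast
  show "e \<inter> e' \<subseteq> L"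
  proof
    fix x assume x: "x \<in> e \<inter> e'"
    show "x \<in> L"
    proof (rule ccontr)
      assume "x \<notin> L"
      then have "tri_sides t = tri_sides t'" using tri_edge_Int[OF t(1,2)] x t(3,4) by blast
      then show False using e(3) t tri_edge_eq by simp
    qed
  qed
qed

text \<open>The vertices on edges of the triangulation are in \<open>A\<close> or \<open>L\<close>,
  whereas corner 2 is in neither. Hence side 2 is not part of such an edge and can meet it at corner
  3 only, which \<open>core\<close> omits.\<close>

lemma core_disjoint:
  assumes t: "t \<in> F"
  shows "core t \<inter> (L \<union> \<Union>tri_edges) = {}"
proof (rule ccontr)
  assume "core t \<inter> (L \<union> \<Union>tri_edges) \<noteq> {}"
  then obtain y where y: "y \<in> core t" "y \<in> L \<union> \<Union>tri_edges" by blast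
  have sub: "\<Union>tri_edges \<subseteq> \<Union>E" unfolding tri_edges_def using tri_edge_eq tri_sides_subset by blast
  have "y \<notin> t" using tile_subset(2)[OF t] tile_subset(3)[OF t] y(2) L_subset sub by blast
  then have y2: "y \<in> side (\<phi> t) 2" "y \<noteq> corner (\<phi> t) 3" using y(1) by (auto simp: core_def)
  note c = corners_L[OF t] and ca = c_in_A[OF t]
  from y(2) show False
  proof
    assume "y \<in> L"
    then have "y \<in> side (\<phi> t) 2 \<inter> V" using y2(1) L_subset by blast
    then have "y = corner (\<phi> t) 2 \<or> y = corner (\<phi> t) 3" unfolding sides_V(3)[OF t] by blast
    then show False using c \<open>y \<in> L\<close> by metis
  next
    assume "y \<in> \<Union>tri_edges"
    then obtain t' where t': "t' \<in> F" "y \<in> tri_edge t'" unfolding tri_edges_def by blast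
    then obtain e where e: "e \<in> tri_sides t'" "y \<in> e" using tri_edge_eq by blast
    have eV: "e \<inter> V \<subseteq> A \<union> L" using tri_sides_V(2)[OF t'(1) e(1)] c_in_A[OF t'(1)] by blast
    have "corner (\<phi> t) 2 \<in> side (\<phi> t) 2 \<inter> V" using sides_V(3)[OF t] by blast
    then have ne: "e \<noteq> side (\<phi> t) 2" using eV ca c by blast
    have "e \<in> E" using tri_sides_subset[OF t'(1)] e(1) by blast
    from edge_Int[OF this s_in[OF t, of 2] ne] have "y \<in> V" using e(2) y2(1) by auto
    then have "y = corner (\<phi> t) 2" using sides_V(3)[OF t] y2 by blast
    then show False using eV ca c e(2) \<open>y \<in> V\<close> by blast
  qed
qed

lemma side_0_turn: "t \<in> F \<Longrightarrow> side (\<phi> t) 0 \<in> tri_sides (turn t 1)"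
  unfolding tri_sides_def using pred_tile(3) by simp

text \<open>Sides 0, 3 and 4 of a tile lie on edges of the triangulation. A remaining point of an
  edge is on side 2, or on side 1, which is side 2 of the next tile.\<close>

lemma core_cover:
  assumes y: "y \<in> topspace X" "y \<notin> L \<union> \<Union>tri_edges"
  shows "\<exists>t\<in>F. y \<in> core t"
proof (cases "y \<in> \<Union>E")
  case False
  then have "y \<notin> V" using vertex_on_edge by blast
  then obtain t where "t \<in> F" "y \<in> t" using tiles_Union y(1) False by blast
  then show ?thesis unfolding core_def by blast
next
  case True
  then obtain e where e: "e \<in> E" "y \<in> e" by blast
  obtain t where t: "t \<in> F" "e \<subseteq> X closure_of t" by (rule edge_is_side[OF e(1)])
  obtain k where k: "k < 5" "e = side (\<phi> t) k" using edge_subset_closure_iff[OF t(1) pentagon[OF t(1)] e(1)] t(2) by blast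
  have no: False if "t' \<in> F" "e \<in> tri_sides t'" for t'
    using y(2) e(2) that tri_edge_eq unfolding tri_edges_def by blast
  have c3: "y \<noteq> corner (\<phi> t') 3" if "t' \<in> F" for t'
  proof
    assume "y = corner (\<phi> t') 3"
    moreover have "corner (\<phi> t') 3 \<in> side (\<phi> t') 3" using sides_V(4)[OF that] by blast
    ultimately have "y \<in> tri_edge t'" using tri_edge_eq[OF that] by (auto simp: tri_sides_def)
    then show False using y(2) that unfolding tri_edges_def by blast
  qed
  have t1: "turn t 1 \<in> F" by (rule turn(1)[OF t(1)])
  have "k = 1 \<or> k = 2"
  proof (rule ccontr)
    assume "\<not> (k = 1 \<or> k = 2)"
    then have "k = 0 \<or> k = 3 \<or> k = 4" using k(1) unfolding less_5_cases by blast
    then show False using no[OF t(1)] no[OF t1] side_0_turn[OF t(1)] k(2) unfolding tri_sides_def by blast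
  qed
  then show ?thesis
  proof
    assume "k = 2"
    then have "y \<in> core t" using c3[OF t(1)] e(2) k(2) by (simp add: core_def)
    then show ?thesis using t(1) by blast
  next
    assume "k = 1"
    then have "y \<in> side (\<phi> (turn t 1)) 2" using turn(7)[OF t(1), of 0] turn(2)[OF t(1)] e(2) k(2) by simp
    then have "y \<in> core (turn t 1)" using c3[OF t1] by (simp add: core_def)
    then show ?thesis using t1 by blast
  qed
qed

lemma core_meet:
  assumes t: "t \<in> F" "t' \<in> F" and y: "y \<in> core t" "y \<in> core t'"
  shows "corner (\<phi> t) 2 = corner (\<phi> t') 2"
proof -
  have tE: "y \<notin> side (\<phi> t') 2" if "t \<in> F" "t' \<in> F" "y \<in> t" for t t'
    using tile_subset(3)[OF that(1) s_in[OF that(2), of 2]] that(3) by auto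
  show ?thesis
  proof (cases "y \<in> t \<or> y \<in> t'")
    case True
    then have "y \<in> t" "y \<in> t'" using tE t y unfolding core_def by blast+
    then show ?thesis using tiles_disjoint[OF t] by blast
  next
    case False
    then have s: "y \<in> side (\<phi> t) 2" "y \<noteq> corner (\<phi> t) 3" "y \<in> side (\<phi> t') 2" "y \<noteq> corner (\<phi> t') 3"
      using y unfolding core_def by blast+
    show ?thesis
    proof (cases "side (\<phi> t) 2 = side (\<phi> t') 2")
      case True
      then show ?thesis using side_2_eq[OF t] by simp
    next
      case ne: False
      have "y \<in> V" by (rule sides_meet_in_V[OF t _ _ ne s(1,3)]) simp_all
      then have "y = corner (\<phi> t) 2" "y = corner (\<phi> t') 2" using sides_V(3)[OF t(1)] sides_V(3)[OF t(2)] s by blast+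
      then show ?thesis by simp
    qed
  qed
qed

lemma core_in_tri_map: "t \<in> F \<Longrightarrow> core t \<subseteq> tri_map t ` ball 0 1"
  using tri_map_ball by blast

lemma tri_map_ball_meet:
  assumes t: "t \<in> F" "t' \<in> F" and m: "tri_map t ` ball 0 1 \<inter> tri_map t' ` ball 0 1 \<noteq> {}"
  shows "corner (\<phi> t) 2 = corner (\<phi> t') 2" "tri_map t ` ball 0 1 = tri_map t' ` ball 0 1"
proof -
  obtain u u' y where "u \<in> F" "corner (\<phi> u) 2 = corner (\<phi> t) 2" "u' \<in> F" "corner (\<phi> u') 2 = corner (\<phi> t') 2" "y \<in> core u" "y \<in> core u'"
    using m unfolding tri_map_ball[OF t(1)] tri_map_ball[OF t(2)] by blast
  then show "corner (\<phi> t) 2 = corner (\<phi> t') 2" using core_meet[of u u' y] by simp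
  then show "tri_map t ` ball 0 1 = tri_map t' ` ball 0 1" unfolding tri_map_ball[OF t(1)] tri_map_ball[OF t(2)] by simp
qed

lemma tri_map_open: "t \<in> F \<Longrightarrow> openin X (tri_map t ` ball 0 1)"
  by (rule surface_invariance_of_domain[OF surface open_ball tri_map_continuous(2) tri_map_inj])

text \<open>The images of the open disks are open, connected, equal or disjoint, and cover the
  complement of the new graph, so they are its components.\<close>

lemma tri_tiles: "tiles X L tri_edges = (\<lambda>t. tri_map t ` ball 0 1) ` F"
  unfolding tiles_def[of X L tri_edges]
proof (rule connected_components_of_open_partition)
  let ?Y = "topspace X - (L \<union> \<Union>tri_edges)"
  have sub: "tri_map t ` ball 0 1 \<subseteq> ?Y" if t: "t \<in> F" for t
  proof
    fix y assume y: "y \<in> tri_map t ` ball 0 1"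
    then obtain t' where "t' \<in> F" "y \<in> core t'" unfolding tri_map_ball[OF t] by (elim UN_E CollectE conjE)
    then have "y \<notin> L \<union> \<Union>tri_edges" using core_disjoint[of t'] by (metis disjoint_iff)
    moreover have "y \<in> topspace X" using y openin_subset[OF tri_map_open[OF t]] by (metis subsetD)
    ultimately show "y \<in> ?Y" by (metis DiffI)
  qed
  have ts: "topspace (subtopology X ?Y) = ?Y" by (rule topspace_subtopology_subset) (rule Diff_subset)
  show "\<Union>((\<lambda>t. tri_map t ` ball 0 1) ` F) = topspace (subtopology X ?Y)"
    unfolding ts
  proof
    show "\<Union>((\<lambda>t. tri_map t ` ball 0 1) ` F) \<subseteq> ?Y" by (rule UN_least) (rule sub)
    show "?Y \<subseteq> \<Union>((\<lambda>t. tri_map t ` ball 0 1) ` F)"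
    proof
      fix y assume "y \<in> ?Y"
      then obtain t where "t \<in> F" "y \<in> core t" using core_cover[of y] by (metis DiffE)
      then show "y \<in> \<Union>((\<lambda>t. tri_map t ` ball 0 1) ` F)" using core_in_tri_map by (metis UN_I subsetD)
    qed
  qed
  fix w assume "w \<in> (\<lambda>t. tri_map t ` ball 0 1) ` F"
  then obtain t where t: "t \<in> F" "w = tri_map t ` ball 0 1" by blast
  have "openin (subtopology X ?Y) w"
    using openin_subtopology_Int2[OF tri_map_open[OF t(1)], of ?Y] sub[OF t(1)] t(2) by (simp add: Int_absorb1)
  moreover have "connectedin X w"
    unfolding t(2) by (rule connectedin_continuous_map_image[OF tri_map_continuous(2)[OF t(1)]]) (simp add: connectedin_subtopology)
  then have "connectedin (subtopology X ?Y) w" using sub[OF t(1)] t(2) by (simp add: connectedin_subtopology)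
  ultimately show "openin (subtopology X ?Y) w \<and> connectedin (subtopology X ?Y) w \<and> w \<noteq> {}" using t(2) by simp
next
  fix w w' assume "w \<in> (\<lambda>t. tri_map t ` ball 0 1) ` F" "w' \<in> (\<lambda>t. tri_map t ` ball 0 1) ` F" "w \<noteq> w'"
  then show "w \<inter> w' = {}" using tri_map_ball_meet(2) by blast
qed

lemma tri_polygon_map:
  assumes t: "t \<in> F"
  shows "polygon_map X L tri_edges 3 (tri_map t ` ball 0 1) (tri_map t)"
  unfolding polygon_map_def
proof (intro conjI allI impI)
  show "homeomorphic_map (top_of_set (ball 0 1)) (subtopology X (tri_map t ` ball 0 1)) (tri_map t)"
    by (rule surface_homeomorphic_map[OF surface open_ball tri_map_continuous(2)[OF t] tri_map_inj[OF t]])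
  fix k :: nat
  have e: "(tri_map t \<circ> polygon_side 3 k) x = tri_path (turn t k) x" if "x \<in> {0..1}" for x
    using tri_map_side[OF t that] by simp
  note p = tri_edge_path[OF turn(1)[OF t, of k]]
  have im: "(tri_map t \<circ> polygon_side 3 k) ` S = tri_path (turn t k) ` S" if "S \<subseteq> {0..1}" for S
    by (rule image_cong) (use e that in blast)+
  show "(tri_map t \<circ> polygon_side 3 k) ` {0..1} \<in> tri_edges"
    using im[of "{0..1}"] turn(1)[OF t, of k] by (simp add: tri_edges_def tri_edge_def)
  have "pathin X (tri_map t \<circ> polygon_side 3 k)"
    using p continuous_map_eq[of "top_of_set {0..1}" X "tri_path (turn t k)" "tri_map t \<circ> polygon_side 3 k"] e
    by (simp add: edge_path_def pathin_def)
  moreover have "inj_on (tri_map t \<circ> polygon_side 3 k) {0<..<1}"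
    using inj_on_cong[of "{0<..<1}" "tri_map t \<circ> polygon_side 3 k" "tri_path (turn t k)"] e p by (simp add: edge_path_def)
  moreover have "(tri_map t \<circ> polygon_side 3 k) ` {0<..<1} = tri_path (turn t k) ` {0<..<1}" by (rule im) auto
  ultimately show "edge_path X L (tri_map t \<circ> polygon_side 3 k)"
    using p e[of 0] e[of 1] unfolding edge_path_def by simp
qed (use tri_map_continuous(1)[OF t] in simp_all)

end

subsection \<open>The triangulation and its pentagonal subdivision\<close>

context circ_matched_tiling
begin

text \<open>The midpoint of \<open>e\<close> is not a vertex, so the piece of
  \<open>tri_edge t\<close> that contains it equals \<open>e\<close>.\<close>

lemma edge_subset_tri_edge:
  assumes t: "t \<in> F" and e: "e \<in> E" "e \<subseteq> tri_edge t"
  shows "e \<in> tri_sides t"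
proof -
  obtain u where u: "u \<in> F" "e \<subseteq> X closure_of u" by (rule edge_is_side[OF e(1)])
  obtain k where k: "k < 5" "e = side (\<phi> u) k" using edge_subset_closure_iff[OF u(1) pentagon[OF u(1)] e(1)] u(2) by blast
  define y where "y = \<phi> u (polygon_side 5 k (1/2))"
  have ye: "y \<in> e" unfolding k(2) y_def by (rule image_eqI[of _ _ "1/2"]) simp_all
  have yV: "y \<notin> V"
  proof
    assume "y \<in> V"
    from side_point_in_V[OF u(1) k(1) _ this[unfolded y_def]] show False by simp
  qed
  obtain d where d: "d \<in> tri_sides t" "y \<in> d" using ye e(2) tri_edge_eq[OF t] by blast
  have "d \<in> E" using tri_sides_subset[OF t] d(1) by blast
  then have "d = e" using edge_Int[OF _ e(1)] d(2) ye yV by blast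
  then show ?thesis using d(1) by simp
qed

lemma tri_edge_Int_L:
  assumes t: "t \<in> F"
  shows "tri_edge t \<inter> L = {corner (\<phi> (pred_tile t)) 0, corner (\<phi> t) 0}"
proof -
  have "tri_edge t \<inter> L = ((side (\<phi> (pred_tile t)) 0 \<inter> V) \<union> (side (\<phi> t) 3 \<inter> V) \<union> (side (\<phi> t) 4 \<inter> V)) \<inter> L"
    unfolding tri_edge_eq[OF t] tri_sides_def using L_subset by blast
  then show ?thesis
    unfolding tri_sides_V(1)[OF t] sides_V(4,5)[OF t]
    using corners_L[OF t] corners_L(1)[OF pred_tile(1)[OF t]] by (simp add: Int_insert_left insert_commute)
qed

text \<open>Every edge of the pentagonal tiling at \<open>v\<close> lies in an edge of the triangulation at \<open>v\<close>, and two of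
  them lie in the same one only if it is a loop, which is counted twice.\<close>

lemma tri_degree:
  assumes v: "v \<in> L"
  shows "3 \<le> vertex_degree L tri_edges v"
proof -
  define S where "S = {e \<in> E. v \<in> e}"
  define M where "M = {e \<in> tri_edges. v \<in> e}"
  define N where "N = {e \<in> tri_edges. e \<inter> L = {v}}"
  define P where "P e = {d \<in> S. d \<subseteq> e}" for e
  have fin: "finite M" using tri_edges_graph by (simp add: M_def embedded_graph_def)
  have NM: "N \<subseteq> M" by (auto simp: N_def M_def)
  have "S \<subseteq> (\<Union>e\<in>M. P e)"
  proof
    fix d assume d: "d \<in> S"
    then have dE: "d \<in> E" "v \<in> d" by (simp_all add: S_def)
    then have "spoke d" using v L_subset unfolding spoke_def by blast
    then obtain t where t: "t \<in> F" "d = side (\<phi> t) 4" using spoke_eq_side_4[OF dE(1)] by blast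
    then have "d \<in> tri_sides t" by (simp add: tri_sides_def)
    then have de: "d \<subseteq> tri_edge t" using tri_edge_eq[OF t(1)] by blast
    then have "tri_edge t \<in> M" using dE(2) t(1) by (auto simp: M_def tri_edges_def)
    then show "d \<in> (\<Union>e\<in>M. P e)" using d de by (auto simp: P_def)
  qed
  moreover have "finite (\<Union>e\<in>M. P e)" using graph(2) fin by (auto simp: P_def S_def)
  ultimately have "card S \<le> card (\<Union>e\<in>M. P e)" by (metis card_mono)
  also have "\<dots> \<le> (\<Sum>e\<in>M. card (P e))" by (rule card_UN_le[OF fin])
  also have "\<dots> \<le> (\<Sum>e\<in>M. 1 + (if e \<in> N then 1 else 0))"
  proof (rule sum_mono)
    fix e assume e: "e \<in> M"
    then obtain t where t: "t \<in> F" "e = tri_edge t" by (auto simp: M_def tri_edges_def)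
    define a b where "a = side (\<phi> (pred_tile t)) 0" and "b = side (\<phi> t) 4"
    have aV: "a \<inter> V = {corner (\<phi> (pred_tile t)) 0, corner (\<phi> t) 3}" "b \<inter> V = {corner (\<phi> t) 4, corner (\<phi> t) 0}"
      unfolding a_def b_def by (rule tri_sides_V(1)[OF t(1)] sides_V(5)[OF t(1)])+
    have vV: "v \<in> V" using v L_subset by blast
    have sub: "P e \<subseteq> {a, b}"
    proof
      fix d assume "d \<in> P e"
      then have d: "d \<in> E" "v \<in> d" "d \<subseteq> e" by (simp_all add: P_def S_def)
      then have "d \<in> tri_sides t" using edge_subset_tri_edge[OF t(1) d(1)] t(2) by simp
      moreover have "d \<noteq> side (\<phi> t) 3"
      proof
        assume "d = side (\<phi> t) 3"
        then have "v \<in> {corner (\<phi> t) 3, corner (\<phi> t) 4}" using sides_V(4)[OF t(1)] d(2) vV by blast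
        then show False using corners_L(4,5)[OF t(1)] v by blast
      qed
      ultimately show "d \<in> {a, b}" unfolding tri_sides_def a_def b_def by blast
    qed
    show "card (P e) \<le> 1 + (if e \<in> N then 1 else 0)"
    proof (cases "e \<in> N")
      case True
      have "card (P e) \<le> card {a, b}" by (rule card_mono[OF _ sub]) simp
      also have "\<dots> \<le> 2" by (simp add: card_insert_if)
      finally show ?thesis using True by simp
    next
      case False
      have "\<not> (a \<in> P e \<and> b \<in> P e)"
      proof
        assume "a \<in> P e \<and> b \<in> P e"
        then have "v \<in> a \<inter> V" "v \<in> b \<inter> V" using vV by (simp_all add: P_def S_def)
        then have "v \<in> {corner (\<phi> (pred_tile t)) 0, corner (\<phi> t) 3}" "v \<in> {corner (\<phi> t) 4, corner (\<phi> t) 0}"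
          unfolding aV .
        then have "v = corner (\<phi> (pred_tile t)) 0" "v = corner (\<phi> t) 0"
          using corners_L(4,5)[OF t(1)] v by (metis insertE singletonD)+
        then have "e \<inter> L = {v}" using tri_edge_Int_L[OF t(1)] t(2) by simp
        then show False using False e by (simp add: N_def M_def)
      qed
      then have "P e \<subseteq> {a} \<or> P e \<subseteq> {b}" using sub by blast
      then have "card (P e) \<le> 1" by (metis card.empty card_mono finite.intros is_singletonI is_singleton_altdef)
      then show ?thesis by simp
    qed
  qed
  also have "\<dots> = card M + card N"
    unfolding sum.distrib using NM fin by (simp add: sum.If_cases Int_absorb1)
  finally have "card S \<le> card M + card N" .
  moreover have "3 \<le> card S" using degree_ge vertex_degree_eq v L_subset unfolding S_def by (metis subsetD)
  ultimately show ?thesis by (simp add: vertex_degree_def M_def N_def)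
qed

lemma tri_tiling: "tiling X L tri_edges"
  unfolding tiling_def
proof (intro conjI ballI)
  fix W assume "W \<in> tiles X L tri_edges"
  then show "\<exists>n \<psi>. polygon_map X L tri_edges n W \<psi>" unfolding tri_tiles using tri_polygon_map by blast
qed (use tri_edges_graph tri_degree in simp_all)

text \<open>The images of the open thirds are dense in the disk. On each of them,
  \<open>tri_map t\<close> is a tile parametrization composed with the inverse of
  \<open>third_map k\<close>, and both preserve orientation.\<close>

lemma tri_positive:
  assumes t: "t \<in> F"
  shows "positively_oriented (positive_charts X (\<phi> ` F)) (tri_map t)"
  unfolding positively_oriented_def
proof clarify
  fix U f assume "(U, f) \<in> positive_charts X (\<phi> ` F)"
  then have ch: "surface_chart X U f" and pos: "positive_on (\<phi> ` F) f U" by (auto simp: positive_charts_def)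
  note C = surface_chart_compose[OF ch open_ball tri_map_continuous(2)[OF t] tri_map_inj[OF t]]
  show "orientation_preserving_on {z \<in> ball 0 1. tri_map t z \<in> U} (f \<circ> tri_map t)"
  proof (rule orientation_preserving_on_dense[OF C(2,3)])
    fix z and e :: real assume z: "z \<in> {z \<in> ball 0 1. tri_map t z \<in> U}" and e: "0 < e"
    define W where "W = {z \<in> ball 0 1. tri_map t z \<in> U} \<inter> ball z e"
    have W: "open W" "z \<in> W" unfolding W_def using C(1) z e by auto
    have "z \<in> cball 0 1" using z by simp
    then obtain k u where u: "u \<in> cball 0 1" "z = third_map k u" using third_map_cover by blast
    \<comment> \<open>The point \<open>u\<close> may lie on the boundary circle; a nearby
      \<open>v\<close> in the open disk is found whose image under \<open>third_map k\<close> is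
      still close to \<open>z\<close>.\<close>
    have "openin (top_of_set (cball 0 1)) (cball 0 1 \<inter> third_map k -` W)"
      by (rule continuous_openin_preimage_gen[OF third_map(1) W(1)])
    then obtain Q where Q: "open Q" "cball 0 1 \<inter> third_map k -` W = cball 0 1 \<inter> Q" unfolding openin_open by blast
    have "u \<in> Q" using u W(2) Q(2) by blast
    moreover have "u \<in> closure (ball 0 1)" using u(1) by simp
    ultimately have "Q \<inter> closure (ball 0 1) \<noteq> {}" by blast
    then have "Q \<inter> ball 0 1 \<noteq> {}" unfolding open_Int_closure_eq_empty[OF Q(1)] .
    then obtain v where v: "v \<in> ball 0 1" "v \<in> Q" by blast
    then have "v \<in> cball 0 1 \<inter> Q" by simp
    then have vW: "third_map k v \<in> W" unfolding Q(2)[symmetric] by simp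
    define g where "g = \<phi> (turn t k)"
    have g: "g \<in> \<phi> ` F" unfolding g_def using turn(1)[OF t] by blast
    have tm: "tri_map t (third_map k w) = g w" if "w \<in> ball 0 1" for w
      unfolding g_def using that by (intro tri_map[OF t]) simp
    define T0 where "T0 = {w \<in> ball 0 1. g w \<in> U}"
    note D = disk_chart[OF ch g, folded T0_def]
    have T0s: "T0 \<subseteq> ball 0 1" by (auto simp: T0_def)
    have b: "ball 0 1 \<subseteq> (cball 0 1 :: complex set)" by auto
    have c: "continuous_on T0 (third_map k)" "inj_on (third_map k) T0"
      using continuous_on_subset[OF third_map(1)] inj_on_subset[OF third_map(2)] T0s b by (metis order_trans)+
    have op: "orientation_preserving_on T0 (third_map k)" "orientation_preserving_on T0 (f \<circ> g)"
      using orientation_preserving_on_subset[OF third_map(5) T0s] pos g unfolding positive_on_def T0_def by blast+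
    define h where "h = inv_into T0 (third_map k)"
    have h: "h (third_map k w) = w" if "w \<in> T0" for w unfolding h_def by (rule inv_into_f_f[OF c(2) that])
    let ?T = "third_map k ` T0"
    have hop: "orientation_preserving_on ?T h" by (rule orientation_preserving_on_inverse[OF D(1) c(1) op(1) h])
    have hc: "continuous_on ?T h" "open ?T" using continuous_on_left_inverse_open[OF D(1) c(1) h] by blast+
    have hi: "inj_on h ?T" by (simp add: h_def inj_on_inv_into)
    have hT: "h ` ?T \<subseteq> T0" using h by auto
    have "orientation_preserving_on ?T ((f \<circ> g) \<circ> h)"
      by (rule orientation_preserving_on_compose[OF hc(2,1) hi hop D op(2) hT])
    moreover have "((f \<circ> g) \<circ> h) y = (f \<circ> tri_map t) y" if "y \<in> ?T" for y
    proof -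
      obtain w where w: "w \<in> T0" "y = third_map k w" using \<open>y \<in> ?T\<close> by blast
      then show ?thesis using h[OF w(1)] tm[of w] T0s by auto
    qed
    ultimately have "orientation_preserving_on ?T (f \<circ> tri_map t)" using orientation_preserving_on_cong by blast
    moreover have "v \<in> T0" using v(1) vW tm[OF v(1)] by (simp add: T0_def W_def)
    ultimately show "\<exists>z' T. z' \<in> ball z e \<and> z' \<in> T \<and> open T \<and> orientation_preserving_on T (f \<circ> tri_map t)"
      using hc(2) vW unfolding W_def by blast
  qed
qed

section \<open>Assembling the data of the pentagonal subdivision\<close>

lemma tri_edge_same:
  assumes t: "t \<in> F" "t' \<in> F" and e: "tri_edge t = tri_edge t'"
  shows "tri_sides t = tri_sides t'" "{corner (\<phi> t) 3, corner (\<phi> t) 4} = {corner (\<phi> t') 3, corner (\<phi> t') 4}"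
proof -
  have "corner (\<phi> t) 3 \<in> tri_edge t"
    using tri_path_values(2)[OF t(1)] unfolding tri_edge_def by (intro image_eqI[of _ _ "1/3"]) simp_all
  then obtain d where d: "d \<in> tri_sides t'" "corner (\<phi> t) 3 \<in> d" unfolding e tri_edge_eq[OF t(2)] by blast
  moreover have "corner (\<phi> t) 3 \<in> V" by (rule corner_in[OF t(1) pentagon[OF t(1)]]) simp
  ultimately have "corner (\<phi> t) 3 = corner (\<phi> t') 3 \<or> corner (\<phi> t) 3 = corner (\<phi> t') 4"
    using tri_sides_V(2)[OF t(2) d(1)] corners_L(4)[OF t(1)] by blast
  then show "tri_sides t = tri_sides t'" "{corner (\<phi> t) 3, corner (\<phi> t) 4} = {corner (\<phi> t') 3, corner (\<phi> t') 4}"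
    using tri_sides_eq[OF t, of "corner (\<phi> t) 3"] by simp_all
qed

text \<open>An edge of the triangulation arises from the two tiles that share a side 3, in opposite
  directions. One of them is chosen to parametrize it; the pair of dividing points does not depend
  on the choice.\<close>

definition edge_tile :: "'a set \<Rightarrow> 'a set" where "edge_tile e = (SOME t. t \<in> F \<and> tri_edge t = e)"

text \<open>A triangle arises from each of the tiles around its center; the choice only rotates the
  numbering of its sides.\<close>

definition region_tile :: "'a set \<Rightarrow> 'a set" where "region_tile W = (SOME t. t \<in> F \<and> tri_map t ` ball 0 1 = W)"

lemma edge_tile:
  assumes "t \<in> F"
  shows "edge_tile (tri_edge t) \<in> F" "tri_edge (edge_tile (tri_edge t)) = tri_edge t"
  using someI[of "\<lambda>u. u \<in> F \<and> tri_edge u = tri_edge t" t] assms unfolding edge_tile_def by blast+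

lemma region_tile:
  assumes t: "t \<in> F"
  shows "region_tile (tri_map t ` ball 0 1) \<in> F"
    "tri_map (region_tile (tri_map t ` ball 0 1)) ` ball 0 1 = tri_map t ` ball 0 1"
    "corner (\<phi> (region_tile (tri_map t ` ball 0 1))) 2 = corner (\<phi> t) 2"
proof -
  let ?u = "region_tile (tri_map t ` ball 0 1)"
  show u: "?u \<in> F" "tri_map ?u ` ball 0 1 = tri_map t ` ball 0 1"
    using someI[of "\<lambda>u. u \<in> F \<and> tri_map u ` ball 0 1 = tri_map t ` ball 0 1" t] t unfolding region_tile_def by blast+
  have "tri_map ?u ` ball 0 1 \<inter> tri_map t ` ball 0 1 \<noteq> {}" unfolding u(2) by simp
  then show "corner (\<phi> ?u) 2 = corner (\<phi> t) 2" by (rule tri_map_ball_meet(1)[OF u(1) t])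
qed

definition radius :: "nat \<Rightarrow> real \<Rightarrow> complex" where "radius k = linepath 0 (polygon_side 3 k (1 / 3))"

lemma path_image_radius: "path_image (radius k) = (\<lambda>r. of_real r * polygon_side 3 k (1 / 3)) ` {0..1}"
  unfolding radius_def path_image_def by (simp add: linepath_def scaleR_conv_of_real)

lemma radius_image:
  assumes t: "t \<in> F"
  shows "tri_map t ` path_image (radius k) = side (\<phi> (turn t k)) 2"
  unfolding path_image_radius image_image by (rule image_cong[OF refl]) (use tri_map_radius[OF t] in simp)

lemma radius:
  assumes k: "k < 3"
  shows "arc (radius k)" "pathstart (radius k) = 0" "pathfinish (radius k) = polygon_side 3 k (1 / 3)"
    "path_image (radius k) - {pathfinish (radius k)} \<subseteq> ball 0 1"
    "l < 3 \<Longrightarrow> k \<noteq> l \<Longrightarrow> path_image (radius k) \<inter> path_image (radius l) = {0}"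
proof -
  have "polygon_side 3 k (1 / 3) \<noteq> 0" using norm_polygon_side[of 3 k "1/3"] by (metis norm_zero zero_neq_one)
  then show "arc (radius k)" by (simp add: radius_def)
  show "pathstart (radius k) = 0" "pathfinish (radius k) = polygon_side 3 k (1 / 3)" by (simp_all add: radius_def)
  have "of_real r * polygon_side 3 k (1 / 3) \<in> ball 0 1" if "r \<in> {0..1}" "of_real r * polygon_side 3 k (1 / 3) \<noteq> polygon_side 3 k (1 / 3)" for r
  proof -
    have "r \<noteq> 1" using that(2) by auto
    then show ?thesis using that(1) by (simp add: norm_mult)
  qed
  then show "path_image (radius k) - {pathfinish (radius k)} \<subseteq> ball 0 1"
    unfolding path_image_radius \<open>pathfinish (radius k) = polygon_side 3 k (1 / 3)\<close> by blast
  assume l: "l < 3" "k \<noteq> l"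
  show "path_image (radius k) \<inter> path_image (radius l) = {0}"
  proof
    show "{0} \<subseteq> path_image (radius k) \<inter> path_image (radius l)"
      unfolding path_image_radius by (auto intro!: image_eqI[of _ _ 0])
    show "path_image (radius k) \<inter> path_image (radius l) \<subseteq> {0}"
    proof
      fix z assume "z \<in> path_image (radius k) \<inter> path_image (radius l)"
      then obtain r q where r: "r \<in> {0..1}" "q \<in> {0..1}" "z = of_real r * polygon_side 3 k (1 / 3)" "z = of_real q * polygon_side 3 l (1 / 3)"
        unfolding path_image_radius by blast
      have "cmod z = r" unfolding r(3) using r(1) by (simp add: norm_mult)
      moreover have "cmod z = q" unfolding r(4) using r(2) by (simp add: norm_mult)
      ultimately have "r = q" by simp
      have "r = 0"
      proof (rule ccontr)
        assume "r \<noteq> 0"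
        then have "polygon_side 3 k (1 / 3) = polygon_side 3 l (1 / 3)" using r(3,4) \<open>r = q\<close> by simp
        then show False using polygon_side_inj[of 3 k "1/3" l "1/3"] k l by simp
      qed
      then show "z \<in> {0}" using r(3) by simp
    qed
  qed
qed

text \<open>The three sets are the vertices of T, the dividing points and the centers. Corner 1 of a
  tile is accounted for as corner 3 of the next one.\<close>

lemma V_eq: "V = L \<union> (\<Union>t\<in>F. {corner (\<phi> t) 3, corner (\<phi> t) 4}) \<union> (\<Union>t\<in>F. {corner (\<phi> t) 2})"
proof
  have "corner (\<phi> t) k \<in> V" if "t \<in> F" "k < 5" for t k using corner_in[OF that(1) pentagon[OF that(1)] that(2)] .
  then show "L \<union> (\<Union>t\<in>F. {corner (\<phi> t) 3, corner (\<phi> t) 4}) \<union> (\<Union>t\<in>F. {corner (\<phi> t) 2}) \<subseteq> V"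
    using L_subset by (intro Un_least UN_least insert_subsetI) simp_all
  show "V \<subseteq> L \<union> (\<Union>t\<in>F. {corner (\<phi> t) 3, corner (\<phi> t) 4}) \<union> (\<Union>t\<in>F. {corner (\<phi> t) 2})"
  proof
    fix v assume v: "v \<in> V"
    obtain e where e: "e \<in> E" "v \<in> e" by (rule vertex_on_edge[OF v])
    obtain t where t: "t \<in> F" "e \<subseteq> X closure_of t" by (rule edge_is_side[OF e(1)])
    have "v \<in> tile_vertices X V t" using v e(2) t(2) unfolding tile_vertices_def by blast
    then obtain k where k: "k < 5" "v = corner (\<phi> t) k" unfolding tile_vertices_eq[OF t(1) pentagon[OF t(1)]] by blast
    have t1: "turn t 1 \<in> F" by (rule turn(1)[OF t(1)])
    have "corner (\<phi> t) 1 = corner (\<phi> (turn t 1)) 3" using pred_tile(2)[OF t1] pred_tile(3)[OF t(1)] by simp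
    moreover have "k = 0 \<or> k = 1 \<or> k = 2 \<or> k = 3 \<or> k = 4" using k(1) unfolding less_5_cases .
    ultimately have "v \<in> L \<or> v = corner (\<phi> (turn t 1)) 3 \<or> v = corner (\<phi> t) 2 \<or> v = corner (\<phi> t) 3 \<or> v = corner (\<phi> t) 4"
      using k(2) corners_L(1)[OF t(1)] by metis
    then show "v \<in> L \<union> (\<Union>t\<in>F. {corner (\<phi> t) 3, corner (\<phi> t) 4}) \<union> (\<Union>t\<in>F. {corner (\<phi> t) 2})"
      using t(1) t1 by blast
  qed
qed

text \<open>Sides 0 and 1 of a tile are accounted for by the next tile: side 0 belongs to its
  triple, and side 1 is its side 2.\<close>

lemma E_eq: "E = (\<Union>t\<in>F. tri_sides t) \<union> (\<Union>t\<in>F. {side (\<phi> t) 2})"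
proof
  show "(\<Union>t\<in>F. tri_sides t) \<union> (\<Union>t\<in>F. {side (\<phi> t) 2}) \<subseteq> E"
  proof (intro Un_least UN_least)
    show "tri_sides t \<subseteq> E" if "t \<in> F" for t using tri_sides_subset[OF that] .
    show "{side (\<phi> t) 2} \<subseteq> E" if "t \<in> F" for t using s_in[OF that, of 2] by simp
  qed
  show "E \<subseteq> (\<Union>t\<in>F. tri_sides t) \<union> (\<Union>t\<in>F. {side (\<phi> t) 2})"
  proof
    fix e assume e: "e \<in> E"
    obtain t where t: "t \<in> F" "e \<subseteq> X closure_of t" by (rule edge_is_side[OF e])
    obtain k where k: "k < 5" "e = side (\<phi> t) k" using edge_subset_closure_iff[OF t(1) pentagon[OF t(1)] e] t(2) by blast
    have t1: "turn t 1 \<in> F" by (rule turn(1)[OF t(1)])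
    have 1: "side (\<phi> t) 1 = side (\<phi> (turn t 1)) 2" using turn(7)[OF t(1), of 0] turn(2)[OF t(1)] by simp
    have 34: "side (\<phi> t) 3 \<in> tri_sides t" "side (\<phi> t) 4 \<in> tri_sides t" by (simp_all add: tri_sides_def)
    have "k = 0 \<or> k = 1 \<or> k = 2 \<or> k = 3 \<or> k = 4" using k(1) unfolding less_5_cases .
    then have "e \<in> tri_sides (turn t 1) \<or> e = side (\<phi> (turn t 1)) 2 \<or> e = side (\<phi> t) 2 \<or> e \<in> tri_sides t"
      using k(2) 1 34 side_0_turn[OF t(1)] by metis
    then show "e \<in> (\<Union>t\<in>F. tri_sides t) \<union> (\<Union>t\<in>F. {side (\<phi> t) 2})" using t(1) t1 by blast
  qed
qed

theorem tri_subdivision: "pentagonal_subdivision X (positive_charts X (\<phi> ` F)) L tri_edges V E"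
proof -
  define \<gamma> where "\<gamma> e = tri_path (edge_tile e)" for e
  define \<Phi> where "\<Phi> W = tri_map (region_tile W)" for W
  define D where "D = (\<Union>t\<in>F. {corner (\<phi> t) 3, corner (\<phi> t) 4})"
  have \<gamma>: "edge_path X L (\<gamma> e) \<and> \<gamma> e ` {0..1} = e" if e: "e \<in> tri_edges" for e
  proof -
    obtain t where t: "t \<in> F" "e = tri_edge t" using e unfolding tri_edges_def by blast
    then show ?thesis using tri_edge_path[OF edge_tile(1)[OF t(1)]] edge_tile(2)[OF t(1)]
      unfolding \<gamma>_def tri_edge_def by simp
  qed
  have \<gamma>D: "{\<gamma> (tri_edge t) (1/3), \<gamma> (tri_edge t) (2/3)} = {corner (\<phi> t) 3, corner (\<phi> t) 4}" if t: "t \<in> F" for t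
    using tri_path_values(2,3)[OF edge_tile(1)[OF t]] tri_edge_same(2)[OF edge_tile(1)[OF t] t edge_tile(2)[OF t]]
    unfolding \<gamma>_def by simp
  have \<gamma>E: "{\<gamma> (tri_edge t) ` {0..1/3}, \<gamma> (tri_edge t) ` {1/3..2/3}, \<gamma> (tri_edge t) ` {2/3..1}} = tri_sides t" if t: "t \<in> F" for t
    using tri_edge_same(1)[OF edge_tile(1)[OF t] t edge_tile(2)[OF t]]
    unfolding \<gamma>_def tri_path_images[OF edge_tile(1)[OF t]] tri_sides_def .
  have D: "D = (\<Union>e\<in>tri_edges. {\<gamma> e (1/3), \<gamma> e (2/3)})"
    unfolding D_def tri_edges_def using \<gamma>D by simp
  have DV: "D \<subseteq> V" unfolding D_def by (subst V_eq) blast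
  have DL: "D \<inter> L = {}" using corners_L(4,5) unfolding D_def by blast
  \<comment> \<open>Before time \<open>1/3\<close>, a side of the triangle meets \<open>V\<close>
    only at its starting point, which is in \<open>L\<close> and hence not a dividing point.\<close>
  have meets: "first_meets (\<Phi> (tri_map t ` ball 0 1) \<circ> polygon_side 3 k) D (1/3)" if t: "t \<in> F" for t k
  proof -
    define u where "u = turn (region_tile (tri_map t ` ball 0 1)) k"
    have u: "u \<in> F" unfolding u_def by (rule turn(1)[OF region_tile(1)[OF t]])
    have p: "(\<Phi> (tri_map t ` ball 0 1) \<circ> polygon_side 3 k) x = tri_path u x" if "x \<in> {0..1}" for x
      unfolding \<Phi>_def u_def using tri_map_side[OF region_tile(1)[OF t] that] by simp
    have "tri_path u (1/3) \<in> D" using tri_path_values(2)[OF u] u unfolding D_def by blast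
    moreover have "tri_path u r \<notin> D" if r: "r \<in> {0..<1/3}" for r
    proof
      assume d: "tri_path u r \<in> D"
      then have "r = 0" using tri_path_in_V[OF u, of r] DV r by auto
      then have "tri_path u r \<in> L" using tri_path_values(1)[OF u] corners_L(1)[OF pred_tile(1)[OF u]] by simp
      then show False using d DL by blast
    qed
    ultimately show ?thesis unfolding first_meets_def using p by simp
  qed
  have tile: "polygon_map X L tri_edges 3 W (\<Phi> W) \<and> positively_oriented (positive_charts X (\<phi> ` F)) (\<Phi> W) \<and> 0 \<in> ball (0::complex) 1 \<and>
      (\<forall>k<3. arc (radius k) \<and> pathstart (radius k) = 0 \<and>
         (\<exists>s. first_meets (\<Phi> W \<circ> polygon_side 3 k) D s \<and> pathfinish (radius k) = polygon_side 3 k s) \<and>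
         path_image (radius k) - {pathfinish (radius k)} \<subseteq> ball 0 1) \<and>
      (\<forall>k<3. \<forall>l<3. k \<noteq> l \<longrightarrow> path_image (radius k) \<inter> path_image (radius l) = {0})"
    if W: "W \<in> tiles X L tri_edges" for W
  proof (intro conjI allI impI)
    obtain t where t: "t \<in> F" "W = tri_map t ` ball 0 1" using W unfolding tri_tiles by blast
    show "polygon_map X L tri_edges 3 W (\<Phi> W)"
      using tri_polygon_map[OF region_tile(1)[OF t(1)]] region_tile(2)[OF t(1)] unfolding \<Phi>_def t(2) by simp
    show "positively_oriented (positive_charts X (\<phi> ` F)) (\<Phi> W)"
      unfolding \<Phi>_def t(2) by (rule tri_positive[OF region_tile(1)[OF t(1)]])
    fix k :: nat assume k: "k < 3"
    show "\<exists>s. first_meets (\<Phi> W \<circ> polygon_side 3 k) D s \<and> pathfinish (radius k) = polygon_side 3 k s"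
      using meets[OF t(1), of k] radius(3)[OF k] t(2) by blast
  qed ((rule radius; assumption) | simp)+
  have centers: "(\<Union>W\<in>tiles X L tri_edges. {\<Phi> W 0}) = (\<Union>t\<in>F. {corner (\<phi> t) 2})"
    unfolding tri_tiles \<Phi>_def using tri_map_0[OF region_tile(1)] region_tile(3) by simp
  have radii: "(\<Union>W\<in>tiles X L tri_edges. \<Union>k<3. {\<Phi> W ` path_image (radius k)}) = (\<Union>t\<in>F. {side (\<phi> t) 2})"
  proof -
    \<comment> \<open>The three radii are the sides 2 of the tiles around the center, whichever of
      these tiles represents the triangle.\<close>
    have "(\<Union>k<3. {\<Phi> (tri_map t ` ball 0 1) ` path_image (radius k)}) = (\<Union>u\<in>{u \<in> F. corner (\<phi> u) 2 = corner (\<phi> t) 2}. {side (\<phi> u) 2})"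
      if t: "t \<in> F" for t
    proof -
      let ?u = "region_tile (tri_map t ` ball 0 1)"
      have "(\<Union>k<3. {\<Phi> (tri_map t ` ball 0 1) ` path_image (radius k)}) = (\<Union>u\<in>turn ?u ` {..<3}. {side (\<phi> u) 2})"
        unfolding \<Phi>_def radius_image[OF region_tile(1)[OF t]] by simp
      then show ?thesis unfolding turn_image[OF region_tile(1)[OF t]] region_tile(3)[OF t] .
    qed
    then have "(\<Union>W\<in>tiles X L tri_edges. \<Union>k<3. {\<Phi> W ` path_image (radius k)}) =
        (\<Union>t\<in>F. \<Union>u\<in>{u \<in> F. corner (\<phi> u) 2 = corner (\<phi> t) 2}. {side (\<phi> u) 2})" unfolding tri_tiles by simp
    also have "\<dots> = (\<Union>t\<in>F. {side (\<phi> t) 2})" by blast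
    finally show ?thesis .
  qed
  have EE: "(\<Union>e\<in>tri_edges. {\<gamma> e ` {0..1/3}, \<gamma> e ` {1/3..2/3}, \<gamma> e ` {2/3..1}}) = (\<Union>t\<in>F. tri_sides t)"
    unfolding tri_edges_def using \<gamma>E by simp
  have edges: "\<forall>e\<in>tri_edges. edge_path X L (\<gamma> e) \<and> \<gamma> e ` {0..1} = e" using \<gamma> by (rule ballI)
  have vertices: "V = L \<union> D \<union> (\<Union>W\<in>tiles X L tri_edges. {\<Phi> W 0})" unfolding centers D_def by (rule V_eq)
  have segments: "E = (\<Union>e\<in>tri_edges. {\<gamma> e ` {0..1/3}, \<gamma> e ` {1/3..2/3}, \<gamma> e ` {2/3..1}}) \<union>
      (\<Union>W\<in>tiles X L tri_edges. \<Union>k<3. {\<Phi> W ` path_image (radius k)})"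
    unfolding EE radii by (rule E_eq)
  show ?thesis
    unfolding pentagonal_subdivision_def
    by (rule exI[of _ \<gamma>], rule exI[of _ "\<lambda>_. 3"], rule exI[of _ \<Phi>], rule exI[of _ "\<lambda>_. 0"],
        rule exI[of _ "\<lambda>_. radius"], rule exI[of _ D],
        rule conjI[OF edges conjI[OF D conjI[OF ballI[OF tile] conjI[OF vertices segments]]]])
qed

end

theorem theorem3p4:
  fixes X :: "'a topology" and V :: "'a set" and E :: "'a set set"
  assumes "compact_connected_surface X"
    and "pentagonal_tiling X V E"
    and "\<forall>t\<in>tiles X V E. nondegenerate_polygon X V E 5 t"
    and "\<exists>L\<subseteq>V. \<forall>t\<in>tiles X V E. \<exists>v. tile_vertices X V t \<inter> L = {v} \<and>
           (\<forall>u\<in>tile_vertices X V t - {v}. vertex_degree V E u = 3)"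
  shows "orientable_surface X \<and>
    (\<exists>A V0 E0. oriented_atlas X A \<and> tiling X V0 E0 \<and> pentagonal_subdivision X A V0 E0 V E)"
proof -
  obtain L where L: "L \<subseteq> V" "\<forall>t\<in>tiles X V E. \<exists>v. tile_vertices X V t \<inter> L = {v} \<and>
           (\<forall>u\<in>tile_vertices X V t - {v}. vertex_degree V E u = 3)" using assms(4) by blast
  interpret circ_pentagonal_tiling X V E L by unfold_locales (use assms L in simp_all)
  obtain \<phi> where \<phi>: "matched_pentagonal_tiling X V E \<phi>"
    "oriented_pentagon_scheme (tiles X V E) E (\<lambda>e. e \<inter> V) L (\<lambda>t. corner (\<phi> t)) (\<lambda>t. side (\<phi> t))"
    using matched_exists by blast
  interpret M: circ_matched_tiling X V E \<phi> L
    by (intro circ_matched_tiling.intro circ_matched_tiling_axioms.intro \<phi> L(1))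
  show ?thesis using M.atlas M.tri_tiling M.tri_subdivision unfolding orientable_surface_def by blast
qed

end
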